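(* Let $k\in\mathbb{N}$, let $\mathbb{D}_Q\subset\mathbb{M}^d$ be an NC operator ball, and let $P\in M_k(\mathbb{C}\langle Z\rangle)$. Then $P$ is left cyclic in $M_k(H^\infty(\mathbb{D}_Q))$ if and only if $P$ is $Q$-stable, and $P$ is right cyclic in $M_k(H^\infty(\mathbb{D}_Q))$ if and only if $P$ is $Q$-stable.
   Context: Fix $d\in\mathbb{N}$. Write $M_n$ for the complex $n\times n$ matrices, $M_n^d$ for $d$-tuples of such matrices, and $\mathbb{M}^d=\bigsqcup_{n\ge1}M_n^d$; for $\Omega\subseteq\mathbb{M}^d$ let $\Omega(n)=\Omega\cap M_n^d$. Let $\mathcal{H}$ be a Hilbert space, let $\mathcal{E}\subseteq B(\mathcal{H})$ be a $d$-dimensional linear subspace (operator space) with basis $Q_1,\dots,Q_d$, and put $Q(X)=\sum_{j=1}^d Q_j\otimes X_j\in B(\mathcal{H}\otimes\mathbb{C}^n)$ for $X\in M_n^d$. The NC operator ball is $\mathbb{D}_Q=\{X\in\mathbb{M}^d:\|Q(X)\|<1\}$. A function $F:\mathbb{D}_Q\to\mathbb{M}^1$ is NC if $F(X)\in M_n$ for $X\in\mathbb{D}_Q(n)$, $F(X\oplus Y)=F(X)\oplus F(Y)$ for $X,Y\in\mathbb{D}_Q$, and $F(S^{-1}XS)=S^{-1}F(X)S$ whenever $X,S^{-1}XS\in\mathbb{D}_Q(n)$, $S\in GL_n$. $H^\infty(\mathbb{D}_Q)$ is the Banach algebra of NC functions $F$ on $\mathbb{D}_Q$ with $\|F\|_Q=\sup_{X\in\mathbb{D}_Q}\|F(X)\|<\infty$.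 $M_k(H^\infty(\mathbb{D}_Q))$ has pointwise evaluation $F(X)=(F_{ij}(X))\in M_k(M_n)$ and norm $\|F\|_Q=\sup_{X\in\mathbb{D}_Q}\|F(X)\|$. $\mathbb{C}\langle Z\rangle$ is the algebra of polynomials in $d$ freely non-commuting variables; $M_k(\mathbb{C}\langle Z\rangle)$ is viewed as a subset of $M_k(H^\infty(\mathbb{D}_Q))$ by evaluation. $F$ is $Q$-stable if $\det F(X)\neq0$ for all $X\in\mathbb{D}_Q$. Weak-* topology: let $\mathcal{X}(\mathbb{D}_Q)$ be the norm-closed span in $(H^\infty(\mathbb{D}_Q))^*$ of all functionals $F\mapsto\eta(F(X))$ with $n\in\mathbb{N}$, $X\in\mathbb{D}_Q(n)$, $\eta\in M_n^*$, and let $\mathcal{X}_k(\mathbb{D}_Q)=M_k^*\otimes\mathcal{X}(\mathbb{D}_Q)\subset(M_k(H^\infty(\mathbb{D}_Q)))^*$, i.e. all functionals $(F_{ij})\mapsto\sum_{i,j}\varphi_{ij}(F_{ij})$ with $\varphi_{ij}\in\mathcal{X}(\mathbb{D}_Q)$. It is a pre-dual of $M_k(H^\infty(\mathbb{D}_Q))$, and the weak-* topology is $\sigma(M_k(H^\infty(\mathbb{D}_Q)),\mathcal{X}_k(\mathbb{D}_Q))$. For $F\in M_k(H^\infty(\mathbb{D}_Q))$, let $[F]_L$ and $[F]_R$ be the weak-* closures of $\{GF:G\in M_k(H^\infty(\mathbb{D}_Q))\}$ and $\{FG:G\in M_k(H^\infty(\mathbb{D}_Q))\}$ respectively. $F$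 is left (resp. right) cyclic if $[F]_L$ (resp. $[F]_R$) equals $M_k(H^\infty(\mathbb{D}_Q))$. *)

theory Defs
  imports
    "HOL-Analysis.L2_Norm"
    "HOL-Analysis.Function_Topology"
    "HOL-Library.FuncSet"
    "HOL-Library.Poly_Mapping"
    "Jordan_Normal_Form.Matrix"
    "Jordan_Normal_Form.Determinant"
begin

section \<open>Complex Hilbert spaces\<close>

text \<open>
  The inner product is conjugate-linear in the first argument. Positive definiteness is contained
  in \<open>cinner_self\<close>, since the norm of a \<open>banach\<close> space is definite.
\<close>

class chilbert_space = banach +
  fixes scaleC :: "complex \<Rightarrow> 'a \<Rightarrow> 'a" (infixr "*\<^sub>C" 75)
    and cinner :: "'a \<Rightarrow> 'a \<Rightarrow> complex"
  assumes scaleC_add_right: "a *\<^sub>C (x + y) = a *\<^sub>C x + a *\<^sub>C y"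
    and scaleC_add_left: "(a + b) *\<^sub>C x = a *\<^sub>C x + b *\<^sub>C x"
    and scaleC_scaleC: "a *\<^sub>C b *\<^sub>C x = (a * b) *\<^sub>C x"
    and scaleC_of_real: "complex_of_real r *\<^sub>C x = r *\<^sub>R x"
    and cinner_commute: "cinner x y = cnj (cinner y x)"
    and cinner_add_right: "cinner x (y + z) = cinner x y + cinner x z"
    and cinner_scaleC_right: "cinner x (a *\<^sub>C y) = a * cinner x y"
    and cinner_self: "cinner x x = complex_of_real ((norm x)\<^sup>2)"

definition bounded_clinear_op :: "('h::chilbert_space \<Rightarrow> 'h) \<Rightarrow> bool" where
  "bounded_clinear_op T \<longleftrightarrow> bounded_linear T \<and> (\<forall>a v. T (a *\<^sub>C v) = a *\<^sub>C T v)"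


section \<open>The NC universe and NC operator balls\<close>

text \<open>
  The number \<open>d \<ge> 1\<close> of variables is the cardinality of the finite index type \<open>'d\<close>. A point of the
  NC universe is a family of square matrices of a common size \<open>n \<ge> 1\<close>; as \<open>'d\<close> is nonempty, \<open>n\<close> is
  determined by the point.
\<close>

type_synonym 'd mtuple = "'d \<Rightarrow> complex mat"

definition tuples :: "nat \<Rightarrow> 'd::finite mtuple set" where
  "tuples n = {X. \<forall>j. X j \<in> carrier_mat n n}"

definition tuple_size :: "'d::finite mtuple \<Rightarrow> nat" where
  "tuple_size X = (THE n. X \<in> tuples n)"

definition mat_dsum :: "complex mat \<Rightarrow> complex mat \<Rightarrow> complex mat" (infixr "\<oplus>\<^sub>M" 65) where
  "A \<oplus>\<^sub>M B = four_block_mat A (0\<^sub>m (dim_row A) (dim_col B)) (0\<^sub>m (dim_row B) (dim_col A)) B"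

text \<open>
  The operators \<open>Q j\<close> are a basis of a \<open>d\<close>-dimensional operator space, namely of their span.
\<close>

definition operator_space_basis :: "('d::finite \<Rightarrow> 'h::chilbert_space \<Rightarrow> 'h) \<Rightarrow> bool" where
  "operator_space_basis Q \<longleftrightarrow>
     (\<forall>j. bounded_clinear_op (Q j)) \<and>
     (\<forall>c. (\<forall>v. (\<Sum>j\<in>UNIV. c j *\<^sub>C Q j v) = 0) \<longrightarrow> (\<forall>j. c j = 0))"

text \<open>
  The Hilbert space \<open>H \<otimes> C\<^sup>n\<close> is realised as the \<open>\<ell>\<^sup>2\<close>-direct sum of \<open>n\<close> copies of \<open>H\<close>, the vector
  \<open>\<Sum>l<n. v l \<otimes> e\<^sub>l\<close> being represented by \<open>v\<close> (entries with index \<open>\<ge> n\<close> are irrelevant). Then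
  \<open>(Q\<^sub>j \<otimes> X\<^sub>j) v\<close> has \<open>i\<close>-th entry \<open>\<Sum>l<n. X\<^sub>j(i,l) Q\<^sub>j (v l)\<close>.
\<close>

definition pencil :: "('d::finite \<Rightarrow> 'h::chilbert_space \<Rightarrow> 'h) \<Rightarrow> nat \<Rightarrow> 'd mtuple
    \<Rightarrow> (nat \<Rightarrow> 'h) \<Rightarrow> nat \<Rightarrow> 'h" where
  "pencil Q n X v i = (\<Sum>j\<in>UNIV. \<Sum>l<n. (X j $$ (i, l)) *\<^sub>C Q j (v l))"

definition pencil_norm :: "('d::finite \<Rightarrow> 'h::chilbert_space \<Rightarrow> 'h) \<Rightarrow> nat \<Rightarrow> 'd mtuple \<Rightarrow> real" where
  "pencil_norm Q n X =
     Sup {L2_set (\<lambda>i. norm (pencil Q n X v i)) {..<n} | v. L2_set (\<lambda>i. norm (v i)) {..<n} \<le> 1}"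

definition nc_ball :: "('d::finite \<Rightarrow> 'h::chilbert_space \<Rightarrow> 'h) \<Rightarrow> 'd mtuple set" where
  "nc_ball Q = {X. \<exists>n\<ge>1. X \<in> tuples n \<and> pencil_norm Q n X < 1}"


section \<open>NC functions and the algebra of bounded NC functions\<close>

text \<open>
  Functions on the ball are represented as \<open>extensional\<close> functions, so that two of them are equal
  iff they agree on the ball.
\<close>

type_synonym 'd ncfun = "'d mtuple \<Rightarrow> complex mat"

definition nc_function :: "('d::finite \<Rightarrow> 'h::chilbert_space \<Rightarrow> 'h) \<Rightarrow> 'd ncfun \<Rightarrow> bool" where
  "nc_function Q F \<longleftrightarrow>
     F \<in> extensional (nc_ball Q) \<and>
     (\<forall>n\<ge>1. \<forall>X \<in> nc_ball Q \<inter> tuples n. F X \<in> carrier_mat n n) \<and>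
     (\<forall>X \<in> nc_ball Q. \<forall>Y \<in> nc_ball Q. F (\<lambda>j. X j \<oplus>\<^sub>M Y j) = F X \<oplus>\<^sub>M F Y) \<and>
     (\<forall>n\<ge>1. \<forall>X \<in> nc_ball Q \<inter> tuples n. \<forall>S \<in> carrier_mat n n. \<forall>T \<in> carrier_mat n n.
        inverts_mat S T \<and> inverts_mat T S \<and> (\<lambda>j. T * X j * S) \<in> nc_ball Q \<longrightarrow>
        F (\<lambda>j. T * X j * S) = T * F X * S)"

definition mat_norm :: "complex mat \<Rightarrow> real" where
  "mat_norm A =
     Sup {L2_set (\<lambda>i. cmod ((A *\<^sub>v v) $ i)) {..<dim_row A} | v.
           v \<in> carrier_vec (dim_col A) \<and> L2_set (\<lambda>i. cmod (v $ i)) {..<dim_col A} \<le> 1}"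

definition Hinf :: "('d::finite \<Rightarrow> 'h::chilbert_space \<Rightarrow> 'h) \<Rightarrow> 'd ncfun set" where
  "Hinf Q = {F. nc_function Q F \<and> bdd_above ((\<lambda>X. mat_norm (F X)) ` nc_ball Q)}"

definition Hinf_norm :: "('d::finite \<Rightarrow> 'h::chilbert_space \<Rightarrow> 'h) \<Rightarrow> 'd ncfun \<Rightarrow> real" where
  "Hinf_norm Q F = (SUP X \<in> nc_ball Q. mat_norm (F X))"

definition Hinf_add :: "('d::finite \<Rightarrow> 'h::chilbert_space \<Rightarrow> 'h) \<Rightarrow> 'd ncfun \<Rightarrow> 'd ncfun \<Rightarrow> 'd ncfun" where
  "Hinf_add Q F G = restrict (\<lambda>X. F X + G X) (nc_ball Q)"

definition Hinf_scale :: "('d::finite \<Rightarrow> 'h::chilbert_space \<Rightarrow> 'h) \<Rightarrow> complex \<Rightarrow> 'd ncfun \<Rightarrow> 'd ncfun" where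
  "Hinf_scale Q c F = restrict (\<lambda>X. c \<cdot>\<^sub>m F X) (nc_ball Q)"


section \<open>Matrices over the algebra\<close>

definition MHinf :: "('d::finite \<Rightarrow> 'h::chilbert_space \<Rightarrow> 'h) \<Rightarrow> nat \<Rightarrow> 'd ncfun mat set" where
  "MHinf Q k = {F \<in> carrier_mat k k. \<forall>i<k. \<forall>j<k. F $$ (i, j) \<in> Hinf Q}"

text \<open>
  \<open>(G F)\<^sub>i\<^sub>j(X) = \<Sum>l<k. G\<^sub>i\<^sub>l(X) F\<^sub>l\<^sub>j(X)\<close>; the sum of matrices is written entrywise because the type of
  matrices of arbitrary size is not a monoid.
\<close>

definition MHinf_mult :: "('d::finite \<Rightarrow> 'h::chilbert_space \<Rightarrow> 'h) \<Rightarrow> nat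
    \<Rightarrow> 'd ncfun mat \<Rightarrow> 'd ncfun mat \<Rightarrow> 'd ncfun mat" where
  "MHinf_mult Q k G F = mat k k (\<lambda>(i, j). restrict (\<lambda>X. mat (tuple_size X) (tuple_size X)
     (\<lambda>(a, b). \<Sum>l<k. ((G $$ (i, l)) X * (F $$ (l, j)) X) $$ (a, b))) (nc_ball Q))"

text \<open>
  The value \<open>F(X) \<in> M\<^sub>k(M\<^sub>n)\<close> as a \<open>kn \<times> kn\<close> matrix whose \<open>(i,j)\<close> block of size \<open>n \<times> n\<close> is
  \<open>F\<^sub>i\<^sub>j(X)\<close>.
\<close>

definition block_value :: "nat \<Rightarrow> 'd::finite ncfun mat \<Rightarrow> 'd mtuple \<Rightarrow> complex mat" where
  "block_value k F X = (let n = tuple_size X in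
     mat (k * n) (k * n) (\<lambda>(r, s). (F $$ (r div n, s div n)) X $$ (r mod n, s mod n)))"

definition Q_stable :: "('d::finite \<Rightarrow> 'h::chilbert_space \<Rightarrow> 'h) \<Rightarrow> nat \<Rightarrow> 'd ncfun mat \<Rightarrow> bool" where
  "Q_stable Q k F \<longleftrightarrow> (\<forall>X \<in> nc_ball Q. det (block_value k F X) \<noteq> 0)"


section \<open>NC polynomials\<close>

text \<open>An NC polynomial is a finitely supported family of coefficients indexed by words.\<close>

type_synonym 'd ncpoly = "'d list \<Rightarrow>\<^sub>0 complex"

definition word_value :: "'d::finite list \<Rightarrow> 'd mtuple \<Rightarrow> complex mat" where
  "word_value w X = foldr (\<lambda>j A. X j * A) w (1\<^sub>m (tuple_size X))"

definition poly_value :: "'d::finite ncpoly \<Rightarrow> 'd mtuple \<Rightarrow> complex mat" where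
  "poly_value p X = mat (tuple_size X) (tuple_size X)
     (\<lambda>(a, b). \<Sum>w\<in>Poly_Mapping.keys p. Poly_Mapping.lookup p w * word_value w X $$ (a, b))"

definition poly_mat_fun :: "('d::finite \<Rightarrow> 'h::chilbert_space \<Rightarrow> 'h) \<Rightarrow> 'd ncpoly mat \<Rightarrow> 'd ncfun mat" where
  "poly_mat_fun Q P = map_mat (\<lambda>p. restrict (poly_value p) (nc_ball Q)) P"


section \<open>The weak-* topology\<close>

text \<open>
  Functionals on \<open>Hinf Q\<close> (and on \<open>MHinf Q k\<close>) are total HOL functions, of which only the values on
  that space matter.
\<close>

definition Hinf_dual :: "('d::finite \<Rightarrow> 'h::chilbert_space \<Rightarrow> 'h) \<Rightarrow> ('d ncfun \<Rightarrow> complex) set" where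
  "Hinf_dual Q = {\<phi>.
     (\<forall>F \<in> Hinf Q. \<forall>G \<in> Hinf Q. \<phi> (Hinf_add Q F G) = \<phi> F + \<phi> G) \<and>
     (\<forall>c. \<forall>F \<in> Hinf Q. \<phi> (Hinf_scale Q c F) = c * \<phi> F) \<and>
     (\<exists>C. \<forall>F \<in> Hinf Q. cmod (\<phi> F) \<le> C * Hinf_norm Q F)}"

definition Hinf_dual_norm :: "('d::finite \<Rightarrow> 'h::chilbert_space \<Rightarrow> 'h) \<Rightarrow> ('d ncfun \<Rightarrow> complex) \<Rightarrow> real" where
  "Hinf_dual_norm Q \<phi> = Sup {cmod (\<phi> F) | F. F \<in> Hinf Q \<and> Hinf_norm Q F \<le> 1}"

definition mat_functional :: "nat \<Rightarrow> (complex mat \<Rightarrow> complex) \<Rightarrow> bool" where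
  "mat_functional n \<eta> \<longleftrightarrow>
     (\<forall>A \<in> carrier_mat n n. \<forall>B \<in> carrier_mat n n. \<eta> (A + B) = \<eta> A + \<eta> B) \<and>
     (\<forall>c. \<forall>A \<in> carrier_mat n n. \<eta> (c \<cdot>\<^sub>m A) = c * \<eta> A)"

definition eval_functionals :: "('d::finite \<Rightarrow> 'h::chilbert_space \<Rightarrow> 'h) \<Rightarrow> ('d ncfun \<Rightarrow> complex) set" where
  "eval_functionals Q =
     {\<lambda>F. \<eta> (F X) | n X \<eta>. 1 \<le> n \<and> X \<in> nc_ball Q \<inter> tuples n \<and> mat_functional n \<eta>}"

definition eval_span :: "('d::finite \<Rightarrow> 'h::chilbert_space \<Rightarrow> 'h) \<Rightarrow> ('d ncfun \<Rightarrow> complex) set" where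
  "eval_span Q = {\<lambda>F. \<Sum>i<m. c i * \<phi> i F | (m::nat) c \<phi>. \<forall>i<m. \<phi> i \<in> eval_functionals Q}"

definition predual :: "('d::finite \<Rightarrow> 'h::chilbert_space \<Rightarrow> 'h) \<Rightarrow> ('d ncfun \<Rightarrow> complex) set" where
  "predual Q = {\<phi> \<in> Hinf_dual Q.
     \<forall>\<epsilon>>0. \<exists>\<psi> \<in> eval_span Q. Hinf_dual_norm Q (\<lambda>F. \<phi> F - \<psi> F) < \<epsilon>}"

definition Mpredual :: "('d::finite \<Rightarrow> 'h::chilbert_space \<Rightarrow> 'h) \<Rightarrow> nat \<Rightarrow> ('d ncfun mat \<Rightarrow> complex) set" where
  "Mpredual Q k =
     {\<lambda>F. \<Sum>i<k. \<Sum>j<k. \<phi> i j (F $$ (i, j)) | \<phi>. \<forall>i<k. \<forall>j<k. \<phi> i j \<in> predual Q}"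

definition weak_star :: "('d::finite \<Rightarrow> 'h::chilbert_space \<Rightarrow> 'h) \<Rightarrow> nat \<Rightarrow> 'd ncfun mat topology" where
  "weak_star Q k = topology_generated_by
     {{F \<in> MHinf Q k. \<Phi> F \<in> U} | \<Phi> U. \<Phi> \<in> Mpredual Q k \<and> open U}"


section \<open>Cyclicity\<close>

definition left_ideal_closure :: "('d::finite \<Rightarrow> 'h::chilbert_space \<Rightarrow> 'h) \<Rightarrow> nat
    \<Rightarrow> 'd ncfun mat \<Rightarrow> 'd ncfun mat set" where
  "left_ideal_closure Q k F = weak_star Q k closure_of {MHinf_mult Q k G F | G. G \<in> MHinf Q k}"

definition right_ideal_closure :: "('d::finite \<Rightarrow> 'h::chilbert_space \<Rightarrow> 'h) \<Rightarrow> nat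
    \<Rightarrow> 'd ncfun mat \<Rightarrow> 'd ncfun mat set" where
  "right_ideal_closure Q k F = weak_star Q k closure_of {MHinf_mult Q k F G | G. G \<in> MHinf Q k}"

definition left_cyclic :: "('d::finite \<Rightarrow> 'h::chilbert_space \<Rightarrow> 'h) \<Rightarrow> nat \<Rightarrow> 'd ncfun mat \<Rightarrow> bool" where
  "left_cyclic Q k F \<longleftrightarrow> left_ideal_closure Q k F = MHinf Q k"

definition right_cyclic :: "('d::finite \<Rightarrow> 'h::chilbert_space \<Rightarrow> 'h) \<Rightarrow> nat \<Rightarrow> 'd ncfun mat \<Rightarrow> bool" where
  "right_cyclic Q k F \<longleftrightarrow> right_ideal_closure Q k F = MHinf Q k"

end

theory Submission
  imports Defs "HOL-Library.Function_Algebras"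
begin

text \<open>
  If \<open>P(X)\<close> is singular, a functional \<open>F \<mapsto> (F(X) v)\<^sub>r\<close> with \<open>v\<close> in the kernel annihilates the ideal but
  not the identity. For the converse, weak-* continuous functionals respect bounded pointwise
  convergence, so it suffices that every additive functional with this continuity which annihilates
  the ideal vanishes.

  Higman linearisation reduces a stable polynomial matrix to a stable linear one \<open>1 - A(Z)\<close>.
  The Gram matrices of \<open>v\<close> minus those of \<open>A(X) v\<close>, for \<open>X\<close> in the ball, form a convex cone. It contains
  no negative definite matrix: otherwise \<open>v = (1 \<otimes> W) A(X) v = A(W X) v\<close> for a contraction \<open>W\<close> by Douglas'
  lemma, contradicting stability at \<open>W X\<close>. Separation yields a nonzero positive semidefinite form for
  which all \<open>A(X)\<close> are contractions. Its radical is invariant under the coefficients of \<open>A\<close>, which makes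
  \<open>A\<close> block triangular. The block on the radical is handled by induction on the size. On the other
  block the powers \<open>A(X)\<^sup>N\<close> are uniformly bounded on the ball and tend to \<open>0\<close>, and a functional \<open>\<phi>\<close> that
  annihilates the ideal of \<open>1 - A\<close> satisfies \<open>\<phi>(g) = \<phi>(g A) = \<dots> = \<phi>(g A\<^sup>N) \<longrightarrow> 0\<close>.
\<close>

section \<open>Separation of open convex cones\<close>

text \<open>Stability does not bound the inverse on the ball: \<open>1 - z\<close> on the unit disc
  is stable with an unbounded inverse, so density cannot come from inverting \<open>P\<close>. For
  the powers of \<open>A(X)\<close> the uniform bound comes from the form, while decay comes from
  \<open>X / s\<close> still lying in the ball for some \<open>s < 1\<close>. This \<open>s\<close>
  depends on \<open>X\<close>, so in general the convergence is bounded and pointwise but not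
  uniform; this dictates the class of functionals. Two features of the ball make the separation
  possible: direct sums turn sums of Gram differences into Gram differences, and left multiplication
  by a contraction keeps a point in the ball. All matrix sizes therefore enter at once. The density
  statements are tested on polynomials only. They reach a bounded NC function \<open>H\<close>
  because \<phi>(H p) is, as a function of the polynomial p, again a functional of the same kind,
  and p = 1 recovers the value at H.\<close>

lemma cone_separation:
  fixes scale :: "real \<Rightarrow> 'v::ab_group_add \<Rightarrow> 'v"
  assumes vs: "vector_space scale"
    and C_add: "\<And>x y. x \<in> C \<Longrightarrow> y \<in> C \<Longrightarrow> x + y \<in> C"
    and C_scale: "\<And>c x. c > 0 \<Longrightarrow> x \<in> C \<Longrightarrow> scale c x \<in> C"
    and C_open: "\<And>x y. x \<in> C \<Longrightarrow> \<exists>e>0. \<forall>t. \<bar>t\<bar> < e \<longrightarrow> x + scale t y \<in> C"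
    and C_0: "0 \<notin> C" and C_p: "p \<in> C"
  obtains f :: "'v \<Rightarrow> real" where "\<And>x y. f (x + y) = f x + f y" "\<And>c x. f (scale c x) = c * f x"
    "\<And>x. x \<in> C \<Longrightarrow> f x > 0"
proof -
  interpret vector_space scale by (rule vs)
  \<comment> \<open>Zorn's lemma works here with openness along lines only. A maximal subspace
    missing the cone turns out to have codimension one and becomes the kernel of
    \<open>f\<close>.\<close>
  define \<A> where "\<A> = {M. subspace M \<and> M \<inter> C = {}}"
  have "{0} \<in> \<A>" using C_0 by (auto simp: \<A>_def subspace_def)
  then have "\<A> \<noteq> {}" by blast
  moreover have "\<Union>\<C> \<in> \<A>" if "\<C> \<noteq> {}" "subset.chain \<A> \<C>" for \<C>
  proof -
    have sub: "subspace M" "M \<inter> C = {}" if "M \<in> \<C>" for M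
      using that \<open>subset.chain \<A> \<C>\<close> by (auto simp: subset.chain_def \<A>_def)
    have "x + y \<in> \<Union>\<C>" if xy: "x \<in> \<Union>\<C>" "y \<in> \<Union>\<C>" for x y
    proof -
      obtain M N where MN: "M \<in> \<C>" "N \<in> \<C>" "x \<in> M" "y \<in> N" using xy by auto
      then have "M \<subseteq> N \<or> N \<subseteq> M" using \<open>subset.chain \<A> \<C>\<close> by (auto simp: subset.chain_def)
      then show ?thesis using MN sub by (meson Union_iff subsetD subspace_add)
    qed
    moreover have "scale c x \<in> \<Union>\<C>" if "x \<in> \<Union>\<C>" for c x
      using that sub subspace_scale by blast
    moreover have "0 \<in> \<Union>\<C>" using \<open>\<C> \<noteq> {}\<close> sub subspace_0 by blast
    ultimately have "subspace (\<Union>\<C>)" by (simp add: subspace_def)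
    then show ?thesis using sub by (auto simp: \<A>_def)
  qed
  ultimately obtain M where "M \<in> \<A>" and max: "\<And>X. X \<in> \<A> \<Longrightarrow> M \<subseteq> X \<Longrightarrow> X = M"
    using subset_Zorn_nonempty[of \<A>] by metis
  then have M: "subspace M" and MC: "M \<inter> C = {}" by (auto simp: \<A>_def)
  note M_add = subspace_add[OF M] and M_scale = subspace_scale[OF M] and M_diff = subspace_diff[OF M]
    and M_neg = subspace_neg[OF M] and M_0 = subspace_0[OF M]
  \<comment> \<open>This is \<open>C + M\<close>, since \<open>M = - M\<close>. It is again a cone
    that is open along lines and misses \<open>M\<close>, and it is invariant under translation by
    \<open>M\<close>.\<close>
  define D where "D = {x. \<exists>m\<in>M. x + m \<in> C}"
  have D_add: "x + y \<in> D" if xy: "x \<in> D" "y \<in> D" for x y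
  proof -
    obtain m n where "m \<in> M" "n \<in> M" "x + m \<in> C" "y + n \<in> C" using xy by (auto simp: D_def)
    then have "m + n \<in> M" "(x + y) + (m + n) \<in> C"
      using M_add C_add[of "x + m" "y + n"] by (auto simp: algebra_simps)
    then show ?thesis by (auto simp: D_def)
  qed
  have D_scale: "scale c x \<in> D" if cx: "x \<in> D" "c > 0" for c x
  proof -
    obtain m where "m \<in> M" "x + m \<in> C" using cx by (auto simp: D_def)
    then have "scale c m \<in> M" "scale c x + scale c m \<in> C"
      using M_scale C_scale[of c "x + m"] cx by (auto simp: algebra_simps)
    then show ?thesis by (auto simp: D_def)
  qed
  have D_M: "x \<notin> M" if "x \<in> D" for x
    using that M_add MC by (auto simp: D_def)
  have D_neg: "- x \<notin> D" if "x \<in> D" for x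
    using D_add[of x "- x"] that D_M M_0 by auto
  have D_open: "\<exists>e>0. \<forall>t. \<bar>t\<bar> < e \<longrightarrow> x + scale t y \<in> D" if x: "x \<in> D" for x y
  proof -
    obtain m where m: "m \<in> M" "x + m \<in> C" using x by (auto simp: D_def)
    obtain e where "e > 0" "\<forall>t. \<bar>t\<bar> < e \<longrightarrow> x + m + scale t y \<in> C" using C_open[OF m(2)] by blast
    then show ?thesis using m by (intro exI[of _ e]) (auto simp: D_def add_ac intro!: bexI[of _ m])
  qed
  \<comment> \<open>By maximality the span of \<open>M\<close> and \<open>x\<close> meets
    \<open>C\<close>; the sign of the coefficient of \<open>x\<close> at such a point decides
    between \<open>x\<close> and \<open>- x\<close>.\<close>
  have trich: "x \<in> D \<or> - x \<in> D" if x: "x \<notin> M" for x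
  proof -
    define N where "N = {m + scale s x | m s. m \<in> M}"
    have "subspace N"
      unfolding subspace_def
    proof (intro conjI allI ballI)
      show "0 \<in> N" unfolding N_def using M_0 by (force intro: exI[of _ 0])
      fix u v c assume "u \<in> N"
      then obtain m s where u: "u = m + scale s x" "m \<in> M" by (auto simp: N_def)
      have "scale c u = scale c m + scale (c * s) x" by (simp add: u algebra_simps)
      then show "scale c u \<in> N" unfolding N_def using M_scale u(2) by blast
      assume "v \<in> N"
      then obtain m' s' where v: "v = m' + scale s' x" "m' \<in> M" by (auto simp: N_def)
      have "u + v = (m + m') + scale (s + s') x" by (simp add: u v algebra_simps)
      then show "u + v \<in> N" unfolding N_def using M_add u(2) v(2) by blast
    qed
    moreover have "M \<subseteq> N" unfolding N_def by (force intro: exI[of _ 0])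
    moreover have "x \<in> N"
      unfolding N_def using M_0 by (auto intro!: exI[of _ 0] exI[of _ 1])
    ultimately have "N \<inter> C \<noteq> {}" using max[of N] x by (auto simp: \<A>_def)
    then obtain m s where ms: "m \<in> M" "m + scale s x \<in> C" by (auto simp: N_def)
    consider "s = 0" | "s > 0" | "s < 0" by linarith
    then show ?thesis
    proof cases
      case 1 then show ?thesis using ms MC by auto
    next
      case 2
      then have "x + scale (1/s) m \<in> C" using C_scale[of "1/s", OF _ ms(2)] by (simp add: algebra_simps)
      then show ?thesis using M_scale[OF ms(1)] by (auto simp: D_def)
    next
      case 3
      then have "- x + scale (1/-s) m \<in> C"
        using C_scale[of "1/-s", OF _ ms(2)] by (simp add: algebra_simps)
      then have "- x \<in> D" unfolding D_def using M_scale[OF ms(1), of "1/-s"] by blast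
      then show ?thesis ..
    qed
  qed
  have p_D: "p \<in> D" using C_p M_0 by (auto simp: D_def intro!: bexI[of _ 0])
  have p_M: "p \<notin> M" using MC C_p by auto
  \<comment> \<open>The line through \<open>x\<close> in direction \<open>p\<close> must cross
    \<open>M\<close>. Otherwise the parameters whose point lies in \<open>D\<close> and those whose
    point lies in \<open>- D\<close> would split the real line into two nonempty disjoint open
    sets.\<close>
  have ex: "\<exists>s. x - scale s p \<in> M" for x
  proof (rule ccontr)
    assume neg: "\<nexists>s. x - scale s p \<in> M"
    define A where "A = {s. x - scale s p \<in> D}"
    define B where "B = {s. - (x - scale s p) \<in> D}"
    have open_line: "open {s. y + scale s z \<in> D}" for y z
      unfolding open_dist
    proof (intro ballI)
      fix s assume "s \<in> {s. y + scale s z \<in> D}"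
      then obtain e where e: "e > 0" "\<And>t. \<bar>t\<bar> < e \<Longrightarrow> (y + scale s z) + scale t z \<in> D"
        using D_open[of "y + scale s z" z] by auto
      have "y + scale s' z \<in> D" if "dist s' s < e" for s'
        using e(2)[of "s' - s"] that by (simp add: dist_real_def algebra_simps)
      then show "\<exists>e>0. \<forall>s'. dist s' s < e \<longrightarrow> s' \<in> {s. y + scale s z \<in> D}" using e(1) by auto
    qed
    have "open A" using open_line[of x "- p"] by (simp add: A_def)
    moreover have "open B" using open_line[of "- x" p] by (simp add: B_def)
    moreover have "UNIV \<subseteq> A \<union> B" using trich[of "x - scale s p" for s] neg unfolding A_def B_def by blast
    moreover have "A \<inter> B \<inter> UNIV = {}" using D_neg[of "x - scale s p" for s] unfolding A_def B_def by blast
    moreover obtain e where e: "e > 0" "\<And>t. \<bar>t\<bar> < e \<Longrightarrow> p + scale t x \<in> D" using D_open[OF p_D] by blast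
    \<comment> \<open>Nonemptiness of \<open>B\<close> and \<open>A\<close>: perturbing
      \<open>p\<close> by a small multiple of \<open>x\<close> of either sign stays in
      \<open>D\<close>, and rescaling by \<open>2/e\<close> brings the coefficient of
      \<open>x\<close> to \<open>1\<close> or \<open>- 1\<close>.\<close>
    have "scale (2/e) (p + scale (e/2) x) \<in> D" "scale (2/e) (p + scale (-e/2) x) \<in> D"
      using e(1) e(2)[of "e/2"] e(2)[of "-e/2"] by (auto simp del: scale_minus_left intro!: D_scale)
    then have "- 2/e \<in> A" "2/e \<in> B" using e(1) by (auto simp: A_def B_def scale_right_distrib scale_right_diff_distrib add_ac)
    ultimately show False using connectedD[OF connected_UNIV, of A B] by blast
  qed
  define f where "f x = (THE s. x - scale s p \<in> M)" for x
  have uniq: "s = t" if st: "x - scale s p \<in> M" "x - scale t p \<in> M" for x s t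
  proof (rule ccontr)
    assume "s \<noteq> t"
    have "scale (t - s) p \<in> M" using M_diff[OF st] by (simp add: algebra_simps)
    then have "scale (1/(t - s)) (scale (t - s) p) \<in> M" by (rule M_scale)
    then show False using p_M \<open>s \<noteq> t\<close> by simp
  qed
  have fI: "f x = s" if "x - scale s p \<in> M" for x s
    unfolding f_def using that uniq by blast
  have f_M: "x - scale (f x) p \<in> M" for x
    using ex[of x] fI by blast
  show thesis
  proof
    show "f (x + y) = f x + f y" for x y
      using M_add[OF f_M[of x] f_M[of y]] by (intro fI) (simp add: algebra_simps)
    show "f (scale c x) = c * f x" for c x
      using M_scale[OF f_M[of x], of c] by (intro fI) (simp add: algebra_simps)
    fix x assume "x \<in> C"
    then have x_D: "x \<in> D" using M_0 by (auto simp: D_def intro!: bexI[of _ 0])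
    show "f x > 0"
    proof (rule ccontr)
      assume "\<not> f x > 0"
      \<comment> \<open>If \<open>f x\<close> is at most \<open>0\<close>, this point is a sum of
        elements of the cone \<open>D\<close>; but \<open>f_M\<close> puts it into \<open>M\<close>,
        which \<open>D\<close> misses.\<close>
      have "x + scale (- f x) p \<in> D"
      proof (cases "f x = 0")
        case False
        then show ?thesis using \<open>\<not> f x > 0\<close> by (intro D_add D_scale x_D p_D) auto
      qed (simp add: x_D)
      then show False using D_M f_M[of x] by simp
    qed
  qed
qed

section \<open>Matrices over finite index sets\<close>

abbreviation delta :: "'i \<Rightarrow> 'i \<Rightarrow> 'a::zero_neq_one" where
  "delta i j \<equiv> (if i = j then 1 else 0)"

definition mutually_inverse_on :: "'i set \<Rightarrow> ('i \<Rightarrow> 'i \<Rightarrow> 'a::semiring_1) \<Rightarrow> ('i \<Rightarrow> 'i \<Rightarrow> 'a) \<Rightarrow> bool" where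
  "mutually_inverse_on I M N \<longleftrightarrow>
     (\<forall>i\<in>I. \<forall>j\<in>I. (\<Sum>l\<in>I. M i l * N l j) = delta i j \<and> (\<Sum>l\<in>I. N i l * M l j) = delta i j)"

lemma mutually_inverse_onD:
  assumes "mutually_inverse_on I M N" "i \<in> I" "j \<in> I"
  shows "(\<Sum>l\<in>I. M i l * N l j) = delta i j" "(\<Sum>l\<in>I. N i l * M l j) = delta i j"
  using assms by (auto simp: mutually_inverse_on_def)

text \<open>Enumerating the index set by \<open>0..<card I\<close> makes the determinant criterion
  available, which turns injectivity into a two-sided inverse.\<close>

lemma ex_inverse_on:
  fixes M :: "'i \<Rightarrow> 'i \<Rightarrow> complex"
  assumes "finite I"
    and inj: "\<And>x. (\<And>i. i \<in> I \<Longrightarrow> (\<Sum>j\<in>I. M i j * x j) = 0) \<Longrightarrow> \<forall>i\<in>I. x i = 0"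
  obtains N where "mutually_inverse_on I M N"
proof -
  obtain h where h: "bij_betw h {0..<card I} I" using ex_bij_betw_nat_finite[OF assms(1)] by blast
  define n where "n = card I"
  define g where "g = the_inv_into {0..<n} h"
  have g: "g i < n" "h (g i) = i" if "i \<in> I" for i
    using the_inv_into_into[of h "{0..<n}" i "{0..<n}"] f_the_inv_into_f_bij_betw[of h "{0..<n}" I i]
      h that by (auto simp: g_def n_def bij_betw_def)
  have h_in: "h a \<in> I" "g (h a) = a" if "a < n" for a
    using h that by (auto simp: n_def g_def bij_betw_def intro!: the_inv_into_f_f)
  have re: "(\<Sum>a=0..<n. F (h a)) = (\<Sum>i\<in>I. F i)" for F :: "'i \<Rightarrow> complex"
    using sum.reindex_bij_betw[OF h, of F] by (simp add: n_def)
  define A where "A = mat n n (\<lambda>(a, b). M (h a) (h b))"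
  have A: "A \<in> carrier_mat n n" by (simp add: A_def)
  have "det A \<noteq> 0"
  proof
    assume "det A = 0"
    then obtain v where v: "v \<in> carrier_vec n" "v \<noteq> 0\<^sub>v n" "A *\<^sub>v v = 0\<^sub>v n"
      using det_0_iff_vec_prod_zero[OF A] by blast
    have "(\<Sum>j\<in>I. M i j * v $ g j) = 0" if "i \<in> I" for i
    proof -
      have "0 = (A *\<^sub>v v) $ g i" using v(3) g(1)[OF that] by simp
      also have "\<dots> = (\<Sum>b=0..<n. M i (h b) * v $ g (h b))"
        using g[OF that] v(1) h_in by (simp add: A_def scalar_prod_def)
      also have "\<dots> = (\<Sum>j\<in>I. M i j * v $ g j)" by (rule re)
      finally show ?thesis by simp
    qed
    then have "\<forall>i\<in>I. v $ g i = 0" by (rule inj)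
    then have "v $ a = 0" if "a < n" for a using h_in[OF that] by metis
    then show False using v(1,2) by auto
  qed
  then obtain B where B: "B \<in> carrier_mat n n" "B * A = 1\<^sub>m n" "A * B = 1\<^sub>m n"
    using det_non_zero_imp_unit[OF A] unfolding Units_def ring_mat_def by auto
  define N where "N i j = B $$ (g i, g j)" for i j
  have "mutually_inverse_on I M N"
    unfolding mutually_inverse_on_def
  proof (intro ballI conjI)
    fix i j assume ij: "i \<in> I" "j \<in> I"
    have gg: "g i = g j \<longleftrightarrow> i = j" using g ij by metis
    have "(\<Sum>l\<in>I. M i l * N l j) = (\<Sum>a=0..<n. M i (h a) * N (h a) j)" by (rule re[symmetric])
    also have "\<dots> = (A * B) $$ (g i, g j)"
      using A B(1) g ij h_in by (simp add: A_def N_def scalar_prod_def)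
    finally show "(\<Sum>l\<in>I. M i l * N l j) = delta i j" using g ij gg by (simp add: B(3))
    have "(\<Sum>l\<in>I. N i l * M l j) = (\<Sum>a=0..<n. N i (h a) * M (h a) j)" by (rule re[symmetric])
    also have "\<dots> = (B * A) $$ (g i, g j)"
      using A B(1) g ij h_in by (simp add: A_def N_def scalar_prod_def)
    finally show "(\<Sum>l\<in>I. N i l * M l j) = delta i j" using g ij gg by (simp add: B(2))
  qed
  then show thesis by (rule that)
qed

section \<open>Hermitian forms: diagonalisation, separation and contractions\<close>

definition qform :: "'i set \<Rightarrow> ('i \<Rightarrow> 'i \<Rightarrow> complex) \<Rightarrow> ('i \<Rightarrow> complex) \<Rightarrow> real" where
  "qform I T x = Re (\<Sum>i\<in>I. \<Sum>j\<in>I. cnj (x i) * T i j * x j)"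

definition hermitian_on :: "'i set \<Rightarrow> ('i \<Rightarrow> 'i \<Rightarrow> complex) \<Rightarrow> bool" where
  "hermitian_on I T \<longleftrightarrow> (\<forall>i\<in>I. \<forall>j\<in>I. T i j = cnj (T j i))"

lemma qform_cong:
  "(\<And>i. i \<in> I \<Longrightarrow> x i = y i) \<Longrightarrow> qform I T x = qform I T y"
  unfolding qform_def by (intro arg_cong[of _ _ Re] sum.cong refl) auto

text \<open>This is the \<open>LDL\<close> factorisation, obtained by symmetric Gaussian elimination
  of one index at a time. \<open>S\<close> stays invertible while some \<open>d\<close> may vanish,
  so in the coordinates given by \<open>S\<close> the zero weights mark exactly the radical of the
  form.\<close>

lemma psd_ldl:
  assumes "finite I" "hermitian_on I T" "\<And>x. qform I T x \<ge> 0"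
  shows "\<exists>S R d. (\<forall>i. d i \<ge> (0::real)) \<and> mutually_inverse_on I S R \<and>
    (\<forall>i\<in>I. \<forall>j\<in>I. T i j = (\<Sum>m\<in>I. of_real (d m) * cnj (S m i) * S m j))"
  using assms
proof (induction I arbitrary: T rule: finite_induct)
  case empty
  show ?case by (intro exI[of _ "\<lambda>_. 0"] exI) (simp add: mutually_inverse_on_def)
next
  case (insert a I)
  note fin = \<open>finite I\<close> and aI = \<open>a \<notin> I\<close>
  have neq: "i \<noteq> a" "a \<noteq> i" if "i \<in> I" for i using that aI by auto
  have herm: "T i j = cnj (T j i)" if "i \<in> insert a I" "j \<in> insert a I" for i j
    using insert.prems(1) that unfolding hermitian_on_def by blast
  define t where "t = Re (T a a)"
  have "Im (T a a) = 0" using herm[of a a] by (simp add: complex_eq_iff)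
  then have Taa: "T a a = of_real t" by (simp add: t_def complex_eq_iff)
  have q1: "qform (insert a I) T x = Re (cnj (x a) * T a a * x a + (\<Sum>j\<in>I. cnj (x a) * T a j * x j)
      + (\<Sum>i\<in>I. cnj (x i) * T i a * x a)) + qform I T x" for x
    using fin aI by (simp add: qform_def sum.distrib)
  have "t \<ge> 0"
  proof -
    have "qform (insert a I) T (\<lambda>i. delta i a) = t"
      unfolding q1 using fin neq by (simp add: qform_def t_def)
    then show ?thesis using insert.prems(2) by metis
  qed
  \<comment> \<open>A zero pivot forces its whole row to vanish: otherwise the form would be linear,
    not quadratic, in the direction \<open>a\<close> and hence negative somewhere. The constant
    \<open>s\<close> below is tuned so that the test vector gives the value
    \<open>- 1\<close>.\<close>
  have T0: "T a i = 0" if "t = 0" "i \<in> I" for i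
  proof (rule ccontr)
    assume nz: "T a i \<noteq> 0"
    define s where "s = (Re (T i i) + 1) / (2 * (cmod (T a i))\<^sup>2)"
    define x where "x j = (if j = a then - of_real s * T a i else delta j i)" for j
    have [simp]: "x a = - of_real s * T a i" by (simp add: x_def)
    have xI: "x j = delta j i" if "j \<in> I" for j using neq(1)[OF that] by (simp add: x_def)
    have c: "T a i * cnj (T a i) = of_real ((cmod (T a i))\<^sup>2)" by (simp only: complex_norm_square)
    have s1: "(\<Sum>j\<in>I. cnj (x a) * T a j * x j) = cnj (x a) * T a i"
      and s2: "(\<Sum>j\<in>I. cnj (x j) * T j a * x a) = T i a * x a"
    proof -
      have "(\<Sum>j\<in>I. cnj (x a) * T a j * x j) = (\<Sum>j\<in>I. if j = i then cnj (x a) * T a i else 0)"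
        "(\<Sum>j\<in>I. cnj (x j) * T j a * x a) = (\<Sum>j\<in>I. if j = i then T i a * x a else 0)"
        by (rule sum.cong[OF refl], simp add: xI)+
      then show "(\<Sum>j\<in>I. cnj (x a) * T a j * x j) = cnj (x a) * T a i"
        "(\<Sum>j\<in>I. cnj (x j) * T j a * x a) = T i a * x a" using fin that by simp_all
    qed
    have "qform I T x = qform I T (\<lambda>j. delta j i)" by (rule qform_cong) (rule xI)
    also have "\<dots> = Re (\<Sum>j\<in>I. if j = i then (\<Sum>k\<in>I. if k = i then T i i else 0) else 0)"
      unfolding qform_def by (intro arg_cong[of _ _ Re] sum.cong refl) (auto intro!: sum.cong)
    also have "\<dots> = Re (T i i)" using fin that by simp
    finally have s3: "qform I T x = Re (T i i)" .
    have "qform (insert a I) T x = Re (cnj (x a) * T a i + T i a * x a) + Re (T i i)"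
      unfolding q1 s1 s2 s3 using Taa that by simp
    also have "T i a = cnj (T a i)" using herm[of i a] that by simp
    also have "Re (cnj (x a) * T a i + cnj (T a i) * x a) = - 2 * s * (cmod (T a i))\<^sup>2"
      by (simp add: cmod_power2) (simp add: power2_eq_square algebra_simps)
    also have "\<dots> + Re (T i i) = - 1" using nz by (simp add: s_def field_simps)
    finally show False using insert.prems(2)[of x] by simp
  qed
  \<comment> \<open>For \<open>t = 0\<close> this quotient is \<open>0\<close>, and
    \<open>T0\<close> keeps \<open>T a i = t * c i\<close> true, so a zero pivot goes through the
    same elimination as a positive one.\<close>
  define c where "c i = T a i / of_real t" for i
  have Tai: "T a i = of_real t * c i" if "i \<in> I" for i using T0[OF _ that] by (auto simp: c_def)
  have Tia: "T i a = of_real t * cnj (c i)" if "i \<in> I" for i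
    using herm[of i a] Tai[OF that] that by simp
  \<comment> \<open>What remains after completing the square in the coordinate \<open>a\<close>: the
    Schur complement of the pivot.\<close>
  define T' where "T' i j = T i j - of_real t * cnj (c i) * c j" for i j
  have "hermitian_on I T'"
    unfolding hermitian_on_def
  proof (intro ballI)
    fix i j assume "i \<in> I" "j \<in> I"
    then show "T' i j = cnj (T' j i)" using herm[of i j] by (simp add: T'_def)
  qed
  moreover have "qform I T' x \<ge> 0" for x
  proof -
    \<comment> \<open>The value \<open>- s\<close> at \<open>a\<close> makes the completed square
      vanish, so at this vector the form of \<open>T\<close> equals the form of
      \<open>T'\<close>.\<close>
    define s where "s = (\<Sum>j\<in>I. c j * x j)"
    have scnj: "cnj s = (\<Sum>i\<in>I. cnj (x i) * cnj (c i))" by (simp add: s_def mult.commute)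
    have eq: "qform I T (x(a := - s)) = qform I T x"
      by (rule qform_cong) (use neq in auto)
    have "qform (insert a I) T (x(a := - s)) =
      Re (cnj s * of_real t * s - (\<Sum>j\<in>I. cnj s * (of_real t * c j) * x j)
        - (\<Sum>i\<in>I. cnj (x i) * (of_real t * cnj (c i)) * s)) + qform I T x"
      unfolding q1 eq using neq Tai Tia Taa by (simp add: sum_negf cong: sum.cong)
    also have "(\<Sum>j\<in>I. cnj s * (of_real t * c j) * x j) = of_real t * cnj s * s"
      by (subst (2) s_def) (simp add: sum_distrib_left mult_ac)
    also have "(\<Sum>i\<in>I. cnj (x i) * (of_real t * cnj (c i)) * s) = of_real t * cnj s * s"
      unfolding scnj by (simp only: sum_distrib_left sum_distrib_right mult_ac)
    also have "Re (cnj s * of_real t * s - of_real t * cnj s * s - of_real t * cnj s * s) + qform I T x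
       = qform I T x - Re (of_real t * (cnj s * s))" by (simp add: algebra_simps)
    also have "of_real t * (cnj s * s) = (\<Sum>i\<in>I. \<Sum>j\<in>I. cnj (x i) * (of_real t * cnj (c i) * c j) * x j)"
    proof -
      have "cnj s * s = (\<Sum>i\<in>I. cnj (x i) * cnj (c i)) * (\<Sum>j\<in>I. c j * x j)"
        by (subst scnj) (simp only: s_def)
      then show ?thesis by (simp only: sum_product) (simp add: sum_distrib_left mult_ac)
    qed
    also have "qform I T x - Re \<dots> = qform I T' x"
      by (simp add: qform_def T'_def sum_subtractf[symmetric] algebra_simps)
    finally show ?thesis using insert.prems(2) by metis
  qed
  ultimately obtain S R d where d: "\<And>i. d i \<ge> 0" and inv: "mutually_inverse_on I S R"
    and T': "\<And>i j. i \<in> I \<Longrightarrow> j \<in> I \<Longrightarrow> T' i j = (\<Sum>m\<in>I. of_real (d m) * cnj (S m i) * S m j)"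
    using insert.IH[of T'] by blast
  \<comment> \<open>Unit triangular extension of \<open>S\<close> by the row \<open>c\<close>;
    \<open>R'\<close> is its inverse, by block elimination.\<close>
  define S' where "S' m i = (if m = a then if i = a then 1 else c i else if i = a then 0 else S m i)" for m i
  define R' where "R' i m = (if i = a then if m = a then 1 else - (\<Sum>l\<in>I. c l * R l m)
      else if m = a then 0 else R i m)" for i m
  have S': "S' a a = 1" "i \<in> I \<Longrightarrow> S' a i = c i" "i \<in> I \<Longrightarrow> S' i a = 0"
    "i \<in> I \<Longrightarrow> j \<in> I \<Longrightarrow> S' i j = S i j" for i j using neq by (auto simp: S'_def)
  have R': "R' a a = 1" "i \<in> I \<Longrightarrow> R' a i = - (\<Sum>l\<in>I. c l * R l i)" "i \<in> I \<Longrightarrow> R' i a = 0"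
    "i \<in> I \<Longrightarrow> j \<in> I \<Longrightarrow> R' i j = R i j" for i j using neq by (auto simp: R'_def)
  have inv': "mutually_inverse_on (insert a I) S' R'"
    unfolding mutually_inverse_on_def
  proof (intro ballI)
    fix i j assume "i \<in> insert a I" "j \<in> insert a I"
    then consider "i = a" "j = a" | "i = a" "j \<in> I" | "i \<in> I" "j = a" | "i \<in> I" "j \<in> I" by blast
    then show "(\<Sum>l\<in>insert a I. S' i l * R' l j) = delta i j \<and> (\<Sum>l\<in>insert a I. R' i l * S' l j) = delta i j"
    proof cases
      case 2
      have "(\<Sum>l\<in>I. (\<Sum>m\<in>I. c m * R m l) * S l j) = (\<Sum>m\<in>I. c m * (\<Sum>l\<in>I. R m l * S l j))"
        by (simp add: sum_distrib_left sum_distrib_right mult_ac) (rule sum.swap)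
      also have "\<dots> = (\<Sum>m\<in>I. c m * delta m j)"
        using 2 mutually_inverse_onD[OF inv] by (simp cong: sum.cong)
      also have "\<dots> = c j" using 2 fin by (simp add: if_distrib cong: if_cong)
      finally show ?thesis using 2 fin aI neq S' R' by (simp add: sum_negf cong: sum.cong)
    qed (use fin aI neq S' R' mutually_inverse_onD[OF inv] in \<open>simp_all cong: sum.cong\<close>)
  qed
  define d' where "d' = d(a := t)"
  have d': "d' a = t" "i \<in> I \<Longrightarrow> d' i = d i" for i using neq by (auto simp: d'_def)
  have "T i j = (\<Sum>m\<in>insert a I. of_real (d' m) * cnj (S' m i) * S' m j)"
    if ij: "i \<in> insert a I" "j \<in> insert a I" for i j
  proof -
    have *: "(\<Sum>m\<in>insert a I. of_real (d' m) * cnj (S' m i) * S' m j)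
      = of_real t * cnj (S' a i) * S' a j + (\<Sum>m\<in>I. of_real (d m) * cnj (S' m i) * S' m j)"
      using fin aI d' by (simp cong: sum.cong)
    consider "i = a" "j = a" | "i = a" "j \<in> I" | "i \<in> I" "j = a" | "i \<in> I" "j \<in> I" using ij by blast
    then show ?thesis unfolding *
      by cases (use S' Taa Tai Tia T'[symmetric] in \<open>simp_all cong: sum.cong add: T'_def\<close>)
  qed
  moreover have "\<forall>i. d' i \<ge> 0" using d \<open>t \<ge> 0\<close> by (simp add: d'_def)
  ultimately show ?case using inv' by blast
qed

lemma qform_ldl:
  assumes "\<And>i j. i \<in> I \<Longrightarrow> j \<in> I \<Longrightarrow> T i j = (\<Sum>m\<in>I. of_real (d m) * cnj (S m i) * S m j)"
  shows "qform I T x = (\<Sum>m\<in>I. d m * (cmod (\<Sum>j\<in>I. S m j * x j))\<^sup>2)"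
proof -
  have "(\<Sum>i\<in>I. \<Sum>j\<in>I. cnj (x i) * T i j * x j)
     = (\<Sum>i\<in>I. \<Sum>j\<in>I. \<Sum>m\<in>I. of_real (d m) * (cnj (S m i * x i) * (S m j * x j)))"
    using assms by (intro sum.cong refl) (simp add: sum_distrib_left sum_distrib_right mult_ac)
  also have "\<dots> = (\<Sum>i\<in>I. \<Sum>m\<in>I. \<Sum>j\<in>I. of_real (d m) * (cnj (S m i * x i) * (S m j * x j)))"
    by (intro sum.cong refl sum.swap)
  also have "\<dots> = (\<Sum>m\<in>I. \<Sum>i\<in>I. \<Sum>j\<in>I. of_real (d m) * (cnj (S m i * x i) * (S m j * x j)))"
    by (rule sum.swap)
  also have "\<dots> = (\<Sum>m\<in>I. of_real (d m * (cmod (\<Sum>j\<in>I. S m j * x j))\<^sup>2))"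
  proof (rule sum.cong[OF refl])
    fix m
    define z where "z j = S m j * x j" for j
    have "(\<Sum>i\<in>I. \<Sum>j\<in>I. of_real (d m) * (cnj (z i) * z j)) = of_real (d m) * (cnj (sum z I) * sum z I)"
      by (subst cnj_sum, subst sum_product) (simp add: sum_distrib_left)
    also have "cnj (sum z I) * sum z I = of_real ((cmod (sum z I))\<^sup>2)"
      by (simp only: complex_norm_square mult.commute)
    finally show "(\<Sum>i\<in>I. \<Sum>j\<in>I. of_real (d m) * (cnj (S m i * x i) * (S m j * x j)))
      = complex_of_real (d m * (cmod (\<Sum>j\<in>I. S m j * x j))\<^sup>2)" by (simp add: z_def)
  qed
  finally show ?thesis by (simp add: qform_def)
qed

lemma qform_add: "qform I (\<lambda>i j. T i j + U i j) x = qform I T x + qform I U x"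
  by (simp add: qform_def algebra_simps sum.distrib)

lemma qform_scale: "qform I (\<lambda>i j. of_real c * T i j) x = c * qform I T x"
  by (simp add: qform_def sum_distrib_left algebra_simps)

lemma qform_delta: "finite I \<Longrightarrow> qform I delta x = (\<Sum>i\<in>I. (cmod (x i))\<^sup>2)"
proof -
  assume "finite I"
  have "(\<Sum>j\<in>I. cnj (x i) * delta i j * x j) = of_real ((cmod (x i))\<^sup>2)" if "i \<in> I" for i
  proof -
    have "(\<Sum>j\<in>I. cnj (x i) * delta i j * x j) = (\<Sum>j\<in>I. if j = i then cnj (x i) * x i else 0)"
      by (intro sum.cong) auto
    also have "\<dots> = x i * cnj (x i)" using that \<open>finite I\<close> by simp
    also have "\<dots> = of_real ((cmod (x i))\<^sup>2)" by (simp only: complex_norm_square)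
    finally show ?thesis .
  qed
  then show ?thesis by (simp add: qform_def)
qed

lemma qform_rank_one:
  "qform I (\<lambda>i j. y i * cnj (y j)) x = (cmod (\<Sum>i\<in>I. cnj (x i) * y i))\<^sup>2"
proof -
  define z where "z i = cnj (x i) * y i" for i
  have "(\<Sum>i\<in>I. \<Sum>j\<in>I. cnj (x i) * (y i * cnj (y j)) * x j) = sum z I * cnj (sum z I)"
    by (subst cnj_sum, subst sum_product) (simp add: z_def mult_ac)
  also have "\<dots> = of_real ((cmod (sum z I))\<^sup>2)" by (simp only: complex_norm_square)
  finally show ?thesis by (simp add: qform_def z_def)
qed

lemma qform_bound:
  assumes "finite I"
  shows "\<bar>qform I T x\<bar> \<le> (\<Sum>i\<in>I. \<Sum>j\<in>I. cmod (T i j)) * (\<Sum>i\<in>I. (cmod (x i))\<^sup>2)"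
proof -
  define s where "s = (\<Sum>i\<in>I. (cmod (x i))\<^sup>2)"
  have le: "(cmod (x i))\<^sup>2 \<le> s" if "i \<in> I" for i
    unfolding s_def using assms that by (intro member_le_sum) auto
  have *: "cmod (x i) * cmod (x j) \<le> s" if "i \<in> I" "j \<in> I" for i j
    using le[OF that(1)] le[OF that(2)] sum_squares_bound[of "cmod (x i)" "cmod (x j)"] by simp
  have "\<bar>qform I T x\<bar> \<le> cmod (\<Sum>i\<in>I. \<Sum>j\<in>I. cnj (x i) * T i j * x j)"
    unfolding qform_def by (rule abs_Re_le_cmod)
  also have "\<dots> \<le> (\<Sum>i\<in>I. \<Sum>j\<in>I. cmod (T i j) * s)"
  proof (intro sum_norm_le)
    fix i j assume ij: "i \<in> I" "j \<in> I"
    have "cmod (cnj (x i) * T i j * x j) = cmod (T i j) * (cmod (x i) * cmod (x j))"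
      by (simp add: norm_mult)
    then show "cmod (cnj (x i) * T i j * x j) \<le> cmod (T i j) * s"
      using *[OF ij] by (simp add: mult_left_mono)
  qed
  finally show ?thesis by (simp add: s_def sum_distrib_right)
qed

text \<open>
  The separation is applied to the open cone of all matrices that dominate some element
  of the given cone by a positive multiple of the identity.
\<close>

lemma psd_separation:
  fixes K :: "('i \<Rightarrow> 'i \<Rightarrow> complex) set"
  assumes fin: "finite I"
    and K_add: "\<And>\<kappa> \<mu>. \<kappa> \<in> K \<Longrightarrow> \<mu> \<in> K \<Longrightarrow> (\<lambda>i j. \<kappa> i j + \<mu> i j) \<in> K"
    and K_scale: "\<And>c \<kappa>. c > 0 \<Longrightarrow> \<kappa> \<in> K \<Longrightarrow> (\<lambda>i j. of_real c * \<kappa> i j) \<in> K"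
    and K_0: "(\<lambda>i j. 0) \<in> K"
    and K_neg: "\<And>\<kappa> \<epsilon>. \<kappa> \<in> K \<Longrightarrow> \<epsilon> > 0 \<Longrightarrow> \<exists>x. qform I \<kappa> x + \<epsilon> * (\<Sum>i\<in>I. (cmod (x i))\<^sup>2) > 0"
  obtains f T where "additive f" "\<And>y. f (\<lambda>i j. y i * cnj (y j)) = qform I T y" "hermitian_on I T"
    "\<And>x. qform I T x \<ge> 0" "\<exists>x. qform I T x > 0" "\<And>\<kappa>. \<kappa> \<in> K \<Longrightarrow> f \<kappa> \<ge> 0"
proof -
  \<comment> \<open>Only real scalars act, since positivity is a notion over the reals and
    \<open>f\<close> will be real linear. The space consists of all matrix functions on the index
    type; entries outside \<open>I\<close> are disposed of in \<open>f_zero\<close>.\<close>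
  define scale where "scale c M = (\<lambda>i j. complex_of_real c * M i j)" for c and M :: "'i \<Rightarrow> 'i \<Rightarrow> complex"
  have vs: "vector_space scale"
    by unfold_locales (auto simp: scale_def fun_eq_iff algebra_simps)
  define N where "N x = (\<Sum>i\<in>I. (cmod (x i))\<^sup>2)" for x :: "'i \<Rightarrow> complex"
  have N_nonneg: "N x \<ge> 0" for x by (simp add: N_def sum_nonneg)
  define C where "C = {M. \<exists>\<kappa>\<in>K. \<exists>\<epsilon>>0. \<forall>x. qform I \<kappa> x + \<epsilon> * N x \<le> qform I M x}"
  have CI: "M \<in> C" if "\<kappa> \<in> K" "\<epsilon> > 0" "\<And>x. qform I \<kappa> x + \<epsilon> * N x \<le> qform I M x" for M \<kappa> \<epsilon>
    using that by (auto simp: C_def)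
  have C_add: "M + M' \<in> C" if "M \<in> C" "M' \<in> C" for M M'
  proof -
    obtain \<kappa> \<epsilon> \<kappa>' \<epsilon>' where *: "\<kappa> \<in> K" "\<epsilon> > 0" "\<And>x. qform I \<kappa> x + \<epsilon> * N x \<le> qform I M x"
      "\<kappa>' \<in> K" "\<epsilon>' > 0" "\<And>x. qform I \<kappa>' x + \<epsilon>' * N x \<le> qform I M' x"
      using \<open>M \<in> C\<close> \<open>M' \<in> C\<close> by (auto simp: C_def)
    show ?thesis
    proof (rule CI)
      show "(\<lambda>i j. \<kappa> i j + \<kappa>' i j) \<in> K" "\<epsilon> + \<epsilon>' > 0" using * K_add by auto
      show "qform I (\<lambda>i j. \<kappa> i j + \<kappa>' i j) x + (\<epsilon> + \<epsilon>') * N x \<le> qform I (M + M') x" for x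
        using *(3)[of x] *(6)[of x] by (simp add: plus_fun_def qform_add algebra_simps)
    qed
  qed
  have C_scale: "scale c M \<in> C" if "c > 0" "M \<in> C" for c M
  proof -
    obtain \<kappa> \<epsilon> where *: "\<kappa> \<in> K" "\<epsilon> > 0" "\<And>x. qform I \<kappa> x + \<epsilon> * N x \<le> qform I M x"
      using \<open>M \<in> C\<close> by (auto simp: C_def)
    show ?thesis
    proof (rule CI)
      show "(\<lambda>i j. of_real c * \<kappa> i j) \<in> K" "c * \<epsilon> > 0" using * that K_scale by auto
      show "qform I (\<lambda>i j. of_real c * \<kappa> i j) x + c * \<epsilon> * N x \<le> qform I (scale c M) x" for x
        using mult_left_mono[OF *(3)[of x], of c] that by (simp add: scale_def qform_scale algebra_simps)
    qed
  qed
  have C_open: "\<exists>e>0. \<forall>t. \<bar>t\<bar> < e \<longrightarrow> M + scale t H \<in> C" if "M \<in> C" for M H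
  proof -
    obtain \<kappa> \<epsilon> where *: "\<kappa> \<in> K" "\<epsilon> > 0" "\<And>x. qform I \<kappa> x + \<epsilon> * N x \<le> qform I M x"
      using \<open>M \<in> C\<close> by (auto simp: C_def)
    define h where "h = (\<Sum>i\<in>I. \<Sum>j\<in>I. cmod (H i j))"
    have h: "h \<ge> 0" by (simp add: h_def sum_nonneg)
    define e where "e = \<epsilon> / (2 * (h + 1))"
    have "M + scale t H \<in> C" if t: "\<bar>t\<bar> < e" for t
    proof (rule CI[OF *(1)])
      show "\<epsilon>/2 > 0" using * by simp
      fix x
      have "e * h \<le> \<epsilon>/2"
      proof -
        have "e * h \<le> e * (h + 1)" using h * by (simp add: e_def field_simps)
        also have "\<dots> = \<epsilon>/2" using h by (simp add: e_def field_simps)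
        finally show ?thesis .
      qed
      have "\<bar>t * qform I H x\<bar> \<le> e * (h * N x)"
        unfolding abs_mult using t qform_bound[OF fin, of H x] by (intro mult_mono) (auto simp: h_def N_def)
      also have "\<dots> \<le> \<epsilon>/2 * N x"
        using mult_right_mono[OF \<open>e * h \<le> \<epsilon>/2\<close> N_nonneg[of x]] by (simp add: mult.assoc)
      finally show "qform I \<kappa> x + \<epsilon>/2 * N x \<le> qform I (M + scale t H) x"
        using *(3)[of x] by (simp add: plus_fun_def scale_def qform_add qform_scale)
    qed
    moreover have "e > 0" using * h by (simp add: e_def)
    ultimately show ?thesis by blast
  qed
  have C_0: "0 \<notin> C"
  proof
    assume "0 \<in> C"
    then obtain \<kappa> \<epsilon> where *: "\<kappa> \<in> K" "\<epsilon> > 0" "\<And>x. qform I \<kappa> x + \<epsilon> * N x \<le> qform I 0 x"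
      by (auto simp: C_def)
    then show False using K_neg[OF *(1,2)] by (auto simp: N_def qform_def not_less[symmetric])
  qed
  have psd_C: "(\<lambda>i j. M i j + of_real \<epsilon> * delta i j) \<in> C" if "\<epsilon> > 0" "\<And>x. qform I M x \<ge> 0" for M \<epsilon>
  proof (rule CI[OF K_0 \<open>\<epsilon> > 0\<close>])
    show "qform I (\<lambda>i j. 0) x + \<epsilon> * N x \<le> qform I (\<lambda>i j. M i j + of_real \<epsilon> * delta i j) x" for x
      using that(2)[of x] unfolding qform_add qform_scale qform_delta[OF fin] by (simp add: qform_def N_def)
  qed
  have C_1: "delta \<in> C" using psd_C[of 1 "\<lambda>i j. 0"] by (simp add: qform_def)
  obtain f where f_add: "\<And>x y. f (x + y) = f x + f y" and f_scale: "\<And>c x. f (scale c x) = c * f x"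
    and f_pos: "\<And>x. x \<in> C \<Longrightarrow> f x > 0"
    using cone_separation[OF vs C_add C_scale C_open C_0 C_1] by metis
  have add: "additive f" by (simp add: additive_def f_add)
  \<comment> \<open>\<open>C\<close> contains only strict dominators. Positivity extends to its
    boundary, because a negative value of \<open>f\<close> could be lifted to exactly
    \<open>0\<close> inside \<open>C\<close> by a suitable \<epsilon>.\<close>
  have limit: "f M \<ge> 0" if M: "\<And>\<epsilon>. \<epsilon> > 0 \<Longrightarrow> (\<lambda>i j. M i j + of_real \<epsilon> * delta i j) \<in> C" for M
  proof (rule ccontr)
    assume "\<not> f M \<ge> 0"
    define \<epsilon> where "\<epsilon> = - f M / f delta"
    have "f delta > 0" by (rule f_pos[OF C_1])
    then have "\<epsilon> > 0" using \<open>\<not> f M \<ge> 0\<close> by (simp add: \<epsilon>_def divide_neg_pos)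
    have "0 < f (M + scale \<epsilon> delta)"
      using f_pos[OF M[OF \<open>\<epsilon> > 0\<close>]] by (simp add: plus_fun_def scale_def)
    also have "\<dots> = f M + \<epsilon> * f delta" by (simp add: f_add f_scale)
    also have "\<dots> = 0" using \<open>f delta > 0\<close> by (simp add: \<epsilon>_def)
    finally show False by simp
  qed
  have f_K: "f \<kappa> \<ge> 0" if "\<kappa> \<in> K" for \<kappa>
  proof (rule limit)
    fix \<epsilon> :: real assume "\<epsilon> > 0"
    then show "(\<lambda>i j. \<kappa> i j + of_real \<epsilon> * delta i j) \<in> C"
      by (intro CI[OF that \<open>\<epsilon> > 0\<close>]) (simp only: qform_add qform_scale qform_delta[OF fin] N_def order_refl)
  qed
  have f_psd: "f M \<ge> 0" if "\<And>x. qform I M x \<ge> 0" for M using psd_C that by (intro limit) auto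
  \<comment> \<open>Both \<open>M\<close> and \<open>- M\<close> have the zero form on
    \<open>I\<close>, so both values of \<open>f\<close> are nonnegative.\<close>
  have f_zero: "f M = 0" if M: "\<And>i j. i \<in> I \<Longrightarrow> j \<in> I \<Longrightarrow> M i j = 0" for M
  proof -
    have "qform I M x = 0" "qform I (- M) x = 0" for x using M by (simp_all add: qform_def)
    then have "f M \<ge> 0" "f (- M) \<ge> 0" by (intro f_psd; simp)+
    then show ?thesis using additive.minus[OF add, of M] by simp
  qed
  define E where "E i j z = (\<lambda>k l. if k = i \<and> l = j then z else 0 :: complex)" for i j :: 'i and z
  \<comment> \<open>A real linear functional has two real coefficients for each complex entry; they
    are packed into one complex number so that \<open>f_E\<close> holds.\<close>
  define t where "t i j = Complex (f (E i j 1)) (- f (E i j \<i>))" for i j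
  have f_E: "f (E i j z) = Re (z * t i j)" for i j z
  proof -
    have "E i j z = scale (Re z) (E i j 1) + scale (Im z) (E i j \<i>)"
      by (auto simp: E_def scale_def fun_eq_iff complex_eq_iff)
    then have "f (E i j z) = Re z * f (E i j 1) + Im z * f (E i j \<i>)" by (simp add: f_add f_scale)
    then show ?thesis by (simp add: t_def)
  qed
  have f_sum: "f M = Re (\<Sum>i\<in>I. \<Sum>j\<in>I. M i j * t i j)" for M
  proof -
    define M' where "M' = (\<Sum>i\<in>I. \<Sum>j\<in>I. E i j (M i j))"
    have sum_app: "sum F A k l = (\<Sum>a\<in>A. F a k l)" for F :: "'i \<Rightarrow> 'i \<Rightarrow> 'i \<Rightarrow> complex" and A k l
      by (induction A rule: infinite_finite_induct) auto
    have "M' k l = M k l" if "k \<in> I" "l \<in> I" for k l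
    proof -
      have "M' k l = (\<Sum>i\<in>I. if i = k then (\<Sum>j\<in>I. if j = l then M k l else 0) else 0)"
        unfolding M'_def sum_app E_def by (auto intro!: sum.cong)
      then show ?thesis using that fin by simp
    qed
    then have "f (M - M') = 0" by (intro f_zero) simp
    then have "f M = f M'" using additive.diff[OF add, of M M'] by simp
    also have "\<dots> = (\<Sum>i\<in>I. \<Sum>j\<in>I. f (E i j (M i j)))"
      unfolding M'_def by (simp add: additive.sum[OF add])
    finally show ?thesis by (simp add: f_E)
  qed
  \<comment> \<open>On rank-one matrices only the hermitian part of the transpose of
    \<open>t\<close> is visible, and this part is chosen as \<open>T\<close>.\<close>
  define T where "T i j = (t j i + cnj (t i j)) / 2" for i j
  have T: "f (\<lambda>i j. y i * cnj (y j)) = qform I T y" for y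
  proof -
    define z where "z = (\<Sum>i\<in>I. \<Sum>j\<in>I. y i * cnj (y j) * t i j)"
    have "(\<Sum>i\<in>I. \<Sum>j\<in>I. cnj (y i) * t j i * y j) = z"
      unfolding z_def by (subst sum.swap) (simp add: mult_ac)
    moreover have "(\<Sum>i\<in>I. \<Sum>j\<in>I. cnj (y i) * cnj (t i j) * y j) = cnj z"
      by (simp only: z_def cnj_sum complex_cnj_mult complex_cnj_cnj mult_ac)
    moreover have "(\<Sum>i\<in>I. \<Sum>j\<in>I. cnj (y i) * T i j * y j) =
       ((\<Sum>i\<in>I. \<Sum>j\<in>I. cnj (y i) * t j i * y j) + (\<Sum>i\<in>I. \<Sum>j\<in>I. cnj (y i) * cnj (t i j) * y j)) / 2"
      by (simp add: T_def sum.distrib[symmetric] sum_divide_distrib algebra_simps add_divide_distrib)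
    ultimately have "qform I T y = Re ((z + cnj z) / 2)" by (simp only: qform_def)
    then show ?thesis by (simp add: f_sum z_def[symmetric] del: Re_sum)
  qed
  show thesis
  proof
    show "hermitian_on I T" by (simp add: hermitian_on_def T_def)
    show "qform I T x \<ge> 0" for x
      unfolding T[symmetric] by (rule f_psd) (simp add: qform_rank_one)
    show "\<exists>x. qform I T x > 0"
    proof (rule ccontr)
      assume "\<not> ?thesis"
      then have "qform I T x \<le> 0" for x by (simp add: not_less)
      then have le: "f (\<lambda>i j. y i * cnj (y j)) \<le> 0" for y by (simp add: T)
      \<comment> \<open>As far as \<open>f\<close> can see, the identity is the sum of the rank-one
        units at the indices in \<open>I\<close>; a form that is nowhere positive would make
        \<open>f delta\<close> at most \<open>0\<close>.\<close>
      have "f delta = (\<Sum>m\<in>I. Re (t m m))"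
      proof -
        have "(\<Sum>j\<in>I. delta i j * t i j) = t i i" if "i \<in> I" for i
        proof -
          have "(\<Sum>j\<in>I. delta i j * t i j) = (\<Sum>j\<in>I. if j = i then t i i else 0)" by (intro sum.cong) auto
          then show ?thesis using that fin by simp
        qed
        then show ?thesis by (simp add: f_sum)
      qed
      also have "\<dots> \<le> 0"
      proof (rule sum_nonpos)
        fix m assume "m \<in> I"
        have "(\<lambda>i j. delta i m * cnj (delta j m)) = E m m 1" by (auto simp: E_def fun_eq_iff)
        then show "Re (t m m) \<le> 0" using le[of "\<lambda>i. delta i m"] f_E[of m m 1] by simp
      qed
      finally show False using f_pos[OF C_1] by simp
    qed
  qed (use add T f_K in auto)
qed

text \<open>Douglas' lemma; the hypothesis says that the Gram matrix of \<open>u\<close> exceeds that of \<open>v\<close>.\<close>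

lemma contraction_of_gram_le:
  fixes u v :: "'i \<Rightarrow> nat \<Rightarrow> complex"
  assumes fin: "finite I" and \<epsilon>: "\<epsilon> > 0"
    and le: "\<And>c. (\<Sum>a<n. (cmod (\<Sum>i\<in>I. c i * v i a))\<^sup>2) + \<epsilon> * (\<Sum>i\<in>I. (cmod (c i))\<^sup>2)
      \<le> (\<Sum>a<n. (cmod (\<Sum>i\<in>I. c i * u i a))\<^sup>2)"
  obtains W :: "nat \<Rightarrow> nat \<Rightarrow> complex" where
    "\<And>i a. i \<in> I \<Longrightarrow> (\<Sum>b<n. W a b * u i b) = v i a"
    "\<And>w. (\<Sum>a<n. (cmod (\<Sum>b<n. W a b * w b))\<^sup>2) \<le> (\<Sum>b<n. (cmod (w b))\<^sup>2)"
proof -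
  define G where "G i j = (\<Sum>a<n. cnj (u i a) * u j a)" for i j
  have sq: "complex_of_real ((cmod z)\<^sup>2) = cnj z * z" for z
    by (simp only: complex_norm_square mult.commute)
  have G_mult: "(\<Sum>j\<in>I. G i j * c j) = (\<Sum>a<n. cnj (u i a) * (\<Sum>j\<in>I. c j * u j a))" for i c
    unfolding G_def sum_distrib_left sum_distrib_right
    by (subst sum.swap) (simp add: mult_ac)
  \<comment> \<open>The surplus \<epsilon> enters here: a null vector of the Gram matrix of
    \<open>u\<close> makes the right side of \<open>le\<close> zero, so it vanishes itself. Hence
    the Gram matrix of \<open>u\<close> is invertible.\<close>
  have inj: "\<forall>i\<in>I. c i = 0" if c: "\<And>i. i \<in> I \<Longrightarrow> (\<Sum>j\<in>I. G i j * c j) = 0" for c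
  proof -
    define s where "s a = (\<Sum>j\<in>I. c j * u j a)" for a
    have "complex_of_real (\<Sum>a<n. (cmod (s a))\<^sup>2) = (\<Sum>a<n. cnj (s a) * s a)" by (simp add: sq del: of_real_power)
    also have "\<dots> = (\<Sum>a<n. \<Sum>i\<in>I. cnj (c i) * (cnj (u i a) * s a))"
      by (subst s_def) (simp only: cnj_sum complex_cnj_mult sum_distrib_right mult.assoc)
    also have "\<dots> = (\<Sum>i\<in>I. cnj (c i) * (\<Sum>a<n. cnj (u i a) * s a))"
      by (subst sum.swap) (simp add: sum_distrib_left)
    also have "\<dots> = 0" using c by (simp add: s_def G_mult[symmetric])
    finally have "(\<Sum>a<n. (cmod (s a))\<^sup>2) = 0" by (simp only: of_real_eq_0_iff)
    then have "\<epsilon> * (\<Sum>i\<in>I. (cmod (c i))\<^sup>2) \<le> 0"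
      using le[of c] sum_nonneg[of "{..<n}" "\<lambda>a. (cmod (\<Sum>i\<in>I. c i * v i a))\<^sup>2"] by (simp add: s_def)
    then have "(\<Sum>i\<in>I. (cmod (c i))\<^sup>2) \<le> 0" using \<epsilon> by (simp add: mult_le_0_iff)
    then have "(\<Sum>i\<in>I. (cmod (c i))\<^sup>2) = 0" by (simp add: antisym sum_nonneg)
    then show ?thesis using fin by (simp add: sum_nonneg_eq_0_iff)
  qed
  obtain R where R: "mutually_inverse_on I G R" using ex_inverse_on[OF fin inj] by blast
  \<comment> \<open>\<open>coef w\<close> holds the coefficients of the orthogonal projection of
    \<open>w\<close> onto the span of the \<open>u i\<close>; \<open>W\<close> projects and then
    replaces each \<open>u i\<close> by \<open>v i\<close>.\<close>
  define coef where "coef w i = (\<Sum>j\<in>I. R i j * (\<Sum>b<n. cnj (u j b) * w b))" for w i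
  define W where "W a b = (\<Sum>i\<in>I. \<Sum>j\<in>I. v i a * (R i j * cnj (u j b)))" for a b
  have W: "(\<Sum>b<n. W a b * w b) = (\<Sum>i\<in>I. coef w i * v i a)" for a w
  proof -
    have "(\<Sum>b<n. W a b * w b) = (\<Sum>b<n. \<Sum>i\<in>I. \<Sum>j\<in>I. v i a * (R i j * (cnj (u j b) * w b)))"
      by (simp only: W_def sum_distrib_right mult.assoc)
    also have "\<dots> = (\<Sum>i\<in>I. \<Sum>j\<in>I. \<Sum>b<n. v i a * (R i j * (cnj (u j b) * w b)))"
      by (subst sum.swap, rule sum.cong[OF refl], rule sum.swap)
    also have "\<dots> = (\<Sum>i\<in>I. coef w i * v i a)"
      by (simp add: coef_def sum_distrib_left sum_distrib_right mult_ac)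
    finally show ?thesis .
  qed
  show thesis
  proof
    fix i a assume i: "i \<in> I"
    have "coef (u i) j = delta j i" if "j \<in> I" for j
      using mutually_inverse_onD(2)[OF R that i] by (simp add: coef_def G_def)
    then have "(\<Sum>b<n. W a b * u i b) = (\<Sum>j\<in>I. if j = i then v i a else 0)"
      unfolding W by (intro sum.cong) auto
    then show "(\<Sum>b<n. W a b * u i b) = v i a" using i fin by simp
  next
    fix w
    define c where "c = coef w"
    \<comment> \<open>This is that projection. By Pythagoras it is no longer than \<open>w\<close>,
      and \<open>le\<close> at its coefficients bounds the length of \<open>W w\<close> by the
      length of \<open>p\<close>.\<close>
    define p where "p a = (\<Sum>i\<in>I. c i * u i a)" for a
    have orth: "(\<Sum>a<n. cnj (u i a) * (w a - p a)) = 0" if "i \<in> I" for i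
    proof -
      have "(\<Sum>a<n. cnj (u i a) * p a) = (\<Sum>j\<in>I. G i j * c j)" by (simp add: G_mult p_def)
      also have "\<dots> = (\<Sum>j\<in>I. \<Sum>k\<in>I. (G i j * R j k) * (\<Sum>b<n. cnj (u k b) * w b))"
        by (simp add: c_def coef_def sum_distrib_left mult_ac)
      also have "\<dots> = (\<Sum>k\<in>I. (\<Sum>j\<in>I. G i j * R j k) * (\<Sum>b<n. cnj (u k b) * w b))"
        by (subst sum.swap) (simp only: sum_distrib_right)
      also have "\<dots> = (\<Sum>k\<in>I. if k = i then (\<Sum>b<n. cnj (u i b) * w b) else 0)"
        using mutually_inverse_onD(1)[OF R that] by (intro sum.cong) auto
      also have "\<dots> = (\<Sum>b<n. cnj (u i b) * w b)" using that fin by simp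
      finally show ?thesis by (simp add: algebra_simps sum_subtractf)
    qed
    have "(\<Sum>a<n. cnj (p a) * (w a - p a)) = (\<Sum>a<n. \<Sum>i\<in>I. cnj (c i) * (cnj (u i a) * (w a - p a)))"
      by (subst p_def) (simp only: cnj_sum complex_cnj_mult sum_distrib_right mult.assoc)
    also have "\<dots> = (\<Sum>i\<in>I. cnj (c i) * (\<Sum>a<n. cnj (u i a) * (w a - p a)))"
      by (subst sum.swap) (simp only: sum_distrib_left)
    also have "\<dots> = 0" using orth by simp
    finally have orth_p: "Re (\<Sum>a<n. cnj (p a) * (w a - p a)) = 0" by simp
    have "(cmod (w a))\<^sup>2 = (cmod (p a))\<^sup>2 + (cmod (w a - p a))\<^sup>2 + 2 * Re (cnj (p a) * (w a - p a))" for a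
      by (simp only: cmod_power2) (simp add: power2_eq_square algebra_simps)
    then have "(\<Sum>a<n. (cmod (w a))\<^sup>2) = (\<Sum>a<n. (cmod (p a))\<^sup>2) + (\<Sum>a<n. (cmod (w a - p a))\<^sup>2)
        + 2 * Re (\<Sum>a<n. cnj (p a) * (w a - p a))"
      by (simp only: sum.distrib Re_sum sum_distrib_left)
    then have "(\<Sum>a<n. (cmod (p a))\<^sup>2) \<le> (\<Sum>a<n. (cmod (w a))\<^sup>2)"
      unfolding orth_p by (simp add: sum_nonneg)
    moreover have "(\<Sum>a<n. (cmod (\<Sum>b<n. W a b * w b))\<^sup>2) \<le> (\<Sum>a<n. (cmod (p a))\<^sup>2)"
      using le[of c] mult_nonneg_nonneg[OF less_imp_le[OF \<epsilon>], of "\<Sum>i\<in>I. (cmod (c i))\<^sup>2"]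
      unfolding W p_def c_def by (simp add: sum_nonneg)
    ultimately show "(\<Sum>a<n. (cmod (\<Sum>b<n. W a b * w b))\<^sup>2) \<le> (\<Sum>b<n. (cmod (w b))\<^sup>2)" by linarith
  qed
qed

section \<open>Evaluation of NC polynomials\<close>

text \<open>Multiplication of finitely supported functions is convolution along \<open>+\<close> of
  the index type. With concatenation as \<open>+\<close>, NC polynomials become the free algebra and
  inherit its ring laws.\<close>

instantiation list :: (type) monoid_add
begin
definition zero_list :: "'a list" where "zero_list = []"
definition plus_list :: "'a list \<Rightarrow> 'a list \<Rightarrow> 'a list" where "plus_list = append"
instance by standard (simp_all add: zero_list_def plus_list_def)
end

definition pconst :: "complex \<Rightarrow> 'd ncpoly" where
  "pconst c = Poly_Mapping.single [] c"

definition pvar :: "'d \<Rightarrow> 'd ncpoly" where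
  "pvar j = Poly_Mapping.single [j] 1"

lemma tuples_unique:
  fixes X :: "'d::finite mtuple"
  assumes "X \<in> tuples n" "X \<in> tuples m"
  shows "n = m"
proof -
  have "X (undefined :: 'd) \<in> carrier_mat n n" "X (undefined :: 'd) \<in> carrier_mat m m"
    using assms by (auto simp: tuples_def)
  then show ?thesis by auto
qed

lemma tuple_size_eq: "X \<in> tuples n \<Longrightarrow> tuple_size X = n"
  unfolding tuple_size_def using tuples_unique by blast

lemma tuplesD: "X \<in> tuples n \<Longrightarrow> X j \<in> carrier_mat n n"
  by (simp add: tuples_def)

lemma word_value_carrier: "X \<in> tuples n \<Longrightarrow> word_value w X \<in> carrier_mat n n"
  by (induction w) (auto simp: word_value_def tuple_size_eq dest: tuplesD[of X n] intro: mult_carrier_mat)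

lemma word_value_Nil: "X \<in> tuples n \<Longrightarrow> word_value [] X = 1\<^sub>m n"
  by (simp add: word_value_def tuple_size_eq)

lemma word_value_Cons: "word_value (j # w) X = X j * word_value w X"
  by (simp add: word_value_def)

lemma word_value_append:
  assumes X: "X \<in> tuples n"
  shows "word_value (u @ w) X = word_value u X * word_value w X"
proof (induction u)
  case Nil then show ?case using word_value_carrier[OF X, of w] by (simp add: word_value_Nil[OF X])
next
  case (Cons j u)
  then show ?case
    using tuplesD[OF X, of j] word_value_carrier[OF X, of u] word_value_carrier[OF X, of w]
    by (simp add: word_value_Cons assoc_mult_mat)
qed

lemma poly_value_carrier: "X \<in> tuples n \<Longrightarrow> poly_value p X \<in> carrier_mat n n"
  by (simp add: poly_value_def tuple_size_eq)

lemma poly_value_entry: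
  assumes "X \<in> tuples n" "a < n" "b < n" "finite A" "Poly_Mapping.keys p \<subseteq> A"
  shows "poly_value p X $$ (a, b) = (\<Sum>w\<in>A. Poly_Mapping.lookup p w * word_value w X $$ (a, b))"
  using assms by (auto simp: poly_value_def tuple_size_eq in_keys_iff intro!: sum.mono_neutral_left)

lemma poly_value_add:
  assumes "X \<in> tuples n" "a < n" "b < n"
  shows "poly_value (p + q) X $$ (a, b) = poly_value p X $$ (a, b) + poly_value q X $$ (a, b)"
proof -
  let ?A = "Poly_Mapping.keys p \<union> Poly_Mapping.keys q"
  note e = poly_value_entry[OF assms, of ?A]
  show ?thesis
    using e[of "p + q"] e[of p] e[of q] keys_add[of p q]
    by (simp add: lookup_add algebra_simps sum.distrib)
qed

lemma poly_value_zero: "X \<in> tuples n \<Longrightarrow> a < n \<Longrightarrow> b < n \<Longrightarrow> poly_value 0 X $$ (a, b) = 0"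
  by (simp add: poly_value_def tuple_size_eq)

lemma poly_value_sum:
  assumes "X \<in> tuples n" "a < n" "b < n"
  shows "poly_value (sum f A) X $$ (a, b) = (\<Sum>i\<in>A. poly_value (f i) X $$ (a, b))"
  by (induction A rule: infinite_finite_induct) (simp_all add: poly_value_zero[OF assms] poly_value_add[OF assms])

lemma poly_value_diff:
  assumes "X \<in> tuples n" "a < n" "b < n"
  shows "poly_value (p - q) X $$ (a, b) = poly_value p X $$ (a, b) - poly_value q X $$ (a, b)"
  using poly_value_add[OF assms, of "p - q" q] by simp

lemma poly_value_single:
  assumes "X \<in> tuples n" "a < n" "b < n"
  shows "poly_value (Poly_Mapping.single w c) X $$ (a, b) = c * word_value w X $$ (a, b)"
  using poly_value_entry[OF assms, of "{w}" "Poly_Mapping.single w c"] by (simp add: lookup_single)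

lemma ncpoly_sum_single: "p = (\<Sum>w\<in>Poly_Mapping.keys p. Poly_Mapping.single w (Poly_Mapping.lookup p w))"
proof (rule poly_mapping_eqI)
  fix u
  have "Poly_Mapping.lookup (\<Sum>w\<in>Poly_Mapping.keys p. Poly_Mapping.single w (Poly_Mapping.lookup p w)) u
    = (\<Sum>w\<in>Poly_Mapping.keys p. if w = u then Poly_Mapping.lookup p u else 0)"
    unfolding lookup_sum by (intro sum.cong) (auto simp: lookup_single)
  also have "\<dots> = Poly_Mapping.lookup p u" by (simp add: in_keys_iff)
  finally show "Poly_Mapping.lookup p u
    = Poly_Mapping.lookup (\<Sum>w\<in>Poly_Mapping.keys p. Poly_Mapping.single w (Poly_Mapping.lookup p w)) u" by simp
qed

lemma mat_mult_entry:
  assumes "A \<in> carrier_mat n n" "B \<in> carrier_mat n n" "a < n" "b < n"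
  shows "(A * B) $$ (a, b) = (\<Sum>c<n. A $$ (a, c) * B $$ (c, b))"
  using assms by (simp add: scalar_prod_def atLeast0LessThan)

lemma poly_value_mult_entry:
  assumes X: "X \<in> tuples n" and ab: "a < n" "b < n"
  shows "poly_value (p * q) X $$ (a, b) = (\<Sum>c<n. poly_value p X $$ (a, c) * poly_value q X $$ (c, b))"
proof -
  let ?s = "\<lambda>p w. Poly_Mapping.single w (Poly_Mapping.lookup p w)"
  let ?K = "Poly_Mapping.keys"
  have "p * q = (\<Sum>u\<in>?K p. \<Sum>w\<in>?K q. ?s p u * ?s q w)"
    by (subst ncpoly_sum_single[of p], subst ncpoly_sum_single[of q]) (simp add: sum_product)
  also have "poly_value \<dots> X $$ (a, b)
      = (\<Sum>u\<in>?K p. \<Sum>w\<in>?K q. \<Sum>c<n. (Poly_Mapping.lookup p u * word_value u X $$ (a, c)) * (Poly_Mapping.lookup q w * word_value w X $$ (c, b)))"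
    by (simp add: poly_value_sum[OF X ab] mult_single poly_value_single[OF X ab] plus_list_def
        word_value_append[OF X] mat_mult_entry[OF word_value_carrier[OF X] word_value_carrier[OF X] ab]
        sum_distrib_left mult_ac)
  also have "\<dots> = (\<Sum>c<n. (\<Sum>u\<in>?K p. Poly_Mapping.lookup p u * word_value u X $$ (a, c)) * (\<Sum>w\<in>?K q. Poly_Mapping.lookup q w * word_value w X $$ (c, b)))"
    unfolding sum_product by (rule trans[OF sum.cong[OF refl sum.swap] sum.swap])
  also have "\<dots> = (\<Sum>c<n. poly_value p X $$ (a, c) * poly_value q X $$ (c, b))"
    using ab by (simp add: poly_value_def tuple_size_eq[OF X])
  finally show ?thesis .
qed

lemma poly_value_mult:
  assumes X: "X \<in> tuples n"
  shows "poly_value (p * q) X = poly_value p X * poly_value q X"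
proof (rule eq_matI)
  show "dim_row (poly_value (p * q) X) = dim_row (poly_value p X * poly_value q X)"
    "dim_col (poly_value (p * q) X) = dim_col (poly_value p X * poly_value q X)"
    by (simp_all add: poly_value_def)
  fix a b assume "a < dim_row (poly_value p X * poly_value q X)" "b < dim_col (poly_value p X * poly_value q X)"
  then have ab: "a < n" "b < n" using carrier_matD[OF poly_value_carrier[OF X, of p]] carrier_matD[OF poly_value_carrier[OF X, of q]] by auto
  show "poly_value (p * q) X $$ (a, b) = (poly_value p X * poly_value q X) $$ (a, b)"
    unfolding poly_value_mult_entry[OF X ab]
    using mat_mult_entry[OF poly_value_carrier[OF X] poly_value_carrier[OF X] ab] by simp
qed

lemma poly_value_pconst:
  assumes "X \<in> tuples n" "a < n" "b < n"
  shows "poly_value (pconst c) X $$ (a, b) = c * delta a b"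
  using assms by (simp add: pconst_def poly_value_single[OF assms] word_value_Nil[OF assms(1)])

lemma pconst_one: "pconst 1 = 1"
  unfolding pconst_def by (metis single_one zero_list_def)

lemma poly_value_one:
  assumes "X \<in> tuples n"
  shows "poly_value 1 X = 1\<^sub>m n"
  using poly_value_pconst[OF assms, of _ _ 1] poly_value_carrier[OF assms, of 1]
  by (intro eq_matI) (auto simp: pconst_one)

lemma poly_value_pvar:
  assumes "X \<in> tuples n"
  shows "poly_value (pvar j) X = X j"
  using poly_value_single[OF assms, of _ _ "[j]" 1] poly_value_carrier[OF assms, of "pvar j"] tuplesD[OF assms, of j]
  by (intro eq_matI) (auto simp: pvar_def word_value_Cons word_value_Nil[OF assms])

lemma pconst_add: "pconst (c + e) = pconst c + pconst e"
  by (simp add: pconst_def single_add)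

lemma pconst_zero: "pconst 0 = 0"
  by (simp add: pconst_def)

lemma pconst_mult: "pconst (c * e) = pconst c * pconst e"
  by (simp add: pconst_def mult_single plus_list_def)

lemma pconst_sum: "pconst (sum f A) = (\<Sum>i\<in>A. pconst (f i))"
  by (induction A rule: infinite_finite_induct) (simp_all add: pconst_add pconst_zero)

lemma pconst_delta: "pconst (delta i j) = delta i j"
  by (simp add: pconst_one pconst_zero)

lemma pconst_commute: "pconst c * p = p * pconst c"
  by (subst (1 2) ncpoly_sum_single[of p])
     (simp add: sum_distrib_left sum_distrib_right pconst_def mult_single plus_list_def mult.commute)

lemma poly_mult_pconst_entry:
  assumes "X \<in> tuples n" "a < n" "b < n"
  shows "poly_value (pconst c * p) X $$ (a, b) = c * poly_value p X $$ (a, b)"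
proof -
  have "poly_value (pconst c * p) X $$ (a, b) = (\<Sum>e<n. if e = a then c * poly_value p X $$ (a, b) else 0)"
    unfolding poly_value_mult_entry[OF assms]
    using poly_value_pconst[OF assms(1,2)] by (intro sum.cong) auto
  then show ?thesis using assms by simp
qed

section \<open>Operator norms and the ball\<close>

abbreviation l2n :: "nat \<Rightarrow> (nat \<Rightarrow> 'a::real_normed_vector) \<Rightarrow> real" where
  "l2n n v \<equiv> L2_set (\<lambda>a. norm (v a)) {..<n}"

lemma l2n_sq: "(l2n n v)\<^sup>2 = (\<Sum>a<n. (norm (v a))\<^sup>2)"
  by (simp add: L2_set_def sum_nonneg)

lemma l2n_le_iff: "C \<ge> 0 \<Longrightarrow> l2n n v \<le> C * l2n m w \<longleftrightarrow>
    (\<Sum>a<n. (norm (v a))\<^sup>2) \<le> C\<^sup>2 * (\<Sum>a<m. (norm (w a))\<^sup>2)"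
  unfolding l2n_sq[symmetric] power_mult_distrib[symmetric]
  by (rule iffI) (auto intro: power_mono power2_le_imp_le)

lemma l2n_zero: "l2n n (\<lambda>_. 0) = 0"
  by (simp add: L2_set_def)

lemma norm_le_l2n: "a < n \<Longrightarrow> norm (v a) \<le> l2n n v"
  by (rule member_le_L2_set) auto

lemma l2n_scaleR: "l2n n (\<lambda>a. c *\<^sub>R v a) = \<bar>c\<bar> * l2n n v"
  by (simp add: L2_set_right_distrib)

lemma l2n_triangle: "l2n n (\<lambda>a. v a + w a) \<le> l2n n v + l2n n w"
  by (rule order_trans[OF L2_set_mono L2_set_triangle_ineq]) (auto intro: norm_triangle_ineq)

text \<open>Passing from the unit ball to all vectors divides by the length. A vector of length
  \<open>0\<close> need not be the zero function, as its entries from \<open>n\<close> on are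
  arbitrary; the assumption \<open>cong\<close> covers this case.\<close>

lemma homogeneous_bound:
  fixes f :: "(nat \<Rightarrow> 'a::real_normed_vector) \<Rightarrow> nat \<Rightarrow> 'b::real_normed_vector"
  assumes hom: "\<And>c v i. i < n \<Longrightarrow> f (\<lambda>a. c *\<^sub>R v a) i = c *\<^sub>R f v i"
    and bound: "\<And>v. l2n n v \<le> 1 \<Longrightarrow> l2n n (f v) \<le> C"
    and cong: "\<And>v. l2n n v = 0 \<Longrightarrow> l2n n (f v) = 0"
  shows "l2n n (f v) \<le> C * l2n n v"
proof (cases "l2n n v = 0")
  case True
  then show ?thesis using cong by simp
next
  case False
  define c where "c = l2n n v"
  have c: "c > 0" using False by (simp add: c_def order_less_le)
  have "l2n n (f (\<lambda>a. (1/c) *\<^sub>R v a)) \<le> C"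
    by (rule bound) (use c in \<open>simp only: l2n_scaleR, simp add: c_def\<close>)
  also have "l2n n (f (\<lambda>a. (1/c) *\<^sub>R v a)) = l2n n (\<lambda>i. (1/c) *\<^sub>R f v i)"
    by (intro L2_set_cong refl) (simp add: hom)
  also have "\<dots> = l2n n (f v) / c" using c by (simp only: l2n_scaleR) simp
  finally show ?thesis using c by (simp add: c_def[symmetric] field_simps)
qed

text \<open>Stated as an inequality for all vectors, with no supremum: such bounds compose and add
  directly, and the side conditions of \<open>Sup\<close> arise only in the comparison with
  \<open>mat_norm\<close>.\<close>

definition op_bound :: "nat \<Rightarrow> complex mat \<Rightarrow> real \<Rightarrow> bool" where
  "op_bound n A C \<longleftrightarrow> (\<forall>v. l2n n (\<lambda>a. \<Sum>b<n. A $$ (a, b) * v b) \<le> C * l2n n v)"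

lemma op_boundD: "op_bound n A C \<Longrightarrow> l2n n (\<lambda>a. \<Sum>b<n. A $$ (a, b) * v b) \<le> C * l2n n v"
  by (simp add: op_bound_def)

lemma op_bound_unit:
  assumes "op_bound n A C" "C \<ge> 0" "l2n n v \<le> 1"
  shows "l2n n (\<lambda>a. \<Sum>b<n. A $$ (a, b) * v b) \<le> C"
  using op_boundD[OF assms(1), of v] mult_left_mono[OF assms(3,2)] by simp

lemma mat_norm_set:
  assumes "A \<in> carrier_mat n n"
  shows "mat_norm A = Sup {l2n n (\<lambda>a. \<Sum>b<n. A $$ (a, b) * v b) | v. l2n n v \<le> 1}"
proof -
  have eq: "(A *\<^sub>v v) $ a = (\<Sum>b<n. A $$ (a, b) * v $ b)" if "v \<in> carrier_vec n" "a < n" for v a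
    using assms that by (simp add: scalar_prod_def atLeast0LessThan)
  have "{L2_set (\<lambda>i. cmod ((A *\<^sub>v v) $ i)) {..<dim_row A} | v.
           v \<in> carrier_vec (dim_col A) \<and> L2_set (\<lambda>i. cmod (v $ i)) {..<dim_col A} \<le> 1}
     = {l2n n (\<lambda>a. \<Sum>b<n. A $$ (a, b) * v b) | v. l2n n v \<le> 1}" (is "?L = ?R")
  proof
    show "?L \<subseteq> ?R"
    proof
      fix x assume "x \<in> ?L"
      then obtain v where v: "v \<in> carrier_vec n" "l2n n (\<lambda>a. v $ a) \<le> 1"
        and x: "x = l2n n (\<lambda>a. (A *\<^sub>v v) $ a)" using assms by auto
      have "x = l2n n (\<lambda>a. \<Sum>b<n. A $$ (a, b) * v $ b)" unfolding x by (intro L2_set_cong) (simp_all add: eq v)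
      then show "x \<in> ?R" using v by (auto intro!: exI[of _ "\<lambda>a. v $ a"])
    qed
    show "?R \<subseteq> ?L"
    proof
      fix x assume "x \<in> ?R"
      then obtain v where v: "l2n n v \<le> 1" and x: "x = l2n n (\<lambda>a. \<Sum>b<n. A $$ (a, b) * v b)" by auto
      have "l2n n (\<lambda>a. vec n v $ a) = l2n n v" by (intro L2_set_cong) auto
      moreover have "x = l2n n (\<lambda>a. (A *\<^sub>v vec n v) $ a)" unfolding x by (intro L2_set_cong) (simp_all add: eq)
      ultimately show "x \<in> ?L" using assms v by (auto intro!: exI[of _ "vec n v"])
    qed
  qed
  then show ?thesis by (simp add: mat_norm_def)
qed

text \<open>The sum of the moduli of all entries is a crude bound; its purpose is to make the
  supremum in \<open>mat_norm\<close> a supremum of a bounded set.\<close>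

lemma op_bound_exists: "\<exists>C\<ge>0. op_bound n A C"
proof -
  define C where "C = (\<Sum>a<n. \<Sum>b<n. cmod (A $$ (a, b)))"
  have "l2n n (\<lambda>a. \<Sum>b<n. A $$ (a, b) * v b) \<le> C * l2n n v" for v
  proof -
    have "l2n n (\<lambda>a. \<Sum>b<n. A $$ (a, b) * v b) \<le> (\<Sum>a<n. cmod (\<Sum>b<n. A $$ (a, b) * v b))"
      by (rule L2_set_le_sum) auto
    also have "\<dots> \<le> (\<Sum>a<n. \<Sum>b<n. cmod (A $$ (a, b)) * l2n n v)"
      by (intro sum_mono sum_norm_le) (auto simp: norm_mult intro!: mult_left_mono norm_le_l2n)
    also have "\<dots> = C * l2n n v" by (simp add: C_def sum_distrib_right)
    finally show ?thesis .
  qed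
  moreover have "C \<ge> 0" by (simp add: C_def sum_nonneg)
  ultimately show ?thesis unfolding op_bound_def by blast
qed

lemma mat_norm_le:
  assumes "A \<in> carrier_mat n n" "op_bound n A C" "C \<ge> 0"
  shows "mat_norm A \<le> C"
  unfolding mat_norm_set[OF assms(1)]
proof (rule cSup_least)
  show "{l2n n (\<lambda>a. \<Sum>b<n. A $$ (a, b) * v b) | v. l2n n v \<le> 1} \<noteq> {}"
    using l2n_zero[of n, where ?'a = complex] by (auto intro!: exI[of _ "\<lambda>_. 0"])
  fix x assume "x \<in> {l2n n (\<lambda>a. \<Sum>b<n. A $$ (a, b) * v b) | v. l2n n v \<le> 1}"
  then obtain v where "x = l2n n (\<lambda>a. \<Sum>b<n. A $$ (a, b) * v b)" "l2n n v \<le> 1" by auto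
  then show "x \<le> C" using op_bound_unit[OF assms(2,3)] by simp
qed

lemma op_bound_mat_norm:
  assumes "A \<in> carrier_mat n n"
  shows "op_bound n A (mat_norm A)"
  unfolding op_bound_def
proof
  fix v
  obtain C where C: "C \<ge> 0" "op_bound n A C" using op_bound_exists by blast
  show "l2n n (\<lambda>a. \<Sum>b<n. A $$ (a, b) * v b) \<le> mat_norm A * l2n n v"
  proof (rule homogeneous_bound[where f = "\<lambda>v a. \<Sum>b<n. A $$ (a, b) * v b"])
    show "(\<Sum>b<n. A $$ (i, b) * (c *\<^sub>R v b)) = c *\<^sub>R (\<Sum>b<n. A $$ (i, b) * v b)" for c v i
      by (simp add: scaleR_sum_right)
    show "l2n n (\<lambda>a. \<Sum>b<n. A $$ (a, b) * v b) \<le> mat_norm A" if v: "l2n n v \<le> 1" for v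
      unfolding mat_norm_set[OF assms]
    proof (rule cSup_upper)
      have "l2n n (\<lambda>a. \<Sum>b<n. A $$ (a, b) * v b) \<le> C" if "l2n n v \<le> 1" for v
        using op_bound_unit[OF C(2,1) that] .
      then show "bdd_above {l2n n (\<lambda>a. \<Sum>b<n. A $$ (a, b) * v b) | v. l2n n v \<le> 1}"
        by (auto simp: bdd_above_def)
    qed (use v in blast)
    show "l2n n (\<lambda>a. \<Sum>b<n. A $$ (a, b) * v b) = 0" if "l2n n v = 0" for v
      using op_boundD[OF C(2), of v] that by (simp add: antisym)
  qed
qed

lemma mat_norm_nonneg:
  assumes "A \<in> carrier_mat n n"
  shows "mat_norm A \<ge> 0"
proof -
  obtain C where C: "C \<ge> 0" "op_bound n A C" using op_bound_exists by blast
  have "l2n n (\<lambda>a. \<Sum>b<n. A $$ (a, b) * 0) \<le> mat_norm A"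
    unfolding mat_norm_set[OF assms]
  proof (rule cSup_upper)
    have "l2n n (\<lambda>a. \<Sum>b<n. A $$ (a, b) * v b) \<le> C" if "l2n n v \<le> 1" for v
      using op_bound_unit[OF C(2,1) that] .
    then show "bdd_above {l2n n (\<lambda>a. \<Sum>b<n. A $$ (a, b) * v b) | v. l2n n v \<le> 1}"
      by (auto simp: bdd_above_def)
  qed (use l2n_zero[of n, where ?'a = complex] in \<open>auto intro!: exI[of _ "\<lambda>_. 0"]\<close>)
  then show ?thesis by (simp add: L2_set_def)
qed

lemma op_bound_entry:
  assumes "op_bound n A C" "a < n" "b < n"
  shows "cmod (A $$ (a, b)) \<le> C"
proof -
  have "(\<Sum>i<n. (norm (delta i b :: complex))\<^sup>2) = (\<Sum>i<n. delta i b)" by (intro sum.cong) auto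
  then have 1: "l2n n (\<lambda>i. delta i b :: complex) = 1" using assms by (simp add: L2_set_def)
  have "(\<Sum>i<n. A $$ (a, i) * delta i b) = (\<Sum>i<n. if i = b then A $$ (a, b) else 0)" by (intro sum.cong) auto
  then have "cmod (A $$ (a, b)) = cmod (\<Sum>i<n. A $$ (a, i) * delta i b)" using assms by simp
  also have "\<dots> \<le> l2n n (\<lambda>a. \<Sum>i<n. A $$ (a, i) * delta i b)" by (rule norm_le_l2n[OF assms(2)])
  also have "\<dots> \<le> C * l2n n (\<lambda>i. delta i b :: complex)"
    by (rule op_boundD[OF assms(1)])
  finally show ?thesis unfolding 1 by simp
qed

lemma op_bound_mult:
  assumes "op_bound n A C" "op_bound n B E" "C \<ge> 0" "A \<in> carrier_mat n n" "B \<in> carrier_mat n n"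
  shows "op_bound n (A * B) (C * E)"
  unfolding op_bound_def
proof
  fix v
  define w where "w c = (\<Sum>b<n. B $$ (c, b) * v b)" for c
  have "l2n n (\<lambda>a. \<Sum>b<n. (A * B) $$ (a, b) * v b) = l2n n (\<lambda>a. \<Sum>c<n. A $$ (a, c) * w c)"
  proof (intro L2_set_cong refl arg_cong[of _ _ cmod])
    fix a assume "a \<in> {..<n}"
    then have "(\<Sum>b<n. (A * B) $$ (a, b) * v b) = (\<Sum>b<n. \<Sum>c<n. A $$ (a, c) * B $$ (c, b) * v b)"
      by (simp add: mat_mult_entry[OF assms(4,5)] sum_distrib_right)
    also have "\<dots> = (\<Sum>c<n. A $$ (a, c) * w c)"
      by (subst sum.swap) (simp add: w_def sum_distrib_left mult.assoc)
    finally show "(\<Sum>b<n. (A * B) $$ (a, b) * v b) = (\<Sum>c<n. A $$ (a, c) * w c)" .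
  qed
  also have "\<dots> \<le> C * l2n n w" using assms(1) by (simp add: op_bound_def)
  also have "\<dots> \<le> C * (E * l2n n v)"
    using assms(2,3) by (intro mult_left_mono) (auto simp: op_bound_def w_def)
  finally show "l2n n (\<lambda>a. \<Sum>b<n. (A * B) $$ (a, b) * v b) \<le> C * E * l2n n v" by simp
qed

lemma op_bound_add:
  assumes "op_bound n A C" "op_bound n B E" "A \<in> carrier_mat n n" "B \<in> carrier_mat n n"
  shows "op_bound n (A + B) (C + E)"
  unfolding op_bound_def
proof
  fix v
  have "l2n n (\<lambda>a. \<Sum>b<n. (A + B) $$ (a, b) * v b)
    = l2n n (\<lambda>a. (\<Sum>b<n. A $$ (a, b) * v b) + (\<Sum>b<n. B $$ (a, b) * v b))"
    using assms by (intro L2_set_cong refl arg_cong[of _ _ cmod]) (simp add: algebra_simps sum.distrib)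
  also have "\<dots> \<le> l2n n (\<lambda>a. \<Sum>b<n. A $$ (a, b) * v b) + l2n n (\<lambda>a. \<Sum>b<n. B $$ (a, b) * v b)"
    by (rule l2n_triangle)
  also have "\<dots> \<le> C * l2n n v + E * l2n n v" using assms by (intro add_mono) (auto simp: op_bound_def)
  finally show "l2n n (\<lambda>a. \<Sum>b<n. (A + B) $$ (a, b) * v b) \<le> (C + E) * l2n n v" by (simp add: algebra_simps)
qed

lemma op_bound_smult:
  assumes "op_bound n A C" "A \<in> carrier_mat n n"
  shows "op_bound n (c \<cdot>\<^sub>m A) (cmod c * C)"
  unfolding op_bound_def
proof
  fix v
  have "l2n n (\<lambda>a. \<Sum>b<n. (c \<cdot>\<^sub>m A) $$ (a, b) * v b) = l2n n (\<lambda>a. c * (\<Sum>b<n. A $$ (a, b) * v b))"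
    using assms by (intro L2_set_cong refl arg_cong[of _ _ cmod]) (simp add: sum_distrib_left mult.assoc)
  also have "\<dots> = cmod c * l2n n (\<lambda>a. \<Sum>b<n. A $$ (a, b) * v b)"
    by (simp add: norm_mult L2_set_right_distrib)
  also have "\<dots> \<le> cmod c * (C * l2n n v)" using assms by (intro mult_left_mono) (auto simp: op_bound_def)
  finally show "l2n n (\<lambda>a. \<Sum>b<n. (c \<cdot>\<^sub>m A) $$ (a, b) * v b) \<le> cmod c * C * l2n n v" by simp
qed

lemma mat_norm_mult:
  assumes "A \<in> carrier_mat n n" "B \<in> carrier_mat n n"
  shows "mat_norm (A * B) \<le> mat_norm A * mat_norm B"
  by (rule mat_norm_le[OF _ op_bound_mult[OF op_bound_mat_norm[OF assms(1)] op_bound_mat_norm[OF assms(2)]]])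
     (use assms mat_norm_nonneg[OF assms(1)] mat_norm_nonneg[OF assms(2)] in auto)

lemma mat_norm_add:
  assumes "A \<in> carrier_mat n n" "B \<in> carrier_mat n n"
  shows "mat_norm (A + B) \<le> mat_norm A + mat_norm B"
  by (rule mat_norm_le[OF _ op_bound_add[OF op_bound_mat_norm[OF assms(1)] op_bound_mat_norm[OF assms(2)]]])
     (use assms mat_norm_nonneg[OF assms(1)] mat_norm_nonneg[OF assms(2)] in auto)

lemma mat_norm_smult:
  assumes "A \<in> carrier_mat n n"
  shows "mat_norm (c \<cdot>\<^sub>m A) \<le> cmod c * mat_norm A"
  by (rule mat_norm_le[OF _ op_bound_smult[OF op_bound_mat_norm[OF assms]]])
     (use assms mat_norm_nonneg[OF assms] in auto)

lemma mat_norm_entry: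
  assumes "A \<in> carrier_mat n n" "a < n" "b < n"
  shows "cmod (A $$ (a, b)) \<le> mat_norm A"
  using op_bound_entry[OF op_bound_mat_norm[OF assms(1)] assms(2,3)] .

section \<open>Inner product calculus in the Hilbert space\<close>

lemma scaleC_zero_right [simp]: "a *\<^sub>C (0 :: 'h::chilbert_space) = 0"
  using scaleC_add_right[of a 0 "0 :: 'h"] by simp

lemma scaleC_zero_left [simp]: "0 *\<^sub>C (x :: 'h::chilbert_space) = 0"
  using scaleC_of_real[of 0 x] by simp

lemma scaleC_one [simp]: "1 *\<^sub>C (x :: 'h::chilbert_space) = x"
  using scaleC_of_real[of 1 x] by simp

lemma scaleC_sum_right: "a *\<^sub>C (\<Sum>i\<in>A. f i) = (\<Sum>i\<in>A. a *\<^sub>C (f i :: 'h::chilbert_space))"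
  by (induction A rule: infinite_finite_induct) (simp_all add: scaleC_add_right)

lemma scaleC_sum_left: "(\<Sum>i\<in>A. f i) *\<^sub>C (x :: 'h::chilbert_space) = (\<Sum>i\<in>A. f i *\<^sub>C x)"
  by (induction A rule: infinite_finite_induct) (simp_all add: scaleC_add_left)

lemma cinner_zero_right [simp]: "cinner (x :: 'h::chilbert_space) 0 = 0"
  using cinner_add_right[of x 0 0] by simp

lemma cinner_sum_right: "cinner (x :: 'h::chilbert_space) (\<Sum>i\<in>A. f i) = (\<Sum>i\<in>A. cinner x (f i))"
  by (induction A rule: infinite_finite_induct) (simp_all add: cinner_add_right)

lemma cinner_sum_left: "cinner (\<Sum>i\<in>A. f i) (x :: 'h::chilbert_space) = (\<Sum>i\<in>A. cinner (f i) x)"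
  by (subst cinner_commute) (simp add: cinner_sum_right cinner_commute[of _ x])

lemma cinner_scaleC_left: "cinner (a *\<^sub>C x) (y :: 'h::chilbert_space) = cnj a * cinner x y"
  by (subst cinner_commute) (simp add: cinner_scaleC_right cinner_commute[of _ x])

lemma norm_scaleC: "norm (a *\<^sub>C (x :: 'h::chilbert_space)) = cmod a * norm x"
proof -
  have "complex_of_real ((norm (a *\<^sub>C x))\<^sup>2) = (a * cnj a) * cinner x x"
    by (subst cinner_self[symmetric]) (simp add: cinner_scaleC_left cinner_scaleC_right)
  also have "\<dots> = complex_of_real ((cmod a)\<^sup>2 * (norm x)\<^sup>2)"
    by (simp only: cinner_self complex_norm_square[symmetric] of_real_mult)
  finally have "(norm (a *\<^sub>C x))\<^sup>2 = (cmod a * norm x)\<^sup>2" by (simp only: of_real_eq_iff power_mult_distrib)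
  then show ?thesis by (simp add: power2_eq_iff_nonneg)
qed

lemma norm_sq_sum_scaleC:
  "(norm (\<Sum>a\<in>A. w a *\<^sub>C (h a :: 'h::chilbert_space)))\<^sup>2 = qform A (\<lambda>a b. cinner (h a) (h b)) w"
proof -
  have "complex_of_real ((norm (\<Sum>a\<in>A. w a *\<^sub>C h a))\<^sup>2) = (\<Sum>a\<in>A. \<Sum>b\<in>A. cnj (w a) * cinner (h a) (h b) * w b)"
    by (subst cinner_self[symmetric])
       (simp only: cinner_sum_left, simp add: cinner_sum_right cinner_scaleC_left cinner_scaleC_right sum_distrib_left mult_ac)
  then show ?thesis unfolding qform_def by (metis Re_complex_of_real)
qed

text \<open>The Gram matrix of \<open>h\<close> is decomposed into rank-one pieces, which reduces the claim to scalars.\<close>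

lemma contraction_tensor:
  fixes h :: "nat \<Rightarrow> 'h::chilbert_space"
  assumes W: "\<And>w. (\<Sum>a<n. (cmod (\<Sum>b<n. W a b * w b))\<^sup>2) \<le> (\<Sum>b<n. (cmod (w b))\<^sup>2)"
  shows "(\<Sum>a<n. (norm (\<Sum>b<n. W a b *\<^sub>C h b))\<^sup>2) \<le> (\<Sum>b<n. (norm (h b))\<^sup>2)"
proof -
  define G where "G a b = cinner (h a) (h b)" for a b
  have "hermitian_on {..<n} G" unfolding hermitian_on_def G_def using cinner_commute by blast
  moreover have "qform {..<n} G x \<ge> 0" for x
    using norm_sq_sum_scaleC[where A = "{..<n}" and w = x and h = h] unfolding G_def by (metis zero_le_power2)
  ultimately obtain S R d where d: "\<And>i. d i \<ge> (0::real)"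
    and G: "\<And>i j. i \<in> {..<n} \<Longrightarrow> j \<in> {..<n} \<Longrightarrow> G i j = (\<Sum>m<n. of_real (d m) * cnj (S m i) * S m j)"
    using psd_ldl[of "{..<n}" G] by blast
  have q: "(norm (\<Sum>b<n. w b *\<^sub>C h b))\<^sup>2 = (\<Sum>m<n. d m * (cmod (\<Sum>b<n. S m b * w b))\<^sup>2)" for w
    unfolding norm_sq_sum_scaleC G_def[symmetric] by (rule qform_ldl) (rule G)
  have q1: "(norm (h b))\<^sup>2 = (\<Sum>m<n. d m * (cmod (S m b))\<^sup>2)" if "b < n" for b
  proof -
    have "(\<Sum>c<n. delta c b *\<^sub>C h c) = (\<Sum>c<n. if c = b then h b else 0)" by (intro sum.cong) auto
    moreover have "(\<Sum>c<n. S m c * delta c b) = (\<Sum>c<n. if c = b then S m b else 0)" for m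
      by (intro sum.cong) auto
    ultimately show ?thesis using q[of "\<lambda>c. delta c b"] that by simp
  qed
  have "(\<Sum>a<n. (norm (\<Sum>b<n. W a b *\<^sub>C h b))\<^sup>2)
    = (\<Sum>m<n. d m * (\<Sum>a<n. (cmod (\<Sum>b<n. W a b * S m b))\<^sup>2))"
    unfolding q sum_distrib_left by (subst sum.swap) (simp add: mult.commute)
  also have "\<dots> \<le> (\<Sum>m<n. d m * (\<Sum>b<n. (cmod (S m b))\<^sup>2))"
    by (intro sum_mono mult_left_mono W d)
  also have "\<dots> = (\<Sum>b<n. (norm (h b))\<^sup>2)"
    unfolding sum_distrib_left by (subst sum.swap) (simp add: q1)
  finally show ?thesis .
qed

section \<open>Membership in the ball and the operations that preserve it\<close>

lemma pencil_scaleR: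
  assumes "\<And>j. bounded_clinear_op (Q j)"
  shows "pencil Q n X (\<lambda>l. c *\<^sub>R v l) i = c *\<^sub>R pencil Q n X v i"
proof -
  have "a *\<^sub>C Q j (c *\<^sub>R x) = c *\<^sub>R (a *\<^sub>C Q j x)" for a j x
    using assms[of j] unfolding bounded_clinear_op_def
    by (metis mult.commute scaleC_of_real scaleC_scaleC)
  then show ?thesis by (simp add: pencil_def scaleR_sum_right)
qed

lemma pencil_bound_exists:
  fixes Q :: "'d::finite \<Rightarrow> 'h::chilbert_space \<Rightarrow> 'h"
  assumes "\<And>j. bounded_clinear_op (Q j)"
  shows "\<exists>C\<ge>0. \<forall>v. l2n n (pencil Q n X v) \<le> C * l2n n v"
proof -
  have "\<forall>j. \<exists>K\<ge>0. \<forall>x. norm (Q j x) \<le> norm x * K"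
    using assms bounded_linear.nonneg_bounded unfolding bounded_clinear_op_def by blast
  then obtain K where K: "\<And>j. K j \<ge> 0" "\<And>j x. norm (Q j x) \<le> norm x * K j" by metis
  define C where "C = (\<Sum>i<n. \<Sum>j\<in>UNIV. \<Sum>l<n. cmod (X j $$ (i, l)) * K j)"
  have "l2n n (pencil Q n X v) \<le> C * l2n n v" for v
  proof -
    have "l2n n (pencil Q n X v) \<le> (\<Sum>i<n. norm (pencil Q n X v i))"
      by (rule L2_set_le_sum) auto
    also have "\<dots> \<le> (\<Sum>i<n. \<Sum>j\<in>UNIV. \<Sum>l<n. cmod (X j $$ (i, l)) * K j * l2n n v)"
      unfolding pencil_def
    proof (intro sum_mono sum_norm_le)
      fix i j l assume "l \<in> {..<n}"
      have "norm (Q j (v l)) \<le> l2n n v * K j"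
        using K norm_le_l2n[of l n v] \<open>l \<in> {..<n}\<close>
        by (meson lessThan_iff mult_right_mono order_trans)
      then show "norm (X j $$ (i, l) *\<^sub>C Q j (v l)) \<le> cmod (X j $$ (i, l)) * K j * l2n n v"
        by (simp add: norm_scaleC mult.assoc mult_left_mono mult.commute[of "K j"])
    qed
    also have "\<dots> = C * l2n n v" by (simp add: C_def sum_distrib_right)
    finally show ?thesis .
  qed
  moreover have "C \<ge> 0" using K by (simp add: C_def sum_nonneg)
  ultimately show ?thesis by blast
qed

text \<open>Trades the supremum in \<open>pencil_norm\<close> for a contraction rate
  \<open>r < 1\<close>. The direction from the supremum relies on
  \<open>pencil_bound_exists\<close>, since a supremum of an unbounded set would carry no
  information.\<close>

lemma nc_ball_iff:
  fixes Q :: "'d::finite \<Rightarrow> 'h::chilbert_space \<Rightarrow> 'h"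
  assumes Q: "\<And>j. bounded_clinear_op (Q j)"
  shows "X \<in> nc_ball Q \<longleftrightarrow>
    (\<exists>n\<ge>1. X \<in> tuples n \<and> (\<exists>r. 0 \<le> r \<and> r < 1 \<and> (\<forall>v. l2n n (pencil Q n X v) \<le> r * l2n n v)))"
proof -
  have "pencil_norm Q n X < 1 \<longleftrightarrow> (\<exists>r. 0 \<le> r \<and> r < 1 \<and> (\<forall>v. l2n n (pencil Q n X v) \<le> r * l2n n v))" for n
  proof
    let ?A = "{l2n n (pencil Q n X v) | v. l2n n v \<le> 1}"
    obtain C where C: "C \<ge> 0" "\<And>v. l2n n (pencil Q n X v) \<le> C * l2n n v"
      using pencil_bound_exists[of Q, OF Q] by blast
    have "l2n n (pencil Q n X v) \<le> C" if "l2n n v \<le> 1" for v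
      using C(2)[of v] mult_left_mono[OF that C(1)] by simp
    then have bdd: "bdd_above ?A" by (auto simp: bdd_above_def)
    have zero: "l2n n (\<lambda>_. 0 :: 'h) \<le> 1" by (simp add: L2_set_def)
    have pn: "pencil_norm Q n X = Sup ?A" by (simp add: pencil_norm_def)
    {
      assume less: "pencil_norm Q n X < 1"
      have le: "l2n n (pencil Q n X v) \<le> pencil_norm Q n X" if "l2n n v \<le> 1" for v
        unfolding pn by (rule cSup_upper[OF _ bdd]) (use that in blast)
      have "l2n n (pencil Q n X v) \<le> pencil_norm Q n X * l2n n v" for v
      proof (rule homogeneous_bound[where f = "pencil Q n X"])
        show "l2n n (pencil Q n X v) = 0" if "l2n n v = 0" for v
          using C(2)[of v] that by (simp add: antisym)
      qed (use pencil_scaleR[of Q, OF Q] le in auto)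
      moreover have "0 \<le> pencil_norm Q n X" using le[OF zero] by (meson L2_set_nonneg order_trans)
      ultimately show "\<exists>r. 0 \<le> r \<and> r < 1 \<and> (\<forall>v. l2n n (pencil Q n X v) \<le> r * l2n n v)"
        using less by blast
    }
    assume "\<exists>r. 0 \<le> r \<and> r < 1 \<and> (\<forall>v. l2n n (pencil Q n X v) \<le> r * l2n n v)"
    then obtain r where r: "0 \<le> r" "r < 1" "\<And>v. l2n n (pencil Q n X v) \<le> r * l2n n v" by blast
    have "Sup ?A \<le> r"
    proof (rule cSup_least)
      have "l2n n (pencil Q n X (\<lambda>_. 0)) \<in> ?A" using zero by auto
      then show "?A \<noteq> {}" by (metis empty_iff)
      fix x assume "x \<in> ?A"
      then obtain v where v: "x = l2n n (pencil Q n X v)" "l2n n v \<le> 1" by auto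
      show "x \<le> r" using r(3)[of v] mult_left_mono[OF v(2) r(1)] by (simp add: v(1))
    qed
    then show "pencil_norm Q n X < 1" using r(2) by (simp add: pn)
  qed
  then show ?thesis unfolding nc_ball_def by simp
qed

lemma nc_ballE:
  fixes Q :: "'d::finite \<Rightarrow> 'h::chilbert_space \<Rightarrow> 'h"
  assumes Q: "\<And>j. bounded_clinear_op (Q j)" and X: "X \<in> nc_ball Q" "X \<in> tuples n"
  obtains r where "1 \<le> n" "0 \<le> r" "r < 1" "\<And>v. l2n n (pencil Q n X v) \<le> r * l2n n v"
  using X(1) tuples_unique[OF X(2)] unfolding nc_ball_iff[of Q, OF Q] by metis

lemma nc_ballI:
  fixes Q :: "'d::finite \<Rightarrow> 'h::chilbert_space \<Rightarrow> 'h"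
  assumes Q: "\<And>j. bounded_clinear_op (Q j)" and "1 \<le> n" "X \<in> tuples n" "0 \<le> r" "r < 1"
    and "\<And>v. l2n n (pencil Q n X v) \<le> r * l2n n v"
  shows "X \<in> nc_ball Q"
  unfolding nc_ball_iff[of Q, OF Q] using assms by blast

lemma nc_ball_size:
  assumes "X \<in> nc_ball Q"
  obtains n where "1 \<le> n" "X \<in> tuples n"
  using assms unfolding nc_ball_def by blast

lemma pencil_smult:
  assumes "X \<in> tuples n" "i < n"
  shows "pencil Q n (\<lambda>j. c \<cdot>\<^sub>m X j) v i = c *\<^sub>C pencil Q n X v i"
proof -
  have "(c \<cdot>\<^sub>m X j) $$ (i, l) = c * X j $$ (i, l)" if "l < n" for j l
    using tuplesD[OF assms(1), of j] assms(2) that by simp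
  then show ?thesis by (simp add: pencil_def scaleC_sum_right scaleC_scaleC)
qed

lemma tuples_smult: "X \<in> tuples n \<Longrightarrow> (\<lambda>j. c \<cdot>\<^sub>m X j) \<in> tuples n"
  by (simp add: tuples_def)

lemma pencil_smult_norm:
  assumes "X \<in> tuples n"
  shows "l2n n (pencil Q n (\<lambda>j. c \<cdot>\<^sub>m X j) v) = cmod c * l2n n (pencil Q n X v)"
proof -
  have "l2n n (pencil Q n (\<lambda>j. c \<cdot>\<^sub>m X j) v) = L2_set (\<lambda>i. cmod c * norm (pencil Q n X v i)) {..<n}"
    by (intro L2_set_cong) (auto simp: pencil_smult[OF assms] norm_scaleC)
  then show ?thesis by (simp add: L2_set_right_distrib)
qed

text \<open>The ball is open along rays: \<open>s\<close> is the midpoint of the rate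
  \<open>r\<close> and \<open>1\<close>, so the enlarged point has rate \<open>r / s < 1\<close>.
  This room is the source of the geometric decay of powers.\<close>

lemma nc_ball_inflate:
  fixes Q :: "'d::finite \<Rightarrow> 'h::chilbert_space \<Rightarrow> 'h"
  assumes Q: "\<And>j. bounded_clinear_op (Q j)" and X: "X \<in> nc_ball Q" "X \<in> tuples n"
  obtains s where "0 < s" "s < (1::real)" "(\<lambda>j. complex_of_real (1/s) \<cdot>\<^sub>m X j) \<in> nc_ball Q"
proof -
  obtain r where r: "1 \<le> n" "0 \<le> r" "r < 1" "\<And>v. l2n n (pencil Q n X v) \<le> r * l2n n v"
    using nc_ballE[of Q, OF Q X] by metis
  define s where "s = (1 + r) / 2"
  have s: "0 < s" "s < 1" "r < s" using r by (auto simp: s_def)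
  have "(\<lambda>j. complex_of_real (1/s) \<cdot>\<^sub>m X j) \<in> nc_ball Q"
  proof (rule nc_ballI[of Q, OF Q r(1) tuples_smult[OF X(2)]])
    show "0 \<le> r / s" "r / s < 1" using s r by auto
    show "l2n n (pencil Q n (\<lambda>j. complex_of_real (1/s) \<cdot>\<^sub>m X j) v) \<le> r / s * l2n n v" for v
      using r(4)[of v] s unfolding pencil_smult_norm[OF X(2)] by (simp add: norm_divide divide_right_mono)
  qed
  then show thesis using s that by blast
qed

text \<open>Supplies points of the ball in any prescribed direction, at which linear pencils can be
  probed one coefficient at a time; applied to the zero tuple it supplies the origin.\<close>

lemma nc_ball_shrink:
  fixes Q :: "'d::finite \<Rightarrow> 'h::chilbert_space \<Rightarrow> 'h"
  assumes Q: "\<And>j. bounded_clinear_op (Q j)" and X: "1 \<le> n" "X \<in> tuples n"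
  obtains t where "t > (0::real)" "(\<lambda>j. complex_of_real t \<cdot>\<^sub>m X j) \<in> nc_ball Q"
proof -
  obtain C where C: "C \<ge> 0" "\<And>v. l2n n (pencil Q n X v) \<le> C * l2n n v"
    using pencil_bound_exists[of Q, OF Q] by blast
  define t where "t = 1 / (2 * (C + 1))"
  have t: "t > 0" "t * C \<le> 1/2" using C by (auto simp: t_def field_simps)
  have "(\<lambda>j. complex_of_real t \<cdot>\<^sub>m X j) \<in> nc_ball Q"
  proof (rule nc_ballI[of Q, OF Q X(1) tuples_smult[OF X(2)]])
    show "0 \<le> t * C" "t * C < 1" using t C by auto
    show "l2n n (pencil Q n (\<lambda>j. complex_of_real t \<cdot>\<^sub>m X j) v) \<le> t * C * l2n n v" for v
      using mult_left_mono[OF C(2)[of v], of t] t unfolding pencil_smult_norm[OF X(2)] by (simp add: mult.assoc)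
  qed
  then show thesis using t that by blast
qed

text \<open>The pencil of the new point is the old pencil followed by the identity tensored with
  \<open>W\<close>, a contraction by \<open>contraction_tensor\<close>. The rate of \<open>X\<close>
  is therefore also a rate of the new point.\<close>

lemma nc_ball_contraction:
  fixes Q :: "'d::finite \<Rightarrow> 'h::chilbert_space \<Rightarrow> 'h"
  assumes Q: "\<And>j. bounded_clinear_op (Q j)" and X: "X \<in> nc_ball Q" "X \<in> tuples n"
    and W: "\<And>w. (\<Sum>a<n. (cmod (\<Sum>b<n. W a b * w b))\<^sup>2) \<le> (\<Sum>b<n. (cmod (w b))\<^sup>2)"
  shows "(\<lambda>j. mat n n (\<lambda>(i, l). \<Sum>a<n. W i a * X j $$ (a, l))) \<in> nc_ball Q" (is "?Y \<in> _")
proof -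
  obtain r where r: "1 \<le> n" "0 \<le> r" "r < 1" "\<And>v. l2n n (pencil Q n X v) \<le> r * l2n n v"
    using nc_ballE[of Q, OF Q X] by metis
  have p: "pencil Q n ?Y v i = (\<Sum>a<n. W i a *\<^sub>C pencil Q n X v a)" if "i < n" for v i
  proof -
    have "pencil Q n ?Y v i = (\<Sum>j\<in>UNIV. \<Sum>l<n. \<Sum>a<n. W i a *\<^sub>C X j $$ (a, l) *\<^sub>C Q j (v l))"
      using that by (simp add: pencil_def scaleC_sum_left scaleC_scaleC)
    also have "\<dots> = (\<Sum>j\<in>UNIV. \<Sum>a<n. \<Sum>l<n. W i a *\<^sub>C X j $$ (a, l) *\<^sub>C Q j (v l))"
      by (intro sum.cong refl sum.swap)
    also have "\<dots> = (\<Sum>a<n. \<Sum>j\<in>UNIV. \<Sum>l<n. W i a *\<^sub>C X j $$ (a, l) *\<^sub>C Q j (v l))"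
      by (rule sum.swap)
    finally show ?thesis by (simp add: pencil_def scaleC_sum_right)
  qed
  show ?thesis
  proof (rule nc_ballI[of Q, OF Q r(1) _ r(2,3)])
    show "?Y \<in> tuples n" by (simp add: tuples_def)
    fix v
    have "l2n n (pencil Q n ?Y v) = l2n n (\<lambda>i. \<Sum>a<n. W i a *\<^sub>C pencil Q n X v a)"
      by (intro L2_set_cong refl) (simp add: p)
    also have "\<dots> \<le> 1 * l2n n (pencil Q n X v)"
      by (subst l2n_le_iff) (use contraction_tensor[OF W] in auto)
    finally show "l2n n (pencil Q n ?Y v) \<le> r * l2n n v" using r(4)[of v] by simp
  qed
qed

lemma sum_lessThan_add: "(\<Sum>i<n + m. f i) = (\<Sum>i<n. f i) + (\<Sum>i<m. f (n + i :: nat))"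
  for f :: "nat \<Rightarrow> 'a::comm_monoid_add"
  by (induction m) (simp_all add: add_ac)

lemma mat_dsum_carrier:
  "A \<in> carrier_mat n n \<Longrightarrow> B \<in> carrier_mat m m \<Longrightarrow> A \<oplus>\<^sub>M B \<in> carrier_mat (n + m) (n + m)"
  unfolding mat_dsum_def by simp

lemma mat_dsum_entry:
  assumes "A \<in> carrier_mat n n" "B \<in> carrier_mat m m" "a < n + m" "b < n + m"
  shows "(A \<oplus>\<^sub>M B) $$ (a, b) = (if a < n then if b < n then A $$ (a, b) else 0
      else if b < n then 0 else B $$ (a - n, b - n))"
  using assms unfolding mat_dsum_def by auto

lemma tuples_dsum: "X \<in> tuples n \<Longrightarrow> Y \<in> tuples m \<Longrightarrow> (\<lambda>j. X j \<oplus>\<^sub>M Y j) \<in> tuples (n + m)"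
  using mat_dsum_carrier by (auto simp: tuples_def)

text \<open>The pencil of a direct sum acts on the two blocks separately, so the larger of the two
  rates serves for both.\<close>

lemma nc_ball_dsum:
  fixes Q :: "'d::finite \<Rightarrow> 'h::chilbert_space \<Rightarrow> 'h"
  assumes Q: "\<And>j. bounded_clinear_op (Q j)" and X: "X \<in> nc_ball Q" "X \<in> tuples n"
    and Y: "Y \<in> nc_ball Q" "Y \<in> tuples m"
  shows "(\<lambda>j. X j \<oplus>\<^sub>M Y j) \<in> nc_ball Q"
proof -
  obtain r where r: "1 \<le> n" "0 \<le> r" "r < 1" "\<And>v. l2n n (pencil Q n X v) \<le> r * l2n n v"
    using nc_ballE[of Q, OF Q X] by metis
  obtain s where s: "1 \<le> m" "0 \<le> s" "s < 1" "\<And>v. l2n m (pencil Q m Y v) \<le> s * l2n m v"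
    using nc_ballE[of Q, OF Q Y] by metis
  let ?Z = "\<lambda>j. X j \<oplus>\<^sub>M Y j"
  note e = mat_dsum_entry[OF tuplesD[OF X(2)] tuplesD[OF Y(2)]]
  have p1: "pencil Q (n + m) ?Z v i = pencil Q n X v i" if "i < n" for v i
    using that by (simp add: pencil_def sum_lessThan_add e)
  have p2: "pencil Q (n + m) ?Z v (n + i) = pencil Q m Y (\<lambda>l. v (n + l)) i" if "i < m" for v i
    using that by (simp add: pencil_def sum_lessThan_add e)
  define t where "t = max r s"
  have t: "0 \<le> t" "t < 1" "r \<le> t" "s \<le> t" using r s by (auto simp: t_def)
  show ?thesis
  proof (rule nc_ballI[of Q, OF Q _ tuples_dsum[OF X(2) Y(2)] t(1,2)])
    show "1 \<le> n + m" using r by simp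
    fix v :: "nat \<Rightarrow> 'h"
    have "l2n n (pencil Q n X v) \<le> t * l2n n v"
      using r(4)[of v] mult_right_mono[OF t(3), of "l2n n v"] by simp
    moreover have "l2n m (pencil Q m Y w) \<le> t * l2n m w" for w
      using s(4)[of w] mult_right_mono[OF t(4), of "l2n m w"] by simp
    ultimately show "l2n (n + m) (pencil Q (n + m) ?Z v) \<le> t * l2n (n + m) v"
      unfolding l2n_le_iff[OF t(1)] sum_lessThan_add distrib_left
      by (intro add_mono) (simp_all add: p1 p2)
  qed
qed

text \<open>Equivalence of norms on a finite-dimensional space: coefficients are controlled by the
  operator norm. Normalised coefficient vectors form a compact set on which, by linear independence
  of the \<open>Q i\<close>, no combination is the zero operator.\<close>

lemma coefficient_bound:
  fixes Q :: "'d::finite \<Rightarrow> 'h::chilbert_space \<Rightarrow> 'h"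
  assumes Q: "operator_space_basis Q"
  obtains K where "K \<ge> 0" "\<And>c M j. M \<ge> 0 \<Longrightarrow> (\<And>h. norm (\<Sum>i\<in>UNIV. c i *\<^sub>C Q i h) \<le> M * norm h) \<Longrightarrow> cmod (c j) \<le> K * M"
proof -
  define g where "g c h = norm (\<Sum>i\<in>UNIV. c i *\<^sub>C Q i h)" for c h
  have cont: "continuous_on UNIV (\<lambda>c. g c h)" for h
  proof -
    have bl: "bounded_linear (\<lambda>a. a *\<^sub>C x)" for x :: 'h
    proof (rule bounded_linear_intro)
      show "(a + b) *\<^sub>C x = a *\<^sub>C x + b *\<^sub>C x" for a b by (rule scaleC_add_left)
      show "(r *\<^sub>R a) *\<^sub>C x = r *\<^sub>R a *\<^sub>C x" for r a
        by (metis scaleC_of_real scaleC_scaleC scaleR_conv_of_real)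
      show "norm (a *\<^sub>C x) \<le> norm a * norm x" for a by (simp add: norm_scaleC)
    qed
    show ?thesis unfolding g_def
      by (intro continuous_on_norm continuous_on_sum bounded_linear.continuous_on[OF bl]
          continuous_on_product_coordinates)
  qed
  \<comment> \<open>The weight \<open>norm h + 1\<close> is always positive, so witnesses of
    different lengths can be compared by one constant without dividing by
    \<open>norm h\<close>.\<close>
  have ex: "\<exists>\<delta>>0. \<forall>c. (\<forall>i. cmod (c i) \<le> 1) \<longrightarrow> c j = 1 \<longrightarrow> (\<exists>h. g c h \<ge> \<delta> * (norm h + 1))" for j
  proof -
    \<comment> \<open>A square containing the unit disc; it is compact as the continuous image of a
      product of intervals.\<close>
    define B where "B = (\<lambda>(x, y). Complex x y) ` ({-1..1} \<times> {-1..1})"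
    have "compact B" unfolding B_def
      by (intro compact_continuous_image compact_Times compact_Icc)
         (auto simp: case_prod_unfold Complex_eq intro!: continuous_intros)
    have B: "z \<in> B \<longleftrightarrow> \<bar>Re z\<bar> \<le> 1 \<and> \<bar>Im z\<bar> \<le> 1" for z
      unfolding B_def by (cases z) (auto simp: abs_le_iff image_iff)
    have B_cmod: "z \<in> B" if "cmod z \<le> 1" for z
      using that abs_Re_le_cmod[of z] abs_Im_le_cmod[of z] by (simp add: B)
    define S where "S = PiE UNIV (\<lambda>i. if i = j then {1} else B)"
    have "compactin (product_topology (\<lambda>_. euclidean) UNIV) S"
      unfolding S_def compactin_PiE using \<open>compact B\<close> by (auto simp: compactin_euclidean_iff)
    then have comp: "compact S" by (simp add: euclidean_product_topology compactin_euclidean_iff)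
    have S: "c j = 1" if "c \<in> S" for c
      using PiE_mem[OF that[unfolded S_def], of j] by simp
    have S_I: "c \<in> S" if "\<forall>i. cmod (c i) \<le> 1" "c j = 1" for c
      using that B_cmod by (auto simp: S_def PiE_UNIV_domain)
    have "\<forall>c\<in>S. \<exists>h. g c h > 0"
    proof
      fix c assume "c \<in> S"
      then have "c j \<noteq> 0" by (simp add: S)
      then obtain h where "(\<Sum>i\<in>UNIV. c i *\<^sub>C Q i h) \<noteq> 0"
        using Q unfolding operator_space_basis_def by blast
      then show "\<exists>h. g c h > 0" by (auto simp: g_def)
    qed
    then obtain H where H: "\<And>c. c \<in> S \<Longrightarrow> g c (H c) > 0" by metis
    \<comment> \<open>On \<open>U c\<close> the witness chosen for \<open>c\<close> still achieves
      half of its value, and finitely many such open sets cover \<open>S\<close>.\<close>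
    define U where "U c = {c'. g c' (H c) > g c (H c) / 2}" for c
    have "open (U c)" for c
      unfolding U_def by (rule open_Collect_less[OF continuous_on_const cont])
    moreover have "S \<subseteq> (\<Union>c\<in>S. U c)" using H by (force simp: U_def)
    ultimately obtain F where F: "F \<subseteq> S" "finite F" "S \<subseteq> (\<Union>c\<in>F. U c)"
      using compactE_image[OF comp, of S U] by metis
    define N where "N c = norm (H c) + 1" for c
    define \<delta> where "\<delta> = Min (insert 1 ((\<lambda>c. g c (H c) / 2 / N c) ` F))"
    have pos: "N c > 0" for c by (simp add: N_def add_nonneg_pos)
    have "\<delta> > 0" unfolding \<delta>_def using F H pos by (subst Min_gr_iff) (auto intro!: divide_pos_pos)
    moreover have "\<exists>h. g c h \<ge> \<delta> * (norm h + 1)" if c: "\<forall>i. cmod (c i) \<le> 1" "c j = 1" for c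
    proof -
      obtain c' where c': "c' \<in> F" "c \<in> U c'" using F S_I[OF c] by blast
      have "\<delta> \<le> g c' (H c') / 2 / N c'" unfolding \<delta>_def using c' F by (intro Min_le) auto
      then have "\<delta> * N c' \<le> g c' (H c') / 2" using pos by (simp add: pos_le_divide_eq)
      also have "\<dots> \<le> g c (H c')" using c' by (simp add: U_def)
      finally show ?thesis unfolding N_def by blast
    qed
    ultimately show ?thesis by blast
  qed
  obtain D where D: "\<And>j. D j > 0" "\<And>j c. (\<forall>i. cmod (c i) \<le> 1) \<Longrightarrow> c j = 1 \<Longrightarrow> \<exists>h. g c h \<ge> D j * (norm h + 1)"
    using ex by metis
  define K where "K = (\<Sum>j\<in>UNIV. 1 / D j)"
  have K: "1 / D j \<le> K" for j
    unfolding K_def by (rule member_le_sum) (auto simp: less_imp_le[OF D(1)])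
  show thesis
  proof
    show "K \<ge> 0" unfolding K_def by (intro sum_nonneg) (auto simp: less_imp_le[OF D(1)])
    fix c M j assume M: "M \<ge> 0" "\<And>h. norm (\<Sum>i\<in>UNIV. c i *\<^sub>C Q i h) \<le> M * norm h"
    \<comment> \<open>Dividing by a coefficient of largest modulus moves the vector into the compact
      set belonging to the index \<open>k\<close> of that coefficient.\<close>
    define m where "m = Max (range (\<lambda>i. cmod (c i)))"
    have m: "cmod (c i) \<le> m" for i by (simp add: m_def)
    have "m \<in> range (\<lambda>i. cmod (c i))" unfolding m_def by (rule Max_in) auto
    then obtain k where k: "cmod (c k) = m" by auto
    show "cmod (c j) \<le> K * M"
    proof (cases "c k = 0")
      case True
      then show ?thesis using k m[of j] \<open>K \<ge> 0\<close> M(1) by simp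
    next
      case False
      then have "m > 0" using k by auto
      define c' where "c' i = c i / c k" for i
      have "\<forall>i. cmod (c' i) \<le> 1" using m k \<open>m > 0\<close> by (simp add: c'_def norm_divide)
      moreover have "c' k = 1" using False by (simp add: c'_def)
      ultimately obtain h where h: "g c' h \<ge> D k * (norm h + 1)" using D(2) by blast
      have "(\<Sum>i\<in>UNIV. c' i *\<^sub>C Q i h) = (1 / c k) *\<^sub>C (\<Sum>i\<in>UNIV. c i *\<^sub>C Q i h)"
        by (simp add: c'_def scaleC_sum_right scaleC_scaleC)
      then have "g c' h = g c h / m" using k by (simp add: g_def norm_scaleC norm_divide)
      also have "\<dots> \<le> M * norm h / m" using M(2)[of h] \<open>m > 0\<close> by (simp add: g_def divide_right_mono)
      finally have "g c' h * m \<le> M * norm h" using \<open>m > 0\<close> by (simp add: pos_le_divide_eq)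
      then have "D k * (norm h + 1) * m \<le> M * norm h"
        using mult_right_mono[OF h, of m] \<open>m > 0\<close> by linarith
      also have "\<dots> \<le> M * (norm h + 1)" using M(1) by (simp add: mult_left_mono)
      finally have "(D k * m) * (norm h + 1) \<le> M * (norm h + 1)" by (simp add: mult_ac)
      then have "D k * m \<le> M" by (rule mult_right_le_imp_le) (simp add: add_nonneg_pos)
      then have "m \<le> 1 / D k * M" using D(1)[of k] by (simp add: field_simps)
      also have "\<dots> \<le> K * M" by (rule mult_right_mono[OF K M(1)])
      finally show ?thesis using m[of j] by simp
    qed
  qed
qed

text \<open>Compressing the pencil by \<open>x\<close> and \<open>y\<close> in the matrix factor
  leaves an operator in the span of the \<open>Q i\<close> whose \<open>i\<close>-th coefficient is
  the inner product of \<open>y\<close> with \<open>X i x\<close>, so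
  \<open>coefficient_bound\<close> applies. For \<open>y = X j x\<close> the \<open>j\<close>-th
  coefficient is the squared length of \<open>y\<close>, and one factor cancels.\<close>

lemma coordinates_bounded:
  fixes Q :: "'d::finite \<Rightarrow> 'h::chilbert_space \<Rightarrow> 'h"
  assumes basis: "operator_space_basis Q"
  obtains K where "K \<ge> 0" "\<And>n X j. X \<in> nc_ball Q \<Longrightarrow> X \<in> tuples n \<Longrightarrow> op_bound n (X j) K"
proof -
  have Q: "\<And>j. bounded_clinear_op (Q j)" using basis by (auto simp: operator_space_basis_def)
  obtain K where K: "K \<ge> 0"
    "\<And>c M j. M \<ge> 0 \<Longrightarrow> (\<And>h. norm (\<Sum>i\<in>UNIV. c i *\<^sub>C Q i h) \<le> M * norm h) \<Longrightarrow> cmod (c j) \<le> K * M"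
    using coefficient_bound[OF basis] by metis
  have "op_bound n (X j) K" if X: "X \<in> nc_ball Q" "X \<in> tuples n" for n X j
    unfolding op_bound_def
  proof
    fix x :: "nat \<Rightarrow> complex"
    obtain r where r: "1 \<le> n" "0 \<le> r" "r < 1" "\<And>v. l2n n (pencil Q n X v) \<le> r * l2n n v"
      using nc_ballE[of Q, OF Q X] by metis
    define y where "y a = (\<Sum>b<n. X j $$ (a, b) * x b)" for a
    define c where "c i = (\<Sum>a<n. cnj (y a) * (\<Sum>b<n. X i $$ (a, b) * x b))" for i
    have bd: "norm (\<Sum>i\<in>UNIV. c i *\<^sub>C Q i h) \<le> (l2n n y * l2n n x) * norm h" for h
    proof -
      have Qs: "Q i (a *\<^sub>C h) = a *\<^sub>C Q i h" for i a using Q by (simp add: bounded_clinear_op_def)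
      \<comment> \<open>The elementary tensor of \<open>h\<close> and \<open>x\<close>, whose length
        is the product of the two lengths.\<close>
      define v where "v b = x b *\<^sub>C h" for b
      have "(\<Sum>i\<in>UNIV. c i *\<^sub>C Q i h)
        = (\<Sum>i\<in>UNIV. \<Sum>a<n. cnj (y a) *\<^sub>C (\<Sum>b<n. X i $$ (a, b) *\<^sub>C Q i (v b)))"
        by (simp add: c_def v_def Qs scaleC_sum_left scaleC_sum_right scaleC_scaleC sum_distrib_left mult.assoc)
      also have "\<dots> = (\<Sum>a<n. cnj (y a) *\<^sub>C pencil Q n X v a)"
        by (subst sum.swap) (simp add: pencil_def scaleC_sum_right)
      finally have "norm (\<Sum>i\<in>UNIV. c i *\<^sub>C Q i h) \<le> (\<Sum>a<n. \<bar>cmod (y a)\<bar> * \<bar>norm (pencil Q n X v a)\<bar>)"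
        using sum_norm_le[of "{..<n}" "\<lambda>a. cnj (y a) *\<^sub>C pencil Q n X v a" "\<lambda>a. \<bar>cmod (y a)\<bar> * \<bar>norm (pencil Q n X v a)\<bar>"]
        by (simp add: norm_scaleC)
      also have "\<dots> \<le> l2n n y * l2n n (pencil Q n X v)" by (rule L2_set_mult_ineq)
      also have "\<dots> \<le> l2n n y * l2n n v"
        using r(4)[of v] mult_right_mono[of r 1 "l2n n v"] r(3) by (intro mult_left_mono) auto
      also have "l2n n v = l2n n x * norm h"
        by (simp add: v_def norm_scaleC L2_set_left_distrib)
      finally show ?thesis by (simp add: mult.assoc)
    qed
    have "c j = (\<Sum>a<n. cnj (y a) * y a)" by (simp only: c_def y_def[symmetric])
    also have "\<dots> = of_real ((l2n n y)\<^sup>2)"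
      by (simp only: l2n_sq of_real_sum complex_norm_square mult.commute)
    finally have "c j = of_real ((l2n n y)\<^sup>2)" .
    then have "(l2n n y)\<^sup>2 = cmod (c j)" by (simp add: norm_power)
    also have "\<dots> \<le> K * (l2n n y * l2n n x)" by (rule K(2)[OF _ bd]) simp
    finally have *: "l2n n y * l2n n y \<le> (K * l2n n x) * l2n n y" by (simp add: power2_eq_square mult_ac)
    show "l2n n (\<lambda>a. \<Sum>b<n. X j $$ (a, b) * x b) \<le> K * l2n n x"
    proof (cases "l2n n y = 0")
      case True
      then show ?thesis using K(1) by (simp add: y_def)
    next
      case False
      then have "l2n n y > 0" by (simp add: order_less_le)
      then show ?thesis using mult_right_le_imp_le[OF *] by (simp add: y_def)
    qed
  qed
  then show thesis using K(1) that by blast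
qed

section \<open>Functionals continuous under bounded pointwise convergence\<close>

lemma poly_value_add_mat:
  assumes "X \<in> tuples n"
  shows "poly_value (p + q) X = poly_value p X + poly_value q X"
  using poly_value_add[OF assms, of _ _ p q] poly_value_carrier[OF assms, of p]
    poly_value_carrier[OF assms, of q] poly_value_carrier[OF assms, of "p + q"]
  by (intro eq_matI) auto

lemma op_bound_one: "op_bound n (1\<^sub>m n) 1"
proof -
  have "(\<Sum>b<n. 1\<^sub>m n $$ (a, b) * v b) = (v a :: complex)" if "a < n" for a v
  proof -
    have "(\<Sum>b<n. 1\<^sub>m n $$ (a, b) * v b) = (\<Sum>b<n. if b = a then v a else 0)"
      using that by (intro sum.cong) auto
    then show ?thesis using that by simp
  qed
  then have "l2n n (\<lambda>a. \<Sum>b<n. 1\<^sub>m n $$ (a, b) * v b) = l2n n v" for v :: "nat \<Rightarrow> complex"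
    by (intro L2_set_cong) auto
  then show ?thesis unfolding op_bound_def by simp
qed

lemma ncpoly_bounded:
  fixes Q :: "'d::finite \<Rightarrow> 'h::chilbert_space \<Rightarrow> 'h"
  assumes "operator_space_basis Q"
  shows "\<exists>C\<ge>0. \<forall>n X. X \<in> nc_ball Q \<longrightarrow> X \<in> tuples n \<longrightarrow> op_bound n (poly_value p X) C"
proof -
  obtain K where K: "K \<ge> 0" "\<And>n X j. X \<in> nc_ball Q \<Longrightarrow> X \<in> tuples n \<Longrightarrow> op_bound n (X j) K"
    using coordinates_bounded[OF assms] by metis
  have word: "op_bound n (word_value w X) (K ^ length w)" if "X \<in> nc_ball Q" "X \<in> tuples n" for n X w
  proof (induction w)
    case Nil show ?case by (simp add: word_value_Nil[OF that(2)] op_bound_one)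
  next
    case (Cons j w)
    then show ?case
      using op_bound_mult[OF K(2)[OF that, of j] Cons.IH K(1) tuplesD[OF that(2)] word_value_carrier[OF that(2)]]
      by (simp add: word_value_Cons)
  qed
  have single: "op_bound n (poly_value (Poly_Mapping.single w c) X) (cmod c * K ^ length w)"
    if "X \<in> nc_ball Q" "X \<in> tuples n" for n X w c
  proof -
    have "poly_value (Poly_Mapping.single w c) X = c \<cdot>\<^sub>m word_value w X"
      using poly_value_carrier[OF that(2), of "Poly_Mapping.single w c"] word_value_carrier[OF that(2), of w]
      by (intro eq_matI) (auto simp: poly_value_single[OF that(2)])
    then show ?thesis using op_bound_smult[OF word[OF that] word_value_carrier[OF that(2)]] by simp
  qed
  have "\<exists>C\<ge>0. \<forall>n X. X \<in> nc_ball Q \<longrightarrow> X \<in> tuples n \<longrightarrow>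
      op_bound n (poly_value (\<Sum>w\<in>A. Poly_Mapping.single w (f w)) X) C" if "finite A" for A f
    using that
  proof (induction A)
    case empty
    have "op_bound n (poly_value (0 :: 'd ncpoly) X) 0" if "X \<in> tuples n" for n X
    proof -
      have "l2n n (\<lambda>a. \<Sum>b<n. poly_value 0 X $$ (a, b) * v b) = l2n n (\<lambda>_. 0 :: complex)" for v
        using poly_value_zero[OF that] by (intro L2_set_cong) auto
      then show ?thesis unfolding op_bound_def by (simp add: L2_set_def)
    qed
    then show ?case by auto
  next
    case (insert w A)
    let ?s = "\<lambda>w. Poly_Mapping.single w (f w)"
    obtain C where C: "C \<ge> 0" "\<And>n X. X \<in> nc_ball Q \<Longrightarrow> X \<in> tuples n \<Longrightarrow> op_bound n (poly_value (sum ?s A) X) C"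
      using insert.IH by blast
    have "op_bound n (poly_value (sum ?s (insert w A)) X) (cmod (f w) * K ^ length w + C)"
      if "X \<in> nc_ball Q" "X \<in> tuples n" for n X
      using op_bound_add[OF single[OF that, of w "f w"] C(2)[OF that] poly_value_carrier[OF that(2)] poly_value_carrier[OF that(2)]] insert.hyps
      by (simp add: poly_value_add_mat[OF that(2)])
    moreover have "cmod (f w) * K ^ length w + C \<ge> 0" using K(1) C(1) by simp
    ultimately show ?case by blast
  qed
  from this[of "Poly_Mapping.keys p" "Poly_Mapping.lookup p"] show ?thesis
    by (simp add: ncpoly_sum_single[symmetric])
qed

text \<open>One bound serves all points of all sizes and all members of the sequence, whereas
  convergence is entrywise at each point, without a common rate.\<close>

definition bp_null :: "('d::finite \<Rightarrow> 'h::chilbert_space \<Rightarrow> 'h) \<Rightarrow> (nat \<Rightarrow> 'd ncpoly) \<Rightarrow> bool" where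
  "bp_null Q p \<longleftrightarrow>
     (\<exists>C\<ge>0. \<forall>N n X. X \<in> nc_ball Q \<longrightarrow> X \<in> tuples n \<longrightarrow> op_bound n (poly_value (p N) X) C) \<and>
     (\<forall>n X a b. X \<in> nc_ball Q \<longrightarrow> X \<in> tuples n \<longrightarrow> a < n \<longrightarrow> b < n \<longrightarrow>
        (\<lambda>N. poly_value (p N) X $$ (a, b)) \<longlonglongrightarrow> 0)"

text \<open>Continuity under bounded pointwise convergence is the only property of the weak-* continuous
  functionals that the argument uses.\<close>

definition bp_functional :: "('d::finite \<Rightarrow> 'h::chilbert_space \<Rightarrow> 'h) \<Rightarrow> ('d ncpoly \<Rightarrow> complex) \<Rightarrow> bool" where
  "bp_functional Q \<phi> \<longleftrightarrow> additive \<phi> \<and> (\<forall>p. bp_null Q p \<longrightarrow> (\<lambda>N. \<phi> (p N)) \<longlonglongrightarrow> 0)"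

lemma bp_functional_additive: "bp_functional Q \<phi> \<Longrightarrow> additive \<phi>"
  by (simp add: bp_functional_def)

lemma bp_functional_tendsto: "bp_functional Q \<phi> \<Longrightarrow> bp_null Q p \<Longrightarrow> (\<lambda>N. \<phi> (p N)) \<longlonglongrightarrow> 0"
  by (simp add: bp_functional_def)

lemma bp_null_mult:
  fixes Q :: "'d::finite \<Rightarrow> 'h::chilbert_space \<Rightarrow> 'h"
  assumes basis: "operator_space_basis Q" and p: "bp_null Q p"
  shows "bp_null Q (\<lambda>N. q * p N)" "bp_null Q (\<lambda>N. p N * q)"
proof -
  obtain C where C: "C \<ge> 0" "\<And>N n X. X \<in> nc_ball Q \<Longrightarrow> X \<in> tuples n \<Longrightarrow> op_bound n (poly_value (p N) X) C"
    using p unfolding bp_null_def by blast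
  obtain E where E: "E \<ge> 0" "\<And>n X. X \<in> nc_ball Q \<Longrightarrow> X \<in> tuples n \<Longrightarrow> op_bound n (poly_value q X) E"
    using ncpoly_bounded[OF basis, of q] by blast
  have lim: "(\<lambda>N. poly_value (p N) X $$ (a, b)) \<longlonglongrightarrow> 0" if "X \<in> nc_ball Q" "X \<in> tuples n" "a < n" "b < n" for n X a b
    using p that unfolding bp_null_def by blast
  show "bp_null Q (\<lambda>N. q * p N)"
    unfolding bp_null_def
  proof (intro conjI exI allI impI)
    show "E * C \<ge> 0" using E C by simp
    fix N n X assume X: "X \<in> nc_ball Q" "X \<in> tuples n"
    show "op_bound n (poly_value (q * p N) X) (E * C)"
      unfolding poly_value_mult[OF X(2)]
      by (rule op_bound_mult[OF E(2)[OF X] C(2)[OF X] E(1) poly_value_carrier[OF X(2)] poly_value_carrier[OF X(2)]])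
  next
    fix n X a b assume X: "X \<in> nc_ball Q" "X \<in> tuples n" and ab: "a < n" "b < n"
    have "(\<lambda>N. \<Sum>c<n. poly_value q X $$ (a, c) * poly_value (p N) X $$ (c, b)) \<longlonglongrightarrow> (\<Sum>c<n. poly_value q X $$ (a, c) * 0)"
      by (intro tendsto_intros lim[OF X]) (use ab in auto)
    then show "(\<lambda>N. poly_value (q * p N) X $$ (a, b)) \<longlonglongrightarrow> 0"
      by (simp add: poly_value_mult_entry[OF X(2) ab])
  qed
  show "bp_null Q (\<lambda>N. p N * q)"
    unfolding bp_null_def
  proof (intro conjI exI allI impI)
    show "C * E \<ge> 0" using E C by simp
    fix N n X assume X: "X \<in> nc_ball Q" "X \<in> tuples n"
    show "op_bound n (poly_value (p N * q) X) (C * E)"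
      unfolding poly_value_mult[OF X(2)]
      by (rule op_bound_mult[OF C(2)[OF X] E(2)[OF X] C(1) poly_value_carrier[OF X(2)] poly_value_carrier[OF X(2)]])
  next
    fix n X a b assume X: "X \<in> nc_ball Q" "X \<in> tuples n" and ab: "a < n" "b < n"
    have "(\<lambda>N. \<Sum>c<n. poly_value (p N) X $$ (a, c) * poly_value q X $$ (c, b)) \<longlonglongrightarrow> (\<Sum>c<n. 0 * poly_value q X $$ (c, b))"
      by (intro tendsto_intros lim[OF X]) (use ab in auto)
    then show "(\<lambda>N. poly_value (p N * q) X $$ (a, b)) \<longlonglongrightarrow> 0"
      by (simp add: poly_value_mult_entry[OF X(2) ab])
  qed
qed

text \<open>These functionals form a bimodule over the polynomials. Every change of the matrix
  \<open>P\<close> below is carried out on the functionals through this fact.\<close>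

lemma bp_functional_mult:
  fixes Q :: "'d::finite \<Rightarrow> 'h::chilbert_space \<Rightarrow> 'h"
  assumes "operator_space_basis Q" "bp_functional Q \<phi>"
  shows "bp_functional Q (\<lambda>p. \<phi> (q * p))" "bp_functional Q (\<lambda>p. \<phi> (p * q))"
  using assms bp_null_mult[OF assms(1)] unfolding bp_functional_def additive_def
  by (simp_all add: algebra_simps)

lemma bp_functional_sum:
  assumes "\<And>i. i \<in> A \<Longrightarrow> bp_functional Q (\<phi> i)"
  shows "bp_functional Q (\<lambda>p. \<Sum>i\<in>A. \<phi> i p)"
proof -
  have "additive (\<lambda>p. \<Sum>i\<in>A. \<phi> i p)"
    using assms by (simp add: bp_functional_def additive_def sum.distrib)
  moreover have "(\<lambda>N. \<Sum>i\<in>A. \<phi> i (p N)) \<longlonglongrightarrow> (\<Sum>i\<in>A. 0)" if "bp_null Q p" for p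
    by (intro tendsto_sum bp_functional_tendsto[OF assms that])
  ultimately show ?thesis by (simp add: bp_functional_def)
qed

lemma bp_functional_uminus: "bp_functional Q \<phi> \<Longrightarrow> bp_functional Q (\<lambda>p. - \<phi> p)"
  unfolding bp_functional_def additive_def using tendsto_minus[of "\<lambda>N. \<phi> (p N)" 0 sequentially for p] by simp

text \<open>Density of the one-sided ideal generated by \<open>P\<close>, phrased through annihilating functionals. As the
  rows of \<open>G\<close> enter \<open>G P\<close> independently, a single row \<open>g\<close> (for \<open>P G\<close>: a single column) suffices.\<close>

definition left_dense :: "('d::finite \<Rightarrow> 'h::chilbert_space \<Rightarrow> 'h) \<Rightarrow> 'i set \<Rightarrow> ('i \<Rightarrow> 'i \<Rightarrow> 'd ncpoly) \<Rightarrow> bool" where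
  "left_dense Q I P \<longleftrightarrow> (\<forall>\<phi>. (\<forall>i\<in>I. bp_functional Q (\<phi> i)) \<longrightarrow>
     (\<forall>g. (\<Sum>j\<in>I. \<phi> j (\<Sum>i\<in>I. g i * P i j)) = 0) \<longrightarrow> (\<forall>i\<in>I. \<forall>p. \<phi> i p = 0))"

definition right_dense :: "('d::finite \<Rightarrow> 'h::chilbert_space \<Rightarrow> 'h) \<Rightarrow> 'i set \<Rightarrow> ('i \<Rightarrow> 'i \<Rightarrow> 'd ncpoly) \<Rightarrow> bool" where
  "right_dense Q I P \<longleftrightarrow> (\<forall>\<phi>. (\<forall>i\<in>I. bp_functional Q (\<phi> i)) \<longrightarrow>
     (\<forall>g. (\<Sum>i\<in>I. \<phi> i (\<Sum>j\<in>I. P i j * g j)) = 0) \<longrightarrow> (\<forall>i\<in>I. \<forall>p. \<phi> i p = 0))"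

definition two_sided_dense :: "('d::finite \<Rightarrow> 'h::chilbert_space \<Rightarrow> 'h) \<Rightarrow> 'i set \<Rightarrow> ('i \<Rightarrow> 'i \<Rightarrow> 'd ncpoly) \<Rightarrow> bool" where
  "two_sided_dense Q I P \<longleftrightarrow> left_dense Q I P \<and> right_dense Q I P"

lemma left_denseD:
  assumes "left_dense Q I P" "\<And>i. i \<in> I \<Longrightarrow> bp_functional Q (\<phi> i)"
    "\<And>g. (\<Sum>j\<in>I. \<phi> j (\<Sum>i\<in>I. g i * P i j)) = 0" "i \<in> I"
  shows "\<phi> i p = 0"
  using assms unfolding left_dense_def by blast

lemma right_denseD:
  assumes "right_dense Q I P" "\<And>i. i \<in> I \<Longrightarrow> bp_functional Q (\<phi> i)"
    "\<And>g. (\<Sum>i\<in>I. \<phi> i (\<Sum>j\<in>I. P i j * g j)) = 0" "i \<in> I"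
  shows "\<phi> i p = 0"
  using assms unfolding right_dense_def by blast

lemma left_denseI:
  assumes "\<And>\<phi> i p. (\<And>i. i \<in> I \<Longrightarrow> bp_functional Q (\<phi> i)) \<Longrightarrow>
     (\<And>g. (\<Sum>j\<in>I. \<phi> j (\<Sum>i\<in>I. g i * P i j)) = 0) \<Longrightarrow> i \<in> I \<Longrightarrow> \<phi> i p = 0"
  shows "left_dense Q I P"
  unfolding left_dense_def using assms by blast

lemma right_denseI:
  assumes "\<And>\<phi> i p. (\<And>i. i \<in> I \<Longrightarrow> bp_functional Q (\<phi> i)) \<Longrightarrow>
     (\<And>g. (\<Sum>i\<in>I. \<phi> i (\<Sum>j\<in>I. P i j * g j)) = 0) \<Longrightarrow> i \<in> I \<Longrightarrow> \<phi> i p = 0"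
  shows "right_dense Q I P"
  unfolding right_dense_def using assms by blast

section \<open>Transfer of density between polynomial matrices\<close>

lemma sum_additive_delta:
  assumes "finite I" "k \<in> I" "\<And>i. i \<in> I \<Longrightarrow> additive (\<phi> i)" "\<And>i. i \<in> I \<Longrightarrow> f i = (if i = k then p else 0)"
  shows "(\<Sum>i\<in>I. \<phi> i (f i)) = \<phi> k p"
proof -
  have "(\<Sum>i\<in>I. \<phi> i (f i)) = (\<Sum>i\<in>I. if i = k then \<phi> k p else 0)"
    using assms additive.zero by (intro sum.cong) fastforce+
  then show ?thesis using assms by simp
qed

text \<open>A functional that annihilates the left ideal of \<open>P\<close> is pulled back along
  right multiplication by \<open>U\<close>. The result annihilates the left ideal of
  \<open>P'\<close>, since \<open>g P' U = (g V) P\<close>, and is therefore zero; evaluating it on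
  rows of the left inverse \<open>U'\<close> recovers the original.\<close>

lemma left_dense_transfer:
  fixes Q :: "'d::finite \<Rightarrow> 'h::chilbert_space \<Rightarrow> 'h"
  assumes basis: "operator_space_basis Q" and fin: "finite I"
    and eq: "\<And>i k. i \<in> I \<Longrightarrow> k \<in> I \<Longrightarrow> (\<Sum>j\<in>I. P' i j * U j k) = (\<Sum>j\<in>I. V i j * P j k)"
    and inv: "\<And>i k. i \<in> I \<Longrightarrow> k \<in> I \<Longrightarrow> (\<Sum>j\<in>I. U' i j * U j k) = delta i k"
    and P': "left_dense Q I P'"
  shows "left_dense Q I P"
proof (rule left_denseI)
  fix \<phi> k p
  assume \<phi>: "\<And>i. i \<in> I \<Longrightarrow> bp_functional Q (\<phi> i)" and k: "k \<in> I"
    and zero: "\<And>g. (\<Sum>j\<in>I. \<phi> j (\<Sum>i\<in>I. g i * P i j)) = 0"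
  note add = bp_functional_additive[OF \<phi>]
  define \<psi> where "\<psi> j p = (\<Sum>k\<in>I. \<phi> k (p * U j k))" for j p
  have swap: "(\<Sum>j\<in>I. \<psi> j (f j)) = (\<Sum>k\<in>I. \<phi> k (\<Sum>j\<in>I. f j * U j k))" for f
    unfolding \<psi>_def by (subst sum.swap) (simp add: additive.sum[OF add])
  have "\<psi> j p = 0" if "j \<in> I" for j p
  proof (rule left_denseD[OF P' _ _ that])
    show "bp_functional Q (\<psi> j)" if "j \<in> I" for j
      unfolding \<psi>_def by (intro bp_functional_sum bp_functional_mult(2)[OF basis] \<phi>)
    fix g
    have "(\<Sum>j\<in>I. (\<Sum>i\<in>I. g i * P' i j) * U j k) = (\<Sum>j\<in>I. (\<Sum>i\<in>I. g i * V i j) * P j k)" if "k \<in> I" for k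
    proof -
      have "(\<Sum>j\<in>I. (\<Sum>i\<in>I. g i * P' i j) * U j k) = (\<Sum>i\<in>I. g i * (\<Sum>j\<in>I. P' i j * U j k))"
        by (simp add: sum_distrib_left sum_distrib_right mult.assoc) (rule sum.swap)
      also have "\<dots> = (\<Sum>i\<in>I. g i * (\<Sum>j\<in>I. V i j * P j k))" using eq that by simp
      also have "\<dots> = (\<Sum>j\<in>I. (\<Sum>i\<in>I. g i * V i j) * P j k)"
        by (simp add: sum_distrib_left sum_distrib_right mult.assoc) (rule sum.swap)
      finally show ?thesis .
    qed
    then show "(\<Sum>j\<in>I. \<psi> j (\<Sum>i\<in>I. g i * P' i j)) = 0" unfolding swap by (simp add: zero)
  qed
  then have "0 = (\<Sum>j\<in>I. \<psi> j (p * U' k j))" by simp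
  also have "\<dots> = \<phi> k p"
    unfolding swap
  proof (rule sum_additive_delta[OF fin k add])
    show "(\<Sum>j\<in>I. p * U' k j * U j i) = (if i = k then p else 0)" if "i \<in> I" for i
      using inv[OF k that] by (simp add: mult.assoc sum_distrib_left[symmetric])
  qed
  finally show "\<phi> k p = 0" by simp
qed

text \<open>Mirror image of the left version: the functional is pulled back along left
  multiplication by \<open>U\<close>, and a right inverse of \<open>U\<close> recovers it.\<close>

lemma right_dense_transfer:
  fixes Q :: "'d::finite \<Rightarrow> 'h::chilbert_space \<Rightarrow> 'h"
  assumes basis: "operator_space_basis Q" and fin: "finite I"
    and eq: "\<And>i k. i \<in> I \<Longrightarrow> k \<in> I \<Longrightarrow> (\<Sum>j\<in>I. U i j * P' j k) = (\<Sum>j\<in>I. P i j * V j k)"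
    and inv: "\<And>i k. i \<in> I \<Longrightarrow> k \<in> I \<Longrightarrow> (\<Sum>j\<in>I. U i j * U' j k) = delta i k"
    and P': "right_dense Q I P'"
  shows "right_dense Q I P"
proof (rule right_denseI)
  fix \<phi> k p
  assume \<phi>: "\<And>i. i \<in> I \<Longrightarrow> bp_functional Q (\<phi> i)" and k: "k \<in> I"
    and zero: "\<And>g. (\<Sum>i\<in>I. \<phi> i (\<Sum>j\<in>I. P i j * g j)) = 0"
  note add = bp_functional_additive[OF \<phi>]
  define \<psi> where "\<psi> j p = (\<Sum>k\<in>I. \<phi> k (U k j * p))" for j p
  have swap: "(\<Sum>j\<in>I. \<psi> j (f j)) = (\<Sum>k\<in>I. \<phi> k (\<Sum>j\<in>I. U k j * f j))" for f
    unfolding \<psi>_def by (subst sum.swap) (simp add: additive.sum[OF add])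
  have "\<psi> j p = 0" if "j \<in> I" for j p
  proof (rule right_denseD[OF P' _ _ that])
    show "bp_functional Q (\<psi> j)" if "j \<in> I" for j
      unfolding \<psi>_def by (intro bp_functional_sum bp_functional_mult(1)[OF basis] \<phi>)
    fix g
    have "(\<Sum>j\<in>I. U k j * (\<Sum>i\<in>I. P' j i * g i)) = (\<Sum>j\<in>I. P k j * (\<Sum>i\<in>I. V j i * g i))" if "k \<in> I" for k
    proof -
      have "(\<Sum>j\<in>I. U k j * (\<Sum>i\<in>I. P' j i * g i)) = (\<Sum>i\<in>I. (\<Sum>j\<in>I. U k j * P' j i) * g i)"
        by (simp add: sum_distrib_left sum_distrib_right mult.assoc) (rule sum.swap)
      also have "\<dots> = (\<Sum>i\<in>I. (\<Sum>j\<in>I. P k j * V j i) * g i)" using eq that by simp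
      also have "\<dots> = (\<Sum>j\<in>I. P k j * (\<Sum>i\<in>I. V j i * g i))"
        by (simp add: sum_distrib_left sum_distrib_right mult.assoc) (rule sum.swap)
      finally show ?thesis .
    qed
    then show "(\<Sum>j\<in>I. \<psi> j (\<Sum>i\<in>I. P' j i * g i)) = 0" unfolding swap by (simp add: zero)
  qed
  then have "0 = (\<Sum>j\<in>I. \<psi> j (U' j k * p))" by simp
  also have "\<dots> = \<phi> k p"
    unfolding swap
  proof (rule sum_additive_delta[OF fin k add])
    show "(\<Sum>j\<in>I. U i j * (U' j k * p)) = (if i = k then p else 0)" if "i \<in> I" for i
      using inv[OF that k] by (simp add: mult.assoc[symmetric] sum_distrib_right[symmetric])
  qed
  finally show "\<phi> k p = 0" by simp
qed

text \<open>The order of elimination depends on the side. Rows supported in \<open>J\<close> produce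
  nothing in the columns of \<open>I\<close>, so for left ideals the components in \<open>J\<close>
  vanish first; columns supported in \<open>I\<close> produce nothing in the rows of
  \<open>J\<close>, so for right ideals those in \<open>I\<close> vanish first.\<close>

lemma two_sided_dense_triangular:
  assumes fin: "finite I" "finite J" and disj: "I \<inter> J = {}"
    and tri: "\<And>i j. i \<in> J \<Longrightarrow> j \<in> I \<Longrightarrow> P i j = 0"
    and I: "two_sided_dense Q I P" and J: "two_sided_dense Q J P"
  shows "two_sided_dense Q (I \<union> J) P"
  unfolding two_sided_dense_def
proof
  note un = sum.union_disjoint[OF fin disj]
  have nI: "i \<notin> I" if "i \<in> J" for i using that disj by auto
  show "left_dense Q (I \<union> J) P"
  proof (rule left_denseI)
    fix \<phi> k p
    assume \<phi>: "\<And>i. i \<in> I \<union> J \<Longrightarrow> bp_functional Q (\<phi> i)" and k: "k \<in> I \<union> J"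
      and zero: "\<And>g. (\<Sum>j\<in>I \<union> J. \<phi> j (\<Sum>i\<in>I \<union> J. g i * P i j)) = 0"
    have \<phi>J: "\<phi> k p = 0" if k: "k \<in> J" for k p
    proof (rule left_denseD[of Q J P, OF _ _ _ k])
      show "left_dense Q J P" using J by (simp add: two_sided_dense_def)
      show "(\<Sum>j\<in>J. \<phi> j (\<Sum>i\<in>J. g i * P i j)) = 0" for g
      proof -
        define g' where "g' i = (if i \<in> I then 0 else g i)" for i
        have "(\<Sum>i\<in>I. g' i * P i j) = 0" for j by (simp add: g'_def)
        moreover have "(\<Sum>i\<in>J. g' i * P i j) = (\<Sum>i\<in>J. g i * P i j)" for j
          using nI by (intro sum.cong) (auto simp: g'_def)
        moreover have "(\<Sum>i\<in>J. g i * P i j) = 0" if "j \<in> I" for j using tri that by simp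
        ultimately show ?thesis
          using zero[of g'] additive.zero[OF bp_functional_additive[OF \<phi>]] by (simp add: un)
      qed
    qed (use \<phi> in auto)
    have \<phi>I: "\<phi> k p = 0" if k: "k \<in> I" for k p
    proof (rule left_denseD[of Q I P, OF _ _ _ k])
      show "left_dense Q I P" using I by (simp add: two_sided_dense_def)
      show "(\<Sum>j\<in>I. \<phi> j (\<Sum>i\<in>I. g i * P i j)) = 0" for g
      proof -
        have "(\<Sum>i\<in>J. g i * P i j) = 0" if "j \<in> I" for j using tri that by simp
        then show ?thesis using zero[of g] \<phi>J by (simp add: un)
      qed
    qed (use \<phi> in auto)
    show "\<phi> k p = 0" using k \<phi>I \<phi>J by auto
  qed
  show "right_dense Q (I \<union> J) P"
  proof (rule right_denseI)
    fix \<phi> k p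
    assume \<phi>: "\<And>i. i \<in> I \<union> J \<Longrightarrow> bp_functional Q (\<phi> i)" and k: "k \<in> I \<union> J"
      and zero: "\<And>g. (\<Sum>i\<in>I \<union> J. \<phi> i (\<Sum>j\<in>I \<union> J. P i j * g j)) = 0"
    have \<phi>I: "\<phi> k p = 0" if k: "k \<in> I" for k p
    proof (rule right_denseD[of Q I P, OF _ _ _ k])
      show "right_dense Q I P" using I by (simp add: two_sided_dense_def)
      show "(\<Sum>i\<in>I. \<phi> i (\<Sum>j\<in>I. P i j * g j)) = 0" for g
      proof -
        define g' where "g' i = (if i \<in> I then g i else 0)" for i
        have "(\<Sum>j\<in>J. P i j * g' j) = 0" for i using nI by (auto simp: g'_def intro: sum.neutral)
        moreover have "(\<Sum>j\<in>I. P i j * g' j) = (\<Sum>j\<in>I. P i j * g j)" for i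
          by (intro sum.cong) (auto simp: g'_def)
        moreover have "(\<Sum>j\<in>I. P i j * g j) = 0" if "i \<in> J" for i using tri that by simp
        ultimately show ?thesis
          using zero[of g'] additive.zero[OF bp_functional_additive[OF \<phi>]] by (simp add: un)
      qed
    qed (use \<phi> in auto)
    have \<phi>J: "\<phi> k p = 0" if k: "k \<in> J" for k p
    proof (rule right_denseD[of Q J P, OF _ _ _ k])
      show "right_dense Q J P" using J by (simp add: two_sided_dense_def)
      show "(\<Sum>i\<in>J. \<phi> i (\<Sum>j\<in>J. P i j * g j)) = 0" for g
      proof -
        have "(\<Sum>j\<in>I. P i j * g j) = 0" if "i \<in> J" for i using tri that by simp
        then show ?thesis using zero[of g] \<phi>I by (simp add: un)
      qed
    qed (use \<phi> in auto)
    show "\<phi> k p = 0" using k \<phi>I \<phi>J by auto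
  qed
qed

text \<open>Here \<open>P = C + B Z\<close> is the Schur complement of the identity block of \<open>L = [C, B; -Z, 1]\<close>.\<close>

lemma two_sided_dense_schur:
  fixes Q :: "'d::finite \<Rightarrow> 'h::chilbert_space \<Rightarrow> 'h"
  assumes basis: "operator_space_basis Q" and fin: "finite I" "finite J" and disj: "I \<inter> J = {}"
    and P: "\<And>i l. i \<in> I \<Longrightarrow> l \<in> I \<Longrightarrow> P i l = L i l - (\<Sum>m\<in>J. L i m * L m l)"
    and LJ: "\<And>i l. i \<in> J \<Longrightarrow> l \<in> J \<Longrightarrow> L i l = delta i l"
    and L: "two_sided_dense Q (I \<union> J) L"
  shows "two_sided_dense Q I P"
  unfolding two_sided_dense_def
proof
  note un = sum.union_disjoint[OF fin disj]
  have nJ: "i \<notin> J" if "i \<in> I" for i using that disj by auto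
  have nI: "i \<notin> I" if "i \<in> J" for i using that disj by auto
  have sumJ: "(\<Sum>i\<in>J. g i * L i j) = g j" "(\<Sum>i\<in>J. L j i * g i) = g j" if "j \<in> J" for g j
  proof -
    have "(\<Sum>i\<in>J. g i * L i j) = (\<Sum>i\<in>J. if i = j then g j else 0)"
      "(\<Sum>i\<in>J. L j i * g i) = (\<Sum>i\<in>J. if i = j then g j else 0)"
      using LJ that by (auto intro!: sum.cong)
    then show "(\<Sum>i\<in>J. g i * L i j) = g j" "(\<Sum>i\<in>J. L j i * g i) = g j" using fin that by simp_all
  qed
  show "left_dense Q I P"
  proof (rule left_denseI)
    fix \<phi> k p
    assume \<phi>: "\<And>i. i \<in> I \<Longrightarrow> bp_functional Q (\<phi> i)" and k: "k \<in> I"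
      and zero: "\<And>g. (\<Sum>j\<in>I. \<phi> j (\<Sum>i\<in>I. g i * P i j)) = 0"
    note add = bp_functional_additive[OF \<phi>]
    \<comment> \<open>The extension to \<open>J\<close> is chosen so that the \<open>J\<close> part
      of a row cancels: it contributes \<open>g m * L m l\<close> through the columns in
      \<open>I\<close> and the negative of this through the columns in \<open>J\<close>. What is
      left is the \<open>I\<close> part applied to the Schur complement.\<close>
    define \<psi> where "\<psi> j = (if j \<in> J then (\<lambda>p. - (\<Sum>l\<in>I. \<phi> l (p * L j l))) else \<phi> j)" for j
    have \<psi>I: "\<psi> j = \<phi> j" if "j \<in> I" for j using nJ[OF that] by (simp add: \<psi>_def)
    have "\<psi> k p = 0"
    proof (rule left_denseD[of Q "I \<union> J" L])
      show "left_dense Q (I \<union> J) L" using L by (simp add: two_sided_dense_def)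
      show "bp_functional Q (\<psi> i)" if "i \<in> I \<union> J" for i
        using that \<phi> by (auto simp: \<psi>_def intro!: bp_functional_sum bp_functional_uminus bp_functional_mult(2)[OF basis])
      fix g
      define h where "h m = (\<Sum>i\<in>I. g i * L i m)" for m
      have J: "(\<Sum>m\<in>J. \<psi> m (\<Sum>i\<in>I \<union> J. g i * L i m)) = - (\<Sum>l\<in>I. \<phi> l (\<Sum>m\<in>J. (h m + g m) * L m l))"
      proof -
        have "(\<Sum>m\<in>J. \<psi> m (\<Sum>i\<in>I \<union> J. g i * L i m)) = (\<Sum>m\<in>J. - (\<Sum>l\<in>I. \<phi> l ((h m + g m) * L m l)))"
          by (intro sum.cong refl) (simp add: \<psi>_def un sumJ h_def)
        also have "\<dots> = - (\<Sum>l\<in>I. \<Sum>m\<in>J. \<phi> l ((h m + g m) * L m l))"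
          by (simp add: sum_negf) (rule sum.swap)
        finally show ?thesis by (simp add: additive.sum[OF add])
      qed
      have "(\<Sum>l\<in>I. \<phi> l (h l + (\<Sum>m\<in>J. g m * L m l))) - (\<Sum>l\<in>I. \<phi> l (\<Sum>m\<in>J. (h m + g m) * L m l))
        = (\<Sum>l\<in>I. \<phi> l (\<Sum>i\<in>I. g i * P i l))"
        unfolding sum_subtractf[symmetric]
      proof (rule sum.cong[OF refl])
        fix l assume l: "l \<in> I"
        have "(\<Sum>m\<in>J. h m * L m l) = (\<Sum>i\<in>I. g i * (\<Sum>m\<in>J. L i m * L m l))"
          by (simp add: h_def sum_distrib_left sum_distrib_right mult.assoc) (rule sum.swap)
        then have "h l - (\<Sum>m\<in>J. h m * L m l) = (\<Sum>i\<in>I. g i * P i l)"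
          using l by (simp add: P h_def algebra_simps sum_subtractf)
        then have "(h l + (\<Sum>m\<in>J. g m * L m l)) - (\<Sum>m\<in>J. (h m + g m) * L m l) = (\<Sum>i\<in>I. g i * P i l)"
          by (simp add: algebra_simps sum.distrib)
        then show "\<phi> l (h l + (\<Sum>m\<in>J. g m * L m l)) - \<phi> l (\<Sum>m\<in>J. (h m + g m) * L m l) = \<phi> l (\<Sum>i\<in>I. g i * P i l)"
          using additive.diff[OF add[OF l]] by metis
      qed
      then show "(\<Sum>j\<in>I \<union> J. \<psi> j (\<Sum>i\<in>I \<union> J. g i * L i j)) = 0"
        unfolding un[of "\<lambda>j. \<psi> j (\<Sum>i\<in>I \<union> J. g i * L i j)"] J using zero[of g]
        by (simp add: \<psi>I un h_def)
    qed (use k in auto)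
    then show "\<phi> k p = 0" using \<psi>I[OF k] by simp
  qed
  show "right_dense Q I P"
  proof (rule right_denseI)
    fix \<phi> k p
    assume \<phi>: "\<And>i. i \<in> I \<Longrightarrow> bp_functional Q (\<phi> i)" and k: "k \<in> I"
      and zero: "\<And>g. (\<Sum>i\<in>I. \<phi> i (\<Sum>j\<in>I. P i j * g j)) = 0"
    note add = bp_functional_additive[OF \<phi>]
    \<comment> \<open>The same cancellation for columns, so the factor \<open>L l j\<close> now
      stands on the left of the argument.\<close>
    define \<psi> where "\<psi> j = (if j \<in> J then (\<lambda>p. - (\<Sum>l\<in>I. \<phi> l (L l j * p))) else \<phi> j)" for j
    have \<psi>I: "\<psi> j = \<phi> j" if "j \<in> I" for j using nJ[OF that] by (simp add: \<psi>_def)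
    have "\<psi> k p = 0"
    proof (rule right_denseD[of Q "I \<union> J" L])
      show "right_dense Q (I \<union> J) L" using L by (simp add: two_sided_dense_def)
      show "bp_functional Q (\<psi> i)" if "i \<in> I \<union> J" for i
        using that \<phi> by (auto simp: \<psi>_def intro!: bp_functional_sum bp_functional_uminus bp_functional_mult(1)[OF basis])
      fix g
      define h where "h m = (\<Sum>i\<in>I. L m i * g i)" for m
      have J: "(\<Sum>m\<in>J. \<psi> m (\<Sum>i\<in>I \<union> J. L m i * g i)) = - (\<Sum>l\<in>I. \<phi> l (\<Sum>m\<in>J. L l m * (h m + g m)))"
      proof -
        have "(\<Sum>m\<in>J. \<psi> m (\<Sum>i\<in>I \<union> J. L m i * g i)) = (\<Sum>m\<in>J. - (\<Sum>l\<in>I. \<phi> l (L l m * (h m + g m))))"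
          by (intro sum.cong refl) (simp add: \<psi>_def un sumJ h_def)
        also have "\<dots> = - (\<Sum>l\<in>I. \<Sum>m\<in>J. \<phi> l (L l m * (h m + g m)))"
          by (simp add: sum_negf) (rule sum.swap)
        finally show ?thesis by (simp add: additive.sum[OF add])
      qed
      have "(\<Sum>l\<in>I. \<phi> l (h l + (\<Sum>m\<in>J. L l m * g m))) - (\<Sum>l\<in>I. \<phi> l (\<Sum>m\<in>J. L l m * (h m + g m)))
        = (\<Sum>l\<in>I. \<phi> l (\<Sum>i\<in>I. P l i * g i))"
        unfolding sum_subtractf[symmetric]
      proof (rule sum.cong[OF refl])
        fix l assume l: "l \<in> I"
        have "(\<Sum>m\<in>J. L l m * h m) = (\<Sum>i\<in>I. (\<Sum>m\<in>J. L l m * L m i) * g i)"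
          by (simp add: h_def sum_distrib_left sum_distrib_right mult.assoc) (rule sum.swap)
        then have "h l - (\<Sum>m\<in>J. L l m * h m) = (\<Sum>i\<in>I. P l i * g i)"
          using l by (simp add: P h_def algebra_simps sum_subtractf)
        then have "(h l + (\<Sum>m\<in>J. L l m * g m)) - (\<Sum>m\<in>J. L l m * (h m + g m)) = (\<Sum>i\<in>I. P l i * g i)"
          by (simp add: algebra_simps sum.distrib)
        then show "\<phi> l (h l + (\<Sum>m\<in>J. L l m * g m)) - \<phi> l (\<Sum>m\<in>J. L l m * (h m + g m)) = \<phi> l (\<Sum>i\<in>I. P l i * g i)"
          using additive.diff[OF add[OF l]] by metis
      qed
      then show "(\<Sum>j\<in>I \<union> J. \<psi> j (\<Sum>i\<in>I \<union> J. L j i * g i)) = 0"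
        unfolding un[of "\<lambda>j. \<psi> j (\<Sum>i\<in>I \<union> J. L j i * g i)"] J using zero[of g]
        by (simp add: \<psi>I un h_def)
    qed (use k in auto)
    then show "\<phi> k p = 0" using \<psi>I[OF k] by simp
  qed
qed

section \<open>Stable linear polynomials\<close>

definition block_act :: "('i \<Rightarrow> 'j \<Rightarrow> 'd::finite ncpoly) \<Rightarrow> 'j set \<Rightarrow> nat \<Rightarrow> 'd mtuple
    \<Rightarrow> ('j \<Rightarrow> nat \<Rightarrow> complex) \<Rightarrow> 'i \<Rightarrow> nat \<Rightarrow> complex" where
  "block_act P I n X v i a = (\<Sum>l\<in>I. \<Sum>b<n. poly_value (P i l) X $$ (a, b) * v l b)"

text \<open>Stability is expressed by trivial kernels instead of a determinant, so that it makes
  sense for any index set and passes through Schur complements and changes of basis by solving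
  equations.\<close>

definition stable_on :: "('d::finite \<Rightarrow> 'h::chilbert_space \<Rightarrow> 'h) \<Rightarrow> 'i set \<Rightarrow> ('i \<Rightarrow> 'i \<Rightarrow> 'd ncpoly) \<Rightarrow> bool" where
  "stable_on Q I P \<longleftrightarrow> (\<forall>n X v. X \<in> nc_ball Q \<longrightarrow> X \<in> tuples n \<longrightarrow>
     (\<forall>i\<in>I. \<forall>a<n. block_act P I n X v i a = 0) \<longrightarrow> (\<forall>i\<in>I. \<forall>a<n. v i a = 0))"

lemma stable_onD:
  assumes "stable_on Q I P" "X \<in> nc_ball Q" "X \<in> tuples n"
    "\<And>i a. i \<in> I \<Longrightarrow> a < n \<Longrightarrow> block_act P I n X v i a = 0" "i \<in> I" "a < n"
  shows "v i a = 0"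
  using assms unfolding stable_on_def by blast

lemma block_act_cong:
  assumes "\<And>l b. l \<in> I \<Longrightarrow> b < n \<Longrightarrow> v l b = w l b"
  shows "block_act P I n X v i a = block_act P I n X w i a"
  unfolding block_act_def using assms by (intro sum.cong refl) auto

lemma block_act_mult:
  assumes X: "X \<in> tuples n" and a: "a < n"
  shows "block_act (\<lambda>i l. \<Sum>m\<in>J. P i m * R m l) I n X v i a = block_act P J n X (block_act R I n X v) i a"
proof -
  have "block_act (\<lambda>i l. \<Sum>m\<in>J. P i m * R m l) I n X v i a
    = (\<Sum>l\<in>I. \<Sum>b<n. \<Sum>m\<in>J. \<Sum>c<n. poly_value (P i m) X $$ (a, c) * (poly_value (R m l) X $$ (c, b) * v l b))"
    unfolding block_act_def
    by (intro sum.cong refl) (simp add: poly_value_sum[OF X a] poly_value_mult_entry[OF X a] sum_distrib_right mult.assoc)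
  also have "\<dots> = (\<Sum>l\<in>I. \<Sum>m\<in>J. \<Sum>b<n. \<Sum>c<n. poly_value (P i m) X $$ (a, c) * (poly_value (R m l) X $$ (c, b) * v l b))"
    by (intro sum.cong refl sum.swap)
  also have "\<dots> = (\<Sum>m\<in>J. \<Sum>l\<in>I. \<Sum>b<n. \<Sum>c<n. poly_value (P i m) X $$ (a, c) * (poly_value (R m l) X $$ (c, b) * v l b))"
    by (rule sum.swap)
  also have "\<dots> = (\<Sum>m\<in>J. \<Sum>l\<in>I. \<Sum>c<n. \<Sum>b<n. poly_value (P i m) X $$ (a, c) * (poly_value (R m l) X $$ (c, b) * v l b))"
    by (intro sum.cong refl sum.swap)
  also have "\<dots> = (\<Sum>m\<in>J. \<Sum>c<n. \<Sum>l\<in>I. \<Sum>b<n. poly_value (P i m) X $$ (a, c) * (poly_value (R m l) X $$ (c, b) * v l b))"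
    by (intro sum.cong refl sum.swap)
  finally show ?thesis by (simp add: block_act_def sum_distrib_left)
qed

lemma block_act_diff:
  assumes "X \<in> tuples n" "a < n"
  shows "block_act (\<lambda>i l. P i l - R i l) I n X v i a = block_act P I n X v i a - block_act R I n X v i a"
  by (simp add: block_act_def poly_value_diff[OF assms] left_diff_distrib sum_subtractf)

lemma block_act_pconst:
  assumes "X \<in> tuples n" "a < n"
  shows "block_act (\<lambda>i l. pconst (S i l)) I n X v i a = (\<Sum>l\<in>I. S i l * v l a)"
proof -
  have "(\<Sum>b<n. poly_value (pconst (S i l)) X $$ (a, b) * v l b) = (\<Sum>b<n. if b = a then S i l * v l a else 0)" for l
    using poly_value_pconst[OF assms] by (intro sum.cong) auto
  then show ?thesis using assms by (simp add: block_act_def)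
qed

lemma block_act_delta:
  assumes "X \<in> tuples n" "a < n" "finite I" "i \<in> I"
  shows "block_act (\<lambda>i l. delta i l) I n X v i a = v i a"
proof -
  have "block_act (\<lambda>i l. delta i l) I n X v i a = (\<Sum>l\<in>I. delta i l * v l a)"
    unfolding pconst_delta[symmetric] by (rule block_act_pconst[OF assms(1,2)])
  also have "\<dots> = (\<Sum>l\<in>I. if l = i then v i a else 0)" by (intro sum.cong) auto
  finally show ?thesis using assms by simp
qed

section \<open>Linear pencils and their evaluation\<close>

definition linear_poly :: "('d::finite \<Rightarrow> complex) \<Rightarrow> 'd ncpoly" where
  "linear_poly c = (\<Sum>j\<in>UNIV. pconst (c j) * pvar j)"

lemma linear_poly_sum: "(\<Sum>i\<in>A. linear_poly (c i)) = linear_poly (\<lambda>j. \<Sum>i\<in>A. c i j)"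
  unfolding linear_poly_def by (subst sum.swap) (simp add: pconst_sum sum_distrib_right)

lemma linear_poly_mult_pconst: "linear_poly c * pconst s = linear_poly (\<lambda>j. c j * s)"
  unfolding linear_poly_def sum_distrib_right
  by (intro sum.cong refl) (metis mult.assoc pconst_commute pconst_mult)

lemma pconst_mult_linear_poly: "pconst s * linear_poly c = linear_poly (\<lambda>j. s * c j)"
  by (simp add: linear_poly_def sum_distrib_left pconst_mult mult.assoc)

lemma linear_poly_zero: "linear_poly (\<lambda>_. 0) = 0"
  by (simp add: linear_poly_def pconst_zero)

lemma poly_value_linear_poly:
  assumes "X \<in> tuples n" "a < n" "b < n"
  shows "poly_value (linear_poly c) X $$ (a, b) = (\<Sum>j\<in>UNIV. c j * X j $$ (a, b))"
  by (simp add: linear_poly_def poly_value_sum[OF assms] poly_mult_pconst_entry[OF assms] poly_value_pvar[OF assms(1)])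

definition linear_act :: "('d::finite \<Rightarrow> 'i \<Rightarrow> 'i \<Rightarrow> complex) \<Rightarrow> 'i set \<Rightarrow> nat \<Rightarrow> 'd mtuple
    \<Rightarrow> ('i \<Rightarrow> nat \<Rightarrow> complex) \<Rightarrow> 'i \<Rightarrow> nat \<Rightarrow> complex" where
  "linear_act A I n X v i a = (\<Sum>l\<in>I. \<Sum>b<n. \<Sum>j\<in>UNIV. A j i l * X j $$ (a, b) * v l b)"

lemma block_act_linear_poly:
  assumes "X \<in> tuples n" "a < n"
  shows "block_act (\<lambda>i l. linear_poly (\<lambda>j. A j i l)) I n X v i a = linear_act A I n X v i a"
  using poly_value_linear_poly[OF assms] by (simp add: block_act_def linear_act_def sum_distrib_right)

lemma linear_act_cong:
  assumes "\<And>l b. l \<in> I \<Longrightarrow> b < n \<Longrightarrow> v l b = w l b"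
  shows "linear_act A I n X v i a = linear_act A I n X w i a"
  unfolding linear_act_def using assms by (intro sum.cong refl) auto

lemma linear_act_scale: "linear_act A I n X (\<lambda>l b. c * v l b) i a = c * linear_act A I n X v i a"
  by (simp add: linear_act_def sum_distrib_left mult_ac)

lemma linear_act_smult:
  assumes "X \<in> tuples n" "a < n"
  shows "linear_act A I n (\<lambda>j. c \<cdot>\<^sub>m X j) v i a = c * linear_act A I n X v i a"
proof -
  have "(c \<cdot>\<^sub>m X j) $$ (a, b) = c * X j $$ (a, b)" if "b < n" for j b
    using tuplesD[OF assms(1), of j] assms(2) that by simp
  then show ?thesis by (simp add: linear_act_def sum_distrib_left mult_ac)
qed

text \<open>The coefficients of \<open>A\<close> act on the index \<open>i\<close> and
  \<open>W\<close> acts on the size index \<open>a\<close>; as they act on different tensor factors,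
  \<open>W\<close> can be pulled out.\<close>

lemma linear_act_left_mult:
  assumes "a < n"
  shows "linear_act A I n (\<lambda>j. Matrix.mat n n (\<lambda>(i, l). \<Sum>a<n. W i a * X j $$ (a, l))) v i a
    = (\<Sum>c<n. W a c * linear_act A I n X v i c)"
proof -
  have "linear_act A I n (\<lambda>j. Matrix.mat n n (\<lambda>(i, l). \<Sum>a<n. W i a * X j $$ (a, l))) v i a
    = (\<Sum>l\<in>I. \<Sum>b<n. \<Sum>j\<in>UNIV. \<Sum>c<n. W a c * (A j i l * X j $$ (c, b) * v l b))"
    unfolding linear_act_def using assms
    by (intro sum.cong refl) (simp add: sum_distrib_left sum_distrib_right mult_ac)
  also have "\<dots> = (\<Sum>l\<in>I. \<Sum>b<n. \<Sum>c<n. \<Sum>j\<in>UNIV. W a c * (A j i l * X j $$ (c, b) * v l b))"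
    by (intro sum.cong refl sum.swap)
  also have "\<dots> = (\<Sum>l\<in>I. \<Sum>c<n. \<Sum>b<n. \<Sum>j\<in>UNIV. W a c * (A j i l * X j $$ (c, b) * v l b))"
    by (intro sum.cong refl sum.swap)
  also have "\<dots> = (\<Sum>c<n. \<Sum>l\<in>I. \<Sum>b<n. \<Sum>j\<in>UNIV. W a c * (A j i l * X j $$ (c, b) * v l b))"
    by (rule sum.swap)
  finally show ?thesis by (simp add: linear_act_def sum_distrib_left)
qed

lemma linear_act_dsum:
  assumes X: "X \<in> tuples n" and Y: "Y \<in> tuples m"
  shows "a < n \<Longrightarrow> linear_act A I (n + m) (\<lambda>j. X j \<oplus>\<^sub>M Y j) v i a = linear_act A I n X v i a"
    and "a < m \<Longrightarrow> linear_act A I (n + m) (\<lambda>j. X j \<oplus>\<^sub>M Y j) v i (n + a) = linear_act A I m Y (\<lambda>l b. v l (n + b)) i a"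
  by (simp_all add: linear_act_def sum_lessThan_add mat_dsum_entry[OF tuplesD[OF X] tuplesD[OF Y]])

primrec power_on :: "'i set \<Rightarrow> ('i \<Rightarrow> 'i \<Rightarrow> 'a::semiring_1) \<Rightarrow> nat \<Rightarrow> 'i \<Rightarrow> 'i \<Rightarrow> 'a" where
  "power_on I M 0 = (\<lambda>i l. delta i l)"
| "power_on I M (Suc N) = (\<lambda>i l. \<Sum>m\<in>I. M i m * power_on I M N m l)"

lemma two_sided_dense_contractive:
  fixes Q :: "'d::finite \<Rightarrow> 'h::chilbert_space \<Rightarrow> 'h" and I :: "'i set"
  assumes basis: "operator_space_basis Q" and fin: "finite I" and d: "\<And>i. i \<in> I \<Longrightarrow> d i > (0::real)"
    and contr: "\<And>n X v. X \<in> nc_ball Q \<Longrightarrow> X \<in> tuples n \<Longrightarrow>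
      (\<Sum>a<n. \<Sum>i\<in>I. d i * (cmod (linear_act A I n X v i a))\<^sup>2) \<le> (\<Sum>a<n. \<Sum>i\<in>I. d i * (cmod (v i a))\<^sup>2)"
  shows "two_sided_dense Q I (\<lambda>i l. delta i l - linear_poly (\<lambda>j. A j i l))"
proof -
  have Q: "\<And>j. bounded_clinear_op (Q j)" using basis by (auto simp: operator_space_basis_def)
  define M where "M i l = linear_poly (\<lambda>j. A j i l)" for i l
  define q where "q n v = (\<Sum>a<n. \<Sum>i\<in>I. d i * (cmod (v i a))\<^sup>2)" for n and v :: "'i \<Rightarrow> nat \<Rightarrow> complex"
  \<comment> \<open>By linearity \<open>A(X) = s A(X / s)\<close> with \<open>X / s\<close> in the
    ball, so each application contributes a factor \<open>s\<close> in the weighted norm. The square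
    root converts the weight of the source index \<open>l\<close> into that of the target index
    \<open>i\<close>.\<close>
  have op: "op_bound n (poly_value (power_on I M N i l) X) (sqrt (d l / d i) * s ^ N)"
    if X: "X \<in> nc_ball Q" "X \<in> tuples n" and s: "0 < s" "s < 1"
      "(\<lambda>j. complex_of_real (1/s) \<cdot>\<^sub>m X j) \<in> nc_ball Q" and il: "i \<in> I" "l \<in> I" for n X s N i l
  proof -
    let ?Y = "\<lambda>j. complex_of_real (1/s) \<cdot>\<^sub>m X j"
    have step: "q n (block_act M I n X v) \<le> s\<^sup>2 * q n v" for v
    proof -
      have "block_act M I n X v i a = of_real s * linear_act A I n ?Y v i a" if "a < n" for i a
        unfolding M_def block_act_linear_poly[OF X(2) that] linear_act_smult[OF X(2) that] using s by simp
      then have "q n (block_act M I n X v) = s\<^sup>2 * (\<Sum>a<n. \<Sum>i\<in>I. d i * (cmod (linear_act A I n ?Y v i a))\<^sup>2)"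
        by (simp add: q_def norm_mult power_mult_distrib sum_distrib_left mult_ac)
      also have "\<dots> \<le> s\<^sup>2 * q n v"
        unfolding q_def by (intro mult_left_mono contr s tuples_smult X) simp
      finally show ?thesis .
    qed
    have q_pow: "q n (block_act (power_on I M N) I n X v) \<le> (s ^ N)\<^sup>2 * q n v" for v
    proof (induction N)
      case 0
      have "q n (block_act (power_on I M 0) I n X v) = q n v"
        unfolding q_def by (intro sum.cong refl) (simp add: block_act_delta[OF X(2) _ fin])
      then show ?case by simp
    next
      case (Suc N)
      have "q n (block_act (power_on I M (Suc N)) I n X v) = q n (block_act M I n X (block_act (power_on I M N) I n X v))"
        unfolding q_def by (intro sum.cong refl) (simp add: block_act_mult[OF X(2)])
      also have "\<dots> \<le> s\<^sup>2 * q n (block_act (power_on I M N) I n X v)" by (rule step)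
      also have "\<dots> \<le> s\<^sup>2 * ((s ^ N)\<^sup>2 * q n v)" by (rule mult_left_mono[OF Suc]) simp
      finally show ?case by (simp add: power_mult_distrib mult_ac)
    qed
    show ?thesis
      unfolding op_bound_def
    proof
      fix w :: "nat \<Rightarrow> complex"
      \<comment> \<open>A vector supported at the index \<open>l\<close> isolates the single entry
        \<open>(i, l)\<close> of the power.\<close>
      define v where "v m b = (if m = l then w b else 0)" for m b
      have act: "block_act (power_on I M N) I n X v i a = (\<Sum>b<n. poly_value (power_on I M N i l) X $$ (a, b) * w b)" for a
      proof -
        have "block_act (power_on I M N) I n X v i a
          = (\<Sum>m\<in>I. if m = l then (\<Sum>b<n. poly_value (power_on I M N i l) X $$ (a, b) * w b) else 0)"
          unfolding block_act_def v_def by (intro sum.cong) auto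
        then show ?thesis using fin il by simp
      qed
      have "d i * (\<Sum>a<n. (cmod (\<Sum>b<n. poly_value (power_on I M N i l) X $$ (a, b) * w b))\<^sup>2)
        \<le> q n (block_act (power_on I M N) I n X v)"
        unfolding q_def act[symmetric] sum_distrib_left
        by (intro sum_mono member_le_sum[OF il(1) _ fin]) (use d less_imp_le in fastforce)
      also have "\<dots> \<le> (s ^ N)\<^sup>2 * q n v" by (rule q_pow)
      also have "q n v = (\<Sum>a<n. \<Sum>m\<in>I. if m = l then d l * (cmod (w a))\<^sup>2 else 0)"
        unfolding q_def v_def by (intro sum.cong refl) auto
      also have "\<dots> = d l * (\<Sum>a<n. (cmod (w a))\<^sup>2)" using fin il by (simp add: sum_distrib_left)
      finally have "(\<Sum>a<n. (cmod (\<Sum>b<n. poly_value (power_on I M N i l) X $$ (a, b) * w b))\<^sup>2)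
        \<le> (s ^ N)\<^sup>2 * (d l * (\<Sum>a<n. (cmod (w a))\<^sup>2)) / d i"
        using d[OF il(1)] by (simp only: pos_le_divide_eq mult.commute[of "d i"])
      also have "\<dots> = (sqrt (d l / d i) * s ^ N)\<^sup>2 * (\<Sum>a<n. (cmod (w a))\<^sup>2)"
        using d[OF il(1)] d[OF il(2)] by (simp add: power_mult_distrib)
      finally have "(\<Sum>a<n. (cmod (\<Sum>b<n. poly_value (power_on I M N i l) X $$ (a, b) * w b))\<^sup>2)
        \<le> (sqrt (d l / d i) * s ^ N)\<^sup>2 * (\<Sum>a<n. (cmod (w a))\<^sup>2)" .
      then show "l2n n (\<lambda>a. \<Sum>b<n. poly_value (power_on I M N i l) X $$ (a, b) * w b) \<le> sqrt (d l / d i) * s ^ N * l2n n w"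
        using s d[OF il(1)] d[OF il(2)] by (subst l2n_le_iff) auto
    qed
  qed
  \<comment> \<open>The common bound may not depend on \<open>X\<close>, so there
    \<open>s ^ N\<close> is estimated by \<open>1\<close>; at a fixed point it is kept and yields
    the convergence.\<close>
  have null: "bp_null Q (\<lambda>N. power_on I M N i l)" if il: "i \<in> I" "l \<in> I" for i l
    unfolding bp_null_def
  proof (intro conjI exI allI impI)
    show "sqrt (d l / d i) \<ge> 0" using d[OF il(1)] d[OF il(2)] by simp
    fix N n X assume X: "X \<in> nc_ball Q" "X \<in> tuples n"
    obtain s where s: "0 < s" "s < (1::real)" "(\<lambda>j. complex_of_real (1/s) \<cdot>\<^sub>m X j) \<in> nc_ball Q"
      using nc_ball_inflate[of Q, OF Q X] by metis
    have "sqrt (d l / d i) * s ^ N \<le> sqrt (d l / d i)"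
      using s d[OF il(1)] d[OF il(2)] by (intro mult_left_le power_le_one) auto
    then show "op_bound n (poly_value (power_on I M N i l) X) (sqrt (d l / d i))"
      using op[OF X s il, of N] unfolding op_bound_def by (meson mult_right_mono L2_set_nonneg order_trans)
  next
    fix n X a b assume X: "X \<in> nc_ball Q" "X \<in> tuples n" and ab: "a < n" "b < n"
    obtain s where s: "0 < s" "s < (1::real)" "(\<lambda>j. complex_of_real (1/s) \<cdot>\<^sub>m X j) \<in> nc_ball Q"
      using nc_ball_inflate[of Q, OF Q X] by metis
    have "(\<lambda>N. sqrt (d l / d i) * s ^ N) \<longlonglongrightarrow> sqrt (d l / d i) * 0"
      using s by (intro tendsto_mult tendsto_const LIMSEQ_power_zero) auto
    then have lim: "(\<lambda>N. sqrt (d l / d i) * s ^ N) \<longlonglongrightarrow> 0" by simp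
    show "(\<lambda>N. poly_value (power_on I M N i l) X $$ (a, b)) \<longlonglongrightarrow> 0"
    proof (rule tendsto_0_le[OF lim, where K = 1], rule always_eventually, rule allI)
      fix N
      show "norm (poly_value (power_on I M N i l) X $$ (a, b)) \<le> norm (sqrt (d l / d i) * s ^ N) * 1"
        using op_bound_entry[OF op[OF X s il] ab, of N] by simp
    qed
  qed
  have one: "\<phi> k p = 0" if k: "k \<in> I" and \<phi>: "\<And>i. i \<in> I \<Longrightarrow> bp_functional Q (\<phi> i)"
    and zero: "\<And>g. (\<Sum>j\<in>I. \<phi> j (g j)) = 0" for \<phi> k p
  proof -
    have "0 = (\<Sum>j\<in>I. \<phi> j (if j = k then p else 0))" by (simp add: zero)
    also have "\<dots> = \<phi> k p"
      by (rule sum_additive_delta[OF fin k bp_functional_additive[OF \<phi>]]) auto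
    finally show ?thesis by simp
  qed
  have delta_sum: "(\<Sum>i\<in>I. g i * delta i j) = g j" "(\<Sum>i\<in>I. delta j i * g i) = g j" if "j \<in> I"
    for g :: "'i \<Rightarrow> 'd ncpoly" and j
  proof -
    have "(\<Sum>i\<in>I. g i * delta i j) = (\<Sum>i\<in>I. if i = j then g j else 0)"
      "(\<Sum>i\<in>I. delta j i * g i) = (\<Sum>i\<in>I. if i = j then g j else 0)"
      by (auto intro!: sum.cong)
    then show "(\<Sum>i\<in>I. g i * delta i j) = g j" "(\<Sum>i\<in>I. delta j i * g i) = g j" using fin that by simp_all
  qed
  have "left_dense Q I (\<lambda>i l. delta i l - M i l)"
  proof (rule left_denseI)
    fix \<phi> k p
    assume \<phi>: "\<And>i. i \<in> I \<Longrightarrow> bp_functional Q (\<phi> i)" and k: "k \<in> I"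
      and zero: "\<And>g. (\<Sum>j\<in>I. \<phi> j (\<Sum>i\<in>I. g i * (delta i j - M i j))) = 0"
    note add = bp_functional_additive[OF \<phi>]
    have inv: "(\<Sum>j\<in>I. \<phi> j (g j)) = (\<Sum>j\<in>I. \<phi> j (\<Sum>i\<in>I. g i * M i j))" for g
    proof -
      have "(\<Sum>j\<in>I. \<phi> j (g j)) - (\<Sum>j\<in>I. \<phi> j (\<Sum>i\<in>I. g i * M i j)) = (\<Sum>j\<in>I. \<phi> j (\<Sum>i\<in>I. g i * (delta i j - M i j)))"
        unfolding sum_subtractf[symmetric]
      proof (rule sum.cong[OF refl])
        fix j assume j: "j \<in> I"
        have "(\<Sum>i\<in>I. g i * (delta i j - M i j)) = g j - (\<Sum>i\<in>I. g i * M i j)"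
          by (simp only: right_diff_distrib sum_subtractf delta_sum[OF j])
        then show "\<phi> j (g j) - \<phi> j (\<Sum>i\<in>I. g i * M i j) = \<phi> j (\<Sum>i\<in>I. g i * (delta i j - M i j))"
          using additive.diff[OF add[OF j]] by metis
      qed
      then show ?thesis using zero[of g] by simp
    qed
    \<comment> \<open>\<open>power_on\<close> adds its new factor on the left, so the row is first
      multiplied by \<open>M\<close> and the hypothesis is applied to the new row. For right ideals
      the single step is applied to the column \<open>M^N g\<close>, and \<open>g\<close> can stay
      fixed.\<close>
    have pow: "(\<Sum>j\<in>I. \<phi> j (g j)) = (\<Sum>j\<in>I. \<phi> j (\<Sum>i\<in>I. g i * power_on I M N i j))" for g N
    proof (induction N arbitrary: g)
      case 0
      show ?case by (intro sum.cong refl arg_cong[of _ _ "\<phi> _"]) (simp only: power_on.simps delta_sum)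
    next
      case (Suc N)
      have "(\<Sum>i\<in>I. (\<Sum>m\<in>I. g m * M m i) * power_on I M N i j) = (\<Sum>i\<in>I. g i * power_on I M (Suc N) i j)" for j
        by (simp add: sum_distrib_left sum_distrib_right mult.assoc) (rule sum.swap)
      then show ?case using inv[of g] Suc[of "\<lambda>i. \<Sum>m\<in>I. g m * M m i"] by simp
    qed
    have "(\<Sum>j\<in>I. \<phi> j (g j)) = 0" for g
    proof -
      have "(\<lambda>N. \<Sum>j\<in>I. \<Sum>i\<in>I. \<phi> j (g i * power_on I M N i j)) \<longlonglongrightarrow> (\<Sum>j\<in>I. \<Sum>i\<in>I. 0)"
        by (intro tendsto_sum bp_functional_tendsto[OF bp_functional_mult(1)[OF basis \<phi>]] null)
      moreover have "(\<Sum>j\<in>I. \<Sum>i\<in>I. \<phi> j (g i * power_on I M N i j)) = (\<Sum>j\<in>I. \<phi> j (g j))" for N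
        unfolding pow[of g N] by (simp add: additive.sum[OF add])
      ultimately show ?thesis by (simp add: LIMSEQ_const_iff)
    qed
    then show "\<phi> k p = 0" by (intro one[where \<phi> = \<phi>]) (use k \<phi> in auto)
  qed
  moreover have "right_dense Q I (\<lambda>i l. delta i l - M i l)"
  proof (rule right_denseI)
    fix \<phi> k p
    assume \<phi>: "\<And>i. i \<in> I \<Longrightarrow> bp_functional Q (\<phi> i)" and k: "k \<in> I"
      and zero: "\<And>g. (\<Sum>i\<in>I. \<phi> i (\<Sum>j\<in>I. (delta i j - M i j) * g j)) = 0"
    note add = bp_functional_additive[OF \<phi>]
    have inv: "(\<Sum>j\<in>I. \<phi> j (g j)) = (\<Sum>j\<in>I. \<phi> j (\<Sum>i\<in>I. M j i * g i))" for g
    proof -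
      have "(\<Sum>j\<in>I. \<phi> j (g j)) - (\<Sum>j\<in>I. \<phi> j (\<Sum>i\<in>I. M j i * g i)) = (\<Sum>j\<in>I. \<phi> j (\<Sum>i\<in>I. (delta j i - M j i) * g i))"
        unfolding sum_subtractf[symmetric]
      proof (rule sum.cong[OF refl])
        fix j assume j: "j \<in> I"
        have "(\<Sum>i\<in>I. (delta j i - M j i) * g i) = g j - (\<Sum>i\<in>I. M j i * g i)"
          by (simp only: left_diff_distrib sum_subtractf delta_sum[OF j])
        then show "\<phi> j (g j) - \<phi> j (\<Sum>i\<in>I. M j i * g i) = \<phi> j (\<Sum>i\<in>I. (delta j i - M j i) * g i)"
          using additive.diff[OF add[OF j]] by metis
      qed
      then show ?thesis using zero[of g] by simp
    qed
    have pow: "(\<Sum>j\<in>I. \<phi> j (g j)) = (\<Sum>j\<in>I. \<phi> j (\<Sum>i\<in>I. power_on I M N j i * g i))" for g N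
    proof (induction N)
      case 0
      show ?case by (intro sum.cong refl arg_cong[of _ _ "\<phi> _"]) (simp only: power_on.simps delta_sum)
    next
      case (Suc N)
      have "(\<Sum>i\<in>I. M j i * (\<Sum>m\<in>I. power_on I M N i m * g m)) = (\<Sum>i\<in>I. power_on I M (Suc N) j i * g i)" for j
        by (simp add: sum_distrib_left sum_distrib_right mult.assoc) (rule sum.swap)
      then show ?case using inv[of "\<lambda>i. \<Sum>m\<in>I. power_on I M N i m * g m"] Suc by simp
    qed
    have "(\<Sum>j\<in>I. \<phi> j (g j)) = 0" for g
    proof -
      have "(\<lambda>N. \<Sum>j\<in>I. \<Sum>i\<in>I. \<phi> j (power_on I M N j i * g i)) \<longlonglongrightarrow> (\<Sum>j\<in>I. \<Sum>i\<in>I. 0)"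
        by (intro tendsto_sum bp_functional_tendsto[OF bp_functional_mult(2)[OF basis \<phi>]] null)
      moreover have "(\<Sum>j\<in>I. \<Sum>i\<in>I. \<phi> j (power_on I M N j i * g i)) = (\<Sum>j\<in>I. \<phi> j (g j))" for N
        unfolding pow[of g N] by (simp add: additive.sum[OF add])
      ultimately show ?thesis by (simp add: LIMSEQ_const_iff)
    qed
    then show "\<phi> k p = 0" by (intro one[where \<phi> = \<phi>]) (use k \<phi> in auto)
  qed
  ultimately show ?thesis unfolding two_sided_dense_def M_def by simp
qed

lemma fun_sum_apply2: "sum F A k l = (\<Sum>a\<in>A. F a k l)"
  for F :: "'a \<Rightarrow> 'i \<Rightarrow> 'j \<Rightarrow> complex"
  by (induction A rule: infinite_finite_induct) auto

lemma linear_act_zero: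
  assumes "\<And>l b. l \<in> I \<Longrightarrow> b < n \<Longrightarrow> v l b = 0"
  shows "linear_act A I n X v i a = 0"
  using assms by (simp add: linear_act_def)

lemma stable_on_linearD:
  assumes stab: "stable_on Q I (\<lambda>i l. delta i l - linear_poly (\<lambda>j. A j i l))" and fin: "finite I"
    and X: "X \<in> nc_ball Q" "X \<in> tuples n" and v: "\<And>i a. i \<in> I \<Longrightarrow> a < n \<Longrightarrow> linear_act A I n X v i a = v i a"
    and "i \<in> I" "a < n"
  shows "v i a = 0"
proof (rule stable_onD[OF stab X _ assms(6,7)])
  fix i a assume "i \<in> I" "a < n"
  then show "block_act (\<lambda>i l. delta i l - linear_poly (\<lambda>j. A j i l)) I n X v i a = 0"
    by (simp add: block_act_diff[OF X(2)] block_act_delta[OF X(2) _ fin] block_act_linear_poly[OF X(2)] v)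
qed

text \<open>
  If the Gram matrix of \<open>A(X) v\<close> exceeded that of \<open>v\<close>, then \<open>v = (1 \<otimes> W) A(X) v = A(W X) v\<close> for a
  contraction \<open>W\<close>, against stability. Separation therefore yields an invariant form.
\<close>

lemma contractive_form_exists:
  fixes Q :: "'d::finite \<Rightarrow> 'h::chilbert_space \<Rightarrow> 'h" and I :: "'i set"
  assumes Q: "\<And>j. bounded_clinear_op (Q j)" and fin: "finite I" and ne: "I \<noteq> {}"
    and stab: "stable_on Q I (\<lambda>i l. delta i l - linear_poly (\<lambda>j. A j i l))"
  obtains T where "hermitian_on I T" "\<And>x. qform I T x \<ge> 0" "\<exists>x. qform I T x > 0"
    "\<And>n X v. X \<in> nc_ball Q \<Longrightarrow> X \<in> tuples n \<Longrightarrow>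
      (\<Sum>a<n. qform I T (\<lambda>i. linear_act A I n X v i a)) \<le> (\<Sum>a<n. qform I T (\<lambda>i. v i a))"
proof -
  \<comment> \<open>The conjugate sits on the second factor, which makes \<open>gram\<close> a sum
    of the rank-one matrices on which the separating functional is known. Its form is then read at
    conjugated coefficients when Douglas' lemma is prepared.\<close>
  define gram where "gram n v = (\<lambda>i j. \<Sum>a<n. v i a * cnj (v j a))" for n and v :: "'i \<Rightarrow> nat \<Rightarrow> complex"
  define K where "K = {\<lambda>i j. gram n v i j - gram n (linear_act A I n X v) i j | n X v. X \<in> nc_ball Q \<and> X \<in> tuples n}"
  have K_I: "(\<lambda>i j. gram n v i j - gram n (linear_act A I n X v) i j) \<in> K" if "X \<in> nc_ball Q" "X \<in> tuples n" for n X v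
    using that unfolding K_def by blast
  have K_E: "\<exists>n X v. X \<in> nc_ball Q \<and> X \<in> tuples n \<and> \<kappa> = (\<lambda>i j. gram n v i j - gram n (linear_act A I n X v) i j)"
    if "\<kappa> \<in> K" for \<kappa>
    using that unfolding K_def by blast
  have q_gram: "qform I (gram n v) x = (\<Sum>a<n. (cmod (\<Sum>i\<in>I. cnj (x i) * v i a))\<^sup>2)" for n v x
  proof -
    have "(\<Sum>i\<in>I. \<Sum>j\<in>I. cnj (x i) * gram n v i j * x j)
      = (\<Sum>i\<in>I. \<Sum>j\<in>I. \<Sum>a<n. cnj (x i) * (v i a * cnj (v j a)) * x j)"
      unfolding gram_def sum_distrib_left sum_distrib_right ..
    also have "\<dots> = (\<Sum>i\<in>I. \<Sum>a<n. \<Sum>j\<in>I. cnj (x i) * (v i a * cnj (v j a)) * x j)"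
      by (intro sum.cong refl sum.swap)
    also have "\<dots> = (\<Sum>a<n. \<Sum>i\<in>I. \<Sum>j\<in>I. cnj (x i) * (v i a * cnj (v j a)) * x j)"
      by (rule sum.swap)
    finally have "qform I (gram n v) x = (\<Sum>a<n. qform I (\<lambda>i j. v i a * cnj (v j a)) x)"
      unfolding qform_def by (simp only: Re_sum)
    then show ?thesis by (simp only: qform_rank_one)
  qed
  have q_diff: "qform I (\<lambda>i j. T i j - U i j) x = qform I T x - qform I U x" for T U x
    by (simp add: qform_def algebra_simps sum_subtractf)
  obtain X0 n0 where X0: "X0 \<in> nc_ball Q" "X0 \<in> tuples n0"
  proof -
    have t: "(\<lambda>_ :: 'd. 0\<^sub>m 1 1) \<in> tuples 1" by (simp add: tuples_def)
    show thesis using nc_ball_shrink[of Q, OF Q order_refl t] tuples_smult[OF t] that by metis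
  qed
  have K_0: "(\<lambda>i j. 0) \<in> K"
    using K_I[OF X0, of "\<lambda>_ _. 0"] by (simp add: gram_def linear_act_def)
  have K_add: "(\<lambda>i j. \<kappa> i j + \<mu> i j) \<in> K" if \<kappa>: "\<kappa> \<in> K" and \<mu>: "\<mu> \<in> K" for \<kappa> \<mu>
  proof -
    obtain n X v where X: "X \<in> nc_ball Q" "X \<in> tuples n"
      and k: "\<kappa> = (\<lambda>i j. gram n v i j - gram n (linear_act A I n X v) i j)" using K_E[OF \<kappa>] by blast
    obtain m Y w where Y: "Y \<in> nc_ball Q" "Y \<in> tuples m"
      and u: "\<mu> = (\<lambda>i j. gram m w i j - gram m (linear_act A I m Y w) i j)" using K_E[OF \<mu>] by blast
    \<comment> \<open>The two vectors are stacked in the same way as the direct sum stacks the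
      points, so that both Gram matrices add.\<close>
    define z where "z i a = (if a < n then v i a else w i (a - n))" for i a
    let ?Z = "\<lambda>j. X j \<oplus>\<^sub>M Y j"
    have "linear_act A I (n + m) ?Z z i a = linear_act A I n X v i a" if "a < n" for i a
      unfolding linear_act_dsum(1)[OF X(2) Y(2) that] by (rule linear_act_cong) (simp add: z_def)
    moreover have "linear_act A I (n + m) ?Z z i (n + a) = linear_act A I m Y w i a" if "a < m" for i a
      unfolding linear_act_dsum(2)[OF X(2) Y(2) that] by (rule linear_act_cong) (simp add: z_def)
    ultimately have "gram (n + m) z i j - gram (n + m) (linear_act A I (n + m) ?Z z) i j = \<kappa> i j + \<mu> i j" for i j
      by (simp add: gram_def sum_lessThan_add k u z_def)
    then show ?thesis using K_I[OF nc_ball_dsum[of Q, OF Q X Y] tuples_dsum[OF X(2) Y(2)], of z] by simp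
  qed
  have K_scale: "(\<lambda>i j. of_real c * \<kappa> i j) \<in> K" if c: "c > 0" and \<kappa>: "\<kappa> \<in> K" for c \<kappa>
  proof -
    obtain n X v where X: "X \<in> nc_ball Q" "X \<in> tuples n"
      and k: "\<kappa> = (\<lambda>i j. gram n v i j - gram n (linear_act A I n X v) i j)" using K_E[OF \<kappa>] by blast
    \<comment> \<open>Gram matrices are quadratic in the vector, hence the square root.\<close>
    define s where "s = complex_of_real (sqrt c)"
    have s: "s * cnj s = of_real c" using c by (simp add: s_def of_real_mult[symmetric] del: of_real_mult)
    have gs: "gram n (\<lambda>i a. s * v i a) i j = of_real c * gram n v i j" for v i j
      unfolding gram_def s[symmetric] by (simp add: sum_distrib_left mult_ac)
    have "gram n (\<lambda>i a. s * v i a) i j - gram n (linear_act A I n X (\<lambda>i a. s * v i a)) i j = of_real c * \<kappa> i j" for i j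
    proof -
      have "linear_act A I n X (\<lambda>i a. s * v i a) = (\<lambda>i a. s * linear_act A I n X v i a)"
        by (intro ext linear_act_scale)
      then show ?thesis by (simp add: gs k right_diff_distrib)
    qed
    then show ?thesis using K_I[OF X, of "\<lambda>i a. s * v i a"] by simp
  qed
  have K_neg: "\<exists>x. qform I \<kappa> x + \<epsilon> * (\<Sum>i\<in>I. (cmod (x i))\<^sup>2) > 0" if \<kappa>: "\<kappa> \<in> K" and \<epsilon>: "\<epsilon> > 0" for \<kappa> \<epsilon>
  proof (rule ccontr)
    assume neg: "\<not> ?thesis"
    obtain n X v where X: "X \<in> nc_ball Q" "X \<in> tuples n"
      and k: "\<kappa> = (\<lambda>i j. gram n v i j - gram n (linear_act A I n X v) i j)" using K_E[OF \<kappa>] by blast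
    define u where "u = linear_act A I n X v"
    have le: "(\<Sum>a<n. (cmod (\<Sum>i\<in>I. c i * v i a))\<^sup>2) + \<epsilon> * (\<Sum>i\<in>I. (cmod (c i))\<^sup>2)
      \<le> (\<Sum>a<n. (cmod (\<Sum>i\<in>I. c i * u i a))\<^sup>2)" for c
    proof -
      have "\<not> qform I \<kappa> (\<lambda>i. cnj (c i)) + \<epsilon> * (\<Sum>i\<in>I. (cmod (cnj (c i)))\<^sup>2) > 0" using neg by blast
      then show ?thesis by (simp add: k q_diff q_gram u_def[symmetric])
    qed
    obtain W :: "nat \<Rightarrow> nat \<Rightarrow> complex" where W: "\<And>i a. i \<in> I \<Longrightarrow> (\<Sum>b<n. W a b * u i b) = v i a"
      "\<And>w. (\<Sum>a<n. (cmod (\<Sum>b<n. W a b * w b))\<^sup>2) \<le> (\<Sum>b<n. (cmod (w b))\<^sup>2)"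
      using contraction_of_gram_le[OF fin \<epsilon> le] by blast
    define Y where "Y = (\<lambda>j. Matrix.mat n n (\<lambda>(i, l). \<Sum>a<n. W i a * X j $$ (a, l)))"
    have Y: "Y \<in> nc_ball Q" "Y \<in> tuples n"
      unfolding Y_def using nc_ball_contraction[of Q, OF Q X W(2)] by (auto simp: tuples_def)
    have "linear_act A I n Y v i a = v i a" if "i \<in> I" "a < n" for i a
      unfolding Y_def linear_act_left_mult[OF that(2)] using W(1)[OF that(1)] by (simp add: u_def)
    then have v0: "v i a = 0" if "i \<in> I" "a < n" for i a
      using stable_on_linearD[OF stab fin Y _ that] by blast
    then have "u i a = 0" for i a unfolding u_def by (rule linear_act_zero)
    \<comment> \<open>With \<open>v\<close> and \<open>u\<close> both zero, \<open>le\<close> at a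
      unit vector forces \<epsilon> to be at most \<open>0\<close>; a unit vector exists because
      \<open>I\<close> is nonempty.\<close>
    obtain i0 where i0: "i0 \<in> I" using ne by blast
    have "(\<Sum>i\<in>I. (cmod (delta i i0))\<^sup>2) = (\<Sum>i\<in>I. if i = i0 then 1 else 0)" by (intro sum.cong) auto
    then have "(\<Sum>i\<in>I. (cmod (delta i i0))\<^sup>2) = 1" using fin i0 by simp
    then show False using le[of "\<lambda>i. delta i i0"] \<epsilon> v0 \<open>\<And>i a. u i a = 0\<close> by simp
  qed
  obtain f T where f: "additive f" "\<And>y. f (\<lambda>i j. y i * cnj (y j)) = qform I T y"
    and T: "hermitian_on I T" "\<And>x. qform I T x \<ge> 0" "\<exists>x. qform I T x > 0"
    and f_K: "\<And>\<kappa>. \<kappa> \<in> K \<Longrightarrow> f \<kappa> \<ge> 0"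
    using psd_separation[OF fin K_add K_scale K_0 K_neg] by blast
  have f_gram: "f (gram n v) = (\<Sum>a<n. qform I T (\<lambda>i. v i a))" for n v
  proof -
    have "gram n v = (\<Sum>a<n. (\<lambda>i j. v i a * cnj (v j a)))"
      by (intro ext) (simp add: gram_def fun_sum_apply2)
    then show ?thesis by (simp add: additive.sum[OF f(1)] f(2))
  qed
  show thesis
  proof (rule that[OF T])
    fix n X v assume X: "X \<in> nc_ball Q" "X \<in> tuples n"
    have "0 \<le> f (gram n v - gram n (linear_act A I n X v))"
      using f_K[OF K_I[OF X, of v]] by (simp add: fun_diff_def)
    then show "(\<Sum>a<n. qform I T (\<lambda>i. linear_act A I n X v i a)) \<le> (\<Sum>a<n. qform I T (\<lambda>i. v i a))"
      by (simp add: additive.diff[OF f(1)] f_gram)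
  qed
qed

text \<open>The scalar matrix \<open>S\<close> acts on the index and the point acts on the size, so
  an intertwining relation between the coefficients lifts to the evaluated pencils.\<close>

lemma linear_act_conj:
  assumes "\<And>j i l. i \<in> I \<Longrightarrow> l \<in> I \<Longrightarrow> (\<Sum>k\<in>I. A' j i k * S k l) = (\<Sum>k\<in>I. S i k * A j k l)" "i \<in> I"
  shows "linear_act A' I n X (\<lambda>k b. \<Sum>l\<in>I. S k l * v l b) i a = (\<Sum>k\<in>I. S i k * linear_act A I n X v k a)"
proof -
  define y where "y j l = (\<Sum>b<n. X j $$ (a, b) * v l b)" for j l
  have alt: "linear_act B I n X u i a = (\<Sum>j\<in>UNIV. \<Sum>l\<in>I. B j i l * (\<Sum>b<n. X j $$ (a, b) * u l b))" for B u i
  proof -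
    have "linear_act B I n X u i a = (\<Sum>l\<in>I. \<Sum>j\<in>UNIV. \<Sum>b<n. B j i l * X j $$ (a, b) * u l b)"
      unfolding linear_act_def by (intro sum.cong refl sum.swap)
    also have "\<dots> = (\<Sum>j\<in>UNIV. \<Sum>l\<in>I. \<Sum>b<n. B j i l * X j $$ (a, b) * u l b)"
      by (rule sum.swap)
    finally show ?thesis by (simp only: sum_distrib_left mult.assoc)
  qed
  have yS: "(\<Sum>b<n. X j $$ (a, b) * (\<Sum>l\<in>I. S k l * v l b)) = (\<Sum>l\<in>I. S k l * y j l)" for j k
    unfolding y_def sum_distrib_left by (subst sum.swap) (simp add: mult.left_commute)
  have "linear_act A' I n X (\<lambda>k b. \<Sum>l\<in>I. S k l * v l b) i a
    = (\<Sum>j\<in>UNIV. \<Sum>k\<in>I. A' j i k * (\<Sum>l\<in>I. S k l * y j l))" by (simp only: alt yS)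
  also have "\<dots> = (\<Sum>j\<in>UNIV. \<Sum>l\<in>I. (\<Sum>k\<in>I. A' j i k * S k l) * y j l)"
    unfolding sum_distrib_left sum_distrib_right mult.assoc by (intro sum.cong refl sum.swap)
  also have "\<dots> = (\<Sum>j\<in>UNIV. \<Sum>l\<in>I. (\<Sum>k\<in>I. S i k * A j k l) * y j l)"
    using assms by simp
  also have "\<dots> = (\<Sum>j\<in>UNIV. \<Sum>k\<in>I. S i k * (\<Sum>l\<in>I. A j k l * y j l))"
    unfolding sum_distrib_left sum_distrib_right mult.assoc by (intro sum.cong refl sum.swap)
  also have "\<dots> = (\<Sum>k\<in>I. S i k * linear_act A I n X v k a)"
    unfolding alt y_def sum_distrib_left by (rule sum.swap)
  finally show ?thesis .
qed

lemma sum_mult_delta_on: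
  assumes "mutually_inverse_on I S R" "finite I" "i \<in> I"
  shows "(\<Sum>k\<in>I. S i k * (\<Sum>l\<in>I. R k l * x l)) = x i"
    and "(\<Sum>k\<in>I. (\<Sum>l\<in>I. x l * S l k) * R k i) = x i"
proof -
  have "(\<Sum>k\<in>I. S i k * (\<Sum>l\<in>I. R k l * x l)) = (\<Sum>l\<in>I. (\<Sum>k\<in>I. S i k * R k l) * x l)"
    by (simp add: sum_distrib_left sum_distrib_right mult.assoc) (rule sum.swap)
  also have "\<dots> = (\<Sum>l\<in>I. if l = i then x i else 0)"
    using mutually_inverse_onD(1)[OF assms(1,3)] by (intro sum.cong) auto
  finally show "(\<Sum>k\<in>I. S i k * (\<Sum>l\<in>I. R k l * x l)) = x i" using assms by simp
  have "(\<Sum>k\<in>I. (\<Sum>l\<in>I. x l * S l k) * R k i) = (\<Sum>l\<in>I. x l * (\<Sum>k\<in>I. S l k * R k i))"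
    by (simp add: sum_distrib_left sum_distrib_right mult.assoc) (rule sum.swap)
  also have "\<dots> = (\<Sum>l\<in>I. if l = i then x i else 0)"
    using mutually_inverse_onD(1)[OF assms(1) _ assms(3)] by (intro sum.cong) auto
  finally show "(\<Sum>k\<in>I. (\<Sum>l\<in>I. x l * S l k) * R k i) = x i" using assms by simp
qed

lemma mutually_inverse_on_sym: "mutually_inverse_on I S R \<Longrightarrow> mutually_inverse_on I R S"
  by (auto simp: mutually_inverse_on_def)

text \<open>Each round removes at least one index because the separating form is nonzero, so its
  radical misses some adapted coordinate. Stability descends to the radical because the radical is
  invariant, which is what keeps the induction going.\<close>

lemma two_sided_dense_linear:
  fixes Q :: "'d::finite \<Rightarrow> 'h::chilbert_space \<Rightarrow> 'h" and I :: "'i set"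
  assumes basis: "operator_space_basis Q" and "finite I"
    and "stable_on Q I (\<lambda>i l. delta i l - linear_poly (\<lambda>j. A j i l))"
  shows "two_sided_dense Q I (\<lambda>i l. delta i l - linear_poly (\<lambda>j. A j i l))"
  using assms(2,3)
proof (induction I arbitrary: A rule: finite_psubset_induct)
  case (psubset I)
  note fin = psubset.hyps and stab = psubset.prems
  have Q: "\<And>j. bounded_clinear_op (Q j)" using basis by (auto simp: operator_space_basis_def)
  show ?case
  proof (cases "I = {}")
    case True
    then show ?thesis by (simp add: two_sided_dense_def left_dense_def right_dense_def)
  next
    case False
    obtain T where T: "hermitian_on I T" "\<And>x. qform I T x \<ge> 0" "\<exists>x. qform I T x > 0"
      and contr: "\<And>n X v. X \<in> nc_ball Q \<Longrightarrow> X \<in> tuples n \<Longrightarrow>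
        (\<Sum>a<n. qform I T (\<lambda>i. linear_act A I n X v i a)) \<le> (\<Sum>a<n. qform I T (\<lambda>i. v i a))"
      using contractive_form_exists[of Q, OF Q fin False stab] by blast
    obtain S R d where d: "\<And>i. d i \<ge> (0::real)" and inv: "mutually_inverse_on I S R"
      and T_eq: "\<And>i j. i \<in> I \<Longrightarrow> j \<in> I \<Longrightarrow> T i j = (\<Sum>m\<in>I. of_real (d m) * cnj (S m i) * S m j)"
      using psd_ldl[OF fin T(1,2)] by blast
    note inv' = mutually_inverse_on_sym[OF inv]
    have q: "qform I T x = (\<Sum>m\<in>I. d m * (cmod (\<Sum>j\<in>I. S m j * x j))\<^sup>2)" for x
      by (rule qform_ldl) (rule T_eq)
    \<comment> \<open>These are the coefficients \<open>S A R\<close> in the coordinates in which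
      the form is diagonal with weights \<open>d\<close>.\<close>
    define A' where "A' j i l = (\<Sum>k\<in>I. S i k * (\<Sum>m\<in>I. A j k m * R m l))" for j i l
    have A'S: "(\<Sum>k\<in>I. A' j i k * S k l) = (\<Sum>k\<in>I. S i k * A j k l)" if "i \<in> I" "l \<in> I" for j i l
    proof -
      have "(\<Sum>k\<in>I. A' j i k * S k l) = (\<Sum>m\<in>I. S i m * (\<Sum>k\<in>I. (\<Sum>p\<in>I. A j m p * R p k) * S k l))"
        unfolding A'_def sum_distrib_right sum_distrib_left mult.assoc by (rule sum.swap)
      then show ?thesis by (simp only: sum_mult_delta_on(2)[OF inv' fin that(2)])
    qed
    have RA': "(\<Sum>k\<in>I. R i k * A' j k l) = (\<Sum>k\<in>I. A j i k * R k l)" if "i \<in> I" "l \<in> I" for j i l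
      unfolding A'_def using sum_mult_delta_on(1)[OF inv' fin that(1)] by simp
    define M' where "M' i l = linear_poly (\<lambda>j. A' j i l)" for i l
    have contr': "(\<Sum>a<n. \<Sum>m\<in>I. d m * (cmod (linear_act A' I n X w m a))\<^sup>2) \<le> (\<Sum>a<n. \<Sum>m\<in>I. d m * (cmod (w m a))\<^sup>2)"
      if X: "X \<in> nc_ball Q" "X \<in> tuples n" for n X w
    proof -
      define v where "v k b = (\<Sum>l\<in>I. R k l * w l b)" for k b
      have w: "(\<Sum>k\<in>I. S i k * v k b) = w i b" if "i \<in> I" for i b
        unfolding v_def by (rule sum_mult_delta_on(1)[OF inv fin that])
      have "linear_act A' I n X w m a = (\<Sum>k\<in>I. S m k * linear_act A I n X v k a)" if "m \<in> I" for m a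
      proof -
        have "linear_act A' I n X w m a = linear_act A' I n X (\<lambda>k b. \<Sum>l\<in>I. S k l * v l b) m a"
          by (rule linear_act_cong) (simp add: w)
        then show ?thesis using linear_act_conj[OF A'S that] by simp
      qed
      then have "(\<Sum>a<n. \<Sum>m\<in>I. d m * (cmod (linear_act A' I n X w m a))\<^sup>2) = (\<Sum>a<n. qform I T (\<lambda>i. linear_act A I n X v i a))"
        by (simp add: q)
      also have "\<dots> \<le> (\<Sum>a<n. qform I T (\<lambda>i. v i a))" by (rule contr[OF X])
      also have "\<dots> = (\<Sum>a<n. \<Sum>m\<in>I. d m * (cmod (w m a))\<^sup>2)" by (simp add: q w)
      finally show ?thesis .
    qed
    \<comment> \<open>In the adapted coordinates the indices of weight \<open>0\<close> span the
      radical of the form.\<close>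
    define I1 where "I1 = {i \<in> I. d i = 0}"
    define I2 where "I2 = {i \<in> I. d i > 0}"
    have I12: "I = I1 \<union> I2" "I1 \<inter> I2 = {}" using d by (auto simp: I1_def I2_def less_le)
    have fin12: "finite I1" "finite I2" using fin by (auto simp: I1_def I2_def)
    \<comment> \<open>A contraction for the form maps its radical into itself. At size
      \<open>1\<close>, a point with only the coordinate \<open>j\<close> nonzero isolates the
      coefficient \<open>A' j\<close>; the factor \<open>t\<close> brings that point into the
      ball.\<close>
    have A'0: "A' j i l = 0" if il: "i \<in> I2" "l \<in> I1" for j i l
    proof -
      define E where "E = (\<lambda>j'. Matrix.mat 1 1 (\<lambda>_. if j' = j then 1 else 0 :: complex))"
      have E: "E \<in> tuples 1" by (simp add: E_def tuples_def)
      obtain t :: real where t: "t > 0" "(\<lambda>j. complex_of_real t \<cdot>\<^sub>m E j) \<in> nc_ball Q"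
        using nc_ball_shrink[of Q, OF Q order_refl E] by blast
      have mem: "i \<in> I" "l \<in> I" and dl: "d l = 0" and di: "d i > 0"
        using il by (auto simp: I1_def I2_def)
      have E0: "E j' $$ (0, 0) = delta j' j" for j' by (simp add: E_def)
      have row: "(\<Sum>j'\<in>UNIV. A' j' i m * E j' $$ (0, 0) * delta m l) = (if m = l then A' j i l else 0)" for m
      proof -
        have "(\<Sum>j'\<in>UNIV. A' j' i m * E j' $$ (0, 0) * delta m l)
          = (\<Sum>j'\<in>UNIV. if j' = j then (if m = l then A' j i l else 0) else 0)"
          by (intro sum.cong) (auto simp: E0)
        then show ?thesis by simp
      qed
      have "linear_act A' I 1 E (\<lambda>m b. delta m l) i 0 = (\<Sum>m\<in>I. \<Sum>j'\<in>UNIV. A' j' i m * E j' $$ (0, 0) * delta m l)"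
        unfolding linear_act_def One_nat_def sum.lessThan_Suc by simp
      also have "\<dots> = A' j i l" unfolding row using fin mem by simp
      finally have act: "linear_act A' I 1 E (\<lambda>m b. delta m l) i 0 = A' j i l" .
      have act2: "linear_act A' I 1 (\<lambda>j. complex_of_real t \<cdot>\<^sub>m E j) (\<lambda>m b. delta m l) i 0 = of_real t * A' j i l"
        by (simp add: linear_act_smult[OF E] act del: One_nat_def)
      have "d i * (cmod (of_real t * A' j i l))\<^sup>2
        \<le> (\<Sum>m\<in>I. d m * (cmod (linear_act A' I 1 (\<lambda>j. complex_of_real t \<cdot>\<^sub>m E j) (\<lambda>m b. delta m l) m 0))\<^sup>2)"
        unfolding act2[symmetric]
        by (rule member_le_sum[where f = "\<lambda>m. d m * (cmod (linear_act A' I 1 (\<lambda>j. complex_of_real t \<cdot>\<^sub>m E j) (\<lambda>m b. delta m l) m 0))\<^sup>2", OF mem(1) _ fin])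
          (simp add: d)
      also have "\<dots> \<le> (\<Sum>m\<in>I. d m * (cmod (delta m l))\<^sup>2)"
        using contr'[OF t(2) tuples_smult[OF E], of "\<lambda>m b. delta m l"] by simp
      also have "\<dots> = 0" using dl by (intro sum.neutral) auto
      finally have "(cmod (of_real t * A' j i l))\<^sup>2 \<le> 0" using di by (simp add: mult_le_0_iff)
      then show ?thesis using t by simp
    qed
    have b2: "two_sided_dense Q I2 (\<lambda>i l. delta i l - M' i l)"
      unfolding M'_def
    proof (rule two_sided_dense_contractive[OF basis fin12(2)])
      show "d i > 0" if "i \<in> I2" for i using that by (simp add: I2_def)
      fix n X and v :: "'i \<Rightarrow> nat \<Rightarrow> complex"
      assume X: "X \<in> nc_ball Q" "X \<in> tuples n"
      \<comment> \<open>A vector supported in \<open>I2\<close> sees only the block on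
        \<open>I2\<close>: the columns of \<open>I1\<close> receive \<open>0\<close>, and the rows
        of \<open>I1\<close> carry weight \<open>0\<close>.\<close>
      define w where "w i b = (if i \<in> I1 then 0 else v i b)" for i b
      have act: "linear_act A' I n X w i a = linear_act A' I2 n X v i a" for i a
      proof -
        have "linear_act A' I n X w i a = linear_act A' I1 n X w i a + linear_act A' I2 n X w i a"
          unfolding I12(1) linear_act_def by (rule sum.union_disjoint[OF fin12 I12(2)])
        also have "linear_act A' I1 n X w i a = 0" by (rule linear_act_zero) (simp add: w_def)
        also have "linear_act A' I2 n X w i a = linear_act A' I2 n X v i a"
          by (rule linear_act_cong) (use I12(2) in \<open>auto simp: w_def\<close>)
        finally show ?thesis by simp
      qed
      have red: "(\<Sum>m\<in>I. d m * f m) = (\<Sum>m\<in>I2. d m * f m)" for f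
      proof -
        have "(\<Sum>m\<in>I1. d m * f m) = 0" by (simp add: I1_def)
        then show ?thesis
          using sum.union_disjoint[OF fin12 I12(2), of "\<lambda>m. d m * f m"] I12(1) by simp
      qed
      have "w m a = v m a" if "m \<in> I2" for m a using that I12(2) by (auto simp: w_def)
      then show "(\<Sum>a<n. \<Sum>i\<in>I2. d i * (cmod (linear_act A' I2 n X v i a))\<^sup>2) \<le> (\<Sum>a<n. \<Sum>i\<in>I2. d i * (cmod (v i a))\<^sup>2)"
        using contr'[OF X, of w] by (simp add: act red)
    qed
    have "I1 \<subset> I"
    proof -
      obtain x where x: "qform I T x > 0" using T(3) by blast
      have "\<exists>m\<in>I. d m \<noteq> 0"
      proof (rule ccontr)
        assume "\<not> (\<exists>m\<in>I. d m \<noteq> 0)"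
        then have "qform I T x = 0" unfolding q by (intro sum.neutral) simp
        then show False using x by simp
      qed
      then show ?thesis by (auto simp: I1_def)
    qed
    \<comment> \<open>Extended by \<open>0\<close>, a fixed vector of the radical block is a fixed
      vector of the whole transformed pencil, since the radical is invariant. The matrix
      \<open>R\<close> carries it back to the original coordinates, where stability applies.\<close>
    moreover have "stable_on Q I1 (\<lambda>i l. delta i l - linear_poly (\<lambda>j. A' j i l))"
      unfolding stable_on_def
    proof (intro allI impI ballI)
      fix n X v i a
      assume X: "X \<in> nc_ball Q" "X \<in> tuples n"
        and ker: "\<forall>i\<in>I1. \<forall>a<n. block_act (\<lambda>i l. delta i l - linear_poly (\<lambda>j. A' j i l)) I1 n X v i a = 0"
        and ia: "i \<in> I1" "a < n"
      have ker: "linear_act A' I1 n X v i a = v i a" if "i \<in> I1" "a < n" for i a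
        using ker that by (simp add: block_act_diff[OF X(2)] block_act_delta[OF X(2) _ fin12(1)] block_act_linear_poly[OF X(2)])
      define w where "w i b = (if i \<in> I1 then v i b else 0)" for i b
      have w: "linear_act A' I n X w i a = w i a" if "i \<in> I" "a < n" for i a
      proof -
        have "linear_act A' I n X w i a = linear_act A' I1 n X w i a + linear_act A' I2 n X w i a"
          unfolding I12(1) linear_act_def by (rule sum.union_disjoint[OF fin12 I12(2)])
        also have "linear_act A' I2 n X w i a = 0"
          by (rule linear_act_zero) (use I12(2) in \<open>auto simp: w_def\<close>)
        also have "linear_act A' I1 n X w i a = linear_act A' I1 n X v i a" by (rule linear_act_cong) (simp add: w_def)
        also have "linear_act A' I1 n X v i a = w i a"
        proof (cases "i \<in> I1")
          case True
          then show ?thesis using ker that by (simp add: w_def)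
        next
          case False
          then have "i \<in> I2" using that I12 by auto
          then show ?thesis using False A'0 by (simp add: linear_act_def w_def)
        qed
        finally show ?thesis by simp
      qed
      define z where "z k b = (\<Sum>l\<in>I. R k l * w l b)" for k b
      have "linear_act A I n X z k b = z k b" if kb: "k \<in> I" "b < n" for k b
      proof -
        have "z k b = (\<Sum>i\<in>I. R k i * linear_act A' I n X w i b)" using kb w by (simp add: z_def)
        also have "\<dots> = linear_act A I n X z k b"
          unfolding z_def by (rule linear_act_conj[symmetric]) (use RA' kb in auto)
        finally show ?thesis by simp
      qed
      then have z: "z k b = 0" if "k \<in> I" "b < n" for k b
        using stable_on_linearD[OF stab fin X _ that] by blast
      have "i \<in> I" using ia by (simp add: I1_def)
      have "w i a = (\<Sum>k\<in>I. S i k * z k a)"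
        unfolding z_def by (rule sum_mult_delta_on(1)[OF inv fin \<open>i \<in> I\<close>, symmetric])
      then show "v i a = 0" using z ia by (simp add: w_def)
    qed
    ultimately have b1: "two_sided_dense Q I1 (\<lambda>i l. delta i l - M' i l)"
      unfolding M'_def by (rule psubset.IH)
    have tri: "delta i l - M' i l = 0" if "i \<in> I2" "l \<in> I1" for i l
      using that I12(2) A'0[OF that] by (auto simp: M'_def linear_poly_zero)
    have b: "two_sided_dense Q I (\<lambda>i l. delta i l - M' i l)"
      unfolding I12(1) by (rule two_sided_dense_triangular[OF fin12 I12(2) tri b1 b2])
    let ?P = "\<lambda>i l. delta i l - linear_poly (\<lambda>j. A j i l)"
    have ds: "(\<Sum>j\<in>I. delta i j * f j) = f i" "(\<Sum>j\<in>I. f j * delta j i) = f i" if "i \<in> I" for f :: "'i \<Rightarrow> 'd ncpoly" and i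
    proof -
      have "(\<Sum>j\<in>I. delta i j * f j) = (\<Sum>j\<in>I. if j = i then f i else 0)"
        "(\<Sum>j\<in>I. f j * delta j i) = (\<Sum>j\<in>I. if j = i then f i else 0)" by (auto intro!: sum.cong)
      then show "(\<Sum>j\<in>I. delta i j * f j) = f i" "(\<Sum>j\<in>I. f j * delta j i) = f i" using fin that by simp_all
    qed
    have invp: "(\<Sum>j\<in>I. pconst (R i j) * pconst (S j k)) = (delta i k :: 'd ncpoly)" if "i \<in> I" "k \<in> I" for i k
      using mutually_inverse_onD(2)[OF inv that]
      by (simp only: pconst_mult[symmetric] pconst_sum[symmetric] pconst_delta)
    \<comment> \<open>The intertwining is used here as \<open>(1 - A') S = S (1 - A)\<close>, and
      for right ideals as \<open>R (1 - A') = (1 - A) R\<close>.\<close>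
    have "left_dense Q I ?P"
    proof (rule left_dense_transfer[OF basis fin])
      show "left_dense Q I (\<lambda>i l. delta i l - M' i l)" using b by (simp add: two_sided_dense_def)
      show "(\<Sum>j\<in>I. (delta i j - M' i j) * pconst (S j k)) = (\<Sum>j\<in>I. pconst (S i j) * ?P j k)"
        if "i \<in> I" "k \<in> I" for i k
        by (simp only: left_diff_distrib right_diff_distrib sum_subtractf ds[OF that(1)] ds[OF that(2)] M'_def
            linear_poly_mult_pconst pconst_mult_linear_poly linear_poly_sum A'S[OF that])
    qed (rule invp)
    moreover have "right_dense Q I ?P"
    proof (rule right_dense_transfer[OF basis fin])
      show "right_dense Q I (\<lambda>i l. delta i l - M' i l)" using b by (simp add: two_sided_dense_def)
      show "(\<Sum>j\<in>I. pconst (R i j) * (delta j k - M' j k)) = (\<Sum>j\<in>I. ?P i j * pconst (R j k))"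
        if "i \<in> I" "k \<in> I" for i k
        by (simp only: left_diff_distrib right_diff_distrib sum_subtractf ds[OF that(1)] ds[OF that(2)] M'_def
            linear_poly_mult_pconst pconst_mult_linear_poly linear_poly_sum RA'[OF that])
    qed (rule invp)
    ultimately show ?thesis by (simp add: two_sided_dense_def)
  qed
qed

section \<open>Linearisation\<close>

lemma block_act_cong_left:
  "(\<And>l. l \<in> I \<Longrightarrow> P i l = R i l) \<Longrightarrow> block_act P I n X v i a = block_act R I n X v i a"
  by (simp add: block_act_def)

lemma block_act_union:
  "finite I \<Longrightarrow> finite J \<Longrightarrow> I \<inter> J = {} \<Longrightarrow> block_act P (I \<union> J) n X v i a = block_act P I n X v i a + block_act P J n X v i a"
  unfolding block_act_def by (rule sum.union_disjoint)

lemma block_act_uminus_right: "block_act P I n X (\<lambda>l b. - v l b) i a = - block_act P I n X v i a"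
  by (simp add: block_act_def sum_negf)

text \<open>In the kernel of \<open>L\<close> the components in \<open>J\<close> are determined by
  those in \<open>I\<close> through the identity block. Substituting them leaves the kernel equation
  of \<open>P\<close>.\<close>

lemma stable_on_schur:
  assumes fin: "finite I" "finite J" and disj: "I \<inter> J = {}"
    and P: "\<And>i l. i \<in> I \<Longrightarrow> l \<in> I \<Longrightarrow> P i l = L i l - (\<Sum>m\<in>J. L i m * L m l)"
    and LJ: "\<And>i l. i \<in> J \<Longrightarrow> l \<in> J \<Longrightarrow> L i l = delta i l"
    and stab: "stable_on Q I P"
  shows "stable_on Q (I \<union> J) L"
  unfolding stable_on_def
proof (intro allI impI ballI)
  fix n X v i a
  assume X: "X \<in> nc_ball Q" "X \<in> tuples n" and i: "i \<in> I \<union> J" and a: "a < n"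
    and ker: "\<forall>i\<in>I \<union> J. \<forall>a<n. block_act L (I \<union> J) n X v i a = 0"
  note un = block_act_union[OF fin disj]
  have vJ: "v m a = - block_act L I n X v m a" if "m \<in> J" "a < n" for m a
  proof -
    have "block_act L J n X v m a = block_act (\<lambda>i l. delta i l) J n X v m a"
      by (rule block_act_cong_left) (simp add: LJ that)
    also have "\<dots> = v m a" by (rule block_act_delta[OF X(2) that(2) fin(2) that(1)])
    finally have "block_act L J n X v m a = v m a" .
    moreover have "block_act L (I \<union> J) n X v m a = 0" using ker that by blast
    ultimately have "block_act L I n X v m a + v m a = 0" by (simp add: un)
    then show ?thesis by (simp add: eq_neg_iff_add_eq_0 add.commute)
  qed
  have "block_act P I n X v i a = 0" if "i \<in> I" "a < n" for i a
  proof -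
    have "block_act P I n X v i a = block_act (\<lambda>i l. L i l - (\<Sum>m\<in>J. L i m * L m l)) I n X v i a"
      by (rule block_act_cong_left) (simp add: P that)
    also have "\<dots> = block_act L I n X v i a - block_act L J n X (block_act L I n X v) i a"
      by (simp add: block_act_diff[OF X(2) that(2)] block_act_mult[OF X(2) that(2)])
    also have "block_act L J n X (block_act L I n X v) i a = block_act L J n X (\<lambda>m b. - v m b) i a"
      by (rule block_act_cong) (simp add: vJ)
    also have "block_act L I n X v i a - \<dots> = block_act L (I \<union> J) n X v i a" by (simp add: block_act_uminus_right un)
    finally show ?thesis using ker that by simp
  qed
  then have vI: "v i a = 0" if "i \<in> I" "a < n" for i a
    using stable_onD[OF stab X _ that] by blast
  show "v i a = 0"
  proof (cases "i \<in> I")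
    case False
    then have "v i a = - block_act L I n X v i a" using vJ i a by auto
    also have "\<dots> = 0" using vI by (simp add: block_act_def)
    finally show ?thesis .
  qed (use vI a in auto)
qed

lemma linear_poly_uminus: "linear_poly (\<lambda>j. - c j) = - linear_poly c"
  using pconst_mult_linear_poly[of "- 1" c] by (simp add: pconst_def single_uminus pconst_one[unfolded pconst_def])

text \<open>Stability at the origin of size \<open>1\<close> makes the constant term
  \<open>A0\<close> invertible; multiplying by its inverse on the left normalises the constant term
  to the identity.\<close>

lemma two_sided_dense_affine:
  fixes Q :: "'d::finite \<Rightarrow> 'h::chilbert_space \<Rightarrow> 'h" and I :: "'i set"
  assumes basis: "operator_space_basis Q" and fin: "finite I"
    and P_eq: "\<And>i l. i \<in> I \<Longrightarrow> l \<in> I \<Longrightarrow> P i l = pconst (A0 i l) + linear_poly (\<lambda>j. A j i l)"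
    and stab: "stable_on Q I P"
  shows "two_sided_dense Q I P"
proof -
  have Q: "\<And>j. bounded_clinear_op (Q j)" using basis by (auto simp: operator_space_basis_def)
  define Z where "Z = (\<lambda>_ :: 'd. 0\<^sub>m 1 1 :: complex mat)"
  have Z: "Z \<in> tuples 1" by (simp add: Z_def tuples_def)
  have Z_ball: "Z \<in> nc_ball Q"
  proof -
    obtain t :: real where "(\<lambda>j. complex_of_real t \<cdot>\<^sub>m Z j) \<in> nc_ball Q"
      using nc_ball_shrink[of Q, OF Q order_refl Z] by blast
    moreover have "(\<lambda>j. complex_of_real t \<cdot>\<^sub>m Z j) = Z" by (auto simp: Z_def)
    ultimately show ?thesis by simp
  qed
  have "\<forall>i\<in>I. x i = 0" if x: "\<And>i. i \<in> I \<Longrightarrow> (\<Sum>l\<in>I. A0 i l * x l) = 0" for x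
  proof
    fix i assume i: "i \<in> I"
    show "x i = 0"
    proof (rule stable_onD[OF stab Z_ball Z, of "\<lambda>l b. x l" i 0])
      fix i a assume ia: "i \<in> I" "a < (1::nat)"
      have "block_act P I 1 Z (\<lambda>l b. x l) i a = block_act (\<lambda>i l. pconst (A0 i l)) I 1 Z (\<lambda>l b. x l) i a"
        unfolding block_act_def
      proof (intro sum.cong refl)
        fix l and b :: nat assume lb: "l \<in> I" "b \<in> {..<1}"
        have "poly_value (linear_poly (\<lambda>j. A j i l)) Z $$ (a, b) = 0"
          using poly_value_linear_poly[OF Z ia(2), of b] lb ia by (simp add: Z_def)
        then show "poly_value (P i l) Z $$ (a, b) * x l = poly_value (pconst (A0 i l)) Z $$ (a, b) * x l"
          using poly_value_add[OF Z ia(2), of b] lb ia by (simp add: P_eq)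
      qed
      also have "\<dots> = 0" using block_act_pconst[OF Z ia(2), of A0 I "\<lambda>l b. x l" i] x[OF ia(1)] by simp
      finally show "block_act P I 1 Z (\<lambda>l b. x l) i a = 0" .
    qed (use i in auto)
  qed
  then obtain B where inv: "mutually_inverse_on I A0 B" using ex_inverse_on[OF fin] by blast
  define A' where "A' j i l = - (\<Sum>k\<in>I. B i k * A j k l)" for j i l
  define P' where "P' i l = delta i l - linear_poly (\<lambda>j. A' j i l)" for i l
  have BP: "P' i l = (\<Sum>k\<in>I. pconst (B i k) * P k l)" if "i \<in> I" "l \<in> I" for i l
  proof -
    have "(\<Sum>k\<in>I. pconst (B i k) * P k l) = pconst (\<Sum>k\<in>I. B i k * A0 k l) + linear_poly (\<lambda>j. \<Sum>k\<in>I. B i k * A j k l)"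
      using that by (simp add: P_eq distrib_left sum.distrib pconst_mult_linear_poly linear_poly_sum pconst_sum pconst_mult)
    also have "\<dots> = P' i l"
      by (simp only: mutually_inverse_onD(2)[OF inv that] P'_def A'_def linear_poly_uminus pconst_delta diff_minus_eq_add)
    finally show ?thesis by simp
  qed
  have "stable_on Q I P'"
    unfolding stable_on_def
  proof (intro allI impI ballI)
    fix n X v i a
    assume X: "X \<in> nc_ball Q" "X \<in> tuples n" and i: "i \<in> I" and a: "a < n"
      and ker: "\<forall>i\<in>I. \<forall>a<n. block_act P' I n X v i a = 0"
    have B0: "(\<Sum>k\<in>I. B i k * block_act P I n X v k a) = 0" if "i \<in> I" "a < n" for i a
    proof -
      have "0 = block_act P' I n X v i a" using ker that by simp
      also have "\<dots> = block_act (\<lambda>i l. \<Sum>k\<in>I. pconst (B i k) * P k l) I n X v i a"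
        by (rule block_act_cong_left) (simp add: BP that)
      also have "\<dots> = (\<Sum>k\<in>I. B i k * block_act P I n X v k a)"
        by (simp add: block_act_mult[OF X(2) that(2)] block_act_pconst[OF X(2) that(2)])
      finally show ?thesis by simp
    qed
    have "block_act P I n X v i a = 0" if "i \<in> I" "a < n" for i a
    proof -
      have "block_act P I n X v i a = (\<Sum>k\<in>I. A0 i k * (\<Sum>l\<in>I. B k l * block_act P I n X v l a))"
        by (rule sum_mult_delta_on(1)[OF inv fin that(1), symmetric])
      then show ?thesis using B0 that by simp
    qed
    then show "v i a = 0" using stable_onD[OF stab X _ i a] by blast
  qed
  then have b: "two_sided_dense Q I P'"
    unfolding P'_def by (rule two_sided_dense_linear[OF basis fin])
  have ds: "(\<Sum>j\<in>I. delta i j * f j) = f i" "(\<Sum>j\<in>I. f j * delta j i) = f i" if "i \<in> I" for f :: "'i \<Rightarrow> 'd ncpoly" and i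
  proof -
    have "(\<Sum>j\<in>I. delta i j * f j) = (\<Sum>j\<in>I. if j = i then f i else 0)"
      "(\<Sum>j\<in>I. f j * delta j i) = (\<Sum>j\<in>I. if j = i then f i else 0)" by (auto intro!: sum.cong)
    then show "(\<Sum>j\<in>I. delta i j * f j) = f i" "(\<Sum>j\<in>I. f j * delta j i) = f i" using fin that by simp_all
  qed
  have invp: "(\<Sum>j\<in>I. pconst (A0 i j) * pconst (B j k)) = (delta i k :: 'd ncpoly)" if "i \<in> I" "k \<in> I" for i k
    using mutually_inverse_onD(1)[OF inv that]
    by (simp only: pconst_mult[symmetric] pconst_sum[symmetric] pconst_delta)
  \<comment> \<open>For left ideals \<open>P' = B P\<close> is used directly. For right ideals the
    relation is \<open>A0 P' = P\<close>, with \<open>B\<close> as the right inverse of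
    \<open>A0\<close>.\<close>
  have "left_dense Q I P"
  proof (rule left_dense_transfer[OF basis fin, where P' = P' and U = delta and U' = delta and V = "\<lambda>i j. pconst (B i j)"])
    show "left_dense Q I P'" using b by (simp add: two_sided_dense_def)
  qed (simp_all only: ds BP)
  moreover have "right_dense Q I P"
  proof (rule right_dense_transfer[OF basis fin, where P' = P' and U = "\<lambda>i j. pconst (A0 i j)"
        and U' = "\<lambda>i j. pconst (B i j)" and V = delta])
    show "right_dense Q I P'" using b by (simp add: two_sided_dense_def)
    show "(\<Sum>j\<in>I. pconst (A0 i j) * P' j k) = (\<Sum>j\<in>I. P i j * delta j k)" if "i \<in> I" "k \<in> I" for i k
    proof -
      have "(\<Sum>j\<in>I. pconst (A0 i j) * P' j k) = (\<Sum>j\<in>I. pconst (A0 i j) * (\<Sum>l\<in>I. pconst (B j l) * P l k))"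
        using that by (simp add: BP)
      also have "\<dots> = (\<Sum>l\<in>I. (\<Sum>j\<in>I. pconst (A0 i j) * pconst (B j l)) * P l k)"
        by (simp add: sum_distrib_left sum_distrib_right mult.assoc) (rule sum.swap)
      also have "\<dots> = (\<Sum>l\<in>I. delta i l * P l k)" using that by (simp only: invp cong: sum.cong)
      also have "\<dots> = (\<Sum>j\<in>I. P i j * delta j k)" by (simp only: ds that)
      finally show ?thesis .
    qed
  qed (rule invp)
  ultimately show ?thesis by (simp add: two_sided_dense_def)
qed

section \<open>Lowering the degree to one\<close>

definition deg_le :: "nat \<Rightarrow> 'd ncpoly \<Rightarrow> bool" where
  "deg_le D p \<longleftrightarrow> (\<forall>w\<in>Poly_Mapping.keys p. length w \<le> D)"

text \<open>Noncommutative division by the variable \<open>j\<close> on the right; together with the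
  constant term, these quotients rebuild the polynomial in \<open>ncpoly_decomp\<close>.\<close>

definition right_part :: "'d \<Rightarrow> 'd ncpoly \<Rightarrow> 'd ncpoly" where
  "right_part j p = (\<Sum>w\<in>{w \<in> Poly_Mapping.keys p - {[]}. last w = j}.
     Poly_Mapping.single (butlast w) (Poly_Mapping.lookup p w))"

lemma ncpoly_decomp:
  fixes p :: "'d::finite ncpoly"
  shows "p = pconst (Poly_Mapping.lookup p []) + (\<Sum>j\<in>UNIV. right_part j p * pvar j)"
proof -
  let ?K = "Poly_Mapping.keys p" and ?s = "\<lambda>w. Poly_Mapping.single w (Poly_Mapping.lookup p w)"
  have "right_part j p * pvar j = (\<Sum>w\<in>{w \<in> ?K - {[]}. last w = j}. ?s w)" for j
    unfolding right_part_def sum_distrib_right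
    by (intro sum.cong refl) (auto simp: pvar_def mult_single plus_list_def)
  then have "(\<Sum>j\<in>UNIV. right_part j p * pvar j) = (\<Sum>j\<in>UNIV. \<Sum>w\<in>{w \<in> ?K - {[]}. last w = j}. ?s w)" by simp
  also have "\<dots> = (\<Sum>w\<in>?K - {[]}. ?s w)" by (rule sum.group) auto
  finally have eq: "(\<Sum>j\<in>UNIV. right_part j p * pvar j) = (\<Sum>w\<in>?K - {[]}. ?s w)" .
  show ?thesis
  proof (cases "[] \<in> ?K")
    case True
    have "p = ?s [] + (\<Sum>w\<in>?K - {[]}. ?s w)"
      using ncpoly_sum_single[of p] sum.remove[OF finite_keys True, of ?s] by simp
    then show ?thesis by (simp add: eq pconst_def)
  next
    case False
    then have "Poly_Mapping.lookup p [] = 0" by (simp add: in_keys_iff)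
    moreover have "?K - {[]} = ?K" using False by simp
    ultimately show ?thesis using ncpoly_sum_single[of p] by (simp add: eq pconst_zero)
  qed
qed

lemma deg_le_right_part: "deg_le (Suc D) p \<Longrightarrow> deg_le D (right_part j p)"
  unfolding deg_le_def right_part_def
proof
  fix w
  assume le: "\<forall>w\<in>Poly_Mapping.keys p. length w \<le> Suc D"
    and "w \<in> Poly_Mapping.keys (\<Sum>w\<in>{w \<in> Poly_Mapping.keys p - {[]}. last w = j}.
     Poly_Mapping.single (butlast w) (Poly_Mapping.lookup p w))"
  then obtain u where "u \<in> Poly_Mapping.keys p" "w \<in> Poly_Mapping.keys (Poly_Mapping.single (butlast u) (Poly_Mapping.lookup p u))"
    using keys_sum[of "\<lambda>w. Poly_Mapping.single (butlast w) (Poly_Mapping.lookup p w)"] by blast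
  then have "w = butlast u" "length u \<le> Suc D" using le by (auto split: if_splits)
  then show "length w \<le> D" by simp
qed

lemma deg_le_0: "deg_le 0 p \<Longrightarrow> p = pconst (Poly_Mapping.lookup p [])"
proof (rule poly_mapping_eqI)
  fix w
  assume "deg_le 0 p"
  then have "w \<notin> Poly_Mapping.keys p" if "w \<noteq> []" using that by (auto simp: deg_le_def)
  then show "Poly_Mapping.lookup p w = Poly_Mapping.lookup (pconst (Poly_Mapping.lookup p [])) w"
    by (cases "w = []") (simp_all add: pconst_def lookup_single in_keys_iff)
qed

lemma deg_le_exists: "\<exists>D. deg_le D p"
  unfolding deg_le_def by (rule exI[of _ "Max (length ` Poly_Mapping.keys p)"]) simp

lemma deg_le_mono: "deg_le D p \<Longrightarrow> D \<le> E \<Longrightarrow> deg_le E p"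
  by (auto simp: deg_le_def)

lemma deg_le_pconst: "deg_le D (pconst c)"
  by (auto simp: deg_le_def pconst_def split: if_splits)

lemma deg_le_zero: "deg_le D 0"
  by (simp add: deg_le_def)

lemma deg_le_delta: "deg_le D (delta i l)"
  unfolding pconst_delta[symmetric] by (rule deg_le_pconst)

lemma deg_le_pvar: "deg_le (Suc D) (- pvar j)"
  by (auto simp: deg_le_def pvar_def in_keys_iff lookup_single when_def split: if_splits)

text \<open>Splitting off the last letter of every word exhibits \<open>P\<close> as a Schur
  complement of a larger matrix with lower degrees. The degree bound is \<open>Suc D\<close> because
  the new entries \<open>- pvar j\<close> never drop below degree one; the affine case is therefore
  the base.\<close>

lemma two_sided_dense_of_stable_deg:
  fixes Q :: "'d::finite \<Rightarrow> 'h::chilbert_space \<Rightarrow> 'h" and I :: "nat set"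
  assumes basis: "operator_space_basis Q"
  shows "finite I \<Longrightarrow> (\<And>i l. i \<in> I \<Longrightarrow> l \<in> I \<Longrightarrow> deg_le (Suc D) (P i l)) \<Longrightarrow> stable_on Q I P \<Longrightarrow> two_sided_dense Q I P"
proof (induction D arbitrary: I P)
  case 0
  show ?case
  proof (rule two_sided_dense_affine[OF basis 0(1) _ 0(3)])
    fix i l assume "i \<in> I" "l \<in> I"
    then have "right_part j (P i l) = pconst (Poly_Mapping.lookup (right_part j (P i l)) [])" for j
      by (rule deg_le_0[OF deg_le_right_part[OF 0(2)]])
    then have "(\<Sum>j\<in>UNIV. right_part j (P i l) * pvar j) = linear_poly (\<lambda>j. Poly_Mapping.lookup (right_part j (P i l)) [])"
      unfolding linear_poly_def by (intro sum.cong refl arg_cong2[of _ _ _ _ "(*)"])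
    then show "P i l = pconst (Poly_Mapping.lookup (P i l) []) + linear_poly (\<lambda>j. Poly_Mapping.lookup (right_part j (P i l)) [])"
      using ncpoly_decomp[of "P i l"] by metis
  qed
next
  case (Suc D)
  note fin = Suc.prems(1)
  obtain h :: "'d \<times> nat \<Rightarrow> nat" where h: "inj_on h (UNIV \<times> I)"
    using ex_bij_betw_finite_nat[of "UNIV \<times> I :: ('d \<times> nat) set"] fin by (auto simp: bij_betw_def)
  \<comment> \<open>The new indices, one for each variable and old index, are placed above all old
    ones so that the induction stays within the naturals. Inserting \<open>0\<close> covers an empty
    \<open>I\<close>.\<close>
  define e where "e x = h x + Suc (Max (insert 0 I))" for x
  have inj: "inj_on e (UNIV \<times> I)" using h by (auto simp: inj_on_def e_def)
  have e_notin: "e x \<notin> I" for x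
  proof
    assume "e x \<in> I"
    then have "e x \<le> Max (insert 0 I)" using fin by (intro Max_ge) auto
    then show False by (simp add: e_def)
  qed
  define J where "J = e ` (UNIV \<times> I)"
  have J: "finite J" "I \<inter> J = {}" using fin e_notin by (auto simp: J_def)
  define g where "g = the_inv_into (UNIV \<times> I) e"
  have g: "g (e x) = x" if "x \<in> UNIV \<times> I" for x
    unfolding g_def by (rule the_inv_into_f_f[OF inj that])
  \<comment> \<open>Rows in \<open>I\<close> hold constant terms and right quotients, rows in
    \<open>J\<close> hold negated variables and the identity. The minus sign makes the Schur
    complement reproduce the decomposition of \<open>P i l\<close>.\<close>
  define L where "L i l = (if i \<in> I
      then if l \<in> I then pconst (Poly_Mapping.lookup (P i l) []) else right_part (fst (g l)) (P i (snd (g l)))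
      else if l \<in> I then if snd (g i) = l then - pvar (fst (g i)) else 0 else delta i l)" for i l
  have schur: "P i l = L i l - (\<Sum>m\<in>J. L i m * L m l)" if "i \<in> I" "l \<in> I" for i l
  proof -
    have "(\<Sum>m\<in>J. L i m * L m l) = (\<Sum>x\<in>UNIV \<times> I. L i (e x) * L (e x) l)"
      unfolding J_def by (rule sum.reindex_cong[OF inj]) auto
    also have "\<dots> = (\<Sum>x\<in>UNIV \<times> I. right_part (fst x) (P i (snd x)) * (if snd x = l then - pvar (fst x) else 0))"
      using that e_notin g by (intro sum.cong refl) (simp add: L_def)
    also have "\<dots> = (\<Sum>j\<in>UNIV. \<Sum>k\<in>I. right_part j (P i k) * (if k = l then - pvar j else 0))"
      by (simp only: sum.cartesian_product case_prod_unfold)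
    also have "\<dots> = (\<Sum>j\<in>UNIV. \<Sum>k\<in>I. if k = l then - (right_part j (P i l) * pvar j) else 0)"
      by (intro sum.cong refl) auto
    also have "\<dots> = - (\<Sum>j\<in>UNIV. right_part j (P i l) * pvar j)" using fin that by (simp add: sum_negf)
    finally show ?thesis using ncpoly_decomp[of "P i l"] that by (simp add: L_def)
  qed
  have LJ: "L i l = delta i l" if "i \<in> J" "l \<in> J" for i l
    using that J(2) by (auto simp: L_def)
  have "two_sided_dense Q (I \<union> J) L"
  proof (rule Suc.IH)
    show "finite (I \<union> J)" using fin J by simp
    show "stable_on Q (I \<union> J) L"
      by (rule stable_on_schur[OF fin J schur LJ Suc.prems(3)])
    fix i l assume "i \<in> I \<union> J" "l \<in> I \<union> J"
    have "snd (g l) \<in> I" if "l \<in> J" for l using that g by (auto simp: J_def)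
    then have "deg_le (Suc D) (right_part (fst (g l)) (P i (snd (g l))))" if "i \<in> I" "l \<in> J" for i l
      using deg_le_right_part[OF Suc.prems(2)] that by simp
    then show "deg_le (Suc D) (L i l)"
      using \<open>i \<in> I \<union> J\<close> \<open>l \<in> I \<union> J\<close> 
      by (auto simp: L_def deg_le_pconst deg_le_delta deg_le_pvar deg_le_zero split del: if_split split: if_splits)
  qed
  then show ?case using two_sided_dense_schur[OF basis fin J schur LJ] by blast
qed

lemma two_sided_dense_of_stable:
  fixes Q :: "'d::finite \<Rightarrow> 'h::chilbert_space \<Rightarrow> 'h" and I :: "nat set"
  assumes basis: "operator_space_basis Q" and fin: "finite I" and "stable_on Q I P"
  shows "two_sided_dense Q I P"
proof -
  define D where "D i l = (SOME D. deg_le D (P i l))" for i l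
  have D: "deg_le (D i l) (P i l)" for i l unfolding D_def by (rule someI_ex[OF deg_le_exists])
  define E where "E = (\<Sum>i\<in>I. \<Sum>l\<in>I. D i l)"
  have "D i l \<le> E" if "i \<in> I" "l \<in> I" for i l
  proof -
    have "D i l \<le> (\<Sum>l\<in>I. D i l)" using fin that by (intro member_le_sum) auto
    also have "\<dots> \<le> E" unfolding E_def using fin that by (intro member_le_sum) auto
    finally show ?thesis .
  qed
  then have "deg_le (Suc E) (P i l)" if "i \<in> I" "l \<in> I" for i l
    using D deg_le_mono that by (meson le_SucI)
  then show ?thesis using two_sided_dense_of_stable_deg[OF basis fin] assms(3) by blast
qed

section \<open>The algebra of bounded NC functions\<close>

lemma mat_dsum_mult:
  assumes A: "A \<in> carrier_mat n n" "A' \<in> carrier_mat n n" and B: "B \<in> carrier_mat m m" "B' \<in> carrier_mat m m"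
  shows "(A \<oplus>\<^sub>M B) * (A' \<oplus>\<^sub>M B') = (A * A') \<oplus>\<^sub>M (B * B')"
proof (rule eq_matI)
  note c = mat_dsum_carrier[OF A(1) B(1)] mat_dsum_carrier[OF A(2) B(2)]
    mat_dsum_carrier[OF mult_carrier_mat[OF A] mult_carrier_mat[OF B]]
  show "dim_row ((A \<oplus>\<^sub>M B) * (A' \<oplus>\<^sub>M B')) = dim_row ((A * A') \<oplus>\<^sub>M (B * B'))"
    "dim_col ((A \<oplus>\<^sub>M B) * (A' \<oplus>\<^sub>M B')) = dim_col ((A * A') \<oplus>\<^sub>M (B * B'))"
    using c carrier_matD by auto
  fix a b assume "a < dim_row ((A * A') \<oplus>\<^sub>M (B * B'))" "b < dim_col ((A * A') \<oplus>\<^sub>M (B * B'))"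
  then have ab: "a < n + m" "b < n + m" using c(3) by auto
  show "((A \<oplus>\<^sub>M B) * (A' \<oplus>\<^sub>M B')) $$ (a, b) = ((A * A') \<oplus>\<^sub>M (B * B')) $$ (a, b)"
  proof -
    have "((A \<oplus>\<^sub>M B) * (A' \<oplus>\<^sub>M B')) $$ (a, b)
      = (\<Sum>c<n. (A \<oplus>\<^sub>M B) $$ (a, c) * (A' \<oplus>\<^sub>M B') $$ (c, b))
        + (\<Sum>c<m. (A \<oplus>\<^sub>M B) $$ (a, n + c) * (A' \<oplus>\<^sub>M B') $$ (n + c, b))"
      unfolding mat_mult_entry[OF c(1,2) ab] sum_lessThan_add ..
    also have "\<dots> = ((A * A') \<oplus>\<^sub>M (B * B')) $$ (a, b)"
    proof (cases "a < n"; cases "b < n")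
      assume *: "a < n" "b < n"
      then show ?thesis using ab
        by (simp add: mat_dsum_entry[OF A(1) B(1)] mat_dsum_entry[OF A(2) B(2)]
          mat_dsum_entry[OF mult_carrier_mat[OF A] mult_carrier_mat[OF B]] mat_mult_entry[OF A] del: index_mult_mat)
    next
      assume *: "a < n" "\<not> b < n"
      then show ?thesis using ab
        by (simp add: mat_dsum_entry[OF A(1) B(1)] mat_dsum_entry[OF A(2) B(2)]
          mat_dsum_entry[OF mult_carrier_mat[OF A] mult_carrier_mat[OF B]])
    next
      assume *: "\<not> a < n" "b < n"
      then show ?thesis using ab
        by (simp add: mat_dsum_entry[OF A(1) B(1)] mat_dsum_entry[OF A(2) B(2)]
          mat_dsum_entry[OF mult_carrier_mat[OF A] mult_carrier_mat[OF B]])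
    next
      assume *: "\<not> a < n" "\<not> b < n"
      then have "a - n < m" "b - n < m" using ab by auto
      then show ?thesis using ab *
        by (simp add: mat_dsum_entry[OF A(1) B(1)] mat_dsum_entry[OF A(2) B(2)]
          mat_dsum_entry[OF mult_carrier_mat[OF A] mult_carrier_mat[OF B]] mat_mult_entry[OF B] del: index_mult_mat)
    qed
    finally show ?thesis .
  qed
qed

lemma word_value_dsum:
  assumes X: "X \<in> tuples n" and Y: "Y \<in> tuples m"
  shows "word_value w (\<lambda>j. X j \<oplus>\<^sub>M Y j) = word_value w X \<oplus>\<^sub>M word_value w Y"
proof (induction w)
  case Nil
  show ?case
    unfolding word_value_Nil[OF X] word_value_Nil[OF Y] word_value_Nil[OF tuples_dsum[OF X Y]]
    by (rule eq_matI) (auto simp: mat_dsum_entry[of _ n _ m] mat_dsum_def)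
next
  case (Cons j w)
  then show ?case
    by (simp add: word_value_Cons mat_dsum_mult[OF tuplesD[OF X] word_value_carrier[OF X] tuplesD[OF Y] word_value_carrier[OF Y]])
qed

lemma poly_value_eq_sum:
  assumes "X \<in> tuples n" "a < n" "b < n"
  shows "poly_value p X $$ (a, b) = (\<Sum>w\<in>Poly_Mapping.keys p. Poly_Mapping.lookup p w * word_value w X $$ (a, b))"
  by (rule poly_value_entry[OF assms]) auto

lemma poly_value_dsum:
  assumes X: "X \<in> tuples n" and Y: "Y \<in> tuples m"
  shows "poly_value p (\<lambda>j. X j \<oplus>\<^sub>M Y j) = poly_value p X \<oplus>\<^sub>M poly_value p Y"
proof (rule eq_matI)
  note c = poly_value_carrier[OF tuples_dsum[OF X Y], of p]
    mat_dsum_carrier[OF poly_value_carrier[OF X] poly_value_carrier[OF Y], of p p]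
  show "dim_row (poly_value p (\<lambda>j. X j \<oplus>\<^sub>M Y j)) = dim_row (poly_value p X \<oplus>\<^sub>M poly_value p Y)"
    "dim_col (poly_value p (\<lambda>j. X j \<oplus>\<^sub>M Y j)) = dim_col (poly_value p X \<oplus>\<^sub>M poly_value p Y)"
    using c by auto
  fix a b assume "a < dim_row (poly_value p X \<oplus>\<^sub>M poly_value p Y)" "b < dim_col (poly_value p X \<oplus>\<^sub>M poly_value p Y)"
  then have ab: "a < n + m" "b < n + m" using c(2) by auto
  show "poly_value p (\<lambda>j. X j \<oplus>\<^sub>M Y j) $$ (a, b) = (poly_value p X \<oplus>\<^sub>M poly_value p Y) $$ (a, b)"
    unfolding poly_value_eq_sum[OF tuples_dsum[OF X Y] ab] word_value_dsum[OF X Y]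
      mat_dsum_entry[OF poly_value_carrier[OF X] poly_value_carrier[OF Y] ab]
      mat_dsum_entry[OF word_value_carrier[OF X] word_value_carrier[OF Y] ab]
    using ab by (auto simp: poly_value_eq_sum[OF X] poly_value_eq_sum[OF Y])
qed

lemma tuples_conj:
  assumes "X \<in> tuples n" "S \<in> carrier_mat n n" "T \<in> carrier_mat n n"
  shows "(\<lambda>j. T * X j * S) \<in> tuples n"
  using assms by (auto simp: tuples_def intro!: mult_carrier_mat)

lemma conj_mult:
  fixes S T A B :: "complex mat"
  assumes S: "S \<in> carrier_mat n n" and T: "T \<in> carrier_mat n n" and ST: "S * T = 1\<^sub>m n"
    and A: "A \<in> carrier_mat n n" and B: "B \<in> carrier_mat n n"
  shows "(T * A * S) * (T * B * S) = T * (A * B) * S"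
proof -
  have TA: "T * A \<in> carrier_mat n n" and TB: "T * B \<in> carrier_mat n n" and BS: "B * S \<in> carrier_mat n n"
    and TAS: "T * A * S \<in> carrier_mat n n" using S T A B by auto
  have "(T * A * S) * (T * B * S) = (T * A * S) * (T * (B * S))"
    by (simp only: assoc_mult_mat[OF T B S])
  also have "\<dots> = ((T * A * S) * T) * (B * S)" by (rule assoc_mult_mat[OF TAS T BS, symmetric])
  also have "(T * A * S) * T = (T * A) * (S * T)" by (rule assoc_mult_mat[OF TA S T])
  also have "(T * A) * (S * T) = T * A" unfolding ST by (rule right_mult_one_mat[OF TA])
  also have "T * A * (B * S) = (T * A * B) * S" by (rule assoc_mult_mat[OF TA B S, symmetric])
  also have "T * A * B = T * (A * B)" by (rule assoc_mult_mat[OF T A B])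
  finally show ?thesis .
qed

lemma word_value_conj:
  assumes X: "X \<in> tuples n" and S: "S \<in> carrier_mat n n" and T: "T \<in> carrier_mat n n"
    and ST: "S * T = 1\<^sub>m n" "T * S = 1\<^sub>m n"
  shows "word_value w (\<lambda>j. T * X j * S) = T * word_value w X * S"
proof (induction w)
  case Nil
  show ?case using S T ST by (simp add: word_value_Nil[OF X] word_value_Nil[OF tuples_conj[OF X S T]])
next
  case (Cons j w)
  then show ?case by (simp add: word_value_Cons conj_mult[OF S T ST(1) tuplesD[OF X] word_value_carrier[OF X]])
qed

lemma conj_entry:
  fixes S T A :: "complex mat"
  assumes "S \<in> carrier_mat n n" "T \<in> carrier_mat n n" "A \<in> carrier_mat n n" "a < n" "b < n"
  shows "(T * A * S) $$ (a, b) = (\<Sum>d<n. \<Sum>c<n. T $$ (a, c) * A $$ (c, d) * S $$ (d, b))"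
proof -
  have TA: "T * A \<in> carrier_mat n n" using assms by auto
  have "(T * A) $$ (a, d) * S $$ (d, b) = (\<Sum>c<n. T $$ (a, c) * A $$ (c, d) * S $$ (d, b))" if "d < n" for d
    unfolding mat_mult_entry[OF assms(2,3,4) that] by (rule sum_distrib_right)
  then show ?thesis unfolding mat_mult_entry[OF TA assms(1,4,5)] by simp
qed

lemma poly_value_conj:
  assumes X: "X \<in> tuples n" and S: "S \<in> carrier_mat n n" and T: "T \<in> carrier_mat n n"
    and ST: "S * T = 1\<^sub>m n" "T * S = 1\<^sub>m n"
  shows "poly_value p (\<lambda>j. T * X j * S) = T * poly_value p X * S"
proof (rule eq_matI)
  have c: "T * poly_value p X * S \<in> carrier_mat n n" using S T poly_value_carrier[OF X] by auto
  have c': "poly_value p (\<lambda>j. T * X j * S) \<in> carrier_mat n n" by (rule poly_value_carrier[OF tuples_conj[OF X S T]])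
  show "dim_row (poly_value p (\<lambda>j. T * X j * S)) = dim_row (T * poly_value p X * S)"
    "dim_col (poly_value p (\<lambda>j. T * X j * S)) = dim_col (T * poly_value p X * S)"
    using c c' by auto
  fix a b assume "a < dim_row (T * poly_value p X * S)" "b < dim_col (T * poly_value p X * S)"
  then have ab: "a < n" "b < n" using c by auto
  let ?K = "Poly_Mapping.keys p" and ?l = "Poly_Mapping.lookup p"
  have "poly_value p (\<lambda>j. T * X j * S) $$ (a, b)
    = (\<Sum>w\<in>?K. \<Sum>d<n. \<Sum>c<n. T $$ (a, c) * (?l w * word_value w X $$ (c, d)) * S $$ (d, b))"
    unfolding poly_value_eq_sum[OF tuples_conj[OF X S T] ab] word_value_conj[OF X S T ST]
      conj_entry[OF S T word_value_carrier[OF X] ab] by (simp add: sum_distrib_left mult_ac)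
  also have "\<dots> = (\<Sum>d<n. \<Sum>w\<in>?K. \<Sum>c<n. T $$ (a, c) * (?l w * word_value w X $$ (c, d)) * S $$ (d, b))"
    by (rule sum.swap)
  also have "\<dots> = (\<Sum>d<n. \<Sum>c<n. \<Sum>w\<in>?K. T $$ (a, c) * (?l w * word_value w X $$ (c, d)) * S $$ (d, b))"
    by (intro sum.cong refl sum.swap)
  also have "\<dots> = (T * poly_value p X * S) $$ (a, b)"
    unfolding conj_entry[OF S T poly_value_carrier[OF X] ab]
    by (intro sum.cong refl) (simp add: poly_value_eq_sum[OF X] sum_distrib_left sum_distrib_right mult_ac)
  finally show "poly_value p (\<lambda>j. T * X j * S) $$ (a, b) = (T * poly_value p X * S) $$ (a, b)" .
qed

section \<open>The algebra operations on bounded NC functions\<close>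

lemma HinfD:
  assumes "F \<in> Hinf Q"
  shows "F \<in> extensional (nc_ball Q)"
    and "\<And>n X. X \<in> nc_ball Q \<Longrightarrow> X \<in> tuples n \<Longrightarrow> F X \<in> carrier_mat n n"
    and "\<And>X Y. X \<in> nc_ball Q \<Longrightarrow> Y \<in> nc_ball Q \<Longrightarrow> F (\<lambda>j. X j \<oplus>\<^sub>M Y j) = F X \<oplus>\<^sub>M F Y"
    and "\<And>n X S T. X \<in> nc_ball Q \<Longrightarrow> X \<in> tuples n \<Longrightarrow> S \<in> carrier_mat n n \<Longrightarrow> T \<in> carrier_mat n n \<Longrightarrow>
      inverts_mat S T \<Longrightarrow> inverts_mat T S \<Longrightarrow> (\<lambda>j. T * X j * S) \<in> nc_ball Q \<Longrightarrow> F (\<lambda>j. T * X j * S) = T * F X * S"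
    and "\<exists>C. \<forall>X\<in>nc_ball Q. mat_norm (F X) \<le> C"
proof -
  have F: "nc_function Q F" and bdd: "bdd_above ((\<lambda>X. mat_norm (F X)) ` nc_ball Q)"
    using assms by (auto simp: Hinf_def)
  show "F \<in> extensional (nc_ball Q)" using F by (simp add: nc_function_def)
  have n1: "1 \<le> n" if "X \<in> nc_ball Q" "X \<in> tuples n" for n and X :: "'a mtuple"
    using that tuples_unique nc_ball_size by metis
  show "F X \<in> carrier_mat n n" if "X \<in> nc_ball Q" "X \<in> tuples n" for n X
    using F n1[OF that] that by (auto simp: nc_function_def)
  show "F (\<lambda>j. X j \<oplus>\<^sub>M Y j) = F X \<oplus>\<^sub>M F Y" if "X \<in> nc_ball Q" "Y \<in> nc_ball Q" for X Y
    using F that by (auto simp: nc_function_def)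
  show "F (\<lambda>j. T * X j * S) = T * F X * S" if "X \<in> nc_ball Q" "X \<in> tuples n" "S \<in> carrier_mat n n" "T \<in> carrier_mat n n"
      "inverts_mat S T" "inverts_mat T S" "(\<lambda>j. T * X j * S) \<in> nc_ball Q" for n X S T
    using F n1[OF that(1,2)] that unfolding nc_function_def by blast
  show "\<exists>C. \<forall>X\<in>nc_ball Q. mat_norm (F X) \<le> C" using bdd by (auto simp: bdd_above_def)
qed

lemma HinfI:
  fixes Q :: "'d::finite \<Rightarrow> 'h::chilbert_space \<Rightarrow> 'h"
  assumes "operator_space_basis Q"
    and carrier: "\<And>n X. X \<in> nc_ball Q \<Longrightarrow> X \<in> tuples n \<Longrightarrow> f X \<in> carrier_mat n n"
    and dsum: "\<And>n m X Y. X \<in> nc_ball Q \<Longrightarrow> X \<in> tuples n \<Longrightarrow> Y \<in> nc_ball Q \<Longrightarrow> Y \<in> tuples m \<Longrightarrow>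
      (\<lambda>j. X j \<oplus>\<^sub>M Y j) \<in> nc_ball Q \<Longrightarrow> f (\<lambda>j. X j \<oplus>\<^sub>M Y j) = f X \<oplus>\<^sub>M f Y"
    and conj: "\<And>n X S T. X \<in> nc_ball Q \<Longrightarrow> X \<in> tuples n \<Longrightarrow> S \<in> carrier_mat n n \<Longrightarrow> T \<in> carrier_mat n n \<Longrightarrow>
      inverts_mat S T \<Longrightarrow> inverts_mat T S \<Longrightarrow> (\<lambda>j. T * X j * S) \<in> nc_ball Q \<Longrightarrow> f (\<lambda>j. T * X j * S) = T * f X * S"
    and bound: "\<exists>C. \<forall>X\<in>nc_ball Q. mat_norm (f X) \<le> C"
  shows "restrict f (nc_ball Q) \<in> Hinf Q"
proof -
  have Q: "\<And>j. bounded_clinear_op (Q j)" using assms(1) by (auto simp: operator_space_basis_def)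
  have "restrict f (nc_ball Q) (\<lambda>j. X j \<oplus>\<^sub>M Y j) = restrict f (nc_ball Q) X \<oplus>\<^sub>M restrict f (nc_ball Q) Y"
    if X: "X \<in> nc_ball Q" and Y: "Y \<in> nc_ball Q" for X Y
  proof -
    obtain n m where n: "X \<in> tuples n" and m: "Y \<in> tuples m" using X Y nc_ball_size by metis
    have "(\<lambda>j. X j \<oplus>\<^sub>M Y j) \<in> nc_ball Q" by (rule nc_ball_dsum[of Q, OF Q X n Y m])
    then show ?thesis using dsum[OF X n Y m] X Y by simp
  qed
  moreover have "restrict f (nc_ball Q) (\<lambda>j. T * X j * S) = T * restrict f (nc_ball Q) X * S"
    if "X \<in> nc_ball Q" "X \<in> tuples n" "S \<in> carrier_mat n n" "T \<in> carrier_mat n n"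
      "inverts_mat S T" "inverts_mat T S" "(\<lambda>j. T * X j * S) \<in> nc_ball Q" for n X S T
    using conj[OF that] that by simp
  ultimately have "nc_function Q (restrict f (nc_ball Q))"
    unfolding nc_function_def using carrier by auto
  moreover have "bdd_above ((\<lambda>X. mat_norm (restrict f (nc_ball Q) X)) ` nc_ball Q)"
    using bound by (auto simp: bdd_above_def)
  ultimately show ?thesis by (simp add: Hinf_def)
qed

lemma inverts_matD:
  assumes "S \<in> carrier_mat n n" "T \<in> carrier_mat n n" "inverts_mat S T" "inverts_mat T S"
  shows "S * T = 1\<^sub>m n" "T * S = 1\<^sub>m n"
  using assms by (auto simp: inverts_mat_def)

definition Hinf_poly :: "('d::finite \<Rightarrow> 'h::chilbert_space \<Rightarrow> 'h) \<Rightarrow> 'd ncpoly \<Rightarrow> 'd ncfun" where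
  "Hinf_poly Q p = restrict (poly_value p) (nc_ball Q)"

definition Hinf_mult :: "('d::finite \<Rightarrow> 'h::chilbert_space \<Rightarrow> 'h) \<Rightarrow> 'd ncfun \<Rightarrow> 'd ncfun \<Rightarrow> 'd ncfun" where
  "Hinf_mult Q F G = restrict (\<lambda>X. F X * G X) (nc_ball Q)"

lemma Hinf_poly_Hinf:
  fixes Q :: "'d::finite \<Rightarrow> 'h::chilbert_space \<Rightarrow> 'h"
  assumes "operator_space_basis Q"
  shows "Hinf_poly Q p \<in> Hinf Q"
  unfolding Hinf_poly_def
proof (rule HinfI[OF assms])
  obtain C where C: "C \<ge> 0" "\<And>n X. X \<in> nc_ball Q \<Longrightarrow> X \<in> tuples n \<Longrightarrow> op_bound n (poly_value p X) C"
    using ncpoly_bounded[OF assms, of p] by blast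
  have "mat_norm (poly_value p X) \<le> C" if "X \<in> nc_ball Q" for X
  proof -
    obtain n where n: "X \<in> tuples n" using nc_ball_size[OF \<open>X \<in> nc_ball Q\<close>] by blast
    show ?thesis by (rule mat_norm_le[OF poly_value_carrier[OF n] C(2)[OF that n] C(1)])
  qed
  then show "\<exists>C. \<forall>X\<in>nc_ball Q. mat_norm (poly_value p X) \<le> C" by blast
qed (auto simp: poly_value_dsum poly_value_conj poly_value_carrier inverts_matD)

lemma Hinf_mult_Hinf:
  fixes Q :: "'d::finite \<Rightarrow> 'h::chilbert_space \<Rightarrow> 'h"
  assumes "operator_space_basis Q" and F: "F \<in> Hinf Q" and G: "G \<in> Hinf Q"
  shows "Hinf_mult Q F G \<in> Hinf Q"
  unfolding Hinf_mult_def
proof (rule HinfI[OF assms(1)])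
  show "F X * G X \<in> carrier_mat n n" if "X \<in> nc_ball Q" "X \<in> tuples n" for n X
    using HinfD(2)[OF F that] HinfD(2)[OF G that] by auto
  show "F (\<lambda>j. X j \<oplus>\<^sub>M Y j) * G (\<lambda>j. X j \<oplus>\<^sub>M Y j) = F X * G X \<oplus>\<^sub>M F Y * G Y"
    if X: "X \<in> nc_ball Q" "X \<in> tuples n" and Y: "Y \<in> nc_ball Q" "Y \<in> tuples m" for n m X Y
    unfolding HinfD(3)[OF F X(1) Y(1)] HinfD(3)[OF G X(1) Y(1)]
    by (rule mat_dsum_mult[OF HinfD(2)[OF F X] HinfD(2)[OF G X] HinfD(2)[OF F Y] HinfD(2)[OF G Y]])
  show "F (\<lambda>j. T * X j * S) * G (\<lambda>j. T * X j * S) = T * (F X * G X) * S"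
    if "X \<in> nc_ball Q" "X \<in> tuples n" "S \<in> carrier_mat n n" "T \<in> carrier_mat n n"
      "inverts_mat S T" "inverts_mat T S" "(\<lambda>j. T * X j * S) \<in> nc_ball Q" for n X S T
    unfolding HinfD(4)[OF F that] HinfD(4)[OF G that]
    by (rule conj_mult[OF that(3,4) inverts_matD(1)[OF that(3-6)] HinfD(2)[OF F that(1,2)] HinfD(2)[OF G that(1,2)]])
  obtain C E where C: "\<And>X. X \<in> nc_ball Q \<Longrightarrow> mat_norm (F X) \<le> C" "\<And>X. X \<in> nc_ball Q \<Longrightarrow> mat_norm (G X) \<le> E"
    using HinfD(5)[OF F] HinfD(5)[OF G] by blast
  have "mat_norm (F X * G X) \<le> C * E" if X: "X \<in> nc_ball Q" for X
  proof -
    obtain n where n: "X \<in> tuples n" using nc_ball_size[OF X] by blast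
    note c = HinfD(2)[OF F X n] HinfD(2)[OF G X n]
    have "mat_norm (F X * G X) \<le> mat_norm (F X) * mat_norm (G X)" by (rule mat_norm_mult[OF c])
    also have "\<dots> \<le> C * E"
      using C[OF X] mat_norm_nonneg[OF c(1)] mat_norm_nonneg[OF c(2)] by (intro mult_mono) auto
    finally show ?thesis .
  qed
  then show "\<exists>C. \<forall>X\<in>nc_ball Q. mat_norm (F X * G X) \<le> C" by blast
qed

lemma mat_dsum_add:
  assumes "A \<in> carrier_mat n n" "A' \<in> carrier_mat n n" "B \<in> carrier_mat m m" "B' \<in> carrier_mat m m"
  shows "(A \<oplus>\<^sub>M B) + (A' \<oplus>\<^sub>M B') = (A + A') \<oplus>\<^sub>M (B + B')"
  using assms unfolding mat_dsum_def by (intro eq_matI) auto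

lemma mat_dsum_smult:
  assumes "A \<in> carrier_mat n n" "B \<in> carrier_mat m m"
  shows "c \<cdot>\<^sub>m (A \<oplus>\<^sub>M B) = (c \<cdot>\<^sub>m A) \<oplus>\<^sub>M (c \<cdot>\<^sub>m B)"
  using assms unfolding mat_dsum_def by (intro eq_matI) auto

lemma Hinf_add_Hinf:
  fixes Q :: "'d::finite \<Rightarrow> 'h::chilbert_space \<Rightarrow> 'h"
  assumes "operator_space_basis Q" and F: "F \<in> Hinf Q" and G: "G \<in> Hinf Q"
  shows "Hinf_add Q F G \<in> Hinf Q"
  unfolding Hinf_add_def
proof (rule HinfI[OF assms(1)])
  show "F X + G X \<in> carrier_mat n n" if "X \<in> nc_ball Q" "X \<in> tuples n" for n X
    using HinfD(2)[OF F that] HinfD(2)[OF G that] by auto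
  show "F (\<lambda>j. X j \<oplus>\<^sub>M Y j) + G (\<lambda>j. X j \<oplus>\<^sub>M Y j) = (F X + G X) \<oplus>\<^sub>M (F Y + G Y)"
    if X: "X \<in> nc_ball Q" "X \<in> tuples n" and Y: "Y \<in> nc_ball Q" "Y \<in> tuples m" for n m X Y
    unfolding HinfD(3)[OF F X(1) Y(1)] HinfD(3)[OF G X(1) Y(1)]
    by (rule mat_dsum_add[OF HinfD(2)[OF F X] HinfD(2)[OF G X] HinfD(2)[OF F Y] HinfD(2)[OF G Y]])
  show "F (\<lambda>j. T * X j * S) + G (\<lambda>j. T * X j * S) = T * (F X + G X) * S"
    if "X \<in> nc_ball Q" "X \<in> tuples n" "S \<in> carrier_mat n n" "T \<in> carrier_mat n n"
      "inverts_mat S T" "inverts_mat T S" "(\<lambda>j. T * X j * S) \<in> nc_ball Q" for n X S T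
  proof -
    note c = HinfD(2)[OF F that(1,2)] HinfD(2)[OF G that(1,2)]
    show ?thesis unfolding HinfD(4)[OF F that] HinfD(4)[OF G that] mult_add_distrib_mat[OF that(4) c]
      by (rule add_mult_distrib_mat[symmetric, of _ n n]) (use c that in auto)
  qed
  obtain C E where C: "\<And>X. X \<in> nc_ball Q \<Longrightarrow> mat_norm (F X) \<le> C" "\<And>X. X \<in> nc_ball Q \<Longrightarrow> mat_norm (G X) \<le> E"
    using HinfD(5)[OF F] HinfD(5)[OF G] by blast
  have "mat_norm (F X + G X) \<le> C + E" if X: "X \<in> nc_ball Q" for X
  proof -
    obtain n where n: "X \<in> tuples n" using nc_ball_size[OF X] by blast
    show ?thesis
      using mat_norm_add[OF HinfD(2)[OF F X n] HinfD(2)[OF G X n]] C[OF X] by linarith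
  qed
  then show "\<exists>C. \<forall>X\<in>nc_ball Q. mat_norm (F X + G X) \<le> C" by blast
qed

lemma Hinf_scale_Hinf:
  fixes Q :: "'d::finite \<Rightarrow> 'h::chilbert_space \<Rightarrow> 'h"
  assumes "operator_space_basis Q" and F: "F \<in> Hinf Q"
  shows "Hinf_scale Q c F \<in> Hinf Q"
  unfolding Hinf_scale_def
proof (rule HinfI[OF assms(1)])
  show "c \<cdot>\<^sub>m F X \<in> carrier_mat n n" if "X \<in> nc_ball Q" "X \<in> tuples n" for n X
    using HinfD(2)[OF F that] by auto
  show "c \<cdot>\<^sub>m F (\<lambda>j. X j \<oplus>\<^sub>M Y j) = c \<cdot>\<^sub>m F X \<oplus>\<^sub>M c \<cdot>\<^sub>m F Y"
    if X: "X \<in> nc_ball Q" "X \<in> tuples n" and Y: "Y \<in> nc_ball Q" "Y \<in> tuples m" for n m X Y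
    unfolding HinfD(3)[OF F X(1) Y(1)]
    by (rule mat_dsum_smult[OF HinfD(2)[OF F X] HinfD(2)[OF F Y]])
  show "c \<cdot>\<^sub>m F (\<lambda>j. T * X j * S) = T * (c \<cdot>\<^sub>m F X) * S"
    if "X \<in> nc_ball Q" "X \<in> tuples n" "S \<in> carrier_mat n n" "T \<in> carrier_mat n n"
      "inverts_mat S T" "inverts_mat T S" "(\<lambda>j. T * X j * S) \<in> nc_ball Q" for n X S T
  proof -
    note c = HinfD(2)[OF F that(1,2)]
    show ?thesis unfolding HinfD(4)[OF F that] mult_smult_distrib[OF that(4) c]
      by (rule mult_smult_assoc_mat[symmetric, of _ n n]) (use c that in auto)
  qed
  obtain C where C: "\<And>X. X \<in> nc_ball Q \<Longrightarrow> mat_norm (F X) \<le> C" using HinfD(5)[OF F] by blast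
  have "mat_norm (c \<cdot>\<^sub>m F X) \<le> cmod c * C" if X: "X \<in> nc_ball Q" for X
  proof -
    obtain n where n: "X \<in> tuples n" using nc_ball_size[OF X] by blast
    show ?thesis
      using mat_norm_smult[OF HinfD(2)[OF F X n], of c] mult_left_mono[OF C[OF X], of "cmod c"] by simp
  qed
  then show "\<exists>C. \<forall>X\<in>nc_ball Q. mat_norm (c \<cdot>\<^sub>m F X) \<le> C" by blast
qed

lemma Hinf_eqI:
  assumes "F \<in> extensional (nc_ball Q)" "G \<in> extensional (nc_ball Q)"
    and "\<And>n X. X \<in> nc_ball Q \<Longrightarrow> X \<in> tuples n \<Longrightarrow> F X = G X"
  shows "F = G"
proof (rule extensionalityI[OF assms(1,2)])
  fix X assume X: "X \<in> nc_ball Q"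
  then obtain n where "X \<in> tuples n" using nc_ball_size by metis
  then show "F X = G X" using assms(3) X by blast
qed

lemma Hinf_mult_ext: "Hinf_mult Q F G \<in> extensional (nc_ball Q)"
  and Hinf_poly_ext: "Hinf_poly Q p \<in> extensional (nc_ball Q)"
  and Hinf_add_ext: "Hinf_add Q F G \<in> extensional (nc_ball Q)"
  and Hinf_scale_ext: "Hinf_scale Q c F \<in> extensional (nc_ball Q)"
  by (simp_all add: Hinf_mult_def Hinf_poly_def Hinf_add_def Hinf_scale_def)

lemma Hinf_mult_assoc:
  assumes "F \<in> Hinf Q" "G \<in> Hinf Q" "H \<in> Hinf Q"
  shows "Hinf_mult Q (Hinf_mult Q F G) H = Hinf_mult Q F (Hinf_mult Q G H)"
proof (rule Hinf_eqI[OF Hinf_mult_ext Hinf_mult_ext])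
  fix n X assume X: "X \<in> nc_ball Q" "X \<in> tuples n"
  show "Hinf_mult Q (Hinf_mult Q F G) H X = Hinf_mult Q F (Hinf_mult Q G H) X"
    using X(1) assoc_mult_mat[OF HinfD(2)[OF assms(1) X] HinfD(2)[OF assms(2) X] HinfD(2)[OF assms(3) X]]
    by (simp add: Hinf_mult_def)
qed

lemma Hinf_mult_Hinf_poly: "Hinf_mult Q (Hinf_poly Q p) (Hinf_poly Q q) = Hinf_poly Q (p * q)"
  by (rule Hinf_eqI[OF Hinf_mult_ext Hinf_poly_ext]) (simp add: Hinf_mult_def Hinf_poly_def poly_value_mult)

lemma Hinf_poly_add: "Hinf_poly Q (p + q) = Hinf_add Q (Hinf_poly Q p) (Hinf_poly Q q)"
  by (rule Hinf_eqI[OF Hinf_poly_ext Hinf_add_ext]) (simp add: Hinf_add_def Hinf_poly_def poly_value_add_mat)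

lemma Hinf_mult_one:
  assumes "F \<in> Hinf Q"
  shows "Hinf_mult Q F (Hinf_poly Q 1) = F" "Hinf_mult Q (Hinf_poly Q 1) F = F"
  by (rule Hinf_eqI[OF Hinf_mult_ext HinfD(1)[OF assms]];
      simp add: Hinf_mult_def Hinf_poly_def poly_value_one right_mult_one_mat[OF HinfD(2)[OF assms]]
        left_mult_one_mat[OF HinfD(2)[OF assms]])+

lemma Hinf_mult_add:
  assumes "F \<in> Hinf Q" "G \<in> Hinf Q" "H \<in> Hinf Q"
  shows "Hinf_mult Q F (Hinf_add Q G H) = Hinf_add Q (Hinf_mult Q F G) (Hinf_mult Q F H)"
    and "Hinf_mult Q (Hinf_add Q G H) F = Hinf_add Q (Hinf_mult Q G F) (Hinf_mult Q H F)"
  by (rule Hinf_eqI[OF Hinf_mult_ext Hinf_add_ext];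
      simp add: Hinf_mult_def Hinf_add_def mult_add_distrib_mat[OF HinfD(2)[OF assms(1)] HinfD(2)[OF assms(2)] HinfD(2)[OF assms(3)]]
       add_mult_distrib_mat[OF HinfD(2)[OF assms(2)] HinfD(2)[OF assms(3)] HinfD(2)[OF assms(1)]])+

lemma Hinf_mult_scale:
  assumes "F \<in> Hinf Q" "G \<in> Hinf Q"
  shows "Hinf_mult Q F (Hinf_scale Q c G) = Hinf_scale Q c (Hinf_mult Q F G)"
    and "Hinf_mult Q (Hinf_scale Q c F) G = Hinf_scale Q c (Hinf_mult Q F G)"
  by (rule Hinf_eqI[OF Hinf_mult_ext Hinf_scale_ext];
      simp add: Hinf_mult_def Hinf_scale_def mult_smult_distrib[OF HinfD(2)[OF assms(1)] HinfD(2)[OF assms(2)]]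
       mult_smult_assoc_mat[OF HinfD(2)[OF assms(1)] HinfD(2)[OF assms(2)]])+

text \<open>Mirrors the entrywise sum inside \<open>MHinf_mult\<close>; \<open>Hinf_sum_Suc\<close>
  then reduces it to repeated \<open>Hinf_add\<close>, on which functionals are additive.\<close>

definition Hinf_sum :: "('d::finite \<Rightarrow> 'h::chilbert_space \<Rightarrow> 'h) \<Rightarrow> nat \<Rightarrow> (nat \<Rightarrow> 'd ncfun) \<Rightarrow> 'd ncfun" where
  "Hinf_sum Q k f = restrict (\<lambda>X. Matrix.mat (tuple_size X) (tuple_size X) (\<lambda>(a, b). \<Sum>l<k. f l X $$ (a, b))) (nc_ball Q)"

lemma Hinf_sum_ext: "Hinf_sum Q k f \<in> extensional (nc_ball Q)"
  by (simp add: Hinf_sum_def)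

lemma Hinf_sum_0: "Hinf_sum Q 0 f = Hinf_poly Q 0"
  by (rule Hinf_eqI[OF Hinf_sum_ext Hinf_poly_ext]) (simp add: Hinf_sum_def Hinf_poly_def poly_value_def)

lemma Hinf_sum_Suc:
  assumes "f k \<in> Hinf Q"
  shows "Hinf_sum Q (Suc k) f = Hinf_add Q (Hinf_sum Q k f) (f k)"
proof (rule Hinf_eqI[OF Hinf_sum_ext Hinf_add_ext])
  fix n X assume X: "X \<in> nc_ball Q" "X \<in> tuples n"
  show "Hinf_sum Q (Suc k) f X = Hinf_add Q (Hinf_sum Q k f) (f k) X"
    using X HinfD(2)[OF assms X] by (intro eq_matI) (auto simp: Hinf_sum_def Hinf_add_def tuple_size_eq)
qed

lemma Hinf_sum_Hinf:
  fixes Q :: "'d::finite \<Rightarrow> 'h::chilbert_space \<Rightarrow> 'h"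
  assumes "operator_space_basis Q"
  shows "(\<And>l. l < k \<Longrightarrow> f l \<in> Hinf Q) \<Longrightarrow> Hinf_sum Q k f \<in> Hinf Q"
  by (induction k) (simp_all add: Hinf_sum_0 Hinf_poly_Hinf[OF assms] Hinf_sum_Suc Hinf_add_Hinf[OF assms])

lemma MHinf_mult_entry:
  assumes "i < k" "j < k"
  shows "MHinf_mult Q k G F $$ (i, j) = Hinf_sum Q k (\<lambda>l. Hinf_mult Q (G $$ (i, l)) (F $$ (l, j)))"
  using assms by (auto simp: MHinf_mult_def Hinf_sum_def Hinf_mult_def intro!: restrict_ext)

section \<open>Weak-* continuous functionals and bounded pointwise convergence\<close>

definition Hinf_null :: "('d::finite \<Rightarrow> 'h::chilbert_space \<Rightarrow> 'h) \<Rightarrow> (nat \<Rightarrow> 'd ncfun) \<Rightarrow> bool" where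
  "Hinf_null Q F \<longleftrightarrow> (\<forall>N. F N \<in> Hinf Q) \<and> (\<exists>C. \<forall>N. \<forall>X\<in>nc_ball Q. mat_norm (F N X) \<le> C) \<and>
     (\<forall>n X a b. X \<in> nc_ball Q \<longrightarrow> X \<in> tuples n \<longrightarrow> a < n \<longrightarrow> b < n \<longrightarrow> (\<lambda>N. F N X $$ (a, b)) \<longlonglongrightarrow> 0)"

text \<open>The counterpart of \<open>bp_functional\<close> on the whole algebra. It is complex
  linear, since the closure criterion works with complex subspaces of value vectors.\<close>

definition Hinf_functional :: "('d::finite \<Rightarrow> 'h::chilbert_space \<Rightarrow> 'h) \<Rightarrow> ('d ncfun \<Rightarrow> complex) \<Rightarrow> bool" where
  "Hinf_functional Q \<phi> \<longleftrightarrow>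
     (\<forall>F \<in> Hinf Q. \<forall>G \<in> Hinf Q. \<phi> (Hinf_add Q F G) = \<phi> F + \<phi> G) \<and>
     (\<forall>c. \<forall>F \<in> Hinf Q. \<phi> (Hinf_scale Q c F) = c * \<phi> F) \<and>
     (\<forall>F. Hinf_null Q F \<longrightarrow> (\<lambda>N. \<phi> (F N)) \<longlonglongrightarrow> 0)"

text \<open>The suprema over the ball, as in \<open>Hinf_norm\<close>, are meaningful only over a
  nonempty set.\<close>

lemma nc_ball_nonempty:
  fixes Q :: "'d::finite \<Rightarrow> 'h::chilbert_space \<Rightarrow> 'h"
  assumes "operator_space_basis Q"
  shows "nc_ball Q \<noteq> {}"
proof -
  have Q: "\<And>j. bounded_clinear_op (Q j)" using assms by (auto simp: operator_space_basis_def)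
  have t: "(\<lambda>_ :: 'd. 0\<^sub>m 1 1) \<in> tuples 1" by (simp add: tuples_def)
  show ?thesis using nc_ball_shrink[of Q, OF Q order_refl t] by (metis empty_iff)
qed

lemma mat_norm_le_Hinf_norm:
  assumes "F \<in> Hinf Q" "X \<in> nc_ball Q"
  shows "mat_norm (F X) \<le> Hinf_norm Q F"
  unfolding Hinf_norm_def using assms by (intro cSUP_upper) (auto simp: Hinf_def)

lemma Hinf_norm_le:
  fixes Q :: "'d::finite \<Rightarrow> 'h::chilbert_space \<Rightarrow> 'h"
  assumes "operator_space_basis Q" "\<And>X. X \<in> nc_ball Q \<Longrightarrow> mat_norm (F X) \<le> C"
  shows "Hinf_norm Q F \<le> C"
  unfolding Hinf_norm_def by (rule cSUP_least[OF nc_ball_nonempty[OF assms(1)] assms(2)])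

text \<open>A matrix functional is constrained only on matrices of size \<open>n\<close>, so the
  expansion into matrix units is built inside that carrier, adding one position at a time.\<close>

lemma mat_functional_eq_sum:
  assumes \<eta>: "mat_functional n \<eta>" and A: "A \<in> carrier_mat n n"
  shows "\<eta> A = (\<Sum>a<n. \<Sum>b<n. A $$ (a, b) * \<eta> (Matrix.mat n n (\<lambda>(c, d). if c = a \<and> d = b then 1 else 0)))"
proof -
  define E where "E = (\<lambda>(a, b). Matrix.mat n n (\<lambda>(c, d). if c = a \<and> d = b then 1 else 0 :: complex))"
  have add: "\<eta> (B + B') = \<eta> B + \<eta> B'" if "B \<in> carrier_mat n n" "B' \<in> carrier_mat n n" for B B'
    using \<eta> that by (simp add: mat_functional_def)
  have scale: "\<eta> (c \<cdot>\<^sub>m B) = c * \<eta> B" if "B \<in> carrier_mat n n" for c B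
    using \<eta> that by (simp add: mat_functional_def)
  have E: "E x \<in> carrier_mat n n" for x by (simp add: E_def case_prod_unfold)
  define part where "part S = Matrix.mat n n (\<lambda>x. if x \<in> S then A $$ x else 0)" for S
  have part: "part S \<in> carrier_mat n n" for S by (simp add: part_def)
  have zero: "\<eta> (0\<^sub>m n n) = 0"
  proof -
    have "0 \<cdot>\<^sub>m (0\<^sub>m n n :: complex mat) = 0\<^sub>m n n" by auto
    then show ?thesis using scale[of "0\<^sub>m n n" 0] by simp
  qed
  have "\<eta> (part S) = (\<Sum>x\<in>S. A $$ x * \<eta> (E x))" if "finite S" "S \<subseteq> {..<n} \<times> {..<n}" for S
    using that
  proof (induction S)
    case empty
    have "part {} = 0\<^sub>m n n" by (auto simp: part_def)
    then show ?case by (simp add: zero)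
  next
    case (insert x S)
    have "part (insert x S) = part S + A $$ x \<cdot>\<^sub>m E x"
      using insert.hyps insert.prems by (intro eq_matI) (auto simp: part_def E_def case_prod_unfold split: if_splits)
    then show ?case using insert by (simp add: add[OF part] scale[OF E] E)
  qed
  from this[of "{..<n} \<times> {..<n}"] have "\<eta> (part ({..<n} \<times> {..<n})) = (\<Sum>x\<in>{..<n} \<times> {..<n}. A $$ x * \<eta> (E x))"
    by simp
  also have "part ({..<n} \<times> {..<n}) = A" using A by (intro eq_matI) (auto simp: part_def)
  finally show ?thesis by (simp add: sum.cartesian_product E_def case_prod_unfold)
qed

lemma eval_functionals_Hinf:
  fixes Q :: "'d::finite \<Rightarrow> 'h::chilbert_space \<Rightarrow> 'h"
  assumes "\<psi> \<in> eval_functionals Q"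
  shows "Hinf_functional Q \<psi>" "\<exists>C\<ge>0. \<forall>F\<in>Hinf Q. cmod (\<psi> F) \<le> C * Hinf_norm Q F"
proof -
  obtain n X \<eta> where \<psi>: "\<psi> = (\<lambda>F. \<eta> (F X))" and X: "X \<in> nc_ball Q" "X \<in> tuples n" and \<eta>: "mat_functional n \<eta>"
    using assms unfolding eval_functionals_def by blast
  define e where "e a b = \<eta> (Matrix.mat n n (\<lambda>(c, d). if c = a \<and> d = b then 1 else 0))" for a b
  have eq: "\<psi> F = (\<Sum>a<n. \<Sum>b<n. F X $$ (a, b) * e a b)" if "F \<in> Hinf Q" for F
    unfolding \<psi> e_def by (rule mat_functional_eq_sum[OF \<eta> HinfD(2)[OF that X]])
  show "Hinf_functional Q \<psi>"
    unfolding Hinf_functional_def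
  proof (intro conjI ballI allI impI)
    show "\<psi> (Hinf_add Q F G) = \<psi> F + \<psi> G" if "F \<in> Hinf Q" "G \<in> Hinf Q" for F G
      using \<eta> HinfD(2)[OF that(1) X] HinfD(2)[OF that(2) X] X by (simp add: \<psi> Hinf_add_def mat_functional_def)
    show "\<psi> (Hinf_scale Q c F) = c * \<psi> F" if "F \<in> Hinf Q" for c F
      using \<eta> HinfD(2)[OF that X] X by (simp add: \<psi> Hinf_scale_def mat_functional_def)
    fix F assume F: "Hinf_null Q F"
    have "(\<lambda>N. \<Sum>a<n. \<Sum>b<n. F N X $$ (a, b) * e a b) \<longlonglongrightarrow> (\<Sum>a<n. \<Sum>b<n. 0 * e a b)"
      using F X unfolding Hinf_null_def by (intro tendsto_intros) auto
    moreover have "F N \<in> Hinf Q" for N using F by (simp add: Hinf_null_def)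
    ultimately show "(\<lambda>N. \<psi> (F N)) \<longlonglongrightarrow> 0" by (simp add: eq)
  qed
  define C where "C = (\<Sum>a<n. \<Sum>b<n. cmod (e a b))"
  have "cmod (\<psi> F) \<le> C * Hinf_norm Q F" if F: "F \<in> Hinf Q" for F
  proof -
    have "cmod (\<psi> F) \<le> (\<Sum>a<n. \<Sum>b<n. cmod (e a b) * Hinf_norm Q F)"
      unfolding eq[OF F]
    proof (intro sum_norm_le)
      fix a b assume "a \<in> {..<n}" "b \<in> {..<n}"
      then have "cmod (F X $$ (a, b)) \<le> Hinf_norm Q F"
        using mat_norm_entry[OF HinfD(2)[OF F X]] mat_norm_le_Hinf_norm[OF F X(1)] by (meson lessThan_iff order_trans)
      then show "cmod (F X $$ (a, b) * e a b) \<le> cmod (e a b) * Hinf_norm Q F"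
        using mult_right_mono[of _ _ "cmod (e a b)"] by (fastforce simp: norm_mult mult.commute[of "cmod (e a b)"])
    qed
    then show ?thesis by (simp add: C_def sum_distrib_right)
  qed
  moreover have "C \<ge> 0" by (simp add: C_def sum_nonneg)
  ultimately show "\<exists>C\<ge>0. \<forall>F\<in>Hinf Q. cmod (\<psi> F) \<le> C * Hinf_norm Q F" by blast
qed

lemma Hinf_functional_combo:
  assumes "finite A" "\<And>i. i \<in> A \<Longrightarrow> Hinf_functional Q (\<phi> i)"
  shows "Hinf_functional Q (\<lambda>F. \<Sum>i\<in>A. c i * \<phi> i F)"
  unfolding Hinf_functional_def
proof (intro conjI ballI allI impI)
  show "(\<Sum>i\<in>A. c i * \<phi> i (Hinf_add Q F G)) = (\<Sum>i\<in>A. c i * \<phi> i F) + (\<Sum>i\<in>A. c i * \<phi> i G)"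
    if "F \<in> Hinf Q" "G \<in> Hinf Q" for F G
    unfolding sum.distrib[symmetric] using assms(2) that
    by (intro sum.cong refl) (simp add: Hinf_functional_def algebra_simps)
  show "(\<Sum>i\<in>A. c i * \<phi> i (Hinf_scale Q e F)) = e * (\<Sum>i\<in>A. c i * \<phi> i F)" if "F \<in> Hinf Q" for e F
    unfolding sum_distrib_left using assms(2) that
    by (intro sum.cong refl) (simp add: Hinf_functional_def)
  fix F assume F: "Hinf_null Q F"
  have "(\<lambda>N. \<Sum>i\<in>A. c i * \<phi> i (F N)) \<longlonglongrightarrow> (\<Sum>i\<in>A. c i * 0)"
    using assms(2) F by (intro tendsto_intros) (auto simp: Hinf_functional_def)
  then show "(\<lambda>N. \<Sum>i\<in>A. c i * \<phi> i (F N)) \<longlonglongrightarrow> 0" by simp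
qed

lemma eval_span_Hinf:
  fixes Q :: "'d::finite \<Rightarrow> 'h::chilbert_space \<Rightarrow> 'h"
  assumes basis: "operator_space_basis Q" and "\<psi> \<in> eval_span Q"
  shows "Hinf_functional Q \<psi>" "\<exists>C\<ge>0. \<forall>F\<in>Hinf Q. cmod (\<psi> F) \<le> C * Hinf_norm Q F"
proof -
  obtain m :: nat and c \<phi> where \<psi>: "\<psi> = (\<lambda>F. \<Sum>i<m. c i * \<phi> i F)" and \<phi>: "\<And>i. i < m \<Longrightarrow> \<phi> i \<in> eval_functionals Q"
    using assms(2) unfolding eval_span_def by blast
  show "Hinf_functional Q \<psi>"
    unfolding \<psi> by (rule Hinf_functional_combo) (use \<phi> eval_functionals_Hinf(1) in auto)
  have "\<forall>i. \<exists>C\<ge>0. i < m \<longrightarrow> (\<forall>F\<in>Hinf Q. cmod (\<phi> i F) \<le> C * Hinf_norm Q F)"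
    using eval_functionals_Hinf(2)[OF \<phi>] by (meson order_refl)
  then obtain C where C: "\<And>i. C i \<ge> 0" "\<And>i F. i < m \<Longrightarrow> F \<in> Hinf Q \<Longrightarrow> cmod (\<phi> i F) \<le> C i * Hinf_norm Q F"
    by metis
  have "cmod (\<psi> F) \<le> (\<Sum>i<m. cmod (c i) * C i) * Hinf_norm Q F" if "F \<in> Hinf Q" for F
    unfolding \<psi> sum_distrib_right
    using C(2)[OF _ that] by (intro sum_norm_le) (simp add: norm_mult mult.assoc mult_left_mono)
  moreover have "(\<Sum>i<m. cmod (c i) * C i) \<ge> 0" using C(1) by (simp add: sum_nonneg)
  ultimately show "\<exists>C\<ge>0. \<forall>F\<in>Hinf Q. cmod (\<psi> F) \<le> C * Hinf_norm Q F" by blast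
qed

lemma Hinf_norm_nonneg:
  fixes Q :: "'d::finite \<Rightarrow> 'h::chilbert_space \<Rightarrow> 'h"
  assumes "operator_space_basis Q" "F \<in> Hinf Q"
  shows "Hinf_norm Q F \<ge> 0"
proof -
  obtain X where X: "X \<in> nc_ball Q" using nc_ball_nonempty[OF assms(1)] by blast
  then obtain n where n: "X \<in> tuples n" using nc_ball_size by blast
  show ?thesis
    using mat_norm_nonneg[OF HinfD(2)[OF assms(2) X n]] mat_norm_le_Hinf_norm[OF assms(2) X] by simp
qed

text \<open>The constant \<open>D\<close> makes the supremum in the dual norm one of a bounded set.
  Rescaling by a fixed bound \<open>C > 0\<close>, instead of by the norm of \<open>F\<close>,
  avoids a division by zero.\<close>

lemma Hinf_dual_norm_bound:
  fixes Q :: "'d::finite \<Rightarrow> 'h::chilbert_space \<Rightarrow> 'h"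
  assumes basis: "operator_space_basis Q"
    and scale: "\<And>c F. F \<in> Hinf Q \<Longrightarrow> \<chi> (Hinf_scale Q c F) = c * \<chi> F"
    and bound: "\<And>F. F \<in> Hinf Q \<Longrightarrow> cmod (\<chi> F) \<le> D * Hinf_norm Q F" and D: "D \<ge> 0"
    and F: "F \<in> Hinf Q" "Hinf_norm Q F \<le> C" and C: "C > 0"
  shows "cmod (\<chi> F) \<le> C * Hinf_dual_norm Q \<chi>"
proof -
  let ?G = "Hinf_scale Q (of_real (1/C)) F"
  have G: "?G \<in> Hinf Q" by (rule Hinf_scale_Hinf[OF basis F(1)])
  have norm: "Hinf_norm Q ?G \<le> 1"
  proof (rule Hinf_norm_le[OF basis])
    fix X assume X: "X \<in> nc_ball Q"
    then obtain n where n: "X \<in> tuples n" using nc_ball_size by blast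
    have "mat_norm (?G X) \<le> cmod (of_real (1/C)) * mat_norm (F X)"
      using mat_norm_smult[OF HinfD(2)[OF F(1) X n], of "of_real (1/C)"] X by (simp add: Hinf_scale_def)
    also have "\<dots> = mat_norm (F X) / C" using C by (simp add: norm_divide)
    also have "\<dots> \<le> 1" using mat_norm_le_Hinf_norm[OF F(1) X] F(2) C by simp
    finally show "mat_norm (?G X) \<le> 1" .
  qed
  have "cmod (\<chi> ?G) \<le> Hinf_dual_norm Q \<chi>"
    unfolding Hinf_dual_norm_def
  proof (rule cSup_upper)
    show "cmod (\<chi> ?G) \<in> {cmod (\<chi> F) |F. F \<in> Hinf Q \<and> Hinf_norm Q F \<le> 1}" using G norm by blast
    have "cmod (\<chi> F) \<le> D" if "F \<in> Hinf Q" "Hinf_norm Q F \<le> 1" for F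
      using bound[OF that(1)] mult_left_mono[OF that(2) D] by simp
    then show "bdd_above {cmod (\<chi> F) |F. F \<in> Hinf Q \<and> Hinf_norm Q F \<le> 1}" by (auto simp: bdd_above_def)
  qed
  moreover have "\<chi> ?G = of_real (1/C) * \<chi> F" by (rule scale[OF F(1)])
  ultimately have "cmod (\<chi> F) / C \<le> Hinf_dual_norm Q \<chi>" using C by (simp add: norm_mult norm_divide)
  then show ?thesis using C by (simp add: pos_divide_le_eq mult.commute)
qed

text \<open>Approximation in the dual norm is uniform on a bounded sequence, and finite combinations
  of evaluations respect pointwise convergence; splitting \<epsilon> into halves joins the
  two.\<close>

lemma predual_functional:
  fixes Q :: "'d::finite \<Rightarrow> 'h::chilbert_space \<Rightarrow> 'h"
  assumes basis: "operator_space_basis Q" and \<phi>: "\<phi> \<in> predual Q"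
  shows "Hinf_functional Q \<phi>"
proof -
  have dual: "\<phi> \<in> Hinf_dual Q" using \<phi> by (simp add: predual_def)
  obtain D where D: "\<And>F. F \<in> Hinf Q \<Longrightarrow> cmod (\<phi> F) \<le> D * Hinf_norm Q F"
    using dual unfolding Hinf_dual_def by blast
  have "(\<lambda>N. \<phi> (F N)) \<longlonglongrightarrow> 0" if F: "Hinf_null Q F" for F
  proof -
    have FH: "F N \<in> Hinf Q" for N using F by (simp add: Hinf_null_def)
    obtain C0 where "\<And>N X. X \<in> nc_ball Q \<Longrightarrow> mat_norm (F N X) \<le> C0" using F unfolding Hinf_null_def by blast
    then have "Hinf_norm Q (F N) \<le> C0" for N using Hinf_norm_le[OF basis] by blast
    \<comment> \<open>The summand \<open>1\<close> makes the bound positive, as required for the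
      division in \<delta>.\<close>
    moreover define K where "K = \<bar>C0\<bar> + 1"
    ultimately have C: "Hinf_norm Q (F N) \<le> K" for N by (meson abs_ge_self add_increasing2 order_trans zero_le_one)
    have C_pos: "K > 0" by (simp add: K_def)
    show ?thesis
      unfolding tendsto_iff
    proof (intro allI impI)
      fix \<epsilon> :: real assume \<epsilon>: "\<epsilon> > 0"
      define \<delta> where "\<delta> = \<epsilon> / 2 / K"
      have "\<delta> > 0" using \<epsilon> C_pos by (simp add: \<delta>_def)
      then obtain \<psi> where \<psi>: "\<psi> \<in> eval_span Q" "Hinf_dual_norm Q (\<lambda>F. \<phi> F - \<psi> F) < \<delta>"
        using \<phi> by (auto simp: predual_def)
      obtain E where E: "E \<ge> 0" "\<And>F. F \<in> Hinf Q \<Longrightarrow> cmod (\<psi> F) \<le> E * Hinf_norm Q F"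
        using eval_span_Hinf(2)[OF basis \<psi>(1)] by blast
      have \<psi>f: "Hinf_functional Q \<psi>" by (rule eval_span_Hinf(1)[OF basis \<psi>(1)])
      have diff: "cmod (\<phi> (F N) - \<psi> (F N)) \<le> \<epsilon> / 2" for N
      proof -
        have "cmod (\<phi> (F N) - \<psi> (F N)) \<le> K * Hinf_dual_norm Q (\<lambda>F. \<phi> F - \<psi> F)"
        proof (rule Hinf_dual_norm_bound[OF basis _ _ _ FH C C_pos])
          show "\<phi> (Hinf_scale Q c F) - \<psi> (Hinf_scale Q c F) = c * (\<phi> F - \<psi> F)" if "F \<in> Hinf Q" for c F
            using dual \<psi>f that by (simp add: Hinf_dual_def Hinf_functional_def right_diff_distrib)
          show "cmod (\<phi> F - \<psi> F) \<le> (\<bar>D\<bar> + E) * Hinf_norm Q F" if "F \<in> Hinf Q" for F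
          proof -
            have "cmod (\<phi> F - \<psi> F) \<le> cmod (\<phi> F) + cmod (\<psi> F)" by (rule norm_triangle_ineq4)
            also have "\<dots> \<le> D * Hinf_norm Q F + E * Hinf_norm Q F" by (intro add_mono D E that)
            also have "\<dots> \<le> \<bar>D\<bar> * Hinf_norm Q F + E * Hinf_norm Q F"
              using Hinf_norm_nonneg[OF basis that] by (intro add_right_mono mult_right_mono) auto
            finally show ?thesis by (simp add: distrib_right)
          qed
          show "0 \<le> \<bar>D\<bar> + E" using E(1) by simp
        qed
        also have "\<dots> \<le> K * \<delta>" using \<psi>(2) C_pos by (intro mult_left_mono) auto
        also have "\<dots> = \<epsilon> / 2" using C_pos by (simp add: \<delta>_def)
        finally show ?thesis .
      qed
      have "(\<lambda>N. \<psi> (F N)) \<longlonglongrightarrow> 0" using \<psi>f F by (simp add: Hinf_functional_def)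
      then have "\<forall>\<^sub>F N in sequentially. dist (\<psi> (F N)) 0 < \<epsilon> / 2" by (rule tendstoD) (use \<epsilon> in simp)
      then show "\<forall>\<^sub>F N in sequentially. dist (\<phi> (F N)) 0 < \<epsilon>"
      proof (rule eventually_mono)
        fix N assume "dist (\<psi> (F N)) 0 < \<epsilon> / 2"
        then have "cmod (\<psi> (F N)) < \<epsilon> / 2" by simp
        moreover have "cmod (\<phi> (F N)) \<le> cmod (\<phi> (F N) - \<psi> (F N)) + cmod (\<psi> (F N))"
          using norm_triangle_ineq[of "\<phi> (F N) - \<psi> (F N)" "\<psi> (F N)"] by simp
        ultimately show "dist (\<phi> (F N)) 0 < \<epsilon>" using diff[of N] by simp
      qed
    qed
  qed
  then show ?thesis using dual by (simp add: Hinf_dual_def Hinf_functional_def)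
qed

lemma eval_functional_predual:
  fixes Q :: "'d::finite \<Rightarrow> 'h::chilbert_space \<Rightarrow> 'h"
  assumes basis: "operator_space_basis Q" and X: "X \<in> nc_ball Q" "X \<in> tuples n" and \<eta>: "mat_functional n \<eta>"
  shows "(\<lambda>F. \<eta> (F X)) \<in> predual Q"
proof -
  let ?\<phi> = "\<lambda>F. \<eta> (F X)"
  have "1 \<le> n" using X nc_ball_size tuples_unique by metis
  then have ev: "?\<phi> \<in> eval_functionals Q" unfolding eval_functionals_def using X \<eta> by blast
  have dual: "?\<phi> \<in> Hinf_dual Q"
    using eval_functionals_Hinf[OF ev] unfolding Hinf_dual_def Hinf_functional_def by blast
  have span: "?\<phi> \<in> eval_span Q"
    unfolding eval_span_def
    by (rule CollectI, rule exI[of _ 1], rule exI[of _ "\<lambda>_. 1"], rule exI[of _ "\<lambda>_. ?\<phi>"]) (simp add: ev)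
  \<comment> \<open>An evaluation is approximated by itself. That the dual norm of the zero
    functional is \<open>0\<close> requires a nonempty set under the supremum, and the zero
    polynomial is a member.\<close>
  have "Hinf_norm Q (Hinf_poly Q 0) \<le> 1"
  proof (rule Hinf_norm_le[OF basis])
    fix X assume X: "X \<in> nc_ball Q"
    then obtain n where n: "X \<in> tuples n" using nc_ball_size by blast
    have "op_bound n (poly_value 0 X) 0"
    proof -
      have "l2n n (\<lambda>a. \<Sum>b<n. poly_value 0 X $$ (a, b) * v b) = l2n n (\<lambda>_. 0 :: complex)" for v
        using poly_value_zero[OF n] by (intro L2_set_cong) auto
      then show ?thesis unfolding op_bound_def by (simp add: L2_set_def)
    qed
    then have "mat_norm (poly_value 0 X) \<le> 0" by (rule mat_norm_le[OF poly_value_carrier[OF n]]) simp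
    then show "mat_norm (Hinf_poly Q 0 X) \<le> 1" using X by (simp add: Hinf_poly_def)
  qed
  then have "{cmod (?\<phi> F - ?\<phi> F) |F. F \<in> Hinf Q \<and> Hinf_norm Q F \<le> 1} = {0}"
    using Hinf_poly_Hinf[OF basis, of 0] by auto
  then have "Hinf_dual_norm Q (\<lambda>F. ?\<phi> F - ?\<phi> F) = 0"
    unfolding Hinf_dual_norm_def by simp
  then have "\<exists>\<psi>\<in>eval_span Q. Hinf_dual_norm Q (\<lambda>F. ?\<phi> F - \<psi> F) < \<epsilon>" if "\<epsilon> > 0" for \<epsilon>
    using that by (intro bexI[OF _ span]) simp
  then show ?thesis unfolding predual_def using dual by blast
qed

lemma Hinf_functional_Hinf_sum:
  fixes Q :: "'d::finite \<Rightarrow> 'h::chilbert_space \<Rightarrow> 'h"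
  assumes basis: "operator_space_basis Q" and \<phi>: "Hinf_functional Q \<phi>"
  shows "(\<And>l. l < k \<Longrightarrow> f l \<in> Hinf Q) \<Longrightarrow> \<phi> (Hinf_sum Q k f) = (\<Sum>l<k. \<phi> (f l))"
proof (induction k)
  case 0
  \<comment> \<open>The zero function is its own double, so additivity forces the value
    \<open>0\<close> there.\<close>
  have "Hinf_poly Q 0 = Hinf_add Q (Hinf_poly Q 0) (Hinf_poly Q 0)" using Hinf_poly_add[of Q 0 0] by simp
  then have "\<phi> (Hinf_poly Q 0) = \<phi> (Hinf_poly Q 0) + \<phi> (Hinf_poly Q 0)"
    using \<phi> Hinf_poly_Hinf[OF basis, of 0] unfolding Hinf_functional_def by metis
  then show ?case by (simp add: Hinf_sum_0)
next
  case (Suc k)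
  then show ?case
    using \<phi> Hinf_sum_Hinf[OF basis, of k f] by (simp add: Hinf_sum_Suc Hinf_functional_def)
qed

lemma Hinf_null_Hinf_poly:
  fixes Q :: "'d::finite \<Rightarrow> 'h::chilbert_space \<Rightarrow> 'h"
  assumes basis: "operator_space_basis Q" and p: "bp_null Q p" and H: "H \<in> Hinf Q"
  shows "Hinf_null Q (\<lambda>N. Hinf_mult Q H (Hinf_poly Q (p N)))" "Hinf_null Q (\<lambda>N. Hinf_mult Q (Hinf_poly Q (p N)) H)"
proof -
  obtain C where C: "C \<ge> 0" "\<And>N n X. X \<in> nc_ball Q \<Longrightarrow> X \<in> tuples n \<Longrightarrow> op_bound n (poly_value (p N) X) C"
    using p unfolding bp_null_def by blast
  have lim: "(\<lambda>N. poly_value (p N) X $$ (a, b)) \<longlonglongrightarrow> 0" if "X \<in> nc_ball Q" "X \<in> tuples n" "a < n" "b < n" for n X a b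
    using p that unfolding bp_null_def by blast
  obtain E where E: "\<And>X. X \<in> nc_ball Q \<Longrightarrow> mat_norm (H X) \<le> E" using HinfD(5)[OF H] by blast
  have bounds: "mat_norm (H X * poly_value (p N) X) \<le> E * C" "mat_norm (poly_value (p N) X * H X) \<le> E * C"
    if X: "X \<in> nc_ball Q" for X N
  proof -
    obtain n where n: "X \<in> tuples n" using nc_ball_size[OF X] by blast
    note c = HinfD(2)[OF H X n] poly_value_carrier[OF n, of "p N"]
    have le: "mat_norm (poly_value (p N) X) \<le> C" by (rule mat_norm_le[OF c(2) C(2)[OF X n] C(1)])
    have le2: "mat_norm (H X) * mat_norm (poly_value (p N) X) \<le> E * C"
      using le E[OF X] C(1) mat_norm_nonneg[OF c(1)] mat_norm_nonneg[OF c(2)] by (intro mult_mono) auto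
    show "mat_norm (H X * poly_value (p N) X) \<le> E * C" using mat_norm_mult[OF c] le2 by simp
    show "mat_norm (poly_value (p N) X * H X) \<le> E * C"
      using mat_norm_mult[OF c(2,1)] le2 by (simp add: mult.commute)
  qed
  show "Hinf_null Q (\<lambda>N. Hinf_mult Q H (Hinf_poly Q (p N)))"
    unfolding Hinf_null_def
  proof (intro conjI allI impI)
    show "Hinf_mult Q H (Hinf_poly Q (p N)) \<in> Hinf Q" for N by (intro Hinf_mult_Hinf basis H Hinf_poly_Hinf)
    show "\<exists>C. \<forall>N. \<forall>X\<in>nc_ball Q. mat_norm (Hinf_mult Q H (Hinf_poly Q (p N)) X) \<le> C"
      using bounds(1) by (intro exI[of _ "E * C"]) (simp add: Hinf_mult_def Hinf_poly_def)
    fix n X a b assume X: "X \<in> nc_ball Q" "X \<in> tuples n" and ab: "a < n" "b < n"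
    have "(\<lambda>N. \<Sum>c<n. H X $$ (a, c) * poly_value (p N) X $$ (c, b)) \<longlonglongrightarrow> (\<Sum>c<n. H X $$ (a, c) * 0)"
      by (intro tendsto_intros lim[OF X]) (use ab in auto)
    then show "(\<lambda>N. Hinf_mult Q H (Hinf_poly Q (p N)) X $$ (a, b)) \<longlonglongrightarrow> 0"
      using X(1) mat_mult_entry[OF HinfD(2)[OF H X] poly_value_carrier[OF X(2)] ab]
      by (simp add: Hinf_mult_def Hinf_poly_def del: index_mult_mat)
  qed
  show "Hinf_null Q (\<lambda>N. Hinf_mult Q (Hinf_poly Q (p N)) H)"
    unfolding Hinf_null_def
  proof (intro conjI allI impI)
    show "Hinf_mult Q (Hinf_poly Q (p N)) H \<in> Hinf Q" for N by (intro Hinf_mult_Hinf basis H Hinf_poly_Hinf)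
    show "\<exists>C. \<forall>N. \<forall>X\<in>nc_ball Q. mat_norm (Hinf_mult Q (Hinf_poly Q (p N)) H X) \<le> C"
      using bounds(2) by (intro exI[of _ "E * C"]) (simp add: Hinf_mult_def Hinf_poly_def)
    fix n X a b assume X: "X \<in> nc_ball Q" "X \<in> tuples n" and ab: "a < n" "b < n"
    have "(\<lambda>N. \<Sum>c<n. poly_value (p N) X $$ (a, c) * H X $$ (c, b)) \<longlonglongrightarrow> (\<Sum>c<n. 0 * H X $$ (c, b))"
      by (intro tendsto_intros lim[OF X]) (use ab in auto)
    then show "(\<lambda>N. Hinf_mult Q (Hinf_poly Q (p N)) H X $$ (a, b)) \<longlonglongrightarrow> 0"
      using X(1) mat_mult_entry[OF poly_value_carrier[OF X(2)] HinfD(2)[OF H X] ab]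
      by (simp add: Hinf_mult_def Hinf_poly_def del: index_mult_mat)
  qed
qed

lemma bp_functional_of_Hinf_functional:
  fixes Q :: "'d::finite \<Rightarrow> 'h::chilbert_space \<Rightarrow> 'h"
  assumes basis: "operator_space_basis Q" and \<phi>: "Hinf_functional Q \<phi>" and H: "H \<in> Hinf Q"
  shows "bp_functional Q (\<lambda>p. \<phi> (Hinf_mult Q H (Hinf_poly Q p)))" "bp_functional Q (\<lambda>p. \<phi> (Hinf_mult Q (Hinf_poly Q p) H))"
proof -
  note hp = Hinf_poly_Hinf[OF basis]
  have add: "\<phi> (Hinf_add Q F G) = \<phi> F + \<phi> G" if "F \<in> Hinf Q" "G \<in> Hinf Q" for F G
    using \<phi> that by (simp add: Hinf_functional_def)
  have null: "(\<lambda>N. \<phi> (F N)) \<longlonglongrightarrow> 0" if "Hinf_null Q F" for F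
    using \<phi> that by (simp add: Hinf_functional_def)
  show "bp_functional Q (\<lambda>p. \<phi> (Hinf_mult Q H (Hinf_poly Q p)))"
    unfolding bp_functional_def additive_def
    by (simp add: Hinf_poly_add Hinf_mult_add(1)[OF H hp hp] add Hinf_mult_Hinf[OF basis] H hp null[OF Hinf_null_Hinf_poly(1)[OF basis _ H]])
  show "bp_functional Q (\<lambda>p. \<phi> (Hinf_mult Q (Hinf_poly Q p) H))"
    unfolding bp_functional_def additive_def
    by (simp add: Hinf_poly_add Hinf_mult_add(2)[OF H hp hp] add Hinf_mult_Hinf[OF basis] H hp null[OF Hinf_null_Hinf_poly(2)[OF basis _ H]])
qed

section \<open>Cyclicity\<close>

text \<open>Finite-dimensional duality for a subspace, proved by eliminating one coordinate at a
  time. The functions live on the whole type, so equality is claimed on \<open>A\<close>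
  only.\<close>

lemma subspace_contains_of_annihilated:
  fixes R :: "('a \<Rightarrow> complex) set"
  assumes "finite A" and "R \<noteq> {}"
    and "\<And>r s. r \<in> R \<Longrightarrow> s \<in> R \<Longrightarrow> (\<lambda>m. r m + s m) \<in> R"
    and "\<And>c r. r \<in> R \<Longrightarrow> (\<lambda>m. c * r m) \<in> R"
    and "\<And>c. (\<And>r. r \<in> R \<Longrightarrow> (\<Sum>m\<in>A. c m * r m) = 0) \<Longrightarrow> (\<Sum>m\<in>A. c m * b m) = 0"
  shows "\<exists>r\<in>R. \<forall>m\<in>A. r m = b m"
  using assms
proof (induction A arbitrary: R b rule: finite_induct)
  case empty
  then show ?case by auto
next
  case (insert a A)
  note add = insert.prems(2) and scale = insert.prems(3) and ann = insert.prems(4)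
  have neq: "m \<noteq> a" if "m \<in> A" for m using that insert.hyps by auto
  show ?case
  proof (cases "\<forall>r\<in>R. r a = 0")
    case True
    \<comment> \<open>The coordinate functional at \<open>a\<close> annihilates \<open>R\<close>,
      and hence \<open>b\<close>.\<close>
    have "(\<Sum>m\<in>insert a A. delta m a * b m) = 0"
    proof (rule ann)
      fix r assume "r \<in> R"
      have "(\<Sum>m\<in>A. delta m a * r m) = 0" using neq by (intro sum.neutral) auto
      then show "(\<Sum>m\<in>insert a A. delta m a * r m) = 0" using True \<open>r \<in> R\<close> insert.hyps by simp
    qed
    moreover have "(\<Sum>m\<in>A. delta m a * b m) = 0" using neq by (intro sum.neutral) auto
    ultimately have ba: "b a = 0" using insert.hyps by simp
    have "\<exists>r\<in>R. \<forall>m\<in>A. r m = b m"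
    proof (rule insert.IH[OF insert.prems(1) add scale])
      fix c assume c: "\<And>r. r \<in> R \<Longrightarrow> (\<Sum>m\<in>A. c m * r m) = 0"
      have "(\<Sum>m\<in>insert a A. c m * b m) = 0"
        by (rule ann) (use c True insert.hyps in simp)
      then show "(\<Sum>m\<in>A. c m * b m) = 0" using ba insert.hyps by simp
    qed
    then show ?thesis using True ba by auto
  next
    case False
    then obtain r1 where r1: "r1 \<in> R" "r1 a \<noteq> 0" by blast
    define r0 where "r0 m = 1 / r1 a * r1 m" for m
    have "r0 = (\<lambda>m. 1 / r1 a * r1 m)" by (simp add: r0_def fun_eq_iff)
    then have r0: "r0 \<in> R" "r0 a = 1" using scale[OF r1(1), of "1 / r1 a"] r1(2) by simp_all
    define R' where "R' = {r \<in> R. r a = 0}"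
    define b' where "b' m = b m - b a * r0 m" for m
    have proj: "(\<lambda>m. r m + (- r a) * r0 m) \<in> R'" if "r \<in> R" for r
      using add[OF that scale[OF r0(1), of "- r a"]] r0(2) by (simp add: R'_def)
    have "\<exists>r\<in>R'. \<forall>m\<in>A. r m = b' m"
    proof (rule insert.IH)
      show "R' \<noteq> {}" using proj[OF r0(1)] by blast
      show "(\<lambda>m. r m + s m) \<in> R'" if "r \<in> R'" "s \<in> R'" for r s using that add by (simp add: R'_def)
      show "(\<lambda>m. c * r m) \<in> R'" if "r \<in> R'" for c r using that scale by (simp add: R'_def)
      fix c assume c: "\<And>r. r \<in> R' \<Longrightarrow> (\<Sum>m\<in>A. c m * r m) = 0"
      \<comment> \<open>Composes \<open>c\<close> with the projection along \<open>r0\<close> onto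
        the functions vanishing at \<open>a\<close>; an annihilator of \<open>R'\<close> thereby
        becomes an annihilator of \<open>R\<close>.\<close>
      define c' where "c' = c(a := - (\<Sum>m\<in>A. c m * r0 m))"
      have c'A: "(\<Sum>m\<in>A. c' m * x m) = (\<Sum>m\<in>A. c m * x m)" for x
        using neq by (intro sum.cong) (auto simp: c'_def)
      have split: "(\<Sum>m\<in>insert a A. c' m * x m) = (\<Sum>m\<in>A. c m * (x m + (- x a) * r0 m))" for x
      proof -
        have "(\<Sum>m\<in>insert a A. c' m * x m) = - (\<Sum>m\<in>A. c m * r0 m) * x a + (\<Sum>m\<in>A. c m * x m)"
          using insert.hyps by (simp add: c'A) (simp add: c'_def)
        also have "\<dots> = (\<Sum>m\<in>A. c m * (x m + (- x a) * r0 m))"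
          by (simp add: algebra_simps sum_subtractf sum_distrib_left)
        finally show ?thesis .
      qed
      have "(\<Sum>m\<in>insert a A. c' m * b m) = 0"
        by (rule ann) (use split c proj in simp)
      then show "(\<Sum>m\<in>A. c m * b' m) = 0" unfolding split by (simp add: b'_def)
    qed
    then obtain r where r: "r \<in> R'" "\<And>m. m \<in> A \<Longrightarrow> r m = b' m" by blast
    have "(\<lambda>m. r m + b a * r0 m) \<in> R" using r(1) by (intro add scale r0) (simp add: R'_def)
    moreover have "\<forall>m\<in>insert a A. r m + b a * r0 m = b m"
      using r r0(2) by (auto simp: R'_def b'_def)
    ultimately show ?thesis by (intro bexI[where x = "\<lambda>m. r m + b a * r0 m"]) auto
  qed
qed

lemma zero_predual:
  fixes Q :: "'d::finite \<Rightarrow> 'h::chilbert_space \<Rightarrow> 'h"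
  assumes "operator_space_basis Q"
  shows "(\<lambda>F. 0) \<in> predual Q"
proof -
  obtain X where X: "X \<in> nc_ball Q" using nc_ball_nonempty[OF assms] by blast
  then obtain n where n: "X \<in> tuples n" using nc_ball_size by blast
  show ?thesis by (rule eval_functional_predual[OF assms X n, of "\<lambda>A. 0"]) (simp add: mat_functional_def)
qed

lemma MpredualI:
  assumes "\<And>i j. i < k \<Longrightarrow> j < k \<Longrightarrow> \<phi> i j \<in> predual Q"
  shows "(\<lambda>F. \<Sum>i<k. \<Sum>j<k. \<phi> i j (F $$ (i, j))) \<in> Mpredual Q k"
  using assms unfolding Mpredual_def by blast

text \<open>A subbasic set with the full set of values is the whole space, and the zero functional
  shows that there is one.\<close>

lemma topspace_weak_star:
  fixes Q :: "'d::finite \<Rightarrow> 'h::chilbert_space \<Rightarrow> 'h"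
  assumes "operator_space_basis Q"
  shows "topspace (weak_star Q k) = MHinf Q k"
proof -
  have "(\<lambda>F. \<Sum>i<k. \<Sum>j<k. 0) \<in> Mpredual Q k"
    using MpredualI[of k "\<lambda>_ _ _. 0" Q] zero_predual[OF assms] by simp
  then have "{F \<in> MHinf Q k. (\<Sum>i<k. \<Sum>j<k. 0 :: complex) \<in> UNIV}
    \<in> {{F \<in> MHinf Q k. \<Phi> F \<in> U} | \<Phi> U. \<Phi> \<in> Mpredual Q k \<and> open U}" by blast
  then show ?thesis unfolding weak_star_def topology_generated_by_topspace by auto
qed

text \<open>A neighbourhood restricts only finitely many functionals, which brings density questions
  down to finite-dimensional linear algebra.\<close>

lemma weak_star_nbhd:
  assumes "openin (weak_star Q k) U" "F \<in> U"
  obtains A where "finite A" "\<And>\<Phi> V. (\<Phi>, V) \<in> A \<Longrightarrow> \<Phi> \<in> Mpredual Q k \<and> \<Phi> F \<in> V"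
    "\<And>G. G \<in> MHinf Q k \<Longrightarrow> (\<And>\<Phi> V. (\<Phi>, V) \<in> A \<Longrightarrow> \<Phi> G \<in> V) \<Longrightarrow> G \<in> U"
proof -
  let ?S = "{{F \<in> MHinf Q k. \<Phi> F \<in> U} | \<Phi> U. \<Phi> \<in> Mpredual Q k \<and> open U}"
  have "generate_topology_on ?S U"
    using assms(1) unfolding weak_star_def openin_topology_generated_by_iff .
  then have "\<exists>A. finite A \<and> (\<forall>(\<Phi>, V)\<in>A. \<Phi> \<in> Mpredual Q k \<and> \<Phi> F \<in> V) \<and>
      (\<forall>G\<in>MHinf Q k. (\<forall>(\<Phi>, V)\<in>A. \<Phi> G \<in> V) \<longrightarrow> G \<in> U)"
    using assms(2)
  proof (induction U rule: generate_topology_on.induct)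
    case (Int U W)
    then obtain A B where "finite A" "\<forall>(\<Phi>, V)\<in>A. \<Phi> \<in> Mpredual Q k \<and> \<Phi> F \<in> V"
      "\<forall>G\<in>MHinf Q k. (\<forall>(\<Phi>, V)\<in>A. \<Phi> G \<in> V) \<longrightarrow> G \<in> U"
      "finite B" "\<forall>(\<Phi>, V)\<in>B. \<Phi> \<in> Mpredual Q k \<and> \<Phi> F \<in> V"
      "\<forall>G\<in>MHinf Q k. (\<forall>(\<Phi>, V)\<in>B. \<Phi> G \<in> V) \<longrightarrow> G \<in> W" by auto
    then show ?case by (intro exI[of _ "A \<union> B"]) auto
  next
    case (UN K)
    then obtain W where "W \<in> K" "F \<in> W" by blast
    then show ?case using UN.IH by (meson UnionI)
  next
    case (Basis U)
    then obtain \<Phi> V where "U = {F \<in> MHinf Q k. \<Phi> F \<in> V}" "\<Phi> \<in> Mpredual Q k" by blast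
    then show ?case using Basis by (intro exI[of _ "{(\<Phi>, V)}"]) auto
  qed auto
  then obtain A where A: "finite A" "\<forall>(\<Phi>, V)\<in>A. \<Phi> \<in> Mpredual Q k \<and> \<Phi> F \<in> V"
    "\<forall>G\<in>MHinf Q k. (\<forall>(\<Phi>, V)\<in>A. \<Phi> G \<in> V) \<longrightarrow> G \<in> U" by (elim exE conjE)
  show thesis
  proof (rule that[OF A(1)])
    show "\<Phi> \<in> Mpredual Q k \<and> \<Phi> F \<in> V" if "(\<Phi>, V) \<in> A" for \<Phi> V using A(2) that by auto
    fix G assume "G \<in> MHinf Q k" "\<And>\<Phi> V. (\<Phi>, V) \<in> A \<Longrightarrow> \<Phi> G \<in> V"
    then show "G \<in> U" using A(3) by auto
  qed
qed

text \<open>Given finitely many functionals, a member of the ideal is found on which they take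
  exactly the values they take at \<open>F\<close>. The map \<open>mul\<close> stands for
  multiplication by \<open>P\<close> on either side, so that left and right ideals share the
  argument.\<close>

lemma closure_eq_MHinf:
  fixes Q :: "'d::finite \<Rightarrow> 'h::chilbert_space \<Rightarrow> 'h"
  assumes basis: "operator_space_basis Q"
    and mul: "\<And>G. G \<in> MHinf Q k \<Longrightarrow> mul G \<in> MHinf Q k"
    and zero: "G0 \<in> MHinf Q k"
    and add: "\<And>G G'. G \<in> MHinf Q k \<Longrightarrow> G' \<in> MHinf Q k \<Longrightarrow>
      \<exists>G''\<in>MHinf Q k. \<forall>i<k. \<forall>j<k. mul G'' $$ (i, j) = Hinf_add Q (mul G $$ (i, j)) (mul G' $$ (i, j))"
    and scale: "\<And>c G. G \<in> MHinf Q k \<Longrightarrow>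
      \<exists>G''\<in>MHinf Q k. \<forall>i<k. \<forall>j<k. mul G'' $$ (i, j) = Hinf_scale Q c (mul G $$ (i, j))"
    and dense: "\<forall>\<phi>. (\<forall>i<k. \<forall>j<k. Hinf_functional Q (\<phi> i j)) \<longrightarrow>
      (\<forall>G\<in>MHinf Q k. (\<Sum>i<k. \<Sum>j<k. \<phi> i j (mul G $$ (i, j))) = 0) \<longrightarrow>
      (\<forall>i<k. \<forall>j<k. \<forall>H\<in>Hinf Q. \<phi> i j H = 0)"
  shows "weak_star Q k closure_of {mul G | G. G \<in> MHinf Q k} = MHinf Q k"
proof
  show "weak_star Q k closure_of {mul G | G. G \<in> MHinf Q k} \<subseteq> MHinf Q k"
    by (rule closure_of_subset_topspace[of "weak_star Q k", unfolded topspace_weak_star[OF basis]])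
  show "MHinf Q k \<subseteq> weak_star Q k closure_of {mul G | G. G \<in> MHinf Q k}"
  proof
    fix F assume F: "F \<in> MHinf Q k"
    have ent: "M $$ (i, j) \<in> Hinf Q" if "M \<in> MHinf Q k" "i < k" "j < k" for M i j
      using that by (simp add: MHinf_def)
    have "\<exists>y. y \<in> {mul G | G. G \<in> MHinf Q k} \<and> y \<in> U" if U: "F \<in> U" "openin (weak_star Q k) U" for U
    proof -
      show ?thesis
      proof (rule weak_star_nbhd[OF U(2,1)])
        fix A assume A: "finite A" "\<And>\<Phi> V. (\<Phi>, V) \<in> A \<Longrightarrow> \<Phi> \<in> Mpredual Q k \<and> \<Phi> F \<in> V"
          "\<And>G. G \<in> MHinf Q k \<Longrightarrow> (\<And>\<Phi> V. (\<Phi>, V) \<in> A \<Longrightarrow> \<Phi> G \<in> V) \<Longrightarrow> G \<in> U"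
        have "\<forall>x\<in>A. \<exists>\<phi>. (\<forall>i<k. \<forall>j<k. \<phi> i j \<in> predual Q) \<and> fst x = (\<lambda>F. \<Sum>i<k. \<Sum>j<k. \<phi> i j (F $$ (i, j)))"
        proof
          fix x assume "x \<in> A"
          then have "fst x \<in> Mpredual Q k" using A(2)[of "fst x" "snd x"] by simp
          then show "\<exists>\<phi>. (\<forall>i<k. \<forall>j<k. \<phi> i j \<in> predual Q) \<and> fst x = (\<lambda>F. \<Sum>i<k. \<Sum>j<k. \<phi> i j (F $$ (i, j)))"
            unfolding Mpredual_def by blast
        qed
        from bchoice[OF this] obtain \<phi> where \<phi>': "\<forall>x\<in>A. (\<forall>i<k. \<forall>j<k. \<phi> x i j \<in> predual Q) \<and>
            fst x = (\<lambda>F. \<Sum>i<k. \<Sum>j<k. \<phi> x i j (F $$ (i, j)))" by (elim exE)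
        have \<phi>: "\<phi> x i j \<in> predual Q" if "x \<in> A" "i < k" "j < k" for x i j
          using bspec[OF \<phi>' that(1)] that by blast
        have \<phi>_eq: "fst x = (\<lambda>F. \<Sum>i<k. \<Sum>j<k. \<phi> x i j (F $$ (i, j)))" if "x \<in> A" for x
          by (rule conjunct2[OF bspec[OF \<phi>' that]])
        have hf: "Hinf_functional Q (\<phi> x i j)" if "x \<in> A" "i < k" "j < k" for x i j
          using predual_functional[OF basis \<phi>[OF that]] .
        define R where "R = {\<lambda>x. \<Sum>i<k. \<Sum>j<k. \<phi> x i j (mul G $$ (i, j)) | G. G \<in> MHinf Q k}"
        have R_I: "(\<lambda>x. \<Sum>i<k. \<Sum>j<k. \<phi> x i j (mul G $$ (i, j))) \<in> R" if "G \<in> MHinf Q k" for G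
          unfolding R_def by (rule CollectI, rule exI[of _ G]) (simp add: that)
        have R_E: "\<exists>G\<in>MHinf Q k. r = (\<lambda>x. \<Sum>i<k. \<Sum>j<k. \<phi> x i j (mul G $$ (i, j)))" if "r \<in> R" for r
          using that unfolding R_def by auto
        \<comment> \<open>The functionals are known to be linear only for \<open>x\<close> in
          \<open>A\<close>, so the set of value vectors is saturated under agreement on
          \<open>A\<close> before it serves as a subspace.\<close>
        have on_A: "\<exists>r\<in>{r. \<exists>s\<in>R. \<forall>x\<in>A. r x = s x}. \<forall>x\<in>A. r x = fst x F"
        proof (rule subspace_contains_of_annihilated[OF A(1)])
          let ?R = "{r. \<exists>s\<in>R. \<forall>x\<in>A. r x = s x}"
          have "(\<lambda>x. \<Sum>i<k. \<Sum>j<k. \<phi> x i j (mul G0 $$ (i, j))) \<in> ?R"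
            using R_I[OF zero] by (intro CollectI bexI) auto
          then show "?R \<noteq> {}" by (metis empty_iff)
          show "(\<lambda>m. r m + s m) \<in> ?R" if "r \<in> ?R" "s \<in> ?R" for r s
          proof -
            from that[unfolded mem_Collect_eq] obtain r' s'
              where rs': "r' \<in> R" "\<forall>x\<in>A. r x = r' x" "s' \<in> R" "\<forall>x\<in>A. s x = s' x"
              by (elim bexE)
            obtain G where G1: "G \<in> MHinf Q k" "r' = (\<lambda>x. \<Sum>i<k. \<Sum>j<k. \<phi> x i j (mul G $$ (i, j)))"
              using R_E[OF rs'(1)] by blast
            obtain G' where G2: "G' \<in> MHinf Q k" "s' = (\<lambda>x. \<Sum>i<k. \<Sum>j<k. \<phi> x i j (mul G' $$ (i, j)))"
              using R_E[OF rs'(3)] by blast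
            note G = G1(1) G2(1)
            have r: "r x = (\<Sum>i<k. \<Sum>j<k. \<phi> x i j (mul G $$ (i, j)))"
              and s: "s x = (\<Sum>i<k. \<Sum>j<k. \<phi> x i j (mul G' $$ (i, j)))" if "x \<in> A" for x
              using rs' that G1(2) G2(2) by simp_all
            obtain G'' where G'': "G'' \<in> MHinf Q k"
              "\<And>i j. i < k \<Longrightarrow> j < k \<Longrightarrow> mul G'' $$ (i, j) = Hinf_add Q (mul G $$ (i, j)) (mul G' $$ (i, j))"
              using add[OF G] by blast
            have "r x + s x = (\<Sum>i<k. \<Sum>j<k. \<phi> x i j (mul G'' $$ (i, j)))" if "x \<in> A" for x
              unfolding r[OF that] s[OF that] sum.distrib[symmetric]
            proof (intro sum.cong refl)
              fix i j assume "i \<in> {..<k}" "j \<in> {..<k}"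
              then show "\<phi> x i j (mul G $$ (i, j)) + \<phi> x i j (mul G' $$ (i, j)) = \<phi> x i j (mul G'' $$ (i, j))"
                using hf[OF that, of i j] ent[OF mul[OF G(1)]] ent[OF mul[OF G(2)]] G''(2)
                by (simp add: Hinf_functional_def)
            qed
            then show ?thesis by (intro CollectI bexI[OF _ R_I[OF G''(1)]] ballI)
          qed
          show "(\<lambda>m. c * r m) \<in> ?R" if "r \<in> ?R" for c r
          proof -
            from that[unfolded mem_Collect_eq] obtain r' where r': "r' \<in> R" "\<forall>x\<in>A. r x = r' x"
              by (elim bexE)
            obtain G where G: "G \<in> MHinf Q k" and r'_eq: "r' = (\<lambda>x. \<Sum>i<k. \<Sum>j<k. \<phi> x i j (mul G $$ (i, j)))"
              using R_E[OF r'(1)] by blast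
            have r: "r x = (\<Sum>i<k. \<Sum>j<k. \<phi> x i j (mul G $$ (i, j)))" if "x \<in> A" for x
              using r'(2) that r'_eq by simp
            obtain G'' where G'': "G'' \<in> MHinf Q k"
              "\<And>i j. i < k \<Longrightarrow> j < k \<Longrightarrow> mul G'' $$ (i, j) = Hinf_scale Q c (mul G $$ (i, j))"
              using scale[OF G, of c] by blast
            have "c * r x = (\<Sum>i<k. \<Sum>j<k. \<phi> x i j (mul G'' $$ (i, j)))" if "x \<in> A" for x
              unfolding r[OF that] sum_distrib_left
            proof (intro sum.cong refl)
              fix i j assume "i \<in> {..<k}" "j \<in> {..<k}"
              then show "c * \<phi> x i j (mul G $$ (i, j)) = \<phi> x i j (mul G'' $$ (i, j))"
                using hf[OF that, of i j] ent[OF mul[OF G]] G''(2) by (simp add: Hinf_functional_def)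
            qed
            then show ?thesis by (intro CollectI bexI[OF _ R_I[OF G''(1)]] ballI)
          qed
          fix c assume c: "\<And>r. r \<in> ?R \<Longrightarrow> (\<Sum>x\<in>A. c x * r x) = 0"
          \<comment> \<open>A linear combination of the finitely many functionals is itself given by
            a matrix of functionals. If it annihilates the ideal, the density assumption makes it
            vanish at \<open>F\<close>.\<close>
          define \<theta> where "\<theta> i j = (\<lambda>H. \<Sum>x\<in>A. c x * \<phi> x i j H)" for i j
          have swap: "(\<Sum>x\<in>A. c x * (\<Sum>i<k. \<Sum>j<k. \<phi> x i j (M $$ (i, j)))) = (\<Sum>i<k. \<Sum>j<k. \<theta> i j (M $$ (i, j)))" for M
          proof -
            have "(\<Sum>x\<in>A. c x * (\<Sum>i<k. \<Sum>j<k. \<phi> x i j (M $$ (i, j))))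
              = (\<Sum>i<k. \<Sum>x\<in>A. \<Sum>j<k. c x * \<phi> x i j (M $$ (i, j)))"
              unfolding sum_distrib_left by (rule sum.swap)
            also have "\<dots> = (\<Sum>i<k. \<Sum>j<k. \<theta> i j (M $$ (i, j)))"
              unfolding \<theta>_def by (intro sum.cong refl sum.swap)
            finally show ?thesis .
          qed
          have \<theta>: "\<forall>i<k. \<forall>j<k. Hinf_functional Q (\<theta> i j)"
          proof (intro allI impI)
            fix i j assume "i < k" "j < k"
            then show "Hinf_functional Q (\<theta> i j)"
              unfolding \<theta>_def by (intro Hinf_functional_combo A(1) hf)
          qed
          have "\<forall>G\<in>MHinf Q k. (\<Sum>i<k. \<Sum>j<k. \<theta> i j (mul G $$ (i, j))) = 0"
          proof
            fix G assume "G \<in> MHinf Q k"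
            then have "(\<lambda>x. \<Sum>i<k. \<Sum>j<k. \<phi> x i j (mul G $$ (i, j))) \<in> ?R"
              using R_I[OF \<open>G \<in> MHinf Q k\<close>] by (intro CollectI bexI) auto
            from c[OF this] show "(\<Sum>i<k. \<Sum>j<k. \<theta> i j (mul G $$ (i, j))) = 0" by (simp only: swap)
          qed
          from mp[OF mp[OF spec[OF dense, of \<theta>] \<theta>] this]
          have "\<forall>i<k. \<forall>j<k. \<forall>H\<in>Hinf Q. \<theta> i j H = 0" .
          then have "(\<Sum>i<k. \<Sum>j<k. \<theta> i j (F $$ (i, j))) = 0" using ent[OF F] by simp
          moreover have "(\<Sum>x\<in>A. c x * fst x F) = (\<Sum>x\<in>A. c x * (\<Sum>i<k. \<Sum>j<k. \<phi> x i j (F $$ (i, j))))"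
            by (intro sum.cong refl arg_cong2[of _ _ _ _ "(*)"] fun_cong[OF \<phi>_eq])
          ultimately show "(\<Sum>x\<in>A. c x * fst x F) = 0" by (simp only: swap)
        qed
        obtain G where G: "G \<in> MHinf Q k" "\<And>x. x \<in> A \<Longrightarrow> (\<Sum>i<k. \<Sum>j<k. \<phi> x i j (mul G $$ (i, j))) = fst x F"
        proof -
          from on_A obtain r s where "\<forall>x\<in>A. r x = fst x F" "s \<in> R" "\<forall>x\<in>A. r x = s x"
            unfolding mem_Collect_eq by (elim bexE CollectE)
          moreover obtain G where "G \<in> MHinf Q k" "s = (\<lambda>x. \<Sum>i<k. \<Sum>j<k. \<phi> x i j (mul G $$ (i, j)))"
            using R_E[OF \<open>s \<in> R\<close>] by blast
          ultimately show thesis using that by simp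
        qed
        have "mul G \<in> U"
        proof (rule A(3)[OF mul[OF G(1)]])
          fix \<Phi> V assume x: "(\<Phi>, V) \<in> A"
          have "\<Phi> (mul G) = (\<Sum>i<k. \<Sum>j<k. \<phi> (\<Phi>, V) i j (mul G $$ (i, j)))"
            using fun_cong[OF \<phi>_eq[OF x], of "mul G"] by (simp only: fst_conv)
          also have "\<dots> = \<Phi> F" using G(2)[OF x] by (simp only: fst_conv)
          finally have "\<Phi> (mul G) = \<Phi> F" .
          then show "\<Phi> (mul G) \<in> V" using A(2)[OF x] by simp
        qed
        then show ?thesis using G(1) by blast
      qed
    qed
    then show "F \<in> weak_star Q k closure_of {mul G | G. G \<in> MHinf Q k}"
      unfolding in_closure_of topspace_weak_star[OF basis] using F by blast
  qed
qed

section \<open>Matrices over the algebra and their products\<close>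

lemma Hinf_sum_add:
  assumes "\<And>l. l < k \<Longrightarrow> f l \<in> Hinf Q" "\<And>l. l < k \<Longrightarrow> g l \<in> Hinf Q"
  shows "Hinf_sum Q k (\<lambda>l. Hinf_add Q (f l) (g l)) = Hinf_add Q (Hinf_sum Q k f) (Hinf_sum Q k g)"
proof (rule Hinf_eqI[OF Hinf_sum_ext Hinf_add_ext])
  fix n X assume X: "X \<in> nc_ball Q" "X \<in> tuples n"
  have "(\<Sum>l<k. (f l X + g l X) $$ (a, b)) = (\<Sum>l<k. f l X $$ (a, b)) + (\<Sum>l<k. g l X $$ (a, b))"
    if "a < n" "b < n" for a b
    unfolding sum.distrib[symmetric]
  proof (intro sum.cong refl)
    fix l assume "l \<in> {..<k}"
    then have "f l X \<in> carrier_mat n n" "g l X \<in> carrier_mat n n" using assms HinfD(2)[OF _ X] by auto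
    then show "(f l X + g l X) $$ (a, b) = f l X $$ (a, b) + g l X $$ (a, b)" using that by auto
  qed
  then show "Hinf_sum Q k (\<lambda>l. Hinf_add Q (f l) (g l)) X = Hinf_add Q (Hinf_sum Q k f) (Hinf_sum Q k g) X"
    using X by (intro eq_matI) (auto simp: Hinf_sum_def Hinf_add_def tuple_size_eq)
qed

lemma Hinf_sum_scale:
  assumes "\<And>l. l < k \<Longrightarrow> f l \<in> Hinf Q"
  shows "Hinf_sum Q k (\<lambda>l. Hinf_scale Q c (f l)) = Hinf_scale Q c (Hinf_sum Q k f)"
proof (rule Hinf_eqI[OF Hinf_sum_ext Hinf_scale_ext])
  fix n X assume X: "X \<in> nc_ball Q" "X \<in> tuples n"
  have "(\<Sum>l<k. (c \<cdot>\<^sub>m f l X) $$ (a, b)) = c * (\<Sum>l<k. f l X $$ (a, b))" if "a < n" "b < n" for a b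
    unfolding sum_distrib_left
  proof (intro sum.cong refl)
    fix l assume "l \<in> {..<k}"
    then have "f l X \<in> carrier_mat n n" using assms HinfD(2)[OF _ X] by auto
    then show "(c \<cdot>\<^sub>m f l X) $$ (a, b) = c * f l X $$ (a, b)" using that by auto
  qed
  then show "Hinf_sum Q k (\<lambda>l. Hinf_scale Q c (f l)) X = Hinf_scale Q c (Hinf_sum Q k f) X"
    using X by (intro eq_matI) (auto simp: Hinf_sum_def Hinf_scale_def tuple_size_eq)
qed

lemma Hinf_sum_cong:
  "(\<And>l. l < k \<Longrightarrow> f l = g l) \<Longrightarrow> Hinf_sum Q k f = Hinf_sum Q k g"
  by (auto simp: Hinf_sum_def intro!: restrict_ext eq_matI sum.cong)

lemma MHinfI:
  "(\<And>i j. i < k \<Longrightarrow> j < k \<Longrightarrow> f (i, j) \<in> Hinf Q) \<Longrightarrow> Matrix.mat k k f \<in> MHinf Q k"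
  by (simp add: MHinf_def)

lemma MHinf_entry: "F \<in> MHinf Q k \<Longrightarrow> i < k \<Longrightarrow> j < k \<Longrightarrow> F $$ (i, j) \<in> Hinf Q"
  by (simp add: MHinf_def)

lemma MHinf_mult_MHinf:
  fixes Q :: "'d::finite \<Rightarrow> 'h::chilbert_space \<Rightarrow> 'h"
  assumes "operator_space_basis Q" "G \<in> MHinf Q k" "F \<in> MHinf Q k"
  shows "MHinf_mult Q k G F \<in> MHinf Q k"
proof -
  have "MHinf_mult Q k G F $$ (i, j) \<in> Hinf Q" if "i < k" "j < k" for i j
    unfolding MHinf_mult_entry[OF that] using assms that
    by (intro Hinf_sum_Hinf Hinf_mult_Hinf MHinf_entry) auto
  then show ?thesis by (simp add: MHinf_def MHinf_mult_def)
qed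

lemma MHinf_mult_add:
  fixes Q :: "'d::finite \<Rightarrow> 'h::chilbert_space \<Rightarrow> 'h"
  assumes basis: "operator_space_basis Q" and G: "G \<in> MHinf Q k" "G' \<in> MHinf Q k" and F: "F \<in> MHinf Q k"
  defines "G'' \<equiv> Matrix.mat k k (\<lambda>(i, j). Hinf_add Q (G $$ (i, j)) (G' $$ (i, j)))"
  shows "G'' \<in> MHinf Q k"
    and "i < k \<Longrightarrow> j < k \<Longrightarrow> MHinf_mult Q k G'' F $$ (i, j) = Hinf_add Q (MHinf_mult Q k G F $$ (i, j)) (MHinf_mult Q k G' F $$ (i, j))"
    and "i < k \<Longrightarrow> j < k \<Longrightarrow> MHinf_mult Q k F G'' $$ (i, j) = Hinf_add Q (MHinf_mult Q k F G $$ (i, j)) (MHinf_mult Q k F G' $$ (i, j))"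
proof -
  note e = MHinf_entry[OF G(1)] MHinf_entry[OF G(2)] MHinf_entry[OF F]
  show "G'' \<in> MHinf Q k" unfolding G''_def using e by (intro MHinfI) (auto intro: Hinf_add_Hinf[OF basis])
  assume ij: "i < k" "j < k"
  have "Hinf_sum Q k (\<lambda>l. Hinf_mult Q (G'' $$ (i, l)) (F $$ (l, j)))
    = Hinf_sum Q k (\<lambda>l. Hinf_add Q (Hinf_mult Q (G $$ (i, l)) (F $$ (l, j))) (Hinf_mult Q (G' $$ (i, l)) (F $$ (l, j))))"
    using ij e by (intro Hinf_sum_cong) (simp add: G''_def Hinf_mult_add(2))
  then show "MHinf_mult Q k G'' F $$ (i, j) = Hinf_add Q (MHinf_mult Q k G F $$ (i, j)) (MHinf_mult Q k G' F $$ (i, j))"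
    using ij e by (simp add: MHinf_mult_entry Hinf_sum_add Hinf_mult_Hinf[OF basis])
  have "Hinf_sum Q k (\<lambda>l. Hinf_mult Q (F $$ (i, l)) (G'' $$ (l, j)))
    = Hinf_sum Q k (\<lambda>l. Hinf_add Q (Hinf_mult Q (F $$ (i, l)) (G $$ (l, j))) (Hinf_mult Q (F $$ (i, l)) (G' $$ (l, j))))"
    using ij e by (intro Hinf_sum_cong) (simp add: G''_def Hinf_mult_add(1))
  then show "MHinf_mult Q k F G'' $$ (i, j) = Hinf_add Q (MHinf_mult Q k F G $$ (i, j)) (MHinf_mult Q k F G' $$ (i, j))"
    using ij e by (simp add: MHinf_mult_entry Hinf_sum_add Hinf_mult_Hinf[OF basis])
qed

lemma MHinf_mult_scale:
  fixes Q :: "'d::finite \<Rightarrow> 'h::chilbert_space \<Rightarrow> 'h" and c :: complex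
  assumes basis: "operator_space_basis Q" and G: "G \<in> MHinf Q k" and F: "F \<in> MHinf Q k"
  defines "G'' \<equiv> Matrix.mat k k (\<lambda>(i, j). Hinf_scale Q c (G $$ (i, j)))"
  shows "G'' \<in> MHinf Q k"
    and "i < k \<Longrightarrow> j < k \<Longrightarrow> MHinf_mult Q k G'' F $$ (i, j) = Hinf_scale Q c (MHinf_mult Q k G F $$ (i, j))"
    and "i < k \<Longrightarrow> j < k \<Longrightarrow> MHinf_mult Q k F G'' $$ (i, j) = Hinf_scale Q c (MHinf_mult Q k F G $$ (i, j))"
proof -
  note e = MHinf_entry[OF G] MHinf_entry[OF F]
  show "G'' \<in> MHinf Q k" unfolding G''_def using e by (intro MHinfI) (auto intro: Hinf_scale_Hinf[OF basis])
  assume ij: "i < k" "j < k"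
  have "Hinf_sum Q k (\<lambda>l. Hinf_mult Q (G'' $$ (i, l)) (F $$ (l, j)))
    = Hinf_sum Q k (\<lambda>l. Hinf_scale Q c (Hinf_mult Q (G $$ (i, l)) (F $$ (l, j))))"
    using ij e by (intro Hinf_sum_cong) (simp add: G''_def Hinf_mult_scale(2))
  then show "MHinf_mult Q k G'' F $$ (i, j) = Hinf_scale Q c (MHinf_mult Q k G F $$ (i, j))"
    using ij e by (simp add: MHinf_mult_entry Hinf_sum_scale Hinf_mult_Hinf[OF basis])
  have "Hinf_sum Q k (\<lambda>l. Hinf_mult Q (F $$ (i, l)) (G'' $$ (l, j)))
    = Hinf_sum Q k (\<lambda>l. Hinf_scale Q c (Hinf_mult Q (F $$ (i, l)) (G $$ (l, j))))"
    using ij e by (intro Hinf_sum_cong) (simp add: G''_def Hinf_mult_scale(1))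
  then show "MHinf_mult Q k F G'' $$ (i, j) = Hinf_scale Q c (MHinf_mult Q k F G $$ (i, j))"
    using ij e by (simp add: MHinf_mult_entry Hinf_sum_scale Hinf_mult_Hinf[OF basis])
qed

lemma poly_mat_fun_entry:
  "P \<in> carrier_mat k k \<Longrightarrow> i < k \<Longrightarrow> j < k \<Longrightarrow> poly_mat_fun Q P $$ (i, j) = Hinf_poly Q (P $$ (i, j))"
  by (simp add: poly_mat_fun_def Hinf_poly_def)

lemma poly_mat_fun_MHinf:
  fixes Q :: "'d::finite \<Rightarrow> 'h::chilbert_space \<Rightarrow> 'h"
  assumes "operator_space_basis Q" "P \<in> carrier_mat k k"
  shows "poly_mat_fun Q P \<in> MHinf Q k"
  using assms by (auto simp: MHinf_def poly_mat_fun_entry Hinf_poly_Hinf) (simp add: poly_mat_fun_def)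

section \<open>Block matrices, their kernels and stability\<close>

lemma sum_div_mod:
  fixes f :: "nat \<Rightarrow> nat \<Rightarrow> 'a::comm_monoid_add"
  assumes "0 < n"
  shows "(\<Sum>s<k * n. f (s div n) (s mod n)) = (\<Sum>j<k. \<Sum>b<n. f j b)"
proof (induction k)
  case (Suc k)
  have "(\<Sum>s<Suc k * n. f (s div n) (s mod n)) = (\<Sum>s<k * n + n. f (s div n) (s mod n))"
    by (simp add: add.commute)
  also have "\<dots> = (\<Sum>j<k. \<Sum>b<n. f j b) + (\<Sum>b<n. f k b)"
    unfolding sum_lessThan_add Suc using assms by simp
  finally show ?case by simp
qed simp

lemma block_index:
  assumes "i < k" "a < (n::nat)"
  shows "i * n + a < k * n" "(i * n + a) div n = i" "(i * n + a) mod n = a"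
proof -
  have "i * n + a < Suc i * n" using assms by simp
  also have "\<dots> \<le> k * n" using assms by (intro mult_le_mono1) simp
  finally show "i * n + a < k * n" .
qed (use assms in auto)

lemma block_value_carrier: "X \<in> tuples n \<Longrightarrow> block_value k F X \<in> carrier_mat (k * n) (k * n)"
  by (simp add: block_value_def tuple_size_eq)

lemma block_value_mult_vec:
  assumes P: "P \<in> carrier_mat k k" and X: "X \<in> nc_ball Q" "X \<in> tuples n" and v: "v \<in> carrier_vec (k * n)"
    and ia: "i < k" "a < n"
  shows "(block_value k (poly_mat_fun Q P) X *\<^sub>v v) $ (i * n + a)
    = (\<Sum>j<k. \<Sum>b<n. poly_value (P $$ (i, j)) X $$ (a, b) * v $ (j * n + b))"
proof -
  have n: "0 < n" using ia by simp
  have "(block_value k (poly_mat_fun Q P) X *\<^sub>v v) $ (i * n + a)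
    = (\<Sum>s<k * n. poly_value (P $$ (i, s div n)) X $$ (a, s mod n) * v $ (s div n * n + s mod n))"
    using v block_index[OF ia] P X(1) ia
    by (simp add: block_value_def tuple_size_eq[OF X(2)] scalar_prod_def atLeast0LessThan less_mult_imp_div_less
        poly_mat_fun_entry Hinf_poly_def)
  also have "\<dots> = (\<Sum>j<k. \<Sum>b<n. poly_value (P $$ (i, j)) X $$ (a, b) * v $ (j * n + b))"
    by (rule sum_div_mod[OF n])
  finally show ?thesis .
qed

lemma block_value_transpose_mult_vec:
  assumes P: "P \<in> carrier_mat k k" and X: "X \<in> nc_ball Q" "X \<in> tuples n" and v: "v \<in> carrier_vec (k * n)"
    and ia: "i < k" "a < n"
  shows "(transpose_mat (block_value k (poly_mat_fun Q P) X) *\<^sub>v v) $ (i * n + a)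
    = (\<Sum>j<k. \<Sum>b<n. poly_value (P $$ (j, i)) X $$ (b, a) * v $ (j * n + b))"
proof -
  have n: "0 < n" using ia by simp
  have "(transpose_mat (block_value k (poly_mat_fun Q P) X) *\<^sub>v v) $ (i * n + a)
    = (\<Sum>s<k * n. poly_value (P $$ (s div n, i)) X $$ (s mod n, a) * v $ (s div n * n + s mod n))"
    using v block_index[OF ia] P X(1) ia
    by (simp add: block_value_def tuple_size_eq[OF X(2)] scalar_prod_def atLeast0LessThan less_mult_imp_div_less
        poly_mat_fun_entry Hinf_poly_def)
  also have "\<dots> = (\<Sum>j<k. \<Sum>b<n. poly_value (P $$ (j, i)) X $$ (b, a) * v $ (j * n + b))"
    by (rule sum_div_mod[OF n])
  finally show ?thesis .
qed

lemma stable_on_of_Q_stable: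
  assumes P: "P \<in> carrier_mat k k" and stab: "Q_stable Q k (poly_mat_fun Q P)"
  shows "stable_on Q {..<k} (\<lambda>i j. P $$ (i, j))"
  unfolding stable_on_def
proof (intro allI impI ballI)
  fix n X v i a
  assume X: "X \<in> nc_ball Q" "X \<in> tuples n" and ker: "\<forall>i\<in>{..<k}. \<forall>a<n. block_act (\<lambda>i j. P $$ (i, j)) {..<k} n X v i a = 0"
    and ia: "i \<in> {..<k}" "a < n"
  let ?B = "block_value k (poly_mat_fun Q P) X"
  define w where "w = vec (k * n) (\<lambda>r. v (r div n) (r mod n))"
  have w: "w \<in> carrier_vec (k * n)" by (simp add: w_def)
  have w_entry: "w $ (j * n + b) = v j b" if "j < k" "b < n" for j b
    using block_index[OF that] by (simp add: w_def)
  have "?B *\<^sub>v w = 0\<^sub>v (k * n)"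
  proof (rule eq_vecI)
    show "dim_vec (?B *\<^sub>v w) = dim_vec (0\<^sub>v (k * n))" using block_value_carrier[OF X(2), of k] by auto
    fix r assume "r < dim_vec (0\<^sub>v (k * n))"
    then have r: "r < k * n" by simp
    then have n: "0 < n" by (cases n) auto
    have rk: "r div n < k" "r mod n < n" using r n by (auto simp: less_mult_imp_div_less)
    have "(?B *\<^sub>v w) $ (r div n * n + r mod n) = block_act (\<lambda>i j. P $$ (i, j)) {..<k} n X v (r div n) (r mod n)"
      unfolding block_value_mult_vec[OF P X w rk] block_act_def by (simp add: w_entry)
    then show "(?B *\<^sub>v w) $ r = 0\<^sub>v (k * n) $ r" using ker rk r by simp
  qed
  moreover have "det ?B \<noteq> 0" using stab X(1) by (simp add: Q_stable_def)
  ultimately have "w = 0\<^sub>v (k * n)"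
    using det_0_iff_vec_prod_zero[OF block_value_carrier[OF X(2), of k "poly_mat_fun Q P"]] w by blast
  then have "w $ (i * n + a) = 0" using block_index(1)[of i k a n] ia by simp
  then show "v i a = 0" using w_entry ia by simp
qed

lemma Hinf_poly_zero_functional:
  fixes Q :: "'d::finite \<Rightarrow> 'h::chilbert_space \<Rightarrow> 'h"
  assumes "operator_space_basis Q" "Hinf_functional Q \<phi>"
  shows "\<phi> (Hinf_poly Q 0) = 0"
  using Hinf_functional_Hinf_sum[OF assms, of 0] by (simp add: Hinf_sum_0)

text \<open>The functionals are pulled back to polynomials by multiplying with a bounded NC function
  \<open>H\<close> on the side opposite to \<open>P\<close>, where it does not interfere with the
  ideal. Density gives zero for all polynomials, and the polynomial \<open>1\<close> returns the
  value at \<open>H\<close>.\<close>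

lemma left_closure:
  fixes Q :: "'d::finite \<Rightarrow> 'h::chilbert_space \<Rightarrow> 'h"
  assumes basis: "operator_space_basis Q" and P: "P \<in> carrier_mat k k"
    and cyc: "left_dense Q {..<k} (\<lambda>i j. P $$ (i, j))"
  shows "left_cyclic Q k (poly_mat_fun Q P)"
  unfolding left_cyclic_def left_ideal_closure_def
proof (rule closure_eq_MHinf[OF basis, where mul = "\<lambda>G. MHinf_mult Q k G (poly_mat_fun Q P)" and ?G0.0 = "poly_mat_fun Q P"])
  note PM = poly_mat_fun_MHinf[OF basis P] and hp = Hinf_poly_Hinf[OF basis]
  show "MHinf_mult Q k G (poly_mat_fun Q P) \<in> MHinf Q k" if "G \<in> MHinf Q k" for G
    by (rule MHinf_mult_MHinf[OF basis that PM])
  show "poly_mat_fun Q P \<in> MHinf Q k" by (rule PM)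
  show "\<exists>G''\<in>MHinf Q k. \<forall>i<k. \<forall>j<k. MHinf_mult Q k G'' (poly_mat_fun Q P) $$ (i, j)
      = Hinf_add Q (MHinf_mult Q k G (poly_mat_fun Q P) $$ (i, j)) (MHinf_mult Q k G' (poly_mat_fun Q P) $$ (i, j))"
    if "G \<in> MHinf Q k" "G' \<in> MHinf Q k" for G G'
    using MHinf_mult_add(1,2)[OF basis that PM] by blast
  show "\<exists>G''\<in>MHinf Q k. \<forall>i<k. \<forall>j<k. MHinf_mult Q k G'' (poly_mat_fun Q P) $$ (i, j)
      = Hinf_scale Q c (MHinf_mult Q k G (poly_mat_fun Q P) $$ (i, j))"
    if "G \<in> MHinf Q k" for c G
    using MHinf_mult_scale(1,2)[OF basis that PM] by blast
  show "\<forall>\<phi>. (\<forall>i<k. \<forall>j<k. Hinf_functional Q (\<phi> i j)) \<longrightarrow>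
      (\<forall>G\<in>MHinf Q k. (\<Sum>i<k. \<Sum>j<k. \<phi> i j (MHinf_mult Q k G (poly_mat_fun Q P) $$ (i, j))) = 0) \<longrightarrow>
      (\<forall>i<k. \<forall>j<k. \<forall>H\<in>Hinf Q. \<phi> i j H = 0)"
  proof (rule allI, rule impI, rule impI)
    fix \<phi> :: "nat \<Rightarrow> nat \<Rightarrow> 'd ncfun \<Rightarrow> complex"
    assume \<phi>': "\<forall>i<k. \<forall>j<k. Hinf_functional Q (\<phi> i j)"
      and zero': "\<forall>G\<in>MHinf Q k. (\<Sum>i<k. \<Sum>j<k. \<phi> i j (MHinf_mult Q k G (poly_mat_fun Q P) $$ (i, j))) = 0"
    have \<phi>: "Hinf_functional Q (\<phi> i j)" if "i < k" "j < k" for i j using \<phi>' that by blast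
    have zero: "(\<Sum>i<k. \<Sum>j<k. \<phi> i j (MHinf_mult Q k G (poly_mat_fun Q P) $$ (i, j))) = 0" if "G \<in> MHinf Q k" for G
      using zero' that by blast
    have "\<phi> i0 j0 H = 0" if ij: "i0 < k" "j0 < k" and H: "H \<in> Hinf Q" for i0 j0 H
    proof -
    have bp: "bp_functional Q (\<lambda>p. \<phi> i0 j (Hinf_mult Q H (Hinf_poly Q p)))" if "j < k" for j
      by (rule bp_functional_of_Hinf_functional(1)[OF basis \<phi>[OF ij(1) that] H])
    have "\<phi> i0 j0 (Hinf_mult Q H (Hinf_poly Q 1)) = 0"
    proof (rule left_denseD[OF cyc, of "\<lambda>j p. \<phi> i0 j (Hinf_mult Q H (Hinf_poly Q p))"])
      fix g :: "nat \<Rightarrow> 'd ncpoly"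
      \<comment> \<open>Only row \<open>i0\<close> is nonzero and equals \<open>H g\<close>, so that
        row \<open>i0\<close> of the product is \<open>H\<close> times the polynomial row
        \<open>g P\<close>.\<close>
      define G where "G = Matrix.mat k k (\<lambda>(i, l). if i = i0 then Hinf_mult Q H (Hinf_poly Q (g l)) else Hinf_poly Q 0)"
      have G: "G \<in> MHinf Q k"
        unfolding G_def by (rule MHinfI) (simp add: hp Hinf_mult_Hinf[OF basis H hp])
      have entry_eq: "\<phi> i j (MHinf_mult Q k G (poly_mat_fun Q P) $$ (i, j))
        = (if i = i0 then \<phi> i0 j (Hinf_mult Q H (Hinf_poly Q (\<Sum>l<k. g l * P $$ (l, j)))) else 0)" if "i < k" "j < k" for i j
      proof -
        have "\<phi> i j (MHinf_mult Q k G (poly_mat_fun Q P) $$ (i, j))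
          = (\<Sum>l<k. \<phi> i j (Hinf_mult Q (G $$ (i, l)) (Hinf_poly Q (P $$ (l, j)))))"
          unfolding MHinf_mult_entry[OF that]
          by (subst Hinf_functional_Hinf_sum[OF basis \<phi>[OF that]])
            (use that in \<open>auto simp: poly_mat_fun_entry[OF P] intro!: Hinf_mult_Hinf[OF basis] hp MHinf_entry[OF G]\<close>)
        also have "\<dots> = (if i = i0 then \<phi> i0 j (Hinf_mult Q H (Hinf_poly Q (\<Sum>l<k. g l * P $$ (l, j)))) else 0)"
        proof (cases "i = i0")
          case True
          have "(\<Sum>l<k. \<phi> i j (Hinf_mult Q (G $$ (i, l)) (Hinf_poly Q (P $$ (l, j)))))
            = (\<Sum>l<k. \<phi> i0 j (Hinf_mult Q H (Hinf_poly Q (g l * P $$ (l, j)))))"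
            using True that by (intro sum.cong refl) (simp add: G_def Hinf_mult_assoc[OF H hp hp] Hinf_mult_Hinf_poly)
          then show ?thesis
            using True additive.sum[OF bp_functional_additive[OF bp[OF that(2)]], of "\<lambda>l. g l * P $$ (l, j)" "{..<k}"] by simp
        next
          case False
          then show ?thesis
            using that by (simp add: G_def Hinf_mult_Hinf_poly Hinf_poly_zero_functional[OF basis \<phi>])
        qed
        finally show ?thesis .
      qed
      have "0 = (\<Sum>i<k. \<Sum>j<k. \<phi> i j (MHinf_mult Q k G (poly_mat_fun Q P) $$ (i, j)))"
        by (rule zero[OF G, symmetric])
      also have "\<dots> = (\<Sum>i<k. if i = i0 then (\<Sum>j<k. \<phi> i0 j (Hinf_mult Q H (Hinf_poly Q (\<Sum>l<k. g l * P $$ (l, j))))) else 0)"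
        by (intro sum.cong refl) (auto simp: entry_eq)
      also have "\<dots> = (\<Sum>j<k. \<phi> i0 j (Hinf_mult Q H (Hinf_poly Q (\<Sum>l<k. g l * P $$ (l, j)))))" using ij by simp
      finally show "(\<Sum>j<k. \<phi> i0 j (Hinf_mult Q H (Hinf_poly Q (\<Sum>l<k. g l * P $$ (l, j))))) = 0" by simp
    qed (use ij bp in auto)
    then show "\<phi> i0 j0 H = 0" by (simp add: Hinf_mult_one[OF H])
    qed
    then show "\<forall>i<k. \<forall>j<k. \<forall>H\<in>Hinf Q. \<phi> i j H = 0" by blast
  qed
qed

lemma right_closure:
  fixes Q :: "'d::finite \<Rightarrow> 'h::chilbert_space \<Rightarrow> 'h"
  assumes basis: "operator_space_basis Q" and P: "P \<in> carrier_mat k k"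
    and cyc: "right_dense Q {..<k} (\<lambda>i j. P $$ (i, j))"
  shows "right_cyclic Q k (poly_mat_fun Q P)"
  unfolding right_cyclic_def right_ideal_closure_def
proof (rule closure_eq_MHinf[OF basis, where mul = "\<lambda>G. MHinf_mult Q k (poly_mat_fun Q P) G" and ?G0.0 = "poly_mat_fun Q P"])
  note PM = poly_mat_fun_MHinf[OF basis P] and hp = Hinf_poly_Hinf[OF basis]
  show "MHinf_mult Q k (poly_mat_fun Q P) G \<in> MHinf Q k" if "G \<in> MHinf Q k" for G
    by (rule MHinf_mult_MHinf[OF basis PM that])
  show "poly_mat_fun Q P \<in> MHinf Q k" by (rule PM)
  show "\<exists>G''\<in>MHinf Q k. \<forall>i<k. \<forall>j<k. MHinf_mult Q k (poly_mat_fun Q P) G'' $$ (i, j)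
      = Hinf_add Q (MHinf_mult Q k (poly_mat_fun Q P) G $$ (i, j)) (MHinf_mult Q k (poly_mat_fun Q P) G' $$ (i, j))"
    if "G \<in> MHinf Q k" "G' \<in> MHinf Q k" for G G'
    using MHinf_mult_add(1,3)[OF basis that PM] by blast
  show "\<exists>G''\<in>MHinf Q k. \<forall>i<k. \<forall>j<k. MHinf_mult Q k (poly_mat_fun Q P) G'' $$ (i, j)
      = Hinf_scale Q c (MHinf_mult Q k (poly_mat_fun Q P) G $$ (i, j))"
    if "G \<in> MHinf Q k" for c G
    using MHinf_mult_scale(1,3)[OF basis that PM] by blast
  show "\<forall>\<phi>. (\<forall>i<k. \<forall>j<k. Hinf_functional Q (\<phi> i j)) \<longrightarrow>
      (\<forall>G\<in>MHinf Q k. (\<Sum>i<k. \<Sum>j<k. \<phi> i j (MHinf_mult Q k (poly_mat_fun Q P) G $$ (i, j))) = 0) \<longrightarrow>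
      (\<forall>i<k. \<forall>j<k. \<forall>H\<in>Hinf Q. \<phi> i j H = 0)"
  proof (rule allI, rule impI, rule impI)
    fix \<phi> :: "nat \<Rightarrow> nat \<Rightarrow> 'd ncfun \<Rightarrow> complex"
    assume \<phi>': "\<forall>i<k. \<forall>j<k. Hinf_functional Q (\<phi> i j)"
      and zero': "\<forall>G\<in>MHinf Q k. (\<Sum>i<k. \<Sum>j<k. \<phi> i j (MHinf_mult Q k (poly_mat_fun Q P) G $$ (i, j))) = 0"
    have \<phi>: "Hinf_functional Q (\<phi> i j)" if "i < k" "j < k" for i j using \<phi>' that by blast
    have zero: "(\<Sum>i<k. \<Sum>j<k. \<phi> i j (MHinf_mult Q k (poly_mat_fun Q P) G $$ (i, j))) = 0" if "G \<in> MHinf Q k" for G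
      using zero' that by blast
    have "\<phi> i0 j0 H = 0" if ij: "i0 < k" "j0 < k" and H: "H \<in> Hinf Q" for i0 j0 H
    proof -
    have bp: "bp_functional Q (\<lambda>p. \<phi> i j0 (Hinf_mult Q (Hinf_poly Q p) H))" if "i < k" for i
      by (rule bp_functional_of_Hinf_functional(2)[OF basis \<phi>[OF that ij(2)] H])
    have "\<phi> i0 j0 (Hinf_mult Q (Hinf_poly Q 1) H) = 0"
    proof (rule right_denseD[OF cyc, of "\<lambda>i p. \<phi> i j0 (Hinf_mult Q (Hinf_poly Q p) H)"])
      fix g :: "nat \<Rightarrow> 'd ncpoly"
      \<comment> \<open>For right ideals a single column \<open>g H\<close> is placed at
        \<open>j0\<close>, with \<open>H\<close> now on the right.\<close>
      define G where "G = Matrix.mat k k (\<lambda>(l, j). if j = j0 then Hinf_mult Q (Hinf_poly Q (g l)) H else Hinf_poly Q 0)"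
      have G: "G \<in> MHinf Q k"
        unfolding G_def by (rule MHinfI) (simp add: hp Hinf_mult_Hinf[OF basis hp H])
      have entry_eq: "\<phi> i j (MHinf_mult Q k (poly_mat_fun Q P) G $$ (i, j))
        = (if j = j0 then \<phi> i j0 (Hinf_mult Q (Hinf_poly Q (\<Sum>l<k. P $$ (i, l) * g l)) H) else 0)" if "i < k" "j < k" for i j
      proof -
        have "\<phi> i j (MHinf_mult Q k (poly_mat_fun Q P) G $$ (i, j))
          = (\<Sum>l<k. \<phi> i j (Hinf_mult Q (Hinf_poly Q (P $$ (i, l))) (G $$ (l, j))))"
          unfolding MHinf_mult_entry[OF that]
          by (subst Hinf_functional_Hinf_sum[OF basis \<phi>[OF that]])
            (use that in \<open>auto simp: poly_mat_fun_entry[OF P] intro!: Hinf_mult_Hinf[OF basis] hp MHinf_entry[OF G]\<close>)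
        also have "\<dots> = (if j = j0 then \<phi> i j0 (Hinf_mult Q (Hinf_poly Q (\<Sum>l<k. P $$ (i, l) * g l)) H) else 0)"
        proof (cases "j = j0")
          case True
          have "(\<Sum>l<k. \<phi> i j (Hinf_mult Q (Hinf_poly Q (P $$ (i, l))) (G $$ (l, j))))
            = (\<Sum>l<k. \<phi> i j0 (Hinf_mult Q (Hinf_poly Q (P $$ (i, l) * g l)) H))"
            using True that
            by (intro sum.cong refl) (simp add: G_def Hinf_mult_assoc[OF hp hp H, symmetric] Hinf_mult_Hinf_poly)
          then show ?thesis
            using True additive.sum[OF bp_functional_additive[OF bp[OF that(1)]], of "\<lambda>l. P $$ (i, l) * g l" "{..<k}"] by simp
        next
          case False
          then show ?thesis
            using that by (simp add: G_def Hinf_mult_Hinf_poly Hinf_poly_zero_functional[OF basis \<phi>])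
        qed
        finally show ?thesis .
      qed
      have "0 = (\<Sum>i<k. \<Sum>j<k. \<phi> i j (MHinf_mult Q k (poly_mat_fun Q P) G $$ (i, j)))"
        by (rule zero[OF G, symmetric])
      also have "\<dots> = (\<Sum>i<k. \<Sum>j<k. if j = j0 then \<phi> i j0 (Hinf_mult Q (Hinf_poly Q (\<Sum>l<k. P $$ (i, l) * g l)) H) else 0)"
        by (intro sum.cong refl) (auto simp: entry_eq)
      also have "\<dots> = (\<Sum>i<k. \<phi> i j0 (Hinf_mult Q (Hinf_poly Q (\<Sum>l<k. P $$ (i, l) * g l)) H))" using ij by simp
      finally show "(\<Sum>i<k. \<phi> i j0 (Hinf_mult Q (Hinf_poly Q (\<Sum>l<k. P $$ (i, l) * g l)) H)) = 0" by simp
    qed (use ij bp in auto)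
    then show "\<phi> i0 j0 H = 0" by (simp add: Hinf_mult_one[OF H])
    qed
    then show "\<forall>i<k. \<forall>j<k. \<forall>H\<in>Hinf Q. \<phi> i j H = 0" by blast
  qed
qed

section \<open>Singular points obstruct cyclicity\<close>

lemma closure_neq_MHinf:
  fixes Q :: "'d::finite \<Rightarrow> 'h::chilbert_space \<Rightarrow> 'h"
  assumes basis: "operator_space_basis Q"
    and \<phi>: "\<And>i j. i < k \<Longrightarrow> j < k \<Longrightarrow> \<phi> i j \<in> predual Q"
    and ann: "\<And>F. F \<in> S \<Longrightarrow> (\<Sum>i<k. \<Sum>j<k. \<phi> i j (F $$ (i, j))) = 0"
    and J: "J \<in> MHinf Q k" "(\<Sum>i<k. \<Sum>j<k. \<phi> i j (J $$ (i, j))) \<noteq> 0"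
  shows "weak_star Q k closure_of S \<noteq> MHinf Q k"
proof
  assume eq: "weak_star Q k closure_of S = MHinf Q k"
  define \<Phi> where "\<Phi> = (\<lambda>F. \<Sum>i<k. \<Sum>j<k. \<phi> i j (F $$ (i, j)))"
  define U where "U = {F \<in> MHinf Q k. \<Phi> F \<in> - {0}}"
  have "\<Phi> \<in> Mpredual Q k" unfolding \<Phi>_def by (rule MpredualI[OF \<phi>])
  moreover have "open (- {0 :: complex})" by (simp add: open_Compl)
  ultimately have "U \<in> {{F \<in> MHinf Q k. \<Phi> F \<in> U} | \<Phi> U. \<Phi> \<in> Mpredual Q k \<and> open U}"
    unfolding U_def by blast
  then have "openin (weak_star Q k) U"
    unfolding weak_star_def by (rule topology_generated_by_Basis)
  moreover have "J \<in> U" using J by (simp add: U_def \<Phi>_def)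
  moreover have "J \<in> weak_star Q k closure_of S" using eq J(1) by simp
  ultimately obtain F where "F \<in> S" "F \<in> U" unfolding in_closure_of by blast
  then show False using ann by (simp add: U_def \<Phi>_def)
qed

definition unit_mat :: "('d::finite \<Rightarrow> 'h::chilbert_space \<Rightarrow> 'h) \<Rightarrow> nat \<Rightarrow> 'd ncfun mat" where
  "unit_mat Q k = Matrix.mat k k (\<lambda>(i, j). Hinf_poly Q (delta i j))"

lemma unit_mat_value:
  assumes "X \<in> nc_ball Q" "X \<in> tuples n" "i < k" "j < k" "a < n" "b < n"
  shows "(unit_mat Q k $$ (i, j)) X $$ (a, b) = delta i j * delta a b"
  using assms by (auto simp: unit_mat_def Hinf_poly_def poly_value_one poly_value_zero)

lemma MHinf_mult_value:
  assumes "G \<in> MHinf Q k" "F \<in> MHinf Q k" and X: "X \<in> nc_ball Q" "X \<in> tuples n" and ij: "i < k" "j < k" and ab: "a < n" "b < n"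
  shows "(MHinf_mult Q k G F $$ (i, j)) X $$ (a, b)
    = (\<Sum>l<k. \<Sum>c<n. (G $$ (i, l)) X $$ (a, c) * (F $$ (l, j)) X $$ (c, b))"
proof -
  have "(MHinf_mult Q k G F $$ (i, j)) X $$ (a, b) = (\<Sum>l<k. ((G $$ (i, l)) X * (F $$ (l, j)) X) $$ (a, b))"
    using X ij ab by (simp add: MHinf_mult_def tuple_size_eq del: index_mult_mat)
  also have "\<dots> = (\<Sum>l<k. \<Sum>c<n. (G $$ (i, l)) X $$ (a, c) * (F $$ (l, j)) X $$ (c, b))"
    using assms by (intro sum.cong refl mat_mult_entry HinfD(2)[OF MHinf_entry]) auto
  finally show ?thesis .
qed

lemma sum_double_delta:
  fixes w :: "nat \<Rightarrow> nat \<Rightarrow> complex"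
  assumes "i0 < k" "a0 < n"
  shows "(\<Sum>j<k. \<Sum>b<n. delta i0 j * delta a0 b * w j b) = w i0 a0"
proof -
  have "(\<Sum>b<n. delta i0 j * delta a0 b * w j b) = (if j = i0 then w i0 a0 else 0)" for j
  proof -
    have "(\<Sum>b<n. delta i0 j * delta a0 b * w j b) = (\<Sum>b<n. if b = a0 then delta i0 j * w j a0 else 0)"
      by (intro sum.cong) auto
    then show ?thesis using assms by auto
  qed
  then show ?thesis using assms by simp
qed

lemma vec_nonzero_block:
  assumes "v \<in> carrier_vec (k * n)" "v \<noteq> 0\<^sub>v (k * n)"
  obtains i a where "i < k" "a < (n::nat)" "v $ (i * n + a) \<noteq> (0 :: complex)"
proof -
  obtain r where r: "r < k * n" "v $ r \<noteq> 0" using assms by (metis carrier_vecD eq_vecI index_zero_vec)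
  then have n: "0 < n" by (cases n) auto
  show thesis by (rule that[of "r div n" "r mod n"]) (use r n in \<open>auto simp: less_mult_imp_div_less\<close>)
qed

lemma stable_of_left_cyclic:
  fixes Q :: "'d::finite \<Rightarrow> 'h::chilbert_space \<Rightarrow> 'h"
  assumes basis: "operator_space_basis Q" and P: "P \<in> carrier_mat k k"
    and cyc: "left_cyclic Q k (poly_mat_fun Q P)"
  shows "Q_stable Q k (poly_mat_fun Q P)"
proof (rule ccontr)
  assume "\<not> ?thesis"
  then obtain X where X: "X \<in> nc_ball Q" and det: "det (block_value k (poly_mat_fun Q P) X) = 0"
    by (auto simp: Q_stable_def)
  obtain n where n: "X \<in> tuples n" using nc_ball_size[OF X] by blast
  note PM = poly_mat_fun_MHinf[OF basis P]
  obtain v where v: "v \<in> carrier_vec (k * n)" "v \<noteq> 0\<^sub>v (k * n)"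
    and ker: "block_value k (poly_mat_fun Q P) X *\<^sub>v v = 0\<^sub>v (k * n)"
    using det_0_iff_vec_prod_zero[OF block_value_carrier[OF n]] det by blast
  define w where "w j b = v $ (j * n + b)" for j b
  obtain i0 a0 where i0: "i0 < k" "a0 < n" "w i0 a0 \<noteq> 0" unfolding w_def using vec_nonzero_block[OF v] by blast
  have ker: "(\<Sum>j<k. \<Sum>b<n. poly_value (P $$ (l, j)) X $$ (c, b) * w j b) = 0" if "l < k" "c < n" for l c
    using block_value_mult_vec[OF P X n v(1) that] block_index(1)[OF that] unfolding ker w_def by simp
  \<comment> \<open>Together these read off the component \<open>(i0, a0)\<close> of
    \<open>F(X) v\<close>. The position is one at which the kernel vector is nonzero, so the unit
    receives the value \<open>w i0 a0\<close>.\<close>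
  define \<phi> where "\<phi> i j = (\<lambda>F :: 'd ncfun. if i = i0 then \<Sum>b<n. F X $$ (a0, b) * w j b else 0)" for i j :: nat
  have "weak_star Q k closure_of {MHinf_mult Q k G (poly_mat_fun Q P) | G. G \<in> MHinf Q k} \<noteq> MHinf Q k"
  proof (rule closure_neq_MHinf[OF basis, where \<phi> = \<phi> and J = "unit_mat Q k"])
    show "\<phi> i j \<in> predual Q" for i j
      unfolding \<phi>_def
      by (rule eval_functional_predual[OF basis X n, of "\<lambda>A. if i = i0 then \<Sum>b<n. A $$ (a0, b) * w j b else 0"])
        (use i0 in \<open>auto simp: mat_functional_def sum.distrib sum_distrib_left algebra_simps\<close>)
    show "unit_mat Q k \<in> MHinf Q k"
      unfolding unit_mat_def by (rule MHinfI) (simp add: Hinf_poly_Hinf[OF basis])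
    have red: "(\<Sum>i<k. \<Sum>j<k. \<phi> i j (F $$ (i, j))) = (\<Sum>j<k. \<Sum>b<n. (F $$ (i0, j)) X $$ (a0, b) * w j b)" for F
    proof -
      have "(\<Sum>i<k. \<Sum>j<k. \<phi> i j (F $$ (i, j)))
        = (\<Sum>i<k. if i = i0 then \<Sum>j<k. \<Sum>b<n. (F $$ (i0, j)) X $$ (a0, b) * w j b else 0)"
        by (intro sum.cong refl) (auto simp: \<phi>_def)
      then show ?thesis using i0 by simp
    qed
    have "(\<Sum>j<k. \<Sum>b<n. (unit_mat Q k $$ (i0, j)) X $$ (a0, b) * w j b) = (\<Sum>j<k. \<Sum>b<n. delta i0 j * delta a0 b * w j b)"
      using i0 by (intro sum.cong refl) (auto simp: unit_mat_value[OF X n])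
    then show "(\<Sum>i<k. \<Sum>j<k. \<phi> i j (unit_mat Q k $$ (i, j))) \<noteq> 0"
      unfolding red using i0 sum_double_delta[OF i0(1,2), of w] by simp
    fix F assume "F \<in> {MHinf_mult Q k G (poly_mat_fun Q P) | G. G \<in> MHinf Q k}"
    then obtain G where G: "G \<in> MHinf Q k" and F: "F = MHinf_mult Q k G (poly_mat_fun Q P)" by blast
    define g where "g l c = (G $$ (i0, l)) X $$ (a0, c)" for l c
    have "(\<Sum>j<k. \<Sum>b<n. (F $$ (i0, j)) X $$ (a0, b) * w j b)
      = (\<Sum>j<k. \<Sum>b<n. \<Sum>l<k. \<Sum>c<n. g l c * (poly_value (P $$ (l, j)) X $$ (c, b) * w j b))"
      using i0 X by (intro sum.cong refl)
        (simp add: F g_def MHinf_mult_value[OF G PM X n] poly_mat_fun_entry[OF P] Hinf_poly_def sum_distrib_right mult.assoc)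
    also have "\<dots> = (\<Sum>j<k. \<Sum>l<k. \<Sum>b<n. \<Sum>c<n. g l c * (poly_value (P $$ (l, j)) X $$ (c, b) * w j b))"
      by (intro sum.cong refl sum.swap)
    also have "\<dots> = (\<Sum>l<k. \<Sum>j<k. \<Sum>b<n. \<Sum>c<n. g l c * (poly_value (P $$ (l, j)) X $$ (c, b) * w j b))"
      by (rule sum.swap)
    also have "\<dots> = (\<Sum>l<k. \<Sum>j<k. \<Sum>c<n. \<Sum>b<n. g l c * (poly_value (P $$ (l, j)) X $$ (c, b) * w j b))"
      by (intro sum.cong refl sum.swap)
    also have "\<dots> = (\<Sum>l<k. \<Sum>c<n. \<Sum>j<k. \<Sum>b<n. g l c * (poly_value (P $$ (l, j)) X $$ (c, b) * w j b))"
      by (intro sum.cong refl sum.swap)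
    also have "\<dots> = 0" using ker by (simp add: sum_distrib_left[symmetric])
    finally show "(\<Sum>i<k. \<Sum>j<k. \<phi> i j (F $$ (i, j))) = 0" unfolding red .
  qed
  then show False using cyc by (simp add: left_cyclic_def left_ideal_closure_def)
qed

lemma stable_of_right_cyclic:
  fixes Q :: "'d::finite \<Rightarrow> 'h::chilbert_space \<Rightarrow> 'h"
  assumes basis: "operator_space_basis Q" and P: "P \<in> carrier_mat k k"
    and cyc: "right_cyclic Q k (poly_mat_fun Q P)"
  shows "Q_stable Q k (poly_mat_fun Q P)"
proof (rule ccontr)
  assume "\<not> ?thesis"
  then obtain X where X: "X \<in> nc_ball Q" and det: "det (block_value k (poly_mat_fun Q P) X) = 0"
    by (auto simp: Q_stable_def)
  obtain n where n: "X \<in> tuples n" using nc_ball_size[OF X] by blast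
  note PM = poly_mat_fun_MHinf[OF basis P] and bc = block_value_carrier[OF n, of k "poly_mat_fun Q P"]
  \<comment> \<open>A right ideal is detected by a vector that annihilates \<open>P(X)\<close> from
    the left, that is, by a kernel vector of the transpose.\<close>
  have "det (transpose_mat (block_value k (poly_mat_fun Q P) X)) = 0" using det det_transpose[OF bc] by simp
  moreover have "transpose_mat (block_value k (poly_mat_fun Q P) X) \<in> carrier_mat (k * n) (k * n)" using bc by simp
  ultimately obtain v where v: "v \<in> carrier_vec (k * n)" "v \<noteq> 0\<^sub>v (k * n)"
    and ker: "transpose_mat (block_value k (poly_mat_fun Q P) X) *\<^sub>v v = 0\<^sub>v (k * n)"
    using det_0_iff_vec_prod_zero by blast
  define w where "w j b = v $ (j * n + b)" for j b
  obtain i0 a0 where i0: "i0 < k" "a0 < n" "w i0 a0 \<noteq> 0" unfolding w_def using vec_nonzero_block[OF v] by blast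
  have ker: "(\<Sum>i<k. \<Sum>a<n. poly_value (P $$ (i, l)) X $$ (a, c) * w i a) = 0" if "l < k" "c < n" for l c
    using block_value_transpose_mult_vec[OF P X n v(1) that] block_index(1)[OF that] unfolding ker w_def by simp
  \<comment> \<open>Together these pair the vector with the column \<open>(i0, a0)\<close> of
    \<open>F(X)\<close>, on which the factor \<open>P(X)\<close> acts from the left.\<close>
  define \<phi> where "\<phi> i j = (\<lambda>F :: 'd ncfun. if j = i0 then \<Sum>a<n. F X $$ (a, a0) * w i a else 0)" for i j :: nat
  have "weak_star Q k closure_of {MHinf_mult Q k (poly_mat_fun Q P) G | G. G \<in> MHinf Q k} \<noteq> MHinf Q k"
  proof (rule closure_neq_MHinf[OF basis, where \<phi> = \<phi> and J = "unit_mat Q k"])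
    show "\<phi> i j \<in> predual Q" for i j
      unfolding \<phi>_def
      by (rule eval_functional_predual[OF basis X n, of "\<lambda>A. if j = i0 then \<Sum>a<n. A $$ (a, a0) * w i a else 0"])
        (use i0 in \<open>auto simp: mat_functional_def sum.distrib sum_distrib_left algebra_simps\<close>)
    show "unit_mat Q k \<in> MHinf Q k"
      unfolding unit_mat_def by (rule MHinfI) (simp add: Hinf_poly_Hinf[OF basis])
    have red: "(\<Sum>i<k. \<Sum>j<k. \<phi> i j (F $$ (i, j))) = (\<Sum>i<k. \<Sum>a<n. (F $$ (i, i0)) X $$ (a, a0) * w i a)" for F
    proof -
      have "(\<Sum>i<k. \<Sum>j<k. \<phi> i j (F $$ (i, j)))
        = (\<Sum>i<k. \<Sum>j<k. if j = i0 then \<Sum>a<n. (F $$ (i, i0)) X $$ (a, a0) * w i a else 0)"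
        by (intro sum.cong refl) (auto simp: \<phi>_def)
      then show ?thesis using i0 by simp
    qed
    have "(\<Sum>i<k. \<Sum>a<n. (unit_mat Q k $$ (i, i0)) X $$ (a, a0) * w i a) = (\<Sum>i<k. \<Sum>a<n. delta i0 i * delta a0 a * w i a)"
      using i0 by (intro sum.cong refl) (auto simp: unit_mat_value[OF X n])
    then show "(\<Sum>i<k. \<Sum>j<k. \<phi> i j (unit_mat Q k $$ (i, j))) \<noteq> 0"
      unfolding red using i0 sum_double_delta[OF i0(1,2), of w] by simp
    fix F assume "F \<in> {MHinf_mult Q k (poly_mat_fun Q P) G | G. G \<in> MHinf Q k}"
    then obtain G where G: "G \<in> MHinf Q k" and F: "F = MHinf_mult Q k (poly_mat_fun Q P) G" by blast
    define g where "g l c = (G $$ (l, i0)) X $$ (c, a0)" for l c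
    have "(\<Sum>i<k. \<Sum>a<n. (F $$ (i, i0)) X $$ (a, a0) * w i a)
      = (\<Sum>i<k. \<Sum>a<n. \<Sum>l<k. \<Sum>c<n. poly_value (P $$ (i, l)) X $$ (a, c) * (g l c * w i a))"
      using i0 X by (intro sum.cong refl)
        (simp add: F g_def MHinf_mult_value[OF PM G X n] poly_mat_fun_entry[OF P] Hinf_poly_def sum_distrib_right mult.assoc)
    also have "\<dots> = (\<Sum>i<k. \<Sum>a<n. \<Sum>l<k. \<Sum>c<n. g l c * (poly_value (P $$ (i, l)) X $$ (a, c) * w i a))"
      by (intro sum.cong refl) (rule mult.left_commute)
    also have "\<dots> = (\<Sum>i<k. \<Sum>l<k. \<Sum>a<n. \<Sum>c<n. g l c * (poly_value (P $$ (i, l)) X $$ (a, c) * w i a))"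
      by (intro sum.cong refl sum.swap)
    also have "\<dots> = (\<Sum>l<k. \<Sum>i<k. \<Sum>a<n. \<Sum>c<n. g l c * (poly_value (P $$ (i, l)) X $$ (a, c) * w i a))"
      by (rule sum.swap)
    also have "\<dots> = (\<Sum>l<k. \<Sum>i<k. \<Sum>c<n. \<Sum>a<n. g l c * (poly_value (P $$ (i, l)) X $$ (a, c) * w i a))"
      by (intro sum.cong refl sum.swap)
    also have "\<dots> = (\<Sum>l<k. \<Sum>c<n. \<Sum>i<k. \<Sum>a<n. g l c * (poly_value (P $$ (i, l)) X $$ (a, c) * w i a))"
      by (intro sum.cong refl sum.swap)
    also have "\<dots> = 0" using ker by (simp add: sum_distrib_left[symmetric])
    finally show "(\<Sum>i<k. \<Sum>j<k. \<phi> i j (F $$ (i, j))) = 0" unfolding red .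
  qed
  then show False using cyc by (simp add: right_cyclic_def right_ideal_closure_def)
qed

theorem theorem2:
  fixes Q :: "'d::finite \<Rightarrow> 'h::chilbert_space \<Rightarrow> 'h"
    and k :: nat
    and P :: "'d ncpoly mat"
  assumes "operator_space_basis Q"
    and "1 \<le> k"
    and "P \<in> carrier_mat k k"
  shows "(left_cyclic Q k (poly_mat_fun Q P) \<longleftrightarrow> Q_stable Q k (poly_mat_fun Q P)) \<and>
         (right_cyclic Q k (poly_mat_fun Q P) \<longleftrightarrow> Q_stable Q k (poly_mat_fun Q P))"
proof -
  have "two_sided_dense Q {..<k} (\<lambda>i j. P $$ (i, j))" if "Q_stable Q k (poly_mat_fun Q P)"
    by (rule two_sided_dense_of_stable[OF assms(1) finite_lessThan stable_on_of_Q_stable[OF assms(3) that]])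
  then show ?thesis
    using left_closure[OF assms(1,3)] right_closure[OF assms(1,3)]
      stable_of_left_cyclic[OF assms(1,3)] stable_of_right_cyclic[OF assms(1,3)]
    unfolding two_sided_dense_def by blast
qed

end
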